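(* Let $F\colon\mathcal{A}\to\mathcal{B}$ be a Frobenius quotient between two Frobenius exact categories. Then for each $n\geq1$, the induced functor ${\rm Inf}_n(F)\colon{\rm Inf}_n(\mathcal{A})\to{\rm Inf}_n(\mathcal{B})$ is also a Frobenius quotient, whose essential kernel equals $${\rm add}\,\{\theta^j(P)\mid 1\leq j\leq n,\ P\in{\rm Ker}(F)\}.$$
   Context: **Exact and Frobenius categories.** An exact category (Quillen) is an additive category $\mathcal{A}$ with an exact structure $\mathcal{E}$, i.e. a class of kernel-cokernel pairs $(i,p)$ called conflations ($i$ is an inflation, $p$ a deflation) satisfying the usual axioms. It is Frobenius if it has enough projectives and enough injectives and these two classes coincide; $\mathcal{P}$ denotes the full subcategory of projective-injectives. A functor between exact categories is exact if it is additive and sends conflations to conflations; an exact equivalence is an exact functor which is an equivalence and has an exact quasi-inverse. For an additive subcategory $\mathcal{X}\subseteq\mathcal{A}$, $[\mathcal{X}]$ is the ideal of morphisms factoring through objects of $\mathcal{X}$, and $\mathcal{A}/[\mathcal{X}]$ is the factor category. The essential kernel ${\rm Ker}(F)$ of an additive functor $F$ is the full subcategory of objects annihilated by $F$; ${\rm add}$ denotes the smallest additive subcategory closed under direct summands. **Frobenius quotients.** Let $(\mathcal{A},\mathcal{E})$ be a Frobenius category. A full additive subcategory $\mathcal{F}\subseteq\mathcal{A}$ is removable if $\mathcal{F}\subseteq\mathcal{P}$ and the canonical functor $\pi_{\mathcal{F}}\colon\mathcal{A}\to\mathcal{A}/[\mathcal{F}]$ sends every conflation to a kernel-cokernel pair.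 In that case $\mathcal{A}/[\mathcal{F}]$ is a Frobenius category with exact structure the closure under isomorphism of $\pi_{\mathcal{F}}(\mathcal{E})$ (known fact). An additive functor $F\colon\mathcal{A}\to\mathcal{B}$ between Frobenius categories is a Frobenius quotient if $F=\bar F\circ\pi_{\mathcal{F}}$ for some removable $\mathcal{F}\subseteq\mathcal{A}$ and some exact equivalence $\bar F\colon\mathcal{A}/[\mathcal{F}]\to\mathcal{B}$. In particular, a Frobenius quotient is exact. **Inflation categories.** For a Frobenius category $\mathcal{A}$ and $n\ge1$, an $n$-inflation $(X^s;\iota_X^s)$ is a sequence $X^1\xrightarrow{\iota_X^1}X^2\to\cdots\xrightarrow{\iota_X^{n-1}}X^n$ of $n-1$ composable inflations. A morphism $(f^s)\colon(X^s;\iota_X^s)\to(Y^s;\iota_Y^s)$ consists of $f^s\colon X^s\to Y^s$ with $\iota_Y^s f^s=f^{s+1}\iota_X^s$ for $1\le s\le n-1$. This gives the category ${\rm Inf}_n(\mathcal{A})$, with ${\rm Inf}_1(\mathcal{A})=\mathcal{A}$. A sequence in ${\rm Inf}_n(\mathcal{A})$ is a conflation if and only if each component is a conflation in $\mathcal{A}$; with this, ${\rm Inf}_n(\mathcal{A})$ is a Frobenius category. For an object $A$ and $1\le s\le n$, $\theta^s(A)$ is the $n$-inflation $0\to\cdots\to0\to A\xrightarrow{{\rm Id}}A\to\cdots\xrightarrow{{\rm Id}}A$ with $s-1$ zeros. For an exact functor $F\colon\mathcal{A}\to\mathcal{B}$, ${\rm Inf}_n(F)$ sends $(X^s;\iota_X^s)$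 to $(F(X^s);F(\iota_X^s))$ and $(f^s)$ to $(F(f^s))$. *)

theory Defs
  imports "HOL-Algebra.Group"
begin

section \<open>Categories\<close>

text \<open>
  A category is given by sets of objects and arrows with source and target maps; only the values
  on these sets matter. \<open>g \<cdot> f\<close> is ``\<open>g\<close> after \<open>f\<close>''. A full subcategory is identified with
  its set of objects.
\<close>

record ('o, 'm) cat =
  Obj :: "'o set"
  Arr :: "'m set"
  Dom :: "'m \<Rightarrow> 'o"
  Cod :: "'m \<Rightarrow> 'o"
  Ident :: "'o \<Rightarrow> 'm"
  Comp :: "'m \<Rightarrow> 'm \<Rightarrow> 'm"  (infixl \<open>\<cdot>\<index>\<close> 70)

definition Hom :: "('o, 'm, 'x) cat_scheme \<Rightarrow> 'o \<Rightarrow> 'o \<Rightarrow> 'm set" where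
  "Hom C X Y = {f \<in> Arr C. Dom C f = X \<and> Cod C f = Y}"

locale category =
  fixes C :: "('o, 'm, 'x) cat_scheme" (structure)
  assumes Dom_in: "f \<in> Arr C \<Longrightarrow> Dom C f \<in> Obj C"
    and Cod_in: "f \<in> Arr C \<Longrightarrow> Cod C f \<in> Obj C"
    and Ident_in: "X \<in> Obj C \<Longrightarrow> Ident C X \<in> Hom C X X"
    and Comp_in: "\<lbrakk>f \<in> Hom C X Y; g \<in> Hom C Y Z\<rbrakk> \<Longrightarrow> g \<cdot> f \<in> Hom C X Z"
    and Comp_assoc:
      "\<lbrakk>f \<in> Hom C W X; g \<in> Hom C X Y; h \<in> Hom C Y Z\<rbrakk> \<Longrightarrow> (h \<cdot> g) \<cdot> f = h \<cdot> (g \<cdot> f)"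
    and Ident_left: "f \<in> Hom C X Y \<Longrightarrow> Ident C Y \<cdot> f = f"
    and Ident_right: "f \<in> Hom C X Y \<Longrightarrow> f \<cdot> Ident C X = f"

definition is_iso :: "('o, 'm, 'x) cat_scheme \<Rightarrow> 'm \<Rightarrow> bool" where
  "is_iso C f \<longleftrightarrow> f \<in> Arr C \<and> (\<exists>g \<in> Hom C (Cod C f) (Dom C f).
      g \<cdot>\<^bsub>C\<^esub> f = Ident C (Dom C f) \<and> f \<cdot>\<^bsub>C\<^esub> g = Ident C (Cod C f))"

definition zero_object :: "('o, 'm, 'x) cat_scheme \<Rightarrow> 'o \<Rightarrow> bool" where
  "zero_object C Z \<longleftrightarrow> Z \<in> Obj C \<and>
     (\<forall>X \<in> Obj C. (\<exists>!f. f \<in> Hom C X Z) \<and> (\<exists>!f. f \<in> Hom C Z X))"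

text \<open>The square \<open>f' \<cdot> i = i' \<cdot> f\<close> is a push-out of \<open>i\<close> along \<open>f\<close>, respectively
  \<open>p \<cdot> f' = f \<cdot> p'\<close> is a pull-back of \<open>p\<close> along \<open>f\<close>.\<close>

definition is_pushout :: "('o, 'm, 'x) cat_scheme \<Rightarrow> 'm \<Rightarrow> 'm \<Rightarrow> 'm \<Rightarrow> 'm \<Rightarrow> bool" where
  "is_pushout C i f i' f' \<longleftrightarrow>
     i \<in> Arr C \<and> f \<in> Arr C \<and> i' \<in> Arr C \<and> f' \<in> Arr C \<and>
     Dom C i = Dom C f \<and> Cod C f = Dom C i' \<and> Cod C i = Dom C f' \<and> Cod C i' = Cod C f' \<and>
     f' \<cdot>\<^bsub>C\<^esub> i = i' \<cdot>\<^bsub>C\<^esub> f \<and>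
     (\<forall>T \<in> Obj C. \<forall>u \<in> Hom C (Cod C i) T. \<forall>v \<in> Hom C (Cod C f) T.
        u \<cdot>\<^bsub>C\<^esub> i = v \<cdot>\<^bsub>C\<^esub> f \<longrightarrow>
        (\<exists>!w. w \<in> Hom C (Cod C i') T \<and> w \<cdot>\<^bsub>C\<^esub> f' = u \<and> w \<cdot>\<^bsub>C\<^esub> i' = v))"

definition is_pullback :: "('o, 'm, 'x) cat_scheme \<Rightarrow> 'm \<Rightarrow> 'm \<Rightarrow> 'm \<Rightarrow> 'm \<Rightarrow> bool" where
  "is_pullback C p f p' f' \<longleftrightarrow>
     p \<in> Arr C \<and> f \<in> Arr C \<and> p' \<in> Arr C \<and> f' \<in> Arr C \<and>
     Cod C p = Cod C f \<and> Dom C f = Cod C p' \<and> Dom C p = Cod C f' \<and> Dom C p' = Dom C f' \<and>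
     p \<cdot>\<^bsub>C\<^esub> f' = f \<cdot>\<^bsub>C\<^esub> p' \<and>
     (\<forall>T \<in> Obj C. \<forall>u \<in> Hom C T (Dom C p). \<forall>v \<in> Hom C T (Dom C f).
        p \<cdot>\<^bsub>C\<^esub> u = f \<cdot>\<^bsub>C\<^esub> v \<longrightarrow>
        (\<exists>!w. w \<in> Hom C T (Dom C p') \<and> f' \<cdot>\<^bsub>C\<^esub> w = u \<and> p' \<cdot>\<^bsub>C\<^esub> w = v))"

section \<open>Additive categories\<close>

record ('o, 'm) preadditive_cat = "('o, 'm) cat" +
  Plus :: "'m \<Rightarrow> 'm \<Rightarrow> 'm"  (infixl \<open>\<boxplus>\<index>\<close> 65)
  Zero :: "'o \<Rightarrow> 'o \<Rightarrow> 'm"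

definition hom_group :: "('o, 'm, 'x) preadditive_cat_scheme \<Rightarrow> 'o \<Rightarrow> 'o \<Rightarrow> 'm monoid" where
  "hom_group C X Y = \<lparr>carrier = Hom C X Y, monoid.mult = Plus C, one = Zero C X Y\<rparr>"

locale preadditive_category = category C
  for C :: "('o, 'm, 'x) preadditive_cat_scheme" (structure) +
  assumes hom_comm_group: "\<lbrakk>X \<in> Obj C; Y \<in> Obj C\<rbrakk> \<Longrightarrow> comm_group (hom_group C X Y)"
    and Comp_Plus_left:
      "\<lbrakk>f \<in> Hom C X Y; g \<in> Hom C Y Z; g' \<in> Hom C Y Z\<rbrakk>
        \<Longrightarrow> (g \<boxplus> g') \<cdot> f = (g \<cdot> f) \<boxplus> (g' \<cdot> f)"
    and Comp_Plus_right:
      "\<lbrakk>f \<in> Hom C X Y; f' \<in> Hom C X Y; g \<in> Hom C Y Z\<rbrakk>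
        \<Longrightarrow> g \<cdot> (f \<boxplus> f') = (g \<cdot> f) \<boxplus> (g \<cdot> f')"

definition is_biproduct :: "('o, 'm, 'x) preadditive_cat_scheme \<Rightarrow> 'o \<Rightarrow> 'o \<Rightarrow> 'o \<Rightarrow> bool" where
  "is_biproduct C X Y S \<longleftrightarrow> X \<in> Obj C \<and> Y \<in> Obj C \<and> S \<in> Obj C \<and>
     (\<exists>i \<in> Hom C X S. \<exists>j \<in> Hom C Y S. \<exists>p \<in> Hom C S X. \<exists>q \<in> Hom C S Y.
        p \<cdot>\<^bsub>C\<^esub> i = Ident C X \<and> q \<cdot>\<^bsub>C\<^esub> j = Ident C Y \<and>
        q \<cdot>\<^bsub>C\<^esub> i = Zero C X Y \<and> p \<cdot>\<^bsub>C\<^esub> j = Zero C Y X \<and>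
        (i \<cdot>\<^bsub>C\<^esub> p) \<boxplus>\<^bsub>C\<^esub> (j \<cdot>\<^bsub>C\<^esub> q) = Ident C S)"

locale additive_category = preadditive_category C
  for C :: "('o, 'm, 'x) preadditive_cat_scheme" (structure) +
  assumes ex_zero_object: "\<exists>Z. zero_object C Z"
    and ex_biproduct: "\<lbrakk>X \<in> Obj C; Y \<in> Obj C\<rbrakk> \<Longrightarrow> \<exists>S. is_biproduct C X Y S"

text \<open>Additive subcategories are not required to be closed under isomorphism; those closed
  under direct summands automatically are.\<close>

definition additive_subcategory :: "('o, 'm, 'x) preadditive_cat_scheme \<Rightarrow> 'o set \<Rightarrow> bool" where
  "additive_subcategory C \<X> \<longleftrightarrow> \<X> \<subseteq> Obj C \<and> (\<exists>Z \<in> \<X>. zero_object C Z) \<and>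
     (\<forall>X \<in> \<X>. \<forall>Y \<in> \<X>. \<exists>S \<in> \<X>. is_biproduct C X Y S)"

definition summand_closed :: "('o, 'm, 'x) preadditive_cat_scheme \<Rightarrow> 'o set \<Rightarrow> bool" where
  "summand_closed C \<X> \<longleftrightarrow> (\<forall>S \<in> \<X>. \<forall>X Y. is_biproduct C X Y S \<longrightarrow> X \<in> \<X>)"

definition add_closure :: "('o, 'm, 'x) preadditive_cat_scheme \<Rightarrow> 'o set \<Rightarrow> 'o set" where
  "add_closure C S = \<Inter> {\<X>. additive_subcategory C \<X> \<and> summand_closed C \<X> \<and> S \<subseteq> \<X>}"

definition is_kernel :: "('o, 'm, 'x) preadditive_cat_scheme \<Rightarrow> 'm \<Rightarrow> 'm \<Rightarrow> bool" where
  "is_kernel C i p \<longleftrightarrow> i \<in> Arr C \<and> p \<in> Arr C \<and> Cod C i = Dom C p \<and>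
     p \<cdot>\<^bsub>C\<^esub> i = Zero C (Dom C i) (Cod C p) \<and>
     (\<forall>T \<in> Obj C. \<forall>f \<in> Hom C T (Dom C p). p \<cdot>\<^bsub>C\<^esub> f = Zero C T (Cod C p) \<longrightarrow>
        (\<exists>!g. g \<in> Hom C T (Dom C i) \<and> i \<cdot>\<^bsub>C\<^esub> g = f))"

definition is_cokernel :: "('o, 'm, 'x) preadditive_cat_scheme \<Rightarrow> 'm \<Rightarrow> 'm \<Rightarrow> bool" where
  "is_cokernel C p i \<longleftrightarrow> i \<in> Arr C \<and> p \<in> Arr C \<and> Cod C i = Dom C p \<and>
     p \<cdot>\<^bsub>C\<^esub> i = Zero C (Dom C i) (Cod C p) \<and>
     (\<forall>T \<in> Obj C. \<forall>f \<in> Hom C (Cod C i) T. f \<cdot>\<^bsub>C\<^esub> i = Zero C (Dom C i) T \<longrightarrow>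
        (\<exists>!g. g \<in> Hom C (Cod C p) T \<and> g \<cdot>\<^bsub>C\<^esub> p = f))"

definition kernel_cokernel_pair :: "('o, 'm, 'x) preadditive_cat_scheme \<Rightarrow> 'm \<Rightarrow> 'm \<Rightarrow> bool" where
  "kernel_cokernel_pair C i p \<longleftrightarrow> is_kernel C i p \<and> is_cokernel C p i"

definition iso_closure :: "('o, 'm, 'x) cat_scheme \<Rightarrow> ('m \<times> 'm) set \<Rightarrow> ('m \<times> 'm) set" where
  "iso_closure C E = {(i', p'). i' \<in> Arr C \<and> p' \<in> Arr C \<and> Cod C i' = Dom C p' \<and>
     (\<exists>(i, p) \<in> E. \<exists>a b c. is_iso C a \<and> is_iso C b \<and> is_iso C c \<and>
        a \<in> Hom C (Dom C i) (Dom C i') \<and> b \<in> Hom C (Cod C i) (Cod C i') \<and>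
        c \<in> Hom C (Cod C p) (Cod C p') \<and>
        b \<cdot>\<^bsub>C\<^esub> i = i' \<cdot>\<^bsub>C\<^esub> a \<and> c \<cdot>\<^bsub>C\<^esub> p = p' \<cdot>\<^bsub>C\<^esub> b)}"

section \<open>Exact and Frobenius categories\<close>

record ('o, 'm) exact_cat = "('o, 'm) preadditive_cat" +
  Confl :: "('m \<times> 'm) set"

definition inflation :: "('o, 'm, 'x) exact_cat_scheme \<Rightarrow> 'm \<Rightarrow> bool" where
  "inflation C i \<longleftrightarrow> (\<exists>p. (i, p) \<in> Confl C)"

definition deflation :: "('o, 'm, 'x) exact_cat_scheme \<Rightarrow> 'm \<Rightarrow> bool" where
  "deflation C p \<longleftrightarrow> (\<exists>i. (i, p) \<in> Confl C)"

locale exact_category = additive_category C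
  for C :: "('o, 'm, 'x) exact_cat_scheme" (structure) +
  assumes Confl_kernel_cokernel: "(i, p) \<in> Confl C \<Longrightarrow> kernel_cokernel_pair C i p"
    and Confl_iso_closed: "iso_closure C (Confl C) \<subseteq> Confl C"
    and inflation_Ident: "X \<in> Obj C \<Longrightarrow> inflation C (Ident C X)"
    and deflation_Ident: "X \<in> Obj C \<Longrightarrow> deflation C (Ident C X)"
    and inflation_Comp:
      "\<lbrakk>inflation C i; inflation C j; Cod C i = Dom C j\<rbrakk> \<Longrightarrow> inflation C (j \<cdot> i)"
    and deflation_Comp:
      "\<lbrakk>deflation C p; deflation C q; Cod C p = Dom C q\<rbrakk> \<Longrightarrow> deflation C (q \<cdot> p)"
    and inflation_pushout:
      "\<lbrakk>inflation C i; f \<in> Arr C; Dom C f = Dom C i\<rbrakk>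
        \<Longrightarrow> \<exists>i' f'. is_pushout C i f i' f' \<and> inflation C i'"
    and deflation_pullback:
      "\<lbrakk>deflation C p; f \<in> Arr C; Cod C f = Cod C p\<rbrakk>
        \<Longrightarrow> \<exists>p' f'. is_pullback C p f p' f' \<and> deflation C p'"

definition projective :: "('o, 'm, 'x) exact_cat_scheme \<Rightarrow> 'o \<Rightarrow> bool" where
  "projective C P \<longleftrightarrow> P \<in> Obj C \<and>
     (\<forall>p f. deflation C p \<longrightarrow> f \<in> Hom C P (Cod C p) \<longrightarrow>
        (\<exists>g \<in> Hom C P (Dom C p). p \<cdot>\<^bsub>C\<^esub> g = f))"

definition injective :: "('o, 'm, 'x) exact_cat_scheme \<Rightarrow> 'o \<Rightarrow> bool" where
  "injective C I \<longleftrightarrow> I \<in> Obj C \<and>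
     (\<forall>i f. inflation C i \<longrightarrow> f \<in> Hom C (Dom C i) I \<longrightarrow>
        (\<exists>g \<in> Hom C (Cod C i) I. g \<cdot>\<^bsub>C\<^esub> i = f))"

locale frobenius_category = exact_category C
  for C :: "('o, 'm, 'x) exact_cat_scheme" (structure) +
  assumes enough_projectives:
      "X \<in> Obj C \<Longrightarrow> \<exists>p. deflation C p \<and> Cod C p = X \<and> projective C (Dom C p)"
    and enough_injectives:
      "X \<in> Obj C \<Longrightarrow> \<exists>i. inflation C i \<and> Dom C i = X \<and> injective C (Cod C i)"
    and projective_iff_injective: "projective C X \<longleftrightarrow> injective C X"

definition proj_inj :: "('o, 'm, 'x) exact_cat_scheme \<Rightarrow> 'o set" where
  "proj_inj C = {P. projective C P \<and> injective C P}"

section \<open>Functors\<close>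

record ('o, 'm, 'p, 'q) cat_functor =
  FObj :: "'o \<Rightarrow> 'p"
  FArr :: "'m \<Rightarrow> 'q"

definition is_functor ::
  "('o, 'm, 'x) cat_scheme \<Rightarrow> ('p, 'q, 'y) cat_scheme \<Rightarrow> ('o, 'm, 'p, 'q) cat_functor \<Rightarrow> bool" where
  "is_functor C D F \<longleftrightarrow>
     (\<forall>X \<in> Obj C. FObj F X \<in> Obj D) \<and>
     (\<forall>f \<in> Arr C. FArr F f \<in> Hom D (FObj F (Dom C f)) (FObj F (Cod C f))) \<and>
     (\<forall>X \<in> Obj C. FArr F (Ident C X) = Ident D (FObj F X)) \<and>
     (\<forall>f \<in> Arr C. \<forall>g \<in> Arr C. Cod C f = Dom C g \<longrightarrow>
        FArr F (g \<cdot>\<^bsub>C\<^esub> f) = FArr F g \<cdot>\<^bsub>D\<^esub> FArr F f)"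

definition functor_id :: "('o, 'm, 'o, 'm) cat_functor" where
  "functor_id = \<lparr>FObj = (\<lambda>X. X), FArr = (\<lambda>f. f)\<rparr>"

definition functor_comp ::
  "('p, 'q, 'r, 's) cat_functor \<Rightarrow> ('o, 'm, 'p, 'q) cat_functor \<Rightarrow> ('o, 'm, 'r, 's) cat_functor" where
  "functor_comp G F = \<lparr>FObj = FObj G \<circ> FObj F, FArr = FArr G \<circ> FArr F\<rparr>"

text \<open>Equality of functors with source category \<open>C\<close>, disregarding junk values outside \<open>C\<close>.\<close>

definition functor_eq ::
  "('o, 'm, 'x) cat_scheme \<Rightarrow> ('o, 'm, 'p, 'q) cat_functor \<Rightarrow> ('o, 'm, 'p, 'q) cat_functor \<Rightarrow> bool" where
  "functor_eq C F G \<longleftrightarrow>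
     (\<forall>X \<in> Obj C. FObj F X = FObj G X) \<and> (\<forall>f \<in> Arr C. FArr F f = FArr G f)"

definition naturally_isomorphic ::
  "('o, 'm, 'x) cat_scheme \<Rightarrow> ('p, 'q, 'y) cat_scheme \<Rightarrow>
   ('o, 'm, 'p, 'q) cat_functor \<Rightarrow> ('o, 'm, 'p, 'q) cat_functor \<Rightarrow> bool" where
  "naturally_isomorphic C D F G \<longleftrightarrow> (\<exists>\<eta>.
     (\<forall>X \<in> Obj C. \<eta> X \<in> Hom D (FObj F X) (FObj G X) \<and> is_iso D (\<eta> X)) \<and>
     (\<forall>f \<in> Arr C. \<eta> (Cod C f) \<cdot>\<^bsub>D\<^esub> FArr F f = FArr G f \<cdot>\<^bsub>D\<^esub> \<eta> (Dom C f)))"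

definition additive_functor ::
  "('o, 'm, 'x) preadditive_cat_scheme \<Rightarrow> ('p, 'q, 'y) preadditive_cat_scheme \<Rightarrow>
   ('o, 'm, 'p, 'q) cat_functor \<Rightarrow> bool" where
  "additive_functor C D F \<longleftrightarrow> is_functor C D F \<and>
     (\<forall>X \<in> Obj C. \<forall>Y \<in> Obj C.
        FArr F \<in> hom (hom_group C X Y) (hom_group D (FObj F X) (FObj F Y)))"

definition exact_functor ::
  "('o, 'm, 'x) exact_cat_scheme \<Rightarrow> ('p, 'q, 'y) exact_cat_scheme \<Rightarrow>
   ('o, 'm, 'p, 'q) cat_functor \<Rightarrow> bool" where
  "exact_functor C D F \<longleftrightarrow> additive_functor C D F \<and>
     (\<forall>(i, p) \<in> Confl C. (FArr F i, FArr F p) \<in> Confl D)"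

definition exact_equivalence ::
  "('o, 'm, 'x) exact_cat_scheme \<Rightarrow> ('p, 'q, 'y) exact_cat_scheme \<Rightarrow>
   ('o, 'm, 'p, 'q) cat_functor \<Rightarrow> bool" where
  "exact_equivalence C D F \<longleftrightarrow> exact_functor C D F \<and>
     (\<exists>G. exact_functor D C G \<and>
        naturally_isomorphic C C (functor_comp G F) functor_id \<and>
        naturally_isomorphic D D (functor_comp F G) functor_id)"

definition ess_kernel ::
  "('o, 'm, 'x) cat_scheme \<Rightarrow> ('p, 'q, 'y) cat_scheme \<Rightarrow> ('o, 'm, 'p, 'q) cat_functor \<Rightarrow> 'o set" where
  "ess_kernel C D F = {X \<in> Obj C. zero_object D (FObj F X)}"

section \<open>Factor categories and Frobenius quotients\<close>

definition factors_through :: "('o, 'm, 'x) cat_scheme \<Rightarrow> 'o set \<Rightarrow> 'm set" where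
  "factors_through C \<X> = {f \<in> Arr C. \<exists>X \<in> \<X>.
     \<exists>g \<in> Hom C (Dom C f) X. \<exists>h \<in> Hom C X (Cod C f). f = h \<cdot>\<^bsub>C\<^esub> g}"

definition residue_class ::
  "('o, 'm, 'x) preadditive_cat_scheme \<Rightarrow> 'o set \<Rightarrow> 'm \<Rightarrow> 'm set" where
  "residue_class C \<X> f =
     {f \<boxplus>\<^bsub>C\<^esub> k | k. k \<in> Hom C (Dom C f) (Cod C f) \<and> k \<in> factors_through C \<X>}"

definition rep :: "'m set \<Rightarrow> 'm" where
  "rep c = (SOME f. f \<in> c)"

text \<open>Objects are those of \<open>C\<close>; arrows are residue classes modulo the ideal of arrows factoring
  through \<open>\<X>\<close>. Operations are defined on representatives; the source and target of a class are
  those of any of its elements.\<close>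

definition factor_cat ::
  "('o, 'm, 'x) preadditive_cat_scheme \<Rightarrow> 'o set \<Rightarrow> ('o, 'm set) preadditive_cat" where
  "factor_cat C \<X> =
     \<lparr>Obj = Obj C,
      Arr = residue_class C \<X> ` Arr C,
      Dom = (\<lambda>c. Dom C (rep c)),
      Cod = (\<lambda>c. Cod C (rep c)),
      Ident = (\<lambda>X. residue_class C \<X> (Ident C X)),
      Comp = (\<lambda>d c. residue_class C \<X> (rep d \<cdot>\<^bsub>C\<^esub> rep c)),
      Plus = (\<lambda>c d. residue_class C \<X> (rep c \<boxplus>\<^bsub>C\<^esub> rep d)),
      Zero = (\<lambda>X Y. residue_class C \<X> (Zero C X Y))\<rparr>"

definition proj_functor ::
  "('o, 'm, 'x) preadditive_cat_scheme \<Rightarrow> 'o set \<Rightarrow> ('o, 'm, 'o, 'm set) cat_functor" where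
  "proj_functor C \<X> = \<lparr>FObj = (\<lambda>X. X), FArr = residue_class C \<X>\<rparr>"

text \<open>The factor category together with its induced exact structure.\<close>

definition exact_factor_cat ::
  "('o, 'm, 'x) exact_cat_scheme \<Rightarrow> 'o set \<Rightarrow> ('o, 'm set) exact_cat" where
  "exact_factor_cat C \<X> = preadditive_cat.extend (factor_cat C \<X>)
     (exact_cat.fields (iso_closure (factor_cat C \<X>)
        {(FArr (proj_functor C \<X>) i, FArr (proj_functor C \<X>) p) | i p. (i, p) \<in> Confl C}))"

definition removable :: "('o, 'm, 'x) exact_cat_scheme \<Rightarrow> 'o set \<Rightarrow> bool" where
  "removable C \<F> \<longleftrightarrow> additive_subcategory C \<F> \<and> \<F> \<subseteq> proj_inj C \<and>
     (\<forall>(i, p) \<in> Confl C. kernel_cokernel_pair (factor_cat C \<F>)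
        (FArr (proj_functor C \<F>) i) (FArr (proj_functor C \<F>) p))"

definition frobenius_quotient ::
  "('o, 'm, 'x) exact_cat_scheme \<Rightarrow> ('p, 'q, 'y) exact_cat_scheme \<Rightarrow>
   ('o, 'm, 'p, 'q) cat_functor \<Rightarrow> bool" where
  "frobenius_quotient C D F \<longleftrightarrow> frobenius_category C \<and> frobenius_category D \<and>
     additive_functor C D F \<and>
     (\<exists>\<F> F'. removable C \<F> \<and> exact_equivalence (exact_factor_cat C \<F>) D F' \<and>
        functor_eq C F (functor_comp F' (proj_functor C \<F>)))"

section \<open>Inflation categories\<close>

text \<open>
  An \<open>n\<close>-inflation is a pair \<open>(X, \<iota>)\<close> of families indexed by \<open>{1..n}\<close> and \<open>{1..<n}\<close>; a
  morphism is a triple of source, family of components and target. All families are extensional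
  (\<open>undefined\<close> outside their index set), so that equality is componentwise.
\<close>

type_synonym ('o, 'm) inf_obj = "(nat \<Rightarrow> 'o) \<times> (nat \<Rightarrow> 'm)"
type_synonym ('o, 'm) inf_arr = "('o, 'm) inf_obj \<times> (nat \<Rightarrow> 'm) \<times> ('o, 'm) inf_obj"

definition inf_Obj :: "nat \<Rightarrow> ('o, 'm, 'x) exact_cat_scheme \<Rightarrow> ('o, 'm) inf_obj set" where
  "inf_Obj n C = {(X, \<iota>). X \<in> {1..n} \<rightarrow>\<^sub>E Obj C \<and>
     \<iota> \<in> (\<Pi>\<^sub>E s \<in> {1..<n}. {f \<in> Hom C (X s) (X (Suc s)). inflation C f})}"

definition inf_Arr :: "nat \<Rightarrow> ('o, 'm, 'x) exact_cat_scheme \<Rightarrow> ('o, 'm) inf_arr set" where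
  "inf_Arr n C = {(X, f, Y). X \<in> inf_Obj n C \<and> Y \<in> inf_Obj n C \<and>
     f \<in> (\<Pi>\<^sub>E s \<in> {1..n}. Hom C (fst X s) (fst Y s)) \<and>
     (\<forall>s \<in> {1..<n}. snd Y s \<cdot>\<^bsub>C\<^esub> f s = f (Suc s) \<cdot>\<^bsub>C\<^esub> snd X s)}"

definition Inf_cat ::
  "nat \<Rightarrow> ('o, 'm, 'x) exact_cat_scheme \<Rightarrow> (('o, 'm) inf_obj, ('o, 'm) inf_arr) exact_cat" where
  "Inf_cat n C =
     \<lparr>Obj = inf_Obj n C,
      Arr = inf_Arr n C,
      Dom = (\<lambda>(X, f, Y). X),
      Cod = (\<lambda>(X, f, Y). Y),
      Ident = (\<lambda>X. (X, (\<lambda>s\<in>{1..n}. Ident C (fst X s)), X)),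
      Comp = (\<lambda>(Y', g, Z) (X, f, Y). (X, (\<lambda>s\<in>{1..n}. g s \<cdot>\<^bsub>C\<^esub> f s), Z)),
      Plus = (\<lambda>(X, f, Y) (X', g, Y'). (X, (\<lambda>s\<in>{1..n}. f s \<boxplus>\<^bsub>C\<^esub> g s), Y)),
      Zero = (\<lambda>X Y. (X, (\<lambda>s\<in>{1..n}. Zero C (fst X s) (fst Y s)), Y)),
      Confl = {((X, i, Y), (Y', p, Z)). (X, i, Y) \<in> inf_Arr n C \<and> (Y', p, Z) \<in> inf_Arr n C \<and>
        Y = Y' \<and> (\<forall>s \<in> {1..n}. (i s, p s) \<in> Confl C)}\<rparr>"

text \<open>A fixed choice of zero object; \<open>theta\<close> depends on it only up to isomorphism.\<close>

definition the_zero :: "('o, 'm, 'x) cat_scheme \<Rightarrow> 'o" where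
  "the_zero C = (SOME Z. zero_object C Z)"

definition theta ::
  "nat \<Rightarrow> ('o, 'm, 'x) preadditive_cat_scheme \<Rightarrow> nat \<Rightarrow> 'o \<Rightarrow> ('o, 'm) inf_obj" where
  "theta n C s A =
     (let X = (\<lambda>t. if t < s then the_zero C else A) in
      ((\<lambda>t\<in>{1..n}. X t),
       (\<lambda>t\<in>{1..<n}. if t < s then Zero C (X t) (X (Suc t)) else Ident C A)))"

definition Inf_functor ::
  "nat \<Rightarrow> ('o, 'm, 'p, 'q) cat_functor \<Rightarrow>
   (('o, 'm) inf_obj, ('o, 'm) inf_arr, ('p, 'q) inf_obj, ('p, 'q) inf_arr) cat_functor" where
  "Inf_functor n F =
     (let F_obj = (\<lambda>(X, \<iota>). ((\<lambda>s\<in>{1..n}. FObj F (X s)), (\<lambda>s\<in>{1..<n}. FArr F (\<iota> s)))) in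
      \<lparr>FObj = F_obj,
       FArr = (\<lambda>(X, f, Y). (F_obj X, (\<lambda>s\<in>{1..n}. FArr F (f s)), F_obj Y))\<rparr>)"

end

(* An exact functor F from A to B between Frobenius categories is a Frobenius quotient if and
   only if it is full and dense, preserves projectives, its essential kernel consists of
   projective-injectives, and every arrow killed by F factors through the essential kernel.
   These conditions pass to inflation sequences one index at a time: the obstruction to
   continuing a lift or a factorization from index s to index s+1 is an arrow into, or through,
   an injective object, so it extends along the inflation from index s to s+1 and can then be
   corrected. The objects killed by the induced functor are componentwise injective, hence their
   inflations split, and such an object is built from the theta objects by truncation. *)
theory Submission
  imports Defs
begin

section \<open>Calculating in preadditive categories\<close>

text \<open>The definition of a Frobenius quotient asks for some removable subcategory and some
  exact equivalence, and neither is visibly inherited by inflation sequences. The characterization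
  removes both choices: the whole essential kernel serves as the removable subcategory, since any
  given one consists of killed objects and every killed object is a retract of one of its objects.
  The delicate point is exactness of a quasi-inverse. It comes down to lifting conflations up to
  isomorphism, and this is what preservation of projectives is for: an extension is a push-out of a
  projective resolution, so that only arrows remain to be lifted. Duality settles half of the work
  inside one exact category, but not for inflation sequences, whose opposites are sequences of
  deflations; there the statements on deflations and injectives have proofs of their own. Structure
  maps between componentwise constructions are easily found; the real task is to see that they are
  inflations, and as a rule this follows by exhibiting the object as an extension of two inflation
  sequences.\<close>

lemma Hom_iff: "f \<in> Hom C X Y \<longleftrightarrow> f \<in> Arr C \<and> Dom C f = X \<and> Cod C f = Y"
  by (auto simp: Hom_def)

lemma is_isoD:
  assumes "is_iso C f"
  shows "f \<in> Arr C"
    and "\<exists>g. g \<in> Arr C \<and> Dom C g = Cod C f \<and> Cod C g = Dom C f \<and>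
      g \<cdot>\<^bsub>C\<^esub> f = Ident C (Dom C f) \<and> f \<cdot>\<^bsub>C\<^esub> g = Ident C (Cod C f)"
  using assms by (auto simp: is_iso_def Hom_iff)

lemma is_isoI:
  assumes "f \<in> Arr C" "g \<in> Arr C" "Dom C g = Cod C f" "Cod C g = Dom C f"
    "g \<cdot>\<^bsub>C\<^esub> f = Ident C (Dom C f)" "f \<cdot>\<^bsub>C\<^esub> g = Ident C (Cod C f)"
  shows "is_iso C f"
  using assms by (auto simp: is_iso_def Hom_iff)

lemma iso_closureI:
  assumes "(i, p) \<in> E" "is_iso C a" "is_iso C b" "is_iso C c" "i' \<in> Arr C" "p' \<in> Arr C"
    "Cod C i' = Dom C p'" "Dom C a = Dom C i" "Cod C a = Dom C i'" "Dom C b = Cod C i"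
    "Cod C b = Cod C i'" "Dom C c = Cod C p" "Cod C c = Cod C p'"
    "b \<cdot>\<^bsub>C\<^esub> i = i' \<cdot>\<^bsub>C\<^esub> a" "c \<cdot>\<^bsub>C\<^esub> p = p' \<cdot>\<^bsub>C\<^esub> b"
  shows "(i', p') \<in> iso_closure C E"
proof -
  have "a \<in> Arr C" "b \<in> Arr C" "c \<in> Arr C"
    using is_isoD(1)[OF assms(2)] is_isoD(1)[OF assms(3)] is_isoD(1)[OF assms(4)] .
  with assms show ?thesis
    unfolding iso_closure_def mem_Collect_eq case_prod_conv
    by (intro conjI bexI[OF _ assms(1)] case_prodI exI[of _ a] exI[of _ b] exI[of _ c])
      (simp_all add: Hom_iff)
qed

section \<open>Composition and isomorphisms\<close>

context category
begin

lemma comp_arr [simp]: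
  assumes "f \<in> Arr C" "g \<in> Arr C" "Cod C f = Dom C g"
  shows "g \<cdot> f \<in> Arr C" "Dom C (g \<cdot> f) = Dom C f" "Cod C (g \<cdot> f) = Cod C g"
  using Comp_in[of f "Dom C f" "Cod C f" g "Cod C g"] assms by (auto simp: Hom_iff)

lemma comp_assoc [simp]:
  assumes "f \<in> Arr C" "g \<in> Arr C" "h \<in> Arr C" "Cod C f = Dom C g" "Cod C g = Dom C h"
  shows "(h \<cdot> g) \<cdot> f = h \<cdot> (g \<cdot> f)"
  using Comp_assoc[of f "Dom C f" "Cod C f" g "Cod C g" h "Cod C h"] assms by (auto simp: Hom_iff)

lemma Ident_arr [simp]:
  assumes "X \<in> Obj C"
  shows "Ident C X \<in> Arr C" "Dom C (Ident C X) = X" "Cod C (Ident C X) = X"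
  using Ident_in[OF assms] by (auto simp: Hom_iff)

lemma comp_Ident_left [simp]:
  assumes "f \<in> Arr C" "X = Cod C f" shows "Ident C X \<cdot> f = f"
  using Ident_left[of f "Dom C f" "Cod C f"] assms by (auto simp: Hom_iff)

lemma comp_Ident_right [simp]:
  assumes "f \<in> Arr C" "X = Dom C f" shows "f \<cdot> Ident C X = f"
  using Ident_right[of f "Dom C f" "Cod C f"] assms by (auto simp: Hom_iff)

declare Dom_in [simp] Cod_in [simp]

text \<open>Composites are normalized with brackets to the right, where the left-hand side
  \<open>g \<cdot> f\<close> of an equation no longer occurs as a subterm. Instances of this rule
  supply the form that still matches in front of a further arrow \<open>x\<close>.\<close>

lemma comp_eq_comp:
  assumes "g \<cdot> f = k" "f \<in> Arr C" "g \<in> Arr C" "Cod C f = Dom C g" "x \<in> Arr C" "Cod C x = Dom C f"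
  shows "g \<cdot> (f \<cdot> x) = k \<cdot> x"
  using assms comp_assoc by metis

lemma iso_Ident: "X \<in> Obj C \<Longrightarrow> is_iso C (Ident C X)"
  by (rule is_isoI[where g = "Ident C X"]) auto

lemma iso_comp:
  assumes "is_iso C f" "is_iso C g" "Cod C f = Dom C g"
  shows "is_iso C (g \<cdot> f)"
proof -
  obtain f' where f: "f \<in> Arr C" "f' \<in> Arr C" "Dom C f' = Cod C f" "Cod C f' = Dom C f"
      "f' \<cdot> f = Ident C (Dom C f)" "f \<cdot> f' = Ident C (Cod C f)"
    using assms is_isoD by metis
  obtain g' where g: "g \<in> Arr C" "g' \<in> Arr C" "Dom C g' = Cod C g" "Cod C g' = Dom C g"
      "g' \<cdot> g = Ident C (Dom C g)" "g \<cdot> g' = Ident C (Cod C g)"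
    using assms is_isoD by metis
  show ?thesis
    using f g assms
    by (intro is_isoI[where g = "f' \<cdot> g'"])
      (auto simp: comp_eq_comp[OF g(5)] comp_eq_comp[OF f(6)])
qed

lemma iso_inverse:
  assumes "is_iso C f"
  obtains g where "is_iso C g" "f \<in> Arr C" "g \<in> Arr C" "Dom C g = Cod C f" "Cod C g = Dom C f"
    "g \<cdot> f = Ident C (Dom C f)" "f \<cdot> g = Ident C (Cod C f)"
proof -
  obtain g where g: "f \<in> Arr C" "g \<in> Arr C" "Dom C g = Cod C f" "Cod C g = Dom C f"
      "g \<cdot> f = Ident C (Dom C f)" "f \<cdot> g = Ident C (Cod C f)"
    using assms is_isoD by metis
  moreover have "is_iso C g" by (rule is_isoI[where g = f]) (use g in auto)
  ultimately show thesis using that by blast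
qed

lemma iso_mono:
  assumes "is_iso C f" "f \<cdot> u = f \<cdot> v" "u \<in> Arr C" "v \<in> Arr C" "Cod C u = Dom C f" "Cod C v = Dom C f"
  shows "u = v"
proof -
  obtain g where g: "f \<in> Arr C" "g \<in> Arr C" "Dom C g = Cod C f" "Cod C g = Dom C f"
      "g \<cdot> f = Ident C (Dom C f)"
    using assms iso_inverse by metis
  have "g \<cdot> (f \<cdot> u) = g \<cdot> (f \<cdot> v)" using assms by simp
  then show ?thesis using g assms(3-) by (simp add: comp_eq_comp[OF g(5)])
qed

lemma iso_epi:
  assumes "is_iso C f" "u \<cdot> f = v \<cdot> f" "u \<in> Arr C" "v \<in> Arr C" "Dom C u = Cod C f" "Dom C v = Cod C f"
  shows "u = v"
proof -
  obtain g where g: "f \<in> Arr C" "g \<in> Arr C" "Dom C g = Cod C f" "Cod C g = Dom C f"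
      "f \<cdot> g = Ident C (Cod C f)"
    using assms iso_inverse by metis
  have "u \<cdot> (f \<cdot> g) = (u \<cdot> f) \<cdot> g" "v \<cdot> (f \<cdot> g) = (v \<cdot> f) \<cdot> g"
    using g assms(3-) by (auto simp del: g(5))
  then show ?thesis using g assms(2-) by simp
qed

end

text \<open>The hom group is read off from the source and target of \<open>f\<close>, so that
  negation is a function of the arrow alone and needs no hom-set as an argument.\<close>

definition neg :: "('o, 'm, 'x) preadditive_cat_scheme \<Rightarrow> 'm \<Rightarrow> 'm" where
  "neg C f = inv\<^bsub>hom_group C (Dom C f) (Cod C f)\<^esub> f"

section \<open>Arithmetic of arrows, zero objects, biproducts and kernels\<close>

context preadditive_category
begin

lemma plus_arr [simp]:
  assumes "f \<in> Arr C" "g \<in> Arr C" "Dom C f = Dom C g" "Cod C f = Cod C g"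
  shows "f \<boxplus> g \<in> Arr C" "Dom C (f \<boxplus> g) = Dom C g" "Cod C (f \<boxplus> g) = Cod C g"
proof -
  interpret G: comm_group "hom_group C (Dom C g) (Cod C g)" using assms by (intro hom_comm_group) auto
  show "f \<boxplus> g \<in> Arr C" "Dom C (f \<boxplus> g) = Dom C g" "Cod C (f \<boxplus> g) = Cod C g"
    using G.m_closed[of f g] assms by (auto simp: hom_group_def Hom_iff)
qed

lemma zero_arr [simp]:
  assumes "X \<in> Obj C" "Y \<in> Obj C"
  shows "Zero C X Y \<in> Arr C" "Dom C (Zero C X Y) = X" "Cod C (Zero C X Y) = Y"
proof -
  interpret G: comm_group "hom_group C X Y" using assms by (intro hom_comm_group) auto
  show "Zero C X Y \<in> Arr C" "Dom C (Zero C X Y) = X" "Cod C (Zero C X Y) = Y"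
    using G.one_closed by (auto simp: hom_group_def Hom_iff)
qed

lemma neg_arr [simp]:
  assumes "f \<in> Arr C"
  shows "neg C f \<in> Arr C" "Dom C (neg C f) = Dom C f" "Cod C (neg C f) = Cod C f"
proof -
  interpret G: comm_group "hom_group C (Dom C f) (Cod C f)" using assms by (intro hom_comm_group) auto
  show "neg C f \<in> Arr C" "Dom C (neg C f) = Dom C f" "Cod C (neg C f) = Cod C f"
    using G.inv_closed[of f] assms unfolding neg_def by (auto simp: hom_group_def Hom_iff)
qed

lemma plus_assoc [simp]:
  assumes "f \<in> Arr C" "g \<in> Arr C" "h \<in> Arr C" "Dom C f = Dom C g" "Cod C f = Cod C g"
    "Dom C g = Dom C h" "Cod C g = Cod C h"
  shows "(f \<boxplus> g) \<boxplus> h = f \<boxplus> (g \<boxplus> h)"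
proof -
  interpret G: comm_group "hom_group C (Dom C h) (Cod C h)" using assms by (intro hom_comm_group) auto
  show ?thesis using G.m_assoc[of f g h] assms by (auto simp: hom_group_def Hom_iff)
qed

lemma plus_comm:
  assumes "f \<in> Arr C" "g \<in> Arr C" "Dom C f = Dom C g" "Cod C f = Cod C g"
  shows "f \<boxplus> g = g \<boxplus> f"
proof -
  interpret G: comm_group "hom_group C (Dom C g) (Cod C g)" using assms by (intro hom_comm_group) auto
  show ?thesis using G.m_comm[of f g] assms by (auto simp: hom_group_def Hom_iff)
qed

lemma plus_left_comm:
  assumes "f \<in> Arr C" "g \<in> Arr C" "h \<in> Arr C" "Dom C f = Dom C g" "Cod C f = Cod C g"
    "Dom C g = Dom C h" "Cod C g = Cod C h"
  shows "f \<boxplus> (g \<boxplus> h) = g \<boxplus> (f \<boxplus> h)"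
proof -
  have "f \<boxplus> (g \<boxplus> h) = (f \<boxplus> g) \<boxplus> h" using assms by simp
  also have "\<dots> = (g \<boxplus> f) \<boxplus> h" using plus_comm assms by metis
  also have "\<dots> = g \<boxplus> (f \<boxplus> h)" using assms by simp
  finally show ?thesis .
qed

lemma plus_zero [simp]:
  assumes "f \<in> Arr C" "Dom C f = X" "Cod C f = Y"
  shows "f \<boxplus> Zero C X Y = f" "Zero C X Y \<boxplus> f = f"
proof -
  interpret G: comm_group "hom_group C X Y" using assms by (intro hom_comm_group) auto
  show "f \<boxplus> Zero C X Y = f" "Zero C X Y \<boxplus> f = f"
    using G.l_one[of f] G.r_one[of f] assms by (auto simp: hom_group_def Hom_iff)
qed

lemma plus_neg [simp]:
  assumes "f \<in> Arr C"
  shows "f \<boxplus> neg C f = Zero C (Dom C f) (Cod C f)" "neg C f \<boxplus> f = Zero C (Dom C f) (Cod C f)"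
proof -
  interpret G: comm_group "hom_group C (Dom C f) (Cod C f)" using assms by (intro hom_comm_group) auto
  show "f \<boxplus> neg C f = Zero C (Dom C f) (Cod C f)" "neg C f \<boxplus> f = Zero C (Dom C f) (Cod C f)"
    using G.l_inv[of f] G.r_inv[of f] assms unfolding neg_def
    by (auto simp: hom_group_def Hom_iff)
qed

lemma plus_neg_cancel [simp]:
  assumes "f \<in> Arr C" "g \<in> Arr C" "Dom C f = Dom C g" "Cod C f = Cod C g"
  shows "f \<boxplus> (neg C f \<boxplus> g) = g" "neg C f \<boxplus> (f \<boxplus> g) = g"
proof -
  have "f \<boxplus> (neg C f \<boxplus> g) = (f \<boxplus> neg C f) \<boxplus> g"
    by (rule plus_assoc[symmetric]) (simp_all add: assms)
  also have "\<dots> = g" by (simp add: assms)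
  finally show "f \<boxplus> (neg C f \<boxplus> g) = g" .
  have "neg C f \<boxplus> (f \<boxplus> g) = (neg C f \<boxplus> f) \<boxplus> g"
    by (rule plus_assoc[symmetric]) (simp_all add: assms)
  also have "\<dots> = g" by (simp add: assms)
  finally show "neg C f \<boxplus> (f \<boxplus> g) = g" .
qed

lemma plus_left_cancel:
  assumes "f \<boxplus> g = f \<boxplus> h" "f \<in> Arr C" "g \<in> Arr C" "h \<in> Arr C"
    "Dom C g = Dom C f" "Cod C g = Cod C f" "Dom C h = Dom C f" "Cod C h = Cod C f"
  shows "g = h"
proof -
  have "g = neg C f \<boxplus> (f \<boxplus> g)" by (simp add: assms(2-))
  also have "\<dots> = neg C f \<boxplus> (f \<boxplus> h)" by (simp only: assms(1))
  also have "\<dots> = h" by (simp add: assms(2-))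
  finally show ?thesis .
qed

lemma neg_eqI:
  assumes "f \<boxplus> g = Zero C (Dom C f) (Cod C f)" "f \<in> Arr C" "g \<in> Arr C"
    "Dom C g = Dom C f" "Cod C g = Cod C f"
  shows "neg C f = g"
  using plus_neg_cancel(2)[of f g] assms by simp

lemma eq_if_diff_zero:
  assumes "f \<boxplus> neg C g = Zero C X Y" "f \<in> Arr C" "g \<in> Arr C" "Dom C f = X" "Cod C f = Y"
    "Dom C g = X" "Cod C g = Y"
  shows "f = g"
proof -
  have "f = (f \<boxplus> neg C g) \<boxplus> g" using assms(2-) by simp
  then show ?thesis using assms by simp
qed

lemma neg_zero [simp]: "\<lbrakk>X \<in> Obj C; Y \<in> Obj C\<rbrakk> \<Longrightarrow> neg C (Zero C X Y) = Zero C X Y"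
  by (rule neg_eqI) auto

lemma neg_neg [simp]: "f \<in> Arr C \<Longrightarrow> neg C (neg C f) = f"
  by (rule neg_eqI) auto

lemma neg_plus [simp]:
  assumes "f \<in> Arr C" "g \<in> Arr C" "Dom C f = Dom C g" "Cod C f = Cod C g"
  shows "neg C (f \<boxplus> g) = neg C f \<boxplus> neg C g"
proof (rule neg_eqI)
  show "f \<boxplus> g \<boxplus> (neg C f \<boxplus> neg C g) = Zero C (Dom C (f \<boxplus> g)) (Cod C (f \<boxplus> g))"
    using assms plus_left_comm[of g "neg C f" "neg C g"] by simp
qed (use assms in auto)

lemma comp_plus_left [simp]:
  assumes "f \<in> Arr C" "g \<in> Arr C" "g' \<in> Arr C" "Cod C f = Dom C g" "Dom C g = Dom C g'"
    "Cod C g = Cod C g'"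
  shows "(g \<boxplus> g') \<cdot> f = (g \<cdot> f) \<boxplus> (g' \<cdot> f)"
  using Comp_Plus_left[of f "Dom C f" "Cod C f" g "Cod C g" g'] assms by (auto simp: Hom_iff)

lemma comp_plus_right [simp]:
  assumes "f \<in> Arr C" "f' \<in> Arr C" "g \<in> Arr C" "Cod C f = Dom C g" "Dom C f = Dom C f'"
    "Cod C f = Cod C f'"
  shows "g \<cdot> (f \<boxplus> f') = (g \<cdot> f) \<boxplus> (g \<cdot> f')"
  using Comp_Plus_right[of f "Dom C f" "Cod C f" f' g "Cod C g"] assms by (auto simp: Hom_iff)

lemma comp_zero_left [simp]:
  assumes "f \<in> Arr C" "Cod C f = X" "Y \<in> Obj C"
  shows "Zero C X Y \<cdot> f = Zero C (Dom C f) Y"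
proof (rule plus_left_cancel[of "Zero C X Y \<cdot> f"])
  have "Zero C X Y \<cdot> f \<boxplus> Zero C X Y \<cdot> f = (Zero C X Y \<boxplus> Zero C X Y) \<cdot> f"
    using assms by (intro comp_plus_left[symmetric]) auto
  then show "Zero C X Y \<cdot> f \<boxplus> Zero C X Y \<cdot> f = Zero C X Y \<cdot> f \<boxplus> Zero C (Dom C f) Y"
    using assms by auto
qed (use assms in auto)

lemma comp_zero_right [simp]:
  assumes "f \<in> Arr C" "Dom C f = Y" "X \<in> Obj C"
  shows "f \<cdot> Zero C X Y = Zero C X (Cod C f)"
proof (rule plus_left_cancel[of "f \<cdot> Zero C X Y"])
  have "f \<cdot> Zero C X Y \<boxplus> f \<cdot> Zero C X Y = f \<cdot> (Zero C X Y \<boxplus> Zero C X Y)"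
    using assms by (intro comp_plus_right[symmetric]) auto
  then show "f \<cdot> Zero C X Y \<boxplus> f \<cdot> Zero C X Y = f \<cdot> Zero C X Y \<boxplus> Zero C X (Cod C f)"
    using assms by auto
qed (use assms in auto)

lemma comp_neg_left [simp]:
  assumes "f \<in> Arr C" "g \<in> Arr C" "Cod C f = Dom C g"
  shows "neg C g \<cdot> f = neg C (g \<cdot> f)"
proof (rule neg_eqI[symmetric])
  have "g \<cdot> f \<boxplus> neg C g \<cdot> f = (g \<boxplus> neg C g) \<cdot> f"
    using assms by (intro comp_plus_left[symmetric]) auto
  then show "g \<cdot> f \<boxplus> neg C g \<cdot> f = Zero C (Dom C (g \<cdot> f)) (Cod C (g \<cdot> f))" using assms by simp
qed (use assms in auto)

lemma comp_neg_right [simp]: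
  assumes "f \<in> Arr C" "g \<in> Arr C" "Cod C f = Dom C g"
  shows "g \<cdot> neg C f = neg C (g \<cdot> f)"
proof (rule neg_eqI[symmetric])
  have "g \<cdot> f \<boxplus> g \<cdot> neg C f = g \<cdot> (f \<boxplus> neg C f)"
    using assms by (intro comp_plus_right[symmetric]) auto
  then show "g \<cdot> f \<boxplus> g \<cdot> neg C f = Zero C (Dom C (g \<cdot> f)) (Cod C (g \<cdot> f))" using assms by simp
qed (use assms in auto)

text \<open>If the identity vanishes, so does every arrow into or out of \<open>Z\<close>. The
  universal property thus becomes a single equation between arrows, which additive functors preserve
  and which can be tested componentwise.\<close>

lemma zero_object_iff: "zero_object C Z \<longleftrightarrow> Z \<in> Obj C \<and> Ident C Z = Zero C Z Z"
proof
  assume Z: "zero_object C Z"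
  then have "Z \<in> Obj C" "\<exists>!f. f \<in> Hom C Z Z" by (auto simp: zero_object_def)
  moreover from this have "Ident C Z \<in> Hom C Z Z" "Zero C Z Z \<in> Hom C Z Z" by (auto simp: Hom_iff)
  ultimately show "Z \<in> Obj C \<and> Ident C Z = Zero C Z Z" by blast
next
  assume Z: "Z \<in> Obj C \<and> Ident C Z = Zero C Z Z"
  have "f = Zero C X Z" if "f \<in> Hom C X Z" for X f
    using that Z comp_Ident_left[of f Z] by (auto simp: Hom_iff)
  moreover have "f = Zero C Z X" if "f \<in> Hom C Z X" for X f
    using that Z comp_Ident_right[of f Z] by (auto simp: Hom_iff)
  moreover have "Zero C X Z \<in> Hom C X Z" "Zero C Z X \<in> Hom C Z X" if "X \<in> Obj C" for X
    using that Z by (auto simp: Hom_iff)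
  ultimately show "zero_object C Z" unfolding zero_object_def using Z by metis
qed

lemma zero_object_arr:
  assumes "zero_object C Z" "f \<in> Arr C"
  shows "Cod C f = Z \<Longrightarrow> f = Zero C (Dom C f) Z" "Dom C f = Z \<Longrightarrow> f = Zero C Z (Cod C f)"
proof -
  have Z: "Ident C Z = Zero C Z Z" "Z \<in> Obj C" using assms zero_object_iff by auto
  show "Cod C f = Z \<Longrightarrow> f = Zero C (Dom C f) Z" using comp_Ident_left[of f Z] assms Z by simp
  show "Dom C f = Z \<Longrightarrow> f = Zero C Z (Cod C f)" using comp_Ident_right[of f Z] assms Z by simp
qed

lemma is_biproductE:
  assumes "is_biproduct C X Y S"
  obtains i j p q where "X \<in> Obj C" "Y \<in> Obj C" "S \<in> Obj C"
    "i \<in> Arr C" "Dom C i = X" "Cod C i = S" "j \<in> Arr C" "Dom C j = Y" "Cod C j = S"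
    "p \<in> Arr C" "Dom C p = S" "Cod C p = X" "q \<in> Arr C" "Dom C q = S" "Cod C q = Y"
    "p \<cdot> i = Ident C X" "q \<cdot> j = Ident C Y" "q \<cdot> i = Zero C X Y" "p \<cdot> j = Zero C Y X"
    "(i \<cdot> p) \<boxplus> (j \<cdot> q) = Ident C S"
  using assms unfolding is_biproduct_def
  by (elim conjE bexE) (rule that; simp add: Hom_iff)

lemma is_biproductI:
  assumes "X \<in> Obj C" "Y \<in> Obj C" "S \<in> Obj C"
    "i \<in> Arr C" "Dom C i = X" "Cod C i = S" "j \<in> Arr C" "Dom C j = Y" "Cod C j = S"
    "p \<in> Arr C" "Dom C p = S" "Cod C p = X" "q \<in> Arr C" "Dom C q = S" "Cod C q = Y"
    "p \<cdot> i = Ident C X" "q \<cdot> j = Ident C Y" "q \<cdot> i = Zero C X Y" "p \<cdot> j = Zero C Y X"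
    "(i \<cdot> p) \<boxplus> (j \<cdot> q) = Ident C S"
  shows "is_biproduct C X Y S"
  unfolding is_biproduct_def
  by (intro conjI bexI[of _ i] bexI[of _ j] bexI[of _ p] bexI[of _ q])
    (simp_all add: Hom_iff assms)

text \<open>The matrices \<open>i' \<cdot> p \<boxplus> j' \<cdot> q\<close> and
  \<open>i \<cdot> p' \<boxplus> j \<cdot> q'\<close> are mutually inverse. Needed because an
  additive subcategory contains only some biproduct of two of its objects.\<close>

lemma biproduct_unique:
  assumes "is_biproduct C X Y S" "is_biproduct C X Y T"
  shows "\<exists>f. is_iso C f \<and> Dom C f = S \<and> Cod C f = T"
proof -
  obtain i j p q where b: "X \<in> Obj C" "Y \<in> Obj C" "S \<in> Obj C"
    "i \<in> Arr C" "Dom C i = X" "Cod C i = S" "j \<in> Arr C" "Dom C j = Y" "Cod C j = S"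
    "p \<in> Arr C" "Dom C p = S" "Cod C p = X" "q \<in> Arr C" "Dom C q = S" "Cod C q = Y"
    "p \<cdot> i = Ident C X" "q \<cdot> j = Ident C Y" "q \<cdot> i = Zero C X Y" "p \<cdot> j = Zero C Y X"
    "(i \<cdot> p) \<boxplus> (j \<cdot> q) = Ident C S"
    using assms is_biproductE by metis
  obtain i' j' p' q' where c: "X \<in> Obj C" "Y \<in> Obj C" "T \<in> Obj C"
    "i' \<in> Arr C" "Dom C i' = X" "Cod C i' = T" "j' \<in> Arr C" "Dom C j' = Y" "Cod C j' = T"
    "p' \<in> Arr C" "Dom C p' = T" "Cod C p' = X" "q' \<in> Arr C" "Dom C q' = T" "Cod C q' = Y"
    "p' \<cdot> i' = Ident C X" "q' \<cdot> j' = Ident C Y" "q' \<cdot> i' = Zero C X Y" "p' \<cdot> j' = Zero C Y X"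
    "(i' \<cdot> p') \<boxplus> (j' \<cdot> q') = Ident C T"
    using assms is_biproductE by metis
  note [simp] = b c comp_eq_comp[OF b(16)] comp_eq_comp[OF b(17)] comp_eq_comp[OF b(18)]
    comp_eq_comp[OF b(19)] comp_eq_comp[OF c(16)] comp_eq_comp[OF c(17)] comp_eq_comp[OF c(18)]
    comp_eq_comp[OF c(19)]
  have "is_iso C (i' \<cdot> p \<boxplus> j' \<cdot> q)"
    by (rule is_isoI[where g = "i \<cdot> p' \<boxplus> j \<cdot> q'"]) simp_all
  then show ?thesis by (intro exI[of _ "i' \<cdot> p \<boxplus> j' \<cdot> q"]) simp
qed

lemma kernelD:
  assumes "is_kernel C i p"
  shows "i \<in> Arr C" "p \<in> Arr C" "Cod C i = Dom C p" "p \<cdot> i = Zero C (Dom C i) (Cod C p)"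
  using assms by (auto simp: is_kernel_def)

lemma cokernelD:
  assumes "is_cokernel C p i"
  shows "i \<in> Arr C" "p \<in> Arr C" "Cod C i = Dom C p" "p \<cdot> i = Zero C (Dom C i) (Cod C p)"
  using assms by (auto simp: is_cokernel_def)

lemma kernel_lift:
  assumes "is_kernel C i p" "f \<in> Arr C" "Cod C f = Dom C p" "p \<cdot> f = Zero C (Dom C f) (Cod C p)"
  obtains g where "g \<in> Arr C" "Dom C g = Dom C f" "Cod C g = Dom C i" "i \<cdot> g = f"
proof -
  have "\<exists>!g. g \<in> Hom C (Dom C f) (Dom C i) \<and> i \<cdot> g = f"
    using assms unfolding is_kernel_def by (simp add: Hom_iff)
  then show thesis using that by (auto simp: Hom_iff)
qed

lemma kernel_mono:
  assumes "is_kernel C i p" "i \<cdot> u = i \<cdot> v" "u \<in> Arr C" "v \<in> Arr C" "Cod C u = Dom C i"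
    "Cod C v = Dom C i"
    "Dom C u = Dom C v"
  shows "u = v"
proof -
  note k = kernelD[OF assms(1)]
  have "p \<cdot> (i \<cdot> u) = Zero C (Dom C u) (Cod C p)"
    using comp_eq_comp[OF k(4)] assms k by simp
  then have "\<exists>!g. g \<in> Hom C (Dom C u) (Dom C i) \<and> i \<cdot> g = i \<cdot> u"
    using assms k unfolding is_kernel_def by (simp add: Hom_iff)
  then show ?thesis using assms by (metis Hom_iff)
qed

text \<open>Unique existence is split into a factorization and a cancellation law; for inflation
  sequences the law can then be checked index by index.\<close>

lemma kernelI:
  assumes "i \<in> Arr C" "p \<in> Arr C" "Cod C i = Dom C p" "p \<cdot> i = Zero C (Dom C i) (Cod C p)"
    and lift: "\<And>f. \<lbrakk>f \<in> Arr C; Cod C f = Dom C p; p \<cdot> f = Zero C (Dom C f) (Cod C p)\<rbrakk>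
      \<Longrightarrow> \<exists>g. g \<in> Arr C \<and> Dom C g = Dom C f \<and> Cod C g = Dom C i \<and> i \<cdot> g = f"
    and mono: "\<And>u v. \<lbrakk>u \<in> Arr C; v \<in> Arr C; Cod C u = Dom C i; Cod C v = Dom C i; Dom C u = Dom C v;
       i \<cdot> u = i \<cdot> v\<rbrakk> \<Longrightarrow> u = v"
  shows "is_kernel C i p"
  unfolding is_kernel_def
proof (intro conjI ballI impI)
  fix T f assume T: "T \<in> Obj C" "f \<in> Hom C T (Dom C p)" "p \<cdot> f = Zero C T (Cod C p)"
  then obtain g where g: "g \<in> Arr C" "Dom C g = T" "Cod C g = Dom C i" "i \<cdot> g = f"
    using lift[of f] by (auto simp: Hom_iff)
  show "\<exists>!g. g \<in> Hom C T (Dom C i) \<and> i \<cdot> g = f"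
    by (rule ex1I[of _ g]) (use g mono in \<open>auto simp: Hom_iff\<close>)
qed (use assms in auto)

end

text \<open>The opposite category turns every statement about inflations into one about deflations.\<close>

definition op_cat :: "('o, 'm, 'x) exact_cat_scheme \<Rightarrow> ('o, 'm) exact_cat" where
  "op_cat C = \<lparr>Obj = Obj C, Arr = Arr C, Dom = Cod C, Cod = Dom C, Ident = Ident C,
     Comp = (\<lambda>g f. f \<cdot>\<^bsub>C\<^esub> g), Plus = Plus C, Zero = (\<lambda>X Y. Zero C Y X),
     Confl = {(p, i). (i, p) \<in> Confl C}\<rparr>"

lemma op_cat_simps [simp]:
  "Obj (op_cat C) = Obj C" "Arr (op_cat C) = Arr C" "Dom (op_cat C) = Cod C" "Cod (op_cat C) = Dom C"
  "Ident (op_cat C) = Ident C" "g \<cdot>\<^bsub>op_cat C\<^esub> f = f \<cdot>\<^bsub>C\<^esub> g" "Plus (op_cat C) = Plus C"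
  "Zero (op_cat C) X Y = Zero C Y X" "(p, i) \<in> Confl (op_cat C) \<longleftrightarrow> (i, p) \<in> Confl C"
  by (auto simp: op_cat_def)

lemma Hom_op [simp]: "Hom (op_cat C) X Y = Hom C Y X"
  by (auto simp: Hom_def)

lemma inflation_op [simp]: "inflation (op_cat C) p \<longleftrightarrow> deflation C p"
  by (simp add: inflation_def deflation_def)

lemma deflation_op [simp]: "deflation (op_cat C) i \<longleftrightarrow> inflation C i"
  by (simp add: inflation_def deflation_def)

lemma projective_op [simp]: "projective (op_cat C) X \<longleftrightarrow> injective C X"
  by (simp add: projective_def injective_def)

lemma is_kernel_op [simp]: "is_kernel (op_cat C) p i \<longleftrightarrow> is_cokernel C p i"
  by (auto simp: is_kernel_def is_cokernel_def)

lemma is_cokernel_op [simp]: "is_cokernel (op_cat C) i p \<longleftrightarrow> is_kernel C i p"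
  by (auto simp: is_kernel_def is_cokernel_def)

lemma is_pushout_op [simp]: "is_pushout (op_cat C) p f p' f' \<longleftrightarrow> is_pullback C p f p' f'"
  unfolding is_pushout_def is_pullback_def by auto

lemma is_pullback_op [simp]: "is_pullback (op_cat C) i f i' f' \<longleftrightarrow> is_pushout C i f i' f'"
  unfolding is_pushout_def is_pullback_def by auto

lemma is_iso_op [simp]: "is_iso (op_cat C) f \<longleftrightarrow> is_iso C f"
  by (auto simp: is_iso_def)

lemma zero_object_op [simp]: "zero_object (op_cat C) Z \<longleftrightarrow> zero_object C Z"
  by (auto simp: zero_object_def)

section \<open>Conflations\<close>

lemma kernel_cokernel_pair_op [simp]:
  "kernel_cokernel_pair (op_cat C') p i \<longleftrightarrow> kernel_cokernel_pair C' i p"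
  by (auto simp: kernel_cokernel_pair_def)

lemma hom_group_op: "hom_group (op_cat C) X Y = hom_group C Y X"
  by (simp add: hom_group_def)

context category
begin

lemma pushoutI:
  assumes "i \<in> Arr C" "f \<in> Arr C" "i' \<in> Arr C" "f' \<in> Arr C" "Dom C f = Dom C i" "Dom C i' = Cod C f"
     "Dom C f' = Cod C i" "Cod C f' = Cod C i'" "f' \<cdot> i = i' \<cdot> f"
   and ex: "\<And>u v. \<lbrakk>u \<in> Arr C; v \<in> Arr C; Cod C u = Cod C v; Dom C u = Cod C i; Dom C v = Cod C f;
     u \<cdot> i = v \<cdot> f\<rbrakk>
      \<Longrightarrow> \<exists>w. w \<in> Arr C \<and> Dom C w = Cod C i' \<and> Cod C w = Cod C v \<and> w \<cdot> f' = u \<and> w \<cdot> i' = v"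
   and un: "\<And>u v. \<lbrakk>u \<in> Arr C; v \<in> Arr C; Cod C u = Cod C v; Dom C u = Cod C i'; Dom C v = Cod C i';
      u \<cdot> f' = v \<cdot> f'; u \<cdot> i' = v \<cdot> i'\<rbrakk> \<Longrightarrow> u = v"
  shows "is_pushout C i f i' f'"
  unfolding is_pushout_def
proof (intro conjI ballI impI)
  fix T u v assume "T \<in> Obj C" "u \<in> Hom C (Cod C i) T" "v \<in> Hom C (Cod C f) T" "u \<cdot> i = v \<cdot> f"
  then obtain w where "w \<in> Arr C" "Dom C w = Cod C i'" "Cod C w = T" "w \<cdot> f' = u" "w \<cdot> i' = v"
    using ex[of u v] by (auto simp: Hom_iff)
  then show "\<exists>!w. w \<in> Hom C (Cod C i') T \<and> w \<cdot> f' = u \<and> w \<cdot> i' = v"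
    by (intro ex1I[of _ w]) (use un in \<open>auto simp: Hom_iff\<close>)
qed (use assms in auto)

lemma pullbackI:
  assumes "p \<in> Arr C" "f \<in> Arr C" "p' \<in> Arr C" "f' \<in> Arr C" "Cod C f = Cod C p" "Cod C p' = Dom C f"
     "Cod C f' = Dom C p" "Dom C f' = Dom C p'" "p \<cdot> f' = f \<cdot> p'"
   and ex: "\<And>u v. \<lbrakk>u \<in> Arr C; v \<in> Arr C; Dom C u = Dom C v; Cod C u = Dom C p; Cod C v = Dom C f;
     p \<cdot> u = f \<cdot> v\<rbrakk>
      \<Longrightarrow> \<exists>w. w \<in> Arr C \<and> Cod C w = Dom C p' \<and> Dom C w = Dom C v \<and> f' \<cdot> w = u \<and> p' \<cdot> w = v"
   and un: "\<And>u v. \<lbrakk>u \<in> Arr C; v \<in> Arr C; Dom C u = Dom C v; Cod C u = Dom C p'; Cod C v = Dom C p';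
      f' \<cdot> u = f' \<cdot> v; p' \<cdot> u = p' \<cdot> v\<rbrakk> \<Longrightarrow> u = v"
  shows "is_pullback C p f p' f'"
  unfolding is_pullback_def
proof (intro conjI ballI impI)
  fix T u v assume "T \<in> Obj C" "u \<in> Hom C T (Dom C p)" "v \<in> Hom C T (Dom C f)" "p \<cdot> u = f \<cdot> v"
  then obtain w where "w \<in> Arr C" "Cod C w = Dom C p'" "Dom C w = T" "f' \<cdot> w = u" "p' \<cdot> w = v"
    using ex[of u v] by (auto simp: Hom_iff)
  then show "\<exists>!w. w \<in> Hom C T (Dom C p') \<and> f' \<cdot> w = u \<and> p' \<cdot> w = v"
    by (intro ex1I[of _ w]) (use un in \<open>auto simp: Hom_iff\<close>)
qed (use assms in auto)

end

lemma (in preadditive_category) cokernelI: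
  assumes "i \<in> Arr C" "p \<in> Arr C" "Cod C i = Dom C p" "p \<cdot> i = Zero C (Dom C i) (Cod C p)"
    and descend: "\<And>f. \<lbrakk>f \<in> Arr C; Dom C f = Dom C p; f \<cdot> i = Zero C (Dom C i) (Cod C f)\<rbrakk>
      \<Longrightarrow> \<exists>g. g \<in> Arr C \<and> Cod C g = Cod C f \<and> Dom C g = Cod C p \<and> g \<cdot> p = f"
    and epi: "\<And>u v. \<lbrakk>u \<in> Arr C; v \<in> Arr C; Dom C u = Cod C p; Dom C v = Cod C p; Cod C u = Cod C v;
       u \<cdot> p = v \<cdot> p\<rbrakk> \<Longrightarrow> u = v"
  shows "is_cokernel C p i"
  unfolding is_cokernel_def
proof (intro conjI ballI impI)
  fix T f assume T: "T \<in> Obj C" "f \<in> Hom C (Cod C i) T" "f \<cdot> i = Zero C (Dom C i) T"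
  then obtain g where g: "g \<in> Arr C" "Cod C g = T" "Dom C g = Cod C p" "g \<cdot> p = f"
    using descend[of f] assms(3) by (auto simp: Hom_iff)
  show "\<exists>!g. g \<in> Hom C (Cod C p) T \<and> g \<cdot> p = f"
    by (rule ex1I[of _ g]) (use g epi in \<open>auto simp: Hom_iff\<close>)
qed (use assms in auto)

context additive_category
begin

lemma zero_objectE:
  obtains Z where "zero_object C Z" "Z \<in> Obj C" "Ident C Z = Zero C Z Z"
  using ex_zero_object zero_object_iff by metis

end

section \<open>Duality, push-outs and pull-backs of conflations\<close>

context exact_category
begin

lemma conflD:
  assumes "(i, p) \<in> Confl C"
  shows "i \<in> Arr C" "p \<in> Arr C" "Cod C i = Dom C p" "p \<cdot> i = Zero C (Dom C i) (Cod C p)"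
    "is_kernel C i p" "is_cokernel C p i"
  using Confl_kernel_cokernel[OF assms] kernelD by (auto simp: kernel_cokernel_pair_def)

lemma confl_iso:
  assumes "(i, p) \<in> Confl C" "is_iso C a" "is_iso C b" "is_iso C c" "i' \<in> Arr C" "p' \<in> Arr C"
    "Cod C i' = Dom C p'" "Dom C a = Dom C i" "Cod C a = Dom C i'" "Dom C b = Cod C i"
    "Cod C b = Cod C i'" "Dom C c = Cod C p" "Cod C c = Cod C p'" "b \<cdot> i = i' \<cdot> a" "c \<cdot> p = p' \<cdot> b"
  shows "(i', p') \<in> Confl C"
  using iso_closureI[OF assms] Confl_iso_closed by blast

text \<open>Inverting the three isomorphisms reduces this to \<open>confl_iso\<close>. The direction
  matters for duality: passing to the opposite category turns the isomorphisms around.\<close>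

lemma confl_iso_rev:
  assumes "(i, p) \<in> Confl C" "is_iso C a" "is_iso C b" "is_iso C c" "i' \<in> Arr C" "p' \<in> Arr C"
    "Cod C i' = Dom C p'" "Cod C a = Dom C i" "Dom C a = Dom C i'" "Cod C b = Cod C i"
    "Dom C b = Cod C i'" "Cod C c = Cod C p" "Dom C c = Cod C p'" "i \<cdot> a = b \<cdot> i'" "p \<cdot> b = c \<cdot> p'"
  shows "(i', p') \<in> Confl C"
proof -
  obtain a' where a: "is_iso C a'" "a \<in> Arr C" "a' \<in> Arr C" "Dom C a' = Cod C a" "Cod C a' = Dom C a"
    "a' \<cdot> a = Ident C (Dom C a)" "a \<cdot> a' = Ident C (Cod C a)"
    using iso_inverse[OF assms(2)] by metis
  obtain b' where b: "is_iso C b'" "b \<in> Arr C" "b' \<in> Arr C" "Dom C b' = Cod C b" "Cod C b' = Dom C b"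
    "b' \<cdot> b = Ident C (Dom C b)" "b \<cdot> b' = Ident C (Cod C b)"
    using iso_inverse[OF assms(3)] by metis
  obtain c' where c: "is_iso C c'" "c \<in> Arr C" "c' \<in> Arr C" "Dom C c' = Cod C c" "Cod C c' = Dom C c"
    "c' \<cdot> c = Ident C (Dom C c)" "c \<cdot> c' = Ident C (Cod C c)"
    using iso_inverse[OF assms(4)] by metis
  note ip = conflD[OF assms(1)]
  have [simp]: "Cod C i = Dom C p" "i \<in> Arr C" "p \<in> Arr C" using ip by auto
  note [simp] = a(2-7) b(2-7) c(2-7) assms(5-13)
  have "b' \<cdot> i = b' \<cdot> (i \<cdot> (a \<cdot> a'))" by simp
  also have "\<dots> = b' \<cdot> ((i \<cdot> a) \<cdot> a')" by simp
  also have "\<dots> = i' \<cdot> a'" unfolding assms(14) by (simp add: comp_eq_comp[OF b(6)])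
  finally have 1: "b' \<cdot> i = i' \<cdot> a'" .
  have "c' \<cdot> p = c' \<cdot> ((p \<cdot> b) \<cdot> b')" by simp
  also have "\<dots> = p' \<cdot> b'" unfolding assms(15) by (simp add: comp_eq_comp[OF c(6)])
  finally have 2: "c' \<cdot> p = p' \<cdot> b'" .
  show ?thesis
    by (rule confl_iso[OF assms(1) a(1) b(1) c(1)]) (use 1 2 in simp_all)
qed

text \<open>The axioms come in dual pairs, so most of them are exchanged with their partners.
  Biproducts survive by swapping injections with projections.\<close>

lemma exact_op: "exact_category (op_cat C)"
proof (intro exact_category.intro additive_category.intro preadditive_category.intro category.intro
    exact_category_axioms.intro additive_category_axioms.intro preadditive_category_axioms.intro)
  fix f g g' h X Y Z W
  show "f \<in> Arr (op_cat C) \<Longrightarrow> Dom (op_cat C) f \<in> Obj (op_cat C)"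
    "f \<in> Arr (op_cat C) \<Longrightarrow> Cod (op_cat C) f \<in> Obj (op_cat C)" by auto
  show "X \<in> Obj (op_cat C) \<Longrightarrow> Ident (op_cat C) X \<in> Hom (op_cat C) X X" by (auto simp: Ident_in)
  show "f \<in> Hom (op_cat C) X Y \<Longrightarrow> g \<in> Hom (op_cat C) Y Z \<Longrightarrow> g \<cdot>\<^bsub>op_cat C\<^esub> f \<in> Hom (op_cat C) X Z"
    by (auto simp: Comp_in)
  show "f \<in> Hom (op_cat C) W X \<Longrightarrow> g \<in> Hom (op_cat C) X Y \<Longrightarrow> h \<in> Hom (op_cat C) Y Z \<Longrightarrow>
    (h \<cdot>\<^bsub>op_cat C\<^esub> g) \<cdot>\<^bsub>op_cat C\<^esub> f = h \<cdot>\<^bsub>op_cat C\<^esub> (g \<cdot>\<^bsub>op_cat C\<^esub> f)" by (auto simp: Hom_iff)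
  show "f \<in> Hom (op_cat C) X Y \<Longrightarrow> Ident (op_cat C) Y \<cdot>\<^bsub>op_cat C\<^esub> f = f" by (auto simp: Hom_iff)
  show "f \<in> Hom (op_cat C) X Y \<Longrightarrow> f \<cdot>\<^bsub>op_cat C\<^esub> Ident (op_cat C) X = f" by (auto simp: Hom_iff)
  show "X \<in> Obj (op_cat C) \<Longrightarrow> Y \<in> Obj (op_cat C) \<Longrightarrow> comm_group (hom_group (op_cat C) X Y)"
    by (simp add: hom_group_op hom_comm_group)
  show "f \<in> Hom (op_cat C) X Y \<Longrightarrow> g \<in> Hom (op_cat C) Y Z \<Longrightarrow> g' \<in> Hom (op_cat C) Y Z \<Longrightarrow>
       (g \<boxplus>\<^bsub>op_cat C\<^esub> g') \<cdot>\<^bsub>op_cat C\<^esub> f = g \<cdot>\<^bsub>op_cat C\<^esub> f \<boxplus>\<^bsub>op_cat C\<^esub> g' \<cdot>\<^bsub>op_cat C\<^esub> f"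
    by (auto simp: Hom_iff)
  fix f'
  show "f \<in> Hom (op_cat C) X Y \<Longrightarrow> f' \<in> Hom (op_cat C) X Y \<Longrightarrow> g \<in> Hom (op_cat C) Y Z \<Longrightarrow>
       g \<cdot>\<^bsub>op_cat C\<^esub> (f \<boxplus>\<^bsub>op_cat C\<^esub> f') = g \<cdot>\<^bsub>op_cat C\<^esub> f \<boxplus>\<^bsub>op_cat C\<^esub> g \<cdot>\<^bsub>op_cat C\<^esub> f'"
    by (auto simp: Hom_iff)
next
  show "\<exists>Z. zero_object (op_cat C) Z" by (simp add: ex_zero_object)
next
  fix X Y assume "X \<in> Obj (op_cat C)" "Y \<in> Obj (op_cat C)"
  then obtain S where S: "is_biproduct C X Y S" using ex_biproduct by auto
  then have "is_biproduct (op_cat C) X Y S"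
  proof (rule is_biproductE)
    fix i j p q
    assume *: "X \<in> Obj C" "Y \<in> Obj C" "S \<in> Obj C" "i \<in> Arr C" "Dom C i = X" "Cod C i = S"
      "j \<in> Arr C" "Dom C j = Y" "Cod C j = S" "p \<in> Arr C" "Dom C p = S" "Cod C p = X" "q \<in> Arr C"
      "Dom C q = S" "Cod C q = Y" "p \<cdot> i = Ident C X" "q \<cdot> j = Ident C Y" "q \<cdot> i = Zero C X Y"
      "p \<cdot> j = Zero C Y X" "i \<cdot> p \<boxplus> j \<cdot> q = Ident C S"
    show ?thesis
      unfolding is_biproduct_def
      by (intro conjI bexI[of _ p] bexI[of _ q] bexI[of _ i] bexI[of _ j])
        (simp_all add: Hom_iff *)
  qed
  then show "\<exists>S. is_biproduct (op_cat C) X Y S" by blast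
next
  fix i p assume "(i, p) \<in> Confl (op_cat C)"
  then show "kernel_cokernel_pair (op_cat C) i p" using Confl_kernel_cokernel by simp
next
  show "iso_closure (op_cat C) (Confl (op_cat C)) \<subseteq> Confl (op_cat C)"
  proof (clarify)
    fix p' i' assume "(p', i') \<in> iso_closure (op_cat C) (Confl (op_cat C))"
    then obtain p i a b c where *: "(i, p) \<in> Confl C" "p' \<in> Arr C" "i' \<in> Arr C" "Dom C p' = Cod C i'"
      "is_iso C a" "is_iso C b" "is_iso C c" "a \<in> Hom C (Cod C p') (Cod C p)"
      "b \<in> Hom C (Dom C p') (Dom C p)" "c \<in> Hom C (Dom C i') (Dom C i)"
      "p \<cdot> b = a \<cdot> p'" "i \<cdot> c = b \<cdot> i'"
      unfolding iso_closure_def by auto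
    \<comment> \<open>Read in \<open>C\<close>, the isomorphisms lead from the new pair to the given
      conflation, hence the reversed closure rule.\<close>
    have "(i', p') \<in> Confl C"
      by (rule confl_iso_rev[OF *(1) *(7) *(6) *(5)])
        (use * conflD[OF *(1)] in \<open>simp_all add: Hom_iff\<close>)
    then show "(p', i') \<in> Confl (op_cat C)" by simp
  qed
qed (use inflation_pushout deflation_pullback in
  \<open>simp_all add: inflation_Ident deflation_Ident inflation_Comp deflation_Comp\<close>)

lemmas confl_mono = kernel_mono[OF conflD(5)]
lemmas confl_lift = kernel_lift[OF conflD(5)]

lemma cokernel_lift:
  assumes "is_cokernel C p i" "f \<in> Arr C" "Dom C f = Dom C p" "f \<cdot> i = Zero C (Dom C i) (Cod C f)"
  obtains g where "g \<in> Arr C" "Cod C g = Cod C f" "Dom C g = Cod C p" "g \<cdot> p = f"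
proof -
  interpret op: exact_category "op_cat C" by (rule exact_op)
  have "\<exists>g. g \<in> Arr C \<and> Cod C g = Cod C f \<and> Dom C g = Cod C p \<and> g \<cdot> p = f"
    by (rule op.kernel_lift[of p i f]) (use assms cokernelD(3)[OF assms(1)] in auto)
  then show thesis using that by blast
qed

lemma cokernel_epi:
  assumes "is_cokernel C p i" "u \<cdot> p = v \<cdot> p" "u \<in> Arr C" "v \<in> Arr C" "Dom C u = Cod C p"
    "Dom C v = Cod C p"
    "Cod C u = Cod C v"
  shows "u = v"
proof -
  interpret op: exact_category "op_cat C" by (rule exact_op)
  show ?thesis using op.kernel_mono[of p i u v] assms by simp
qed

lemmas confl_epi = cokernel_epi[OF conflD(6)]
lemmas confl_descend = cokernel_lift[OF conflD(6)]

text \<open>The inflation \<open>i\<close> belongs to some conflation \<open>(i, q)\<close>. Both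
  \<open>p\<close> and \<open>q\<close> are cokernels of \<open>i\<close>, hence differ by an
  isomorphism, and conflations are closed under isomorphism.\<close>

lemma confl_of_cokernel:
  assumes "inflation C i" "is_cokernel C p i"
  shows "(i, p) \<in> Confl C"
proof -
  obtain q where q: "(i, q) \<in> Confl C" using assms by (auto simp: inflation_def)
  note Q = conflD[OF q] and P = cokernelD[OF assms(2)]
  obtain c where c: "c \<in> Arr C" "Cod C c = Cod C p" "Dom C c = Cod C q" "c \<cdot> q = p"
    using confl_descend[OF q, of p] P Q by auto
  obtain d where d: "d \<in> Arr C" "Cod C d = Cod C q" "Dom C d = Cod C p" "d \<cdot> p = q"
    using cokernel_lift[OF assms(2), of q] P Q by auto
  have "d \<cdot> c = Ident C (Cod C q)"
    by (rule confl_epi[OF q]) (use P Q c d in auto)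
  moreover have "c \<cdot> d = Ident C (Cod C p)"
    by (rule cokernel_epi[OF assms(2)]) (use P Q c d in auto)
  ultimately have "is_iso C c"
    by (intro is_isoI[where g = d]) (use c d in auto)
  then show ?thesis
    by (intro confl_iso[OF q, of "Ident C (Dom C i)" "Ident C (Cod C i)" c])
      (use P(1-3) Q(1-3) c in \<open>simp_all add: iso_Ident\<close>)
qed

lemma confl_of_kernel:
  assumes "deflation C p" "is_kernel C i p"
  shows "(i, p) \<in> Confl C"
proof -
  interpret op: exact_category "op_cat C" by (rule exact_op)
  show ?thesis using op.confl_of_cokernel[of p i] assms by simp
qed

lemma pushoutD:
  assumes "is_pushout C i f i' f'"
  shows "i \<in> Arr C" "f \<in> Arr C" "i' \<in> Arr C" "f' \<in> Arr C" "Dom C f = Dom C i" "Dom C i' = Cod C f"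
     "Dom C f' = Cod C i" "Cod C f' = Cod C i'" "f' \<cdot> i = i' \<cdot> f"
  using assms by (auto simp: is_pushout_def)

lemma pushout_universal:
  assumes "is_pushout C i f i' f'" "u \<in> Arr C" "v \<in> Arr C" "Cod C u = Cod C v" "Dom C u = Cod C i"
    "Dom C v = Cod C f" "u \<cdot> i = v \<cdot> f"
  shows "\<exists>!w. w \<in> Hom C (Cod C i') (Cod C v) \<and> w \<cdot> f' = u \<and> w \<cdot> i' = v"
proof -
  have "\<forall>T \<in> Obj C. \<forall>u \<in> Hom C (Cod C i) T. \<forall>v \<in> Hom C (Cod C f) T. u \<cdot> i = v \<cdot> f \<longrightarrow>
      (\<exists>!w. w \<in> Hom C (Cod C i') T \<and> w \<cdot> f' = u \<and> w \<cdot> i' = v)"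
    using assms(1) unfolding is_pushout_def by (elim conjE)
  from this[THEN bspec, of "Cod C v", THEN bspec, of u, THEN bspec, of v]
  show ?thesis using assms(2-) by (simp add: Hom_iff)
qed

lemma pushout_induced:
  assumes "is_pushout C i f i' f'" "u \<in> Arr C" "v \<in> Arr C" "Cod C u = Cod C v" "Dom C u = Cod C i"
    "Dom C v = Cod C f" "u \<cdot> i = v \<cdot> f"
  obtains w where "w \<in> Arr C" "Dom C w = Cod C i'" "Cod C w = Cod C v" "w \<cdot> f' = u" "w \<cdot> i' = v"
  using pushout_universal[OF assms] that unfolding Hom_iff by blast

lemma pushout_epi:
  assumes "is_pushout C i f i' f'" "u \<in> Arr C" "v \<in> Arr C" "Cod C u = Cod C v" "Dom C u = Cod C i'"
    "Dom C v = Cod C i'" "u \<cdot> f' = v \<cdot> f'" "u \<cdot> i' = v \<cdot> i'"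
  shows "u = v"
proof -
  note P = pushoutD[OF assms(1)]
  have "(u \<cdot> f') \<cdot> i = (u \<cdot> i') \<cdot> f" using P assms(2-6) by simp
  then have "\<exists>!w. w \<in> Hom C (Cod C i') (Cod C v) \<and> w \<cdot> f' = u \<cdot> f' \<and> w \<cdot> i' = u \<cdot> i'"
    using pushout_universal[OF assms(1), of "u \<cdot> f'" "u \<cdot> i'"] assms(2-6) P by simp
  moreover have "u \<in> Hom C (Cod C i') (Cod C v)" "v \<in> Hom C (Cod C i') (Cod C v)"
    using assms by (auto simp: Hom_iff)
  ultimately show ?thesis using assms(7,8) by metis
qed

lemma pushout_unique:
  assumes "is_pushout C i f i' f'" "is_pushout C i f j g"
  obtains w where "is_iso C w" "Dom C w = Cod C i'" "Cod C w = Cod C j" "w \<cdot> i' = j" "w \<cdot> f' = g"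
proof -
  note P = pushoutD[OF assms(1)] and Q = pushoutD[OF assms(2)]
  obtain w where w: "w \<in> Arr C" "Dom C w = Cod C i'" "Cod C w = Cod C j" "w \<cdot> f' = g" "w \<cdot> i' = j"
    using pushout_induced[OF assms(1), of g j] P Q by auto
  obtain z where z: "z \<in> Arr C" "Dom C z = Cod C j" "Cod C z = Cod C i'" "z \<cdot> g = f'" "z \<cdot> j = i'"
    using pushout_induced[OF assms(2), of f' i'] P Q by auto
  have "z \<cdot> w = Ident C (Cod C i')"
    by (rule pushout_epi[OF assms(1)]) (use w z P Q in auto)
  moreover have "w \<cdot> z = Ident C (Cod C j)"
    by (rule pushout_epi[OF assms(2)]) (use w z P Q in auto)
  ultimately have "is_iso C w" by (intro is_isoI[where g = z]) (use w z in auto)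
  then show thesis using that w by blast
qed

lemma inflation_iso:
  assumes "inflation C i" "is_iso C w" "Dom C w = Cod C i"
  shows "inflation C (w \<cdot> i)"
proof -
  obtain p where p: "(i, p) \<in> Confl C" using assms by (auto simp: inflation_def)
  obtain z where z: "w \<in> Arr C" "z \<in> Arr C" "Dom C z = Cod C w" "Cod C z = Dom C w"
    "z \<cdot> w = Ident C (Dom C w)" "w \<cdot> z = Ident C (Cod C w)" using iso_inverse[OF assms(2)] by metis
  have "(w \<cdot> i, p \<cdot> z) \<in> Confl C"
    by (rule confl_iso[OF p iso_Ident assms(2) iso_Ident, of "Dom C i" "Cod C p"])
      (use z conflD[OF p] assms(3) in simp_all)
  then show ?thesis by (auto simp: inflation_def)
qed

text \<open>The axiom provides one push-out whose parallel arrow is an inflation; uniqueness of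
  push-outs transfers this to the push-out at hand.\<close>

lemma inflation_of_pushout:
  assumes "is_pushout C i f i' f'" "inflation C i"
  shows "inflation C i'"
proof -
  obtain j g where jg: "is_pushout C i f j g" "inflation C j"
    using inflation_pushout[of i f] assms pushoutD[OF assms(1)] by auto
  obtain w where w: "is_iso C w" "Dom C w = Cod C j" "Cod C w = Cod C i'" "w \<cdot> j = i'" "w \<cdot> g = f'"
    using pushout_unique[OF jg(1) assms(1)] by metis
  show ?thesis using inflation_iso[OF jg(2) w(1)] w by simp
qed

text \<open>The arrow induced by \<open>p\<close> on one leg and by zero on the other is a cokernel
  of \<open>i'\<close>: an arrow vanishing on \<open>i'\<close> is determined by its restriction
  along \<open>f'\<close>, which vanishes on \<open>i\<close> and so descends along
  \<open>p\<close>.\<close>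

lemma pushout_confl:
  assumes "(i, p) \<in> Confl C" "is_pushout C i f i' f'"
  obtains p' where "(i', p') \<in> Confl C" "Cod C p' = Cod C p" "p' \<cdot> f' = p"
proof -
  note P = pushoutD[OF assms(2)] and I = conflD[OF assms(1)]
  have *: "p \<cdot> i = Zero C (Cod C f) (Cod C p) \<cdot> f" using I P by simp
  obtain p' where p': "p' \<in> Arr C" "Dom C p' = Cod C i'" "Cod C p' = Cod C p"
     "p' \<cdot> f' = p" "p' \<cdot> i' = Zero C (Cod C f) (Cod C p)"
    by (rule pushout_induced[OF assms(2), of p "Zero C (Cod C f) (Cod C p)"])
      (use * I(1-3) P in auto)
  have "is_cokernel C p' i'"
  proof (rule cokernelI)
    fix t assume t: "t \<in> Arr C" "Dom C t = Dom C p'" "t \<cdot> i' = Zero C (Dom C i') (Cod C t)"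
    have "(t \<cdot> f') \<cdot> i = (t \<cdot> i') \<cdot> f" using P t(1,2) p' by simp
    then have "(t \<cdot> f') \<cdot> i = Zero C (Dom C i) (Cod C t)" unfolding t(3) using P t by simp
    then obtain g where g: "g \<in> Arr C" "Cod C g = Cod C t" "Dom C g = Cod C p" "g \<cdot> p = t \<cdot> f'"
      using confl_descend[OF assms(1), of "t \<cdot> f'"] P t p' I by auto
    have "g \<cdot> p' = t"
    proof (rule pushout_epi[OF assms(2)])
      show "(g \<cdot> p') \<cdot> f' = t \<cdot> f'" using g p' P t by simp
      show "(g \<cdot> p') \<cdot> i' = t \<cdot> i'" using g p' P t by simp
    qed (use g p' P t in auto)
    then show "\<exists>g. g \<in> Arr C \<and> Cod C g = Cod C t \<and> Dom C g = Cod C p' \<and> g \<cdot> p' = t"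
      using g p' by auto
  next
    fix u v assume uv: "u \<in> Arr C" "v \<in> Arr C" "Dom C u = Cod C p'" "Dom C v = Cod C p'"
      "Cod C u = Cod C v" "u \<cdot> p' = v \<cdot> p'"
    have "(u \<cdot> p') \<cdot> f' = (v \<cdot> p') \<cdot> f'" by (simp only: uv(6))
    then have "u \<cdot> p = v \<cdot> p" using uv(1-5) p' P by simp
    then show "u = v" by (rule confl_epi[OF assms(1)]) (use uv p' in auto)
  qed (use P p' in auto)
  then have "(i', p') \<in> Confl C"
    using confl_of_cokernel inflation_of_pushout[OF assms(2)] assms(1) by (auto simp: inflation_def)
  then show thesis using that p' by blast
qed

lemma confl_pushout:
  assumes "(i, p) \<in> Confl C" "f \<in> Arr C" "Dom C f = Dom C i"
  obtains i' f' p' where "is_pushout C i f i' f'" "(i', p') \<in> Confl C" "Cod C p' = Cod C p"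
    "p' \<cdot> f' = p"
proof -
  obtain i' f' where "is_pushout C i f i' f'"
    using inflation_pushout[of i f] assms by (auto simp: inflation_def)
  then show thesis using pushout_confl[OF assms(1)] that by metis
qed

lemma pullback_induced:
  assumes "is_pullback C p f p' f'" "u \<in> Arr C" "v \<in> Arr C" "Dom C u = Dom C v" "Cod C u = Dom C p"
    "Cod C v = Dom C f" "p \<cdot> u = f \<cdot> v"
  obtains w where "w \<in> Arr C" "Cod C w = Dom C p'" "Dom C w = Dom C v" "f' \<cdot> w = u" "p' \<cdot> w = v"
proof -
  interpret op: exact_category "op_cat C" by (rule exact_op)
  have "\<exists>w. w \<in> Arr C \<and> Cod C w = Dom C p' \<and> Dom C w = Dom C v \<and> f' \<cdot> w = u \<and> p' \<cdot> w = v"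
    by (rule op.pushout_induced[of p f p' f' u v]) (use assms in auto)
  then show thesis using that by blast
qed

lemma pullback_mono:
  assumes "is_pullback C p f p' f'" "u \<in> Arr C" "v \<in> Arr C" "Dom C u = Dom C v" "Cod C u = Dom C p'"
    "Cod C v = Dom C p'" "f' \<cdot> u = f' \<cdot> v" "p' \<cdot> u = p' \<cdot> v"
  shows "u = v"
proof -
  interpret op: exact_category "op_cat C" by (rule exact_op)
  show ?thesis using op.pushout_epi[of p f p' f' u v] assms by simp
qed

lemma pullbackD:
  assumes "is_pullback C p f p' f'"
  shows "p \<in> Arr C" "f \<in> Arr C" "p' \<in> Arr C" "f' \<in> Arr C" "Cod C f = Cod C p" "Cod C p' = Dom C f"
     "Cod C f' = Dom C p" "Dom C f' = Dom C p'" "p \<cdot> f' = f \<cdot> p'"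
  using assms by (auto simp: is_pullback_def)

lemma confl_pullback:
  assumes "(i, p) \<in> Confl C" "f \<in> Arr C" "Cod C f = Cod C p"
  obtains p' f' i' where "is_pullback C p f p' f'" "(i', p') \<in> Confl C" "Dom C i' = Dom C i"
    "f' \<cdot> i' = i"
proof -
  interpret op: exact_category "op_cat C" by (rule exact_op)
  have "\<exists>p' f' i'. is_pullback C p f p' f' \<and> (i', p') \<in> Confl C \<and> Dom C i' = Dom C i \<and> f' \<cdot> i' = i"
    by (rule op.confl_pushout[of p i f]) (use assms in auto)
  then show thesis using that by blast
qed

end

section \<open>Morphisms of conflations\<close>

context exact_category
begin

lemma kernel_cancel_zero:
  assumes "is_kernel C i p" "i \<cdot> r = Zero C (Dom C r) (Cod C i)" "r \<in> Arr C" "Cod C r = Dom C i"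
  shows "r = Zero C (Dom C r) (Dom C i)"
  by (rule kernel_mono[OF assms(1)]) (use assms(2-) kernelD[OF assms(1)] in simp_all)

text \<open>A compatible pair \<open>u\<close>, \<open>v\<close> is lifted after pulling back the deflation \<open>p\<close> along \<open>v\<close>; the
  corrected lift vanishes on the kernel of the pulled back deflation and therefore descends.\<close>

lemma confl_map_pullback:
  assumes ip: "(i, p) \<in> Confl C" and ip': "(i', p') \<in> Confl C" and "b \<in> Arr C" "c \<in> Arr C"
    "Dom C b = Cod C i" "Cod C b = Cod C i'" "Dom C c = Cod C p" "Cod C c = Cod C p'"
    "Dom C i' = Dom C i"
    and bi: "b \<cdot> i = i'" and pb: "p' \<cdot> b = c \<cdot> p"
  shows "is_pullback C p' c p b"
proof -
  note I = conflD[OF ip] and I' = conflD[OF ip']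
  have [simp]: "i \<in> Arr C" "p \<in> Arr C" "i' \<in> Arr C" "p' \<in> Arr C" "Cod C i = Dom C p"
    "Cod C i' = Dom C p'"
    using I I' assms by auto
  have z [simp]: "p \<cdot> i = Zero C (Dom C i) (Cod C p)" "p' \<cdot> i' = Zero C (Dom C i) (Cod C p')"
    using I I' assms by auto
  note [simp] = assms(3-10)[unfolded \<open>Cod C i = Dom C p\<close> \<open>Cod C i' = Dom C p'\<close>] pb
  note [simp] = comp_eq_comp[OF bi] comp_eq_comp[OF pb] comp_eq_comp[OF z(1)] comp_eq_comp[OF z(2)]
  show ?thesis
  proof (rule pullbackI)
    fix u v assume [simp]: "u \<in> Arr C" "v \<in> Arr C" "Dom C u = Dom C v" "Cod C u = Dom C p'"
      "Cod C v = Dom C c"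
      and uv: "p' \<cdot> u = c \<cdot> v"
    note [simp] = uv comp_eq_comp[OF uv]
    obtain w e k where w: "is_pullback C p v w e" "(k, w) \<in> Confl C" "Dom C k = Dom C i" "e \<cdot> k = i"
      using confl_pullback[OF ip, of v] by auto
    note W = conflD[OF w(2)] and E = pullbackD[OF w(1)]
    have [simp]: "w \<in> Arr C" "e \<in> Arr C" "k \<in> Arr C" "Cod C w = Dom C v" "Cod C e = Dom C p"
      "Dom C e = Dom C w"
      "Cod C k = Dom C w"
      using W E by auto
    have pe: "p \<cdot> e = v \<cdot> w" and wk: "w \<cdot> k = Zero C (Dom C k) (Dom C v)" using E W by auto
    note [simp] = pe wk comp_eq_comp[OF pe] comp_eq_comp[OF wk]
    \<comment> \<open>Both \<open>b \<cdot> e\<close> and \<open>u \<cdot> w\<close> lie over the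
      same arrow, so their difference comes from the common kernel via \<open>i'\<close>.
      Subtracting \<open>i \<cdot> s\<close> from \<open>e\<close> then makes \<open>b\<close> send
      the corrected lift to \<open>u \<cdot> w\<close> without changing its image under
      \<open>p\<close>.\<close>
    obtain s where s: "s \<in> Arr C" "Dom C s = Dom C w" "Cod C s = Dom C i"
      "i' \<cdot> s = b \<cdot> e \<boxplus> neg C (u \<cdot> w)"
      by (rule confl_lift[OF ip', of "b \<cdot> e \<boxplus> neg C (u \<cdot> w)"]) simp_all
    define e1 where "e1 = e \<boxplus> neg C (i \<cdot> s)"
    have e1 [simp]: "e1 \<in> Arr C" "Dom C e1 = Dom C w" "Cod C e1 = Dom C p" by (simp_all add: e1_def s)
    have be1: "b \<cdot> e1 = u \<cdot> w" and pe1: "p \<cdot> e1 = v \<cdot> w" by (simp_all add: e1_def s)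
    note [simp] = be1 pe1 comp_eq_comp[OF be1] comp_eq_comp[OF pe1]
    obtain r where r: "r \<in> Arr C" "Dom C r = Dom C k" "Cod C r = Dom C i" "i \<cdot> r = e1 \<cdot> k"
      by (rule confl_lift[OF ip, of "e1 \<cdot> k"]) (simp_all add: w)
    have "i' \<cdot> r = b \<cdot> (i \<cdot> r)" using r(1-3) by simp
    also have "\<dots> = Zero C (Dom C r) (Cod C i')" unfolding r(4) by (simp add: w r)
    finally have "r = Zero C (Dom C r) (Dom C i')"
      using kernel_cancel_zero[OF I'(5), of r] r by simp
    then have "i \<cdot> r = Zero C (Dom C k) (Dom C p)" using r by (metis comp_zero_right Dom_in \<open>i \<in> Arr C\<close>
      \<open>Cod C i = Dom C p\<close> assms(9))
    then have "e1 \<cdot> k = Zero C (Dom C k) (Cod C e1)" using r by simp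
    then obtain z where z: "z \<in> Arr C" "Cod C z = Dom C p" "Dom C z = Dom C v" "z \<cdot> w = e1"
      using confl_descend[OF w(2), of e1] by auto
    have "b \<cdot> z = u" by (rule confl_epi[OF w(2)]) (use z in simp_all)
    moreover have "p \<cdot> z = v" by (rule confl_epi[OF w(2)]) (use z in simp_all)
    ultimately show "\<exists>w. w \<in> Arr C \<and> Cod C w = Dom C p \<and> Dom C w = Dom C v \<and> b \<cdot> w = u \<and> p \<cdot> w = v"
      using z by blast
  next
    fix u v assume uv: "u \<in> Arr C" "v \<in> Arr C" "Dom C u = Dom C v" "Cod C u = Dom C p"
      "Cod C v = Dom C p"
      "b \<cdot> u = b \<cdot> v" "p \<cdot> u = p \<cdot> v"
    obtain r where r: "r \<in> Arr C" "Dom C r = Dom C u" "Cod C r = Dom C i" "i \<cdot> r = u \<boxplus> neg C v"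
      by (rule confl_lift[OF ip, of "u \<boxplus> neg C v"]) (use uv in simp_all)
    have "i' \<cdot> r = b \<cdot> (i \<cdot> r)" using r(1-3) by simp
    also have "\<dots> = Zero C (Dom C r) (Cod C i')" unfolding r(4) using uv r by simp
    finally have "r = Zero C (Dom C r) (Dom C i')"
      using kernel_cancel_zero[OF I'(5), of r] r by simp
    then have "i \<cdot> r = Zero C (Dom C u) (Dom C p)" using r by (metis comp_zero_right Dom_in \<open>i \<in> Arr C\<close>
      \<open>Cod C i = Dom C p\<close> assms(9))
    then have *: "u \<boxplus> neg C v = Zero C (Dom C v) (Dom C p)" using r uv by simp
    show "u = v" by (rule eq_if_diff_zero[OF *]) (use uv in simp_all)
  qed simp_all
qed

text \<open>Recognizes push-outs from conflations alone. An exact functor preserves the conflations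
  and the squares, hence also these push-outs, although nothing is assumed about its effect on
  colimits.\<close>

lemma confl_map_pushout:
  assumes "(i, p) \<in> Confl C" "(i', p') \<in> Confl C" "b \<in> Arr C" "a \<in> Arr C"
    "Dom C b = Cod C i" "Cod C b = Cod C i'" "Dom C a = Dom C i" "Cod C a = Dom C i'"
    "Cod C p' = Cod C p"
    "p' \<cdot> b = p" "b \<cdot> i = i' \<cdot> a"
  shows "is_pushout C i a i' b"
proof -
  interpret op: exact_category "op_cat C" by (rule exact_op)
  have "Cod C i = Dom C p" "Cod C i' = Dom C p'" using assms(1,2) conflD by auto
  then show ?thesis using op.confl_map_pullback[of p' i' p i b a] assms by simp
qed

lemma pushout_sym: "is_pushout C i f i' f' \<Longrightarrow> is_pushout C f i f' i'"
  unfolding is_pushout_def by (elim conjE, intro conjI) (simp_all, metis)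

lemma cokernel_of_pushout:
  assumes "(a, m) \<in> Confl C" "is_pushout C i a i' b"
  obtains n where "(b, n) \<in> Confl C" "Cod C n = Cod C m" "n \<cdot> i' = m"
  using pushout_confl[OF assms(1) pushout_sym[OF assms(2)]] by metis

text \<open>The square formed by \<open>b\<close> and \<open>c\<close> is a pull-back. So
  \<open>b\<close> arises by pulling back the kernel \<open>c\<close> of \<open>n\<close> along
  \<open>p'\<close>, and this is the kernel of the composite deflation
  \<open>n \<cdot> p'\<close>.\<close>

lemma kernel_comp_confl:
  assumes ip: "(i, p) \<in> Confl C" and ip': "(i', p') \<in> Confl C" and cn: "(c, n) \<in> Confl C" and
    "b \<in> Arr C"
    "Dom C b = Cod C i" "Cod C b = Cod C i'" "Dom C c = Cod C p" "Cod C c = Cod C p'"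
    "Dom C i' = Dom C i"
    and "b \<cdot> i = i'" "p' \<cdot> b = c \<cdot> p"
  shows "(b, n \<cdot> p') \<in> Confl C"
proof (rule confl_of_kernel)
  note N = conflD[OF cn] and P = conflD(1-4)[OF ip] conflD(1-4)[OF ip']
  have "deflation C n" "deflation C p'" using cn ip' by (auto simp: deflation_def)
  then show "deflation C (n \<cdot> p')" using N assms by (intro deflation_Comp) simp_all
  have PB: "is_pullback C p' c p b"
    by (rule confl_map_pullback[OF ip ip']) (use assms N in simp_all)
  have pb: "p' \<cdot> b = c \<cdot> p" by fact
  have [simp]: "Dom C n = Cod C p'" "Cod C i' = Dom C p'" "Cod C i = Dom C p"
    using N P assms by simp_all
  have nc [simp]: "n \<cdot> c = Zero C (Cod C p) (Cod C n)" using N assms by simp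
  show "is_kernel C b (n \<cdot> p')"
  proof (rule kernelI)
    fix f assume f: "f \<in> Arr C" "Cod C f = Dom C (n \<cdot> p')"
      "(n \<cdot> p') \<cdot> f = Zero C (Dom C f) (Cod C (n \<cdot> p'))"
    then have [simp]: "Cod C f = Dom C p'" using N P by simp
    have "n \<cdot> (p' \<cdot> f) = Zero C (Dom C f) (Cod C n)" using f N P by simp
    then obtain g where g: "g \<in> Arr C" "Dom C g = Dom C f" "Cod C g = Cod C p" "c \<cdot> g = p' \<cdot> f"
      using confl_lift[OF cn, of "p' \<cdot> f"] N P f assms(7) by auto
    obtain h where "h \<in> Arr C" "Cod C h = Dom C p" "Dom C h = Dom C g" "b \<cdot> h = f" "p \<cdot> h = g"
      by (rule pullback_induced[OF PB, of f g]) (use f g assms in simp_all)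
    then show "\<exists>g. g \<in> Arr C \<and> Dom C g = Dom C f \<and> Cod C g = Dom C b \<and> b \<cdot> g = f"
      using g assms by auto
  next
    fix u v assume uv: "u \<in> Arr C" "v \<in> Arr C" "Cod C u = Dom C b" "Cod C v = Dom C b"
      "Dom C u = Dom C v" "b \<cdot> u = b \<cdot> v"
    have "c \<cdot> (p \<cdot> u) = p' \<cdot> (b \<cdot> u)"
      using uv(1-5) P N assms(4-9) by (simp add: comp_eq_comp[OF pb])
    also have "\<dots> = c \<cdot> (p \<cdot> v)"
      unfolding uv(6) using uv(1-5) P N assms(4-9) by (simp add: comp_eq_comp[OF pb])
    finally have "p \<cdot> u = p \<cdot> v"
      by (rule confl_mono[OF cn]) (use uv P assms(4-9) in simp_all)
    with uv assms(4-9) show "u = v"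
      by - (rule pullback_mono[OF PB], simp_all)
  qed (use assms N P in \<open>simp_all add: comp_eq_comp[OF nc]\<close>)
qed

text \<open>For inflations \<open>A -> B -> C\<close> this is the conflation
  \<open>B/A -> C/A -> C/B\<close>. The push-out of \<open>j\<close> along \<open>p\<close>
  constructs \<open>C/A\<close>, with \<open>\<mu>\<close> as the parallel inflation and the
  cokernel \<open>C/B\<close> unchanged.\<close>

lemma noether:
  assumes ip: "(i, p) \<in> Confl C" and jq: "(j, q) \<in> Confl C" and ij: "Cod C i = Dom C j"
  obtains r \<mu> \<nu> where "(j \<cdot> i, r) \<in> Confl C" "(\<mu>, \<nu>) \<in> Confl C" "Dom C \<mu> = Cod C p" "Cod C \<mu> = Cod C r"
    "Cod C \<nu> = Cod C q" "r \<cdot> j = \<mu> \<cdot> p" "\<nu> \<cdot> r = q"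
proof -
  note I = conflD(1-3)[OF ip] and J = conflD(1-3)[OF jq]
  have pi: "p \<cdot> i = Zero C (Dom C i) (Cod C p)" using conflD[OF ip] by simp
  have [simp]: "i \<in> Arr C" "p \<in> Arr C" "j \<in> Arr C" "q \<in> Arr C" "Cod C i = Dom C p" "Dom C j = Dom C p"
    "Cod C j = Dom C q" using I J ij by auto
  obtain \<mu> r \<nu> where po: "is_pushout C j p \<mu> r" and mn: "(\<mu>, \<nu>) \<in> Confl C" "Cod C \<nu> = Cod C q"
    "\<nu> \<cdot> r = q"
    by (rule confl_pushout[OF jq, of p]) simp_all
  note P = pushoutD[OF po] and M = conflD(1-4)[OF mn(1)]
  have [simp]: "\<mu> \<in> Arr C" "r \<in> Arr C" "Dom C \<mu> = Cod C p" "Dom C r = Dom C q" "Cod C \<mu> = Cod C r"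
    using P by auto
  have rj: "r \<cdot> j = \<mu> \<cdot> p" using P by simp
  have "is_cokernel C r (j \<cdot> i)"
  proof (rule cokernelI)
    show "r \<cdot> (j \<cdot> i) = Zero C (Dom C (j \<cdot> i)) (Cod C r)"
      using pi by (simp add: comp_eq_comp[OF rj])
  next
    fix f assume f: "f \<in> Arr C" "Dom C f = Dom C r" "f \<cdot> (j \<cdot> i) = Zero C (Dom C (j \<cdot> i)) (Cod C f)"
    then obtain g where g: "g \<in> Arr C" "Cod C g = Cod C f" "Dom C g = Cod C p" "g \<cdot> p = f \<cdot> j"
      using confl_descend[OF ip, of "f \<cdot> j"] by auto
    obtain w where "w \<in> Arr C" "Dom C w = Cod C \<mu>" "Cod C w = Cod C g" "w \<cdot> r = f" "w \<cdot> \<mu> = g"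
      by (rule pushout_induced[OF po, of f g]) (use f g in simp_all)
    then show "\<exists>g. g \<in> Arr C \<and> Cod C g = Cod C f \<and> Dom C g = Cod C r \<and> g \<cdot> r = f" using g by auto
  next
    fix u v assume uv: "u \<in> Arr C" "v \<in> Arr C" "Dom C u = Cod C r" "Dom C v = Cod C r"
      "Cod C u = Cod C v" "u \<cdot> r = v \<cdot> r"
    have "(u \<cdot> \<mu>) \<cdot> p = (u \<cdot> r) \<cdot> j" using uv(1-5) rj by simp
    also have "\<dots> = (v \<cdot> \<mu>) \<cdot> p" unfolding uv(6) using uv(1-5) rj by simp
    finally have "u \<cdot> \<mu> = v \<cdot> \<mu>"
      by (rule confl_epi[OF ip]) (use uv in simp_all)
    with uv show "u = v" by - (rule pushout_epi[OF po], simp_all)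
  qed simp_all
  moreover have "inflation C (j \<cdot> i)"
    by (rule inflation_Comp) (use ip jq ij in \<open>auto simp: inflation_def\<close>)
  ultimately have "(j \<cdot> i, r) \<in> Confl C" by (rule confl_of_cokernel[rotated])
  then show thesis using that mn rj by simp
qed

text \<open>Factor the morphism through the push-out of the first conflation along \<open>a\<close>: the first factor
  is a push-out of \<open>a\<close>, and the second is the kernel of a composite of deflations.\<close>

lemma confl_3x3:
  assumes ip: "(i, p) \<in> Confl C" and ip': "(i', p') \<in> Confl C" and am: "(a, m) \<in> Confl C" and cn:
    "(c, n) \<in> Confl C"
    and "b \<in> Arr C" "Dom C a = Dom C i" "Cod C a = Dom C i'"
    "Dom C b = Cod C i" "Cod C b = Cod C i'" "Dom C c = Cod C p" "Cod C c = Cod C p'"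
    and bi: "b \<cdot> i = i' \<cdot> a" and pb: "p' \<cdot> b = c \<cdot> p"
  obtains r \<mu> \<nu> where "(b, r) \<in> Confl C" "(\<mu>, \<nu>) \<in> Confl C" "Dom C \<mu> = Cod C m" "Cod C \<mu> = Cod C r"
    "Cod C \<nu> = Cod C n" "r \<cdot> i' = \<mu> \<cdot> m" "\<nu> \<cdot> r = n \<cdot> p'"
proof -
  note I = conflD(1-3)[OF ip] conflD(1-3)[OF ip'] conflD(1-3)[OF am] conflD(1-3)[OF cn]
  have [simp]: "i \<in> Arr C" "p \<in> Arr C" "i' \<in> Arr C" "p' \<in> Arr C" "a \<in> Arr C" "m \<in> Arr C" "b \<in> Arr C"
    "c \<in> Arr C" "n \<in> Arr C" "Cod C i = Dom C p" "Cod C i' = Dom C p'" "Dom C m = Dom C i'"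
    "Dom C n = Cod C p'"
    "Dom C a = Dom C i" "Cod C a = Dom C i'" "Dom C b = Dom C p" "Cod C b = Dom C p'"
    "Dom C c = Cod C p" "Cod C c = Cod C p'"
    using I assms by simp_all
  have z: "p' \<cdot> i' = Zero C (Dom C i') (Cod C p')" "p \<cdot> i = Zero C (Dom C i) (Cod C p)"
    using conflD(4)[OF ip'] conflD(4)[OF ip] by auto
  obtain e a' q where po: "is_pushout C i a e a'" and eq: "(e, q) \<in> Confl C" "Cod C q = Cod C p"
    "q \<cdot> a' = p"
    using confl_pushout[OF ip, of a] by auto
  note P = pushoutD[OF po] and E = conflD(1-4)[OF eq(1)]
  have [simp]: "e \<in> Arr C" "a' \<in> Arr C" "q \<in> Arr C" "Dom C e = Dom C i'" "Dom C a' = Dom C p"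
    "Cod C e = Dom C q"
    "Cod C a' = Dom C q" using P E by simp_all
  obtain b' where b': "b' \<in> Arr C" "Dom C b' = Dom C q" "Cod C b' = Dom C p'" "b' \<cdot> a' = b"
    "b' \<cdot> e = i'"
    using pushout_induced[OF po, of b i'] bi by auto
  have qb: "p' \<cdot> b' = c \<cdot> q"
  proof (rule pushout_epi[OF po])
    show "(p' \<cdot> b') \<cdot> a' = (c \<cdot> q) \<cdot> a'" using b' eq pb by simp
    show "(p' \<cdot> b') \<cdot> e = (c \<cdot> q) \<cdot> e" using b' eq z E by simp
  qed (use b' eq in simp_all)
  have B': "(b', n \<cdot> p') \<in> Confl C"
    by (rule kernel_comp_confl[OF eq(1) ip' cn]) (use b' eq qb in simp_all)
  obtain l where l: "(a', l) \<in> Confl C" "Cod C l = Cod C m" "l \<cdot> e = m"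
    using cokernel_of_pushout[OF am po] by metis
  \<comment> \<open>The composite is \<open>b\<close>, the cokernel of \<open>a'\<close> is that of
    \<open>a\<close>, and the cokernel of \<open>b'\<close> is that of \<open>c\<close>; the
    conflation of cokernels is therefore the one wanted.\<close>
  obtain r \<mu> \<nu> where n: "(b' \<cdot> a', r) \<in> Confl C" "(\<mu>, \<nu>) \<in> Confl C" "Dom C \<mu> = Cod C l"
    "Cod C \<mu> = Cod C r"
    "Cod C \<nu> = Cod C (n \<cdot> p')" "r \<cdot> b' = \<mu> \<cdot> l" "\<nu> \<cdot> r = n \<cdot> p'"
    using noether[OF l(1) B'] b' by auto
  note R = conflD(1-3)[OF n(1)] conflD(1-3)[OF n(2)] conflD(1-3)[OF l(1)]
  have "r \<cdot> i' = (r \<cdot> b') \<cdot> e" using b' R by simp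
  also have "\<dots> = \<mu> \<cdot> m" unfolding n(6) using l R n(3) by simp
  finally show thesis using that[of r \<mu> \<nu>] n b' l by simp
qed

text \<open>The source of inflations between extensions: if the outer structure maps of a
  componentwise conflation are inflations, so is the middle one.\<close>

lemma inflation_middle:
  assumes "(i, p) \<in> Confl C" "(i', p') \<in> Confl C" "inflation C a" "inflation C c" "b \<in> Arr C"
    "Dom C a = Dom C i"
    "Cod C a = Dom C i'" "Dom C b = Cod C i" "Cod C b = Cod C i'" "Dom C c = Cod C p"
    "Cod C c = Cod C p'"
    "b \<cdot> i = i' \<cdot> a" "p' \<cdot> b = c \<cdot> p"
  shows "inflation C b"
proof -
  obtain m n where "(a, m) \<in> Confl C" "(c, n) \<in> Confl C" using assms by (auto simp: inflation_def)
  then show ?thesis using confl_3x3[OF assms(1,2) _ _ assms(5-)] by (metis inflation_def)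
qed

text \<open>Dually, the kernel of a composite of deflations is an extension of the two
  kernels.\<close>

lemma noether_deflation:
  assumes ip: "(i, p) \<in> Confl C" and jq: "(j, q) \<in> Confl C" and ij: "Cod C p = Dom C q"
  obtains l \<mu> \<nu> where "(l, q \<cdot> p) \<in> Confl C" "(\<mu>, \<nu>) \<in> Confl C" "Cod C \<nu> = Dom C j" "Dom C \<nu> = Dom C l"
    "Dom C \<mu> = Dom C i" "p \<cdot> l = j \<cdot> \<nu>" "l \<cdot> \<mu> = i"
proof -
  interpret op: exact_category "op_cat C" by (rule exact_op)
  have "\<exists>l \<mu> \<nu>. (l, q \<cdot> p) \<in> Confl C \<and> (\<mu>, \<nu>) \<in> Confl C \<and> Cod C \<nu> = Dom C j \<and> Dom C \<nu> = Dom C l \<and>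
    Dom C \<mu> = Dom C i \<and> p \<cdot> l = j \<cdot> \<nu> \<and> l \<cdot> \<mu> = i"
    by (rule op.noether[of q j p i]) (use assms in simp_all, blast)
  then show thesis using that by blast
qed

lemma confl_3x3_deflation:
  assumes ip: "(i, p) \<in> Confl C" and ip': "(i', p') \<in> Confl C" and am: "(m, a) \<in> Confl C" and cn:
    "(n, c) \<in> Confl C"
    and "b \<in> Arr C" "Dom C a = Dom C i" "Cod C a = Dom C i'"
    "Dom C b = Cod C i" "Cod C b = Cod C i'" "Dom C c = Cod C p" "Cod C c = Cod C p'"
    and bi: "b \<cdot> i = i' \<cdot> a" and pb: "p' \<cdot> b = c \<cdot> p"
  obtains l \<mu> \<nu> where "(l, b) \<in> Confl C" "(\<mu>, \<nu>) \<in> Confl C" "Cod C \<nu> = Dom C n" "Dom C \<nu> = Dom C l"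
    "Dom C \<mu> = Dom C m" "p \<cdot> l = n \<cdot> \<nu>" "l \<cdot> \<mu> = i \<cdot> m"
proof -
  interpret op: exact_category "op_cat C" by (rule exact_op)
  have "Cod C i = Dom C p" "Cod C i' = Dom C p'" using ip ip' conflD by auto
  then have "\<exists>l \<mu> \<nu>. (l, b) \<in> Confl C \<and> (\<mu>, \<nu>) \<in> Confl C \<and> Cod C \<nu> = Dom C n \<and> Dom C \<nu> = Dom C l \<and>
    Dom C \<mu> = Dom C m \<and> p \<cdot> l = n \<cdot> \<nu> \<and> l \<cdot> \<mu> = i \<cdot> m"
    by - (rule op.confl_3x3[of p' i' p i c n a m b], use assms in simp_all, blast)
  then show thesis using that by blast
qed

lemma pushout_iso:
  assumes po: "is_pushout C i a i' b" and "is_iso C a"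
  shows "is_iso C b"
proof -
  note P = pushoutD[OF po]
  obtain a' where a: "a' \<in> Arr C" "Dom C a' = Cod C a" "Cod C a' = Dom C a"
    "a' \<cdot> a = Ident C (Dom C a)" "a \<cdot> a' = Ident C (Cod C a)" using iso_inverse[OF assms(2)] by metis
  obtain b' where b: "b' \<in> Arr C" "Dom C b' = Cod C i'" "Cod C b' = Cod C i"
    "b' \<cdot> b = Ident C (Cod C i)" "b' \<cdot> i' = i \<cdot> a'"
    by (rule pushout_induced[OF po, of "Ident C (Cod C i)" "i \<cdot> a'"]) (use P(1-8) a in simp_all)
  have "b \<cdot> b' = Ident C (Cod C i')"
  proof (rule pushout_epi[OF po])
    have "(b \<cdot> b') \<cdot> i' = (b \<cdot> i) \<cdot> a'" using P a b by (simp add: comp_eq_comp[OF P(9)])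
    also have "\<dots> = i' \<cdot> (a \<cdot> a')" unfolding P(9) using P(1-8) a by (simp del: a(5))
    also have "\<dots> = Ident C (Cod C i') \<cdot> i'" using P a by simp
    finally show "(b \<cdot> b') \<cdot> i' = Ident C (Cod C i') \<cdot> i'" .
    show "(b \<cdot> b') \<cdot> b = Ident C (Cod C i') \<cdot> b" using P b by simp
  qed (use P b in simp_all)
  then show ?thesis using P b by (intro is_isoI[where g = b']) simp_all
qed

text \<open>A form of the short five lemma with identity on the right: the left square is a
  push-out, and a push-out of an isomorphism is one.\<close>

lemma confl_map_iso:
  assumes "(i, p) \<in> Confl C" "(i', p') \<in> Confl C" "b \<in> Arr C" "is_iso C a"
    "Dom C b = Cod C i" "Cod C b = Cod C i'" "Dom C a = Dom C i" "Cod C a = Dom C i'"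
    "Cod C p' = Cod C p"
    "p' \<cdot> b = p" "b \<cdot> i = i' \<cdot> a"
  shows "is_iso C b"
  by (rule pushout_iso[OF confl_map_pushout[OF assms(1-3)] assms(4)]) (use assms is_isoD(1)[OF assms(4)]
    in simp_all)

end

section \<open>Direct sums, projectives and injectives\<close>

context exact_category
begin

lemma confl_Ident_zero:
  assumes "X \<in> Obj C" "zero_object C Z"
  shows "(Ident C X, Zero C X Z) \<in> Confl C"
proof (rule confl_of_cokernel)
  have [simp]: "Z \<in> Obj C" using assms zero_object_iff by auto
  show "is_cokernel C (Zero C X Z) (Ident C X)"
  proof (rule cokernelI)
    fix f assume "f \<in> Arr C" "Dom C f = Dom C (Zero C X Z)"
      "f \<cdot> Ident C X = Zero C (Dom C (Ident C X)) (Cod C f)"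
    then show "\<exists>g. g \<in> Arr C \<and> Cod C g = Cod C f \<and> Dom C g = Cod C (Zero C X Z) \<and> g \<cdot> Zero C X Z = f"
      using assms by (intro exI[of _ "Zero C Z (Cod C f)"]) simp
  next
    fix u v assume "u \<in> Arr C" "v \<in> Arr C" "Dom C u = Cod C (Zero C X Z)" "Dom C v = Cod C (Zero C X Z)"
      "Cod C u = Cod C v"
    then show "u = v" using zero_object_arr(2)[OF assms(2), of u] zero_object_arr(2)[OF assms(2), of v]
      assms by simp
  qed (use assms in simp_all)
qed (use assms inflation_Ident in auto)

lemma confl_zero_Ident:
  assumes "X \<in> Obj C" "zero_object C Z"
  shows "(Zero C Z X, Ident C X) \<in> Confl C"
proof -
  interpret op: exact_category "op_cat C" by (rule exact_op)
  show ?thesis using op.confl_Ident_zero[of X Z] assms by simp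
qed

lemma inflation_zero: "\<lbrakk>X \<in> Obj C; zero_object C Z\<rbrakk> \<Longrightarrow> inflation C (Zero C Z X)"
  using confl_zero_Ident by (auto simp: inflation_def)

text \<open>The inclusion \<open>i\<close> is the push-out of \<open>0 -> Y\<close> along
  \<open>0 -> X\<close>. The former is an inflation with the identity as cokernel, so
  \<open>i\<close> is an inflation, and \<open>q\<close> is its cokernel by the biproduct
  identities.\<close>

lemma biproduct_confl:
  assumes "i \<in> Arr C" "Dom C i = X" "Cod C i = S" "j \<in> Arr C" "Dom C j = Y" "Cod C j = S"
    "p \<in> Arr C" "Dom C p = S" "Cod C p = X" "q \<in> Arr C" "Dom C q = S" "Cod C q = Y"
    and pi: "p \<cdot> i = Ident C X" and qj: "q \<cdot> j = Ident C Y" and qi: "q \<cdot> i = Zero C X Y" and pj: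
      "p \<cdot> j = Zero C Y X"
    and sum: "(i \<cdot> p) \<boxplus> (j \<cdot> q) = Ident C S"
  shows "(i, q) \<in> Confl C"
proof (rule confl_of_cokernel)
  have [simp]: "X \<in> Obj C" "Y \<in> Obj C" "S \<in> Obj C" using assms(1-6) Dom_in Cod_in by auto
  note [simp] = assms(1-12) pi qj qi pj comp_eq_comp[OF pi] comp_eq_comp[OF pj] comp_eq_comp[OF qi]
    comp_eq_comp[OF qj]
  have decomp: "f = (f \<cdot> i) \<cdot> p \<boxplus> (f \<cdot> j) \<cdot> q" if "f \<in> Arr C" "Dom C f = S" for f
  proof -
    have "f = f \<cdot> (i \<cdot> p \<boxplus> j \<cdot> q)" unfolding sum using that by simp
    then show ?thesis using that by simp
  qed
  obtain Z where Z: "zero_object C Z" "Z \<in> Obj C" using zero_objectE by metis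
  have "is_pushout C (Zero C Z Y) (Zero C Z X) i j"
  proof (rule pushoutI)
    fix u v assume "u \<in> Arr C" "v \<in> Arr C" "Cod C u = Cod C v" "Dom C u = Cod C (Zero C Z Y)"
      "Dom C v = Cod C (Zero C Z X)"
    then show "\<exists>w. w \<in> Arr C \<and> Dom C w = Cod C i \<and> Cod C w = Cod C v \<and> w \<cdot> j = u \<and> w \<cdot> i = v"
      using Z by (intro exI[of _ "v \<cdot> p \<boxplus> u \<cdot> q"]) simp
  next
    fix u v assume *: "u \<in> Arr C" "v \<in> Arr C" "Cod C u = Cod C v" "Dom C u = Cod C i"
      "Dom C v = Cod C i"
      "u \<cdot> j = v \<cdot> j" "u \<cdot> i = v \<cdot> i"
    have "u = (u \<cdot> i) \<cdot> p \<boxplus> (u \<cdot> j) \<cdot> q" by (rule decomp) (use * in simp_all)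
    also have "\<dots> = (v \<cdot> i) \<cdot> p \<boxplus> (v \<cdot> j) \<cdot> q" by (simp only: *)
    also have "\<dots> = v" by (rule decomp[symmetric]) (use * in simp_all)
    finally show "u = v" .
  qed (use Z in simp_all)
  then show "inflation C i"
    by (rule inflation_of_pushout) (use Z inflation_zero in auto)
  show "is_cokernel C q i"
  proof (rule cokernelI)
    fix f assume f: "f \<in> Arr C" "Dom C f = Dom C q" "f \<cdot> i = Zero C (Dom C i) (Cod C f)"
    then have "f = Zero C X (Cod C f) \<cdot> p \<boxplus> (f \<cdot> j) \<cdot> q" using decomp[of f] by simp
    then have "(f \<cdot> j) \<cdot> q = f" using f by simp
    then show "\<exists>g. g \<in> Arr C \<and> Cod C g = Cod C f \<and> Dom C g = Cod C q \<and> g \<cdot> q = f"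
      using f by (intro exI[of _ "f \<cdot> j"]) simp
  next
    fix u v assume *: "u \<in> Arr C" "v \<in> Arr C" "Dom C u = Cod C q" "Dom C v = Cod C q"
      "Cod C u = Cod C v" "u \<cdot> q = v \<cdot> q"
    have "(u \<cdot> q) \<cdot> j = (v \<cdot> q) \<cdot> j" by (simp only: *)
    then show "u = v" using *(1-5) by simp
  qed simp_all
qed

lemma direct_sum:
  assumes "X \<in> Obj C" "Y \<in> Obj C"
  obtains S i j p q where "is_biproduct C X Y S" "S \<in> Obj C"
    "i \<in> Arr C" "Dom C i = X" "Cod C i = S" "j \<in> Arr C" "Dom C j = Y" "Cod C j = S"
    "p \<in> Arr C" "Dom C p = S" "Cod C p = X" "q \<in> Arr C" "Dom C q = S" "Cod C q = Y"
    "p \<cdot> i = Ident C X" "q \<cdot> j = Ident C Y" "q \<cdot> i = Zero C X Y" "p \<cdot> j = Zero C Y X"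
    "(i \<cdot> p) \<boxplus> (j \<cdot> q) = Ident C S" "(i, q) \<in> Confl C"
proof -
  obtain S where S: "is_biproduct C X Y S" using ex_biproduct assms by blast
  then obtain i j p q where *: "S \<in> Obj C" "i \<in> Arr C" "Dom C i = X" "Cod C i = S" "j \<in> Arr C"
    "Dom C j = Y" "Cod C j = S"
    "p \<in> Arr C" "Dom C p = S" "Cod C p = X" "q \<in> Arr C" "Dom C q = S" "Cod C q = Y"
    "p \<cdot> i = Ident C X" "q \<cdot> j = Ident C Y" "q \<cdot> i = Zero C X Y" "p \<cdot> j = Zero C Y X"
    "(i \<cdot> p) \<boxplus> (j \<cdot> q) = Ident C S"
    by (rule is_biproductE)
  have "(i, q) \<in> Confl C" by (rule biproduct_confl[OF *(2-)])
  with S * show thesis by (rule that)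
qed

text \<open>The endomorphism \<open>1 - i \<cdot> r\<close> kills \<open>i\<close> and therefore
  factors through \<open>p\<close>; the factor is the section \<open>s\<close>.\<close>

lemma split_confl:
  assumes ip: "(i, p) \<in> Confl C" and r: "r \<in> Arr C" "Dom C r = Cod C i" "Cod C r = Dom C i"
    and ri: "r \<cdot> i = Ident C (Dom C i)"
  obtains s where "s \<in> Arr C" "Dom C s = Cod C p" "Cod C s = Cod C i" "p \<cdot> s = Ident C (Cod C p)"
    "r \<cdot> s = Zero C (Cod C p) (Dom C i)" "(i \<cdot> r) \<boxplus> (s \<cdot> p) = Ident C (Cod C i)"
proof -
  note I = conflD(1-3)[OF ip]
  have pi: "p \<cdot> i = Zero C (Dom C i) (Cod C p)" using conflD[OF ip] by auto
  note [simp] = I r ri comp_eq_comp[OF ri] pi comp_eq_comp[OF pi]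
  obtain s where s: "s \<in> Arr C" "Cod C s = Dom C p" "Dom C s = Cod C p"
    "s \<cdot> p = Ident C (Dom C p) \<boxplus> neg C (i \<cdot> r)"
    by (rule confl_descend[OF ip, of "Ident C (Dom C p) \<boxplus> neg C (i \<cdot> r)"]) simp_all
  have "p \<cdot> s = Ident C (Cod C p)"
  proof (rule confl_epi[OF ip])
    show "(p \<cdot> s) \<cdot> p = Ident C (Cod C p) \<cdot> p" using s by simp
  qed (use s in simp_all)
  moreover have "r \<cdot> s = Zero C (Cod C p) (Dom C i)"
  proof (rule confl_epi[OF ip])
    show "(r \<cdot> s) \<cdot> p = Zero C (Cod C p) (Dom C i) \<cdot> p" using s by simp
  qed (use s in simp_all)
  moreover have "(i \<cdot> r) \<boxplus> (s \<cdot> p) = Ident C (Cod C i)"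
    unfolding s(4) by (subst plus_left_comm) simp_all
  ultimately show thesis using that s by simp
qed

section \<open>Retracts and direct sums of projectives and injectives\<close>

lemma projectiveE:
  assumes "projective C P" "deflation C p" "f \<in> Arr C" "Dom C f = P" "Cod C f = Cod C p"
  obtains g where "g \<in> Arr C" "Dom C g = P" "Cod C g = Dom C p" "p \<cdot> g = f"
proof -
  have "\<exists>g \<in> Hom C P (Dom C p). p \<cdot> g = f"
    using assms unfolding projective_def by (simp add: Hom_iff)
  then show thesis using that by (auto simp: Hom_iff)
qed

lemma injectiveE:
  assumes "injective C I" "inflation C i" "f \<in> Arr C" "Dom C f = Dom C i" "Cod C f = I"
  obtains g where "g \<in> Arr C" "Dom C g = Cod C i" "Cod C g = I" "g \<cdot> i = f"
proof -
  have "\<exists>g \<in> Hom C (Cod C i) I. g \<cdot> i = f"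
    using assms unfolding injective_def by (simp add: Hom_iff)
  then show thesis using that by (auto simp: Hom_iff)
qed

lemma deflationD:
  assumes "deflation C p" shows "p \<in> Arr C"
  using assms conflD unfolding deflation_def by blast

lemma inflationD:
  assumes "inflation C p" shows "p \<in> Arr C"
  using assms conflD unfolding inflation_def by blast

lemma projective_retract:
  assumes "projective C P" "r \<in> Arr C" "s \<in> Arr C" "Dom C r = P" "Cod C s = P" "Dom C s = Cod C r"
    and rs: "r \<cdot> s = Ident C (Cod C r)"
  shows "projective C (Cod C r)"
  unfolding projective_def Hom_iff
proof (intro conjI allI impI)
  fix p f assume p: "deflation C p" and f: "f \<in> Arr C \<and> Dom C f = Cod C r \<and> Cod C f = Cod C p"
  obtain g where g: "g \<in> Arr C" "Dom C g = P" "Cod C g = Dom C p" "p \<cdot> g = f \<cdot> r"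
    by (rule projectiveE[OF assms(1) p, of "f \<cdot> r"]) (use assms f in simp_all)
  have "p \<cdot> (g \<cdot> s) = f"
    using f assms g deflationD[OF p] by (simp add: comp_eq_comp[OF g(4)])
  then show "\<exists>g\<in>Hom C (Cod C r) (Dom C p). p \<cdot> g = f"
    by (intro bexI[of _ "g \<cdot> s"]) (use g assms in \<open>simp_all add: Hom_iff\<close>)
qed (use assms in simp)

lemma injective_retract:
  assumes "injective C I" "r \<in> Arr C" "s \<in> Arr C" "Dom C r = I" "Cod C s = I" "Dom C s = Cod C r"
    and rs: "r \<cdot> s = Ident C (Cod C r)"
  shows "injective C (Cod C r)"
proof -
  interpret op: exact_category "op_cat C" by (rule exact_op)
  show ?thesis using op.projective_retract[of I s r] assms by simp
qed

lemma projective_biproduct: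
  assumes "projective C P" "projective C Q" "is_biproduct C P Q S"
  shows "projective C S"
proof -
  obtain i j p q where *: "S \<in> Obj C" "i \<in> Arr C" "Dom C i = P" "Cod C i = S" "j \<in> Arr C" "Dom C j = Q"
    "Cod C j = S"
    "p \<in> Arr C" "Dom C p = S" "Cod C p = P" "q \<in> Arr C" "Dom C q = S" "Cod C q = Q"
    "(i \<cdot> p) \<boxplus> (j \<cdot> q) = Ident C S"
    using assms(3) by (rule is_biproductE)
  show ?thesis
    unfolding projective_def Hom_iff
  proof (intro conjI allI impI)
    fix d f assume d: "deflation C d" and f: "f \<in> Arr C \<and> Dom C f = S \<and> Cod C f = Cod C d"
    obtain g where g: "g \<in> Arr C" "Dom C g = P" "Cod C g = Dom C d" "d \<cdot> g = f \<cdot> i"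
      by (rule projectiveE[OF assms(1) d, of "f \<cdot> i"]) (use * f in simp_all)
    obtain h where h: "h \<in> Arr C" "Dom C h = Q" "Cod C h = Dom C d" "d \<cdot> h = f \<cdot> j"
      by (rule projectiveE[OF assms(2) d, of "f \<cdot> j"]) (use * f in simp_all)
    have "d \<cdot> (g \<cdot> p \<boxplus> h \<cdot> q) = f \<cdot> (i \<cdot> p \<boxplus> j \<cdot> q)"
      using *(1-13) f g h deflationD[OF d] by (simp add: comp_eq_comp[OF g(4)] comp_eq_comp[OF h(4)])
    then have "d \<cdot> (g \<cdot> p \<boxplus> h \<cdot> q) = f" using f * by simp
    then show "\<exists>g\<in>Hom C S (Dom C d). d \<cdot> g = f"
      by (intro bexI[of _ "g \<cdot> p \<boxplus> h \<cdot> q"]) (use g h * in \<open>simp_all add: Hom_iff\<close>)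
  qed (use * in simp)
qed

lemma injective_biproduct:
  assumes "injective C P" "injective C Q" "is_biproduct (op_cat C) P Q S"
  shows "injective C S"
proof -
  interpret op: exact_category "op_cat C" by (rule exact_op)
  show ?thesis using op.projective_biproduct[of P Q S] assms by simp
qed

text \<open>The classical horseshoe: \<open>v\<close> is lifted along \<open>p\<close> by
  projectivity of its source, the sum of the two covers maps to the middle by
  \<open>i \<cdot> u\<close> and the lift, and the 3x3 lemma shows that this map is a deflation and
  that the kernels form a conflation.\<close>

lemma horseshoe:
  assumes ip: "(i, p) \<in> Confl C" and ku: "(k, u) \<in> Confl C" and lv: "(l, v) \<in> Confl C"
    and [simp]: "Cod C u = Dom C i" "Cod C v = Cod C p" and Q: "projective C (Dom C v)"
  obtains \<iota> \<pi> k' u' \<mu> \<nu> where "(\<iota>, \<pi>) \<in> Confl C" "(k', u') \<in> Confl C" "(\<mu>, \<nu>) \<in> Confl C"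
    "Dom C \<iota> = Dom C u" "Cod C \<pi> = Dom C v" "Cod C \<iota> = Dom C u'"
    "is_biproduct C (Dom C u) (Dom C v) (Dom C u')"
    "Cod C u' = Cod C i" "u' \<cdot> \<iota> = i \<cdot> u" "Dom C \<mu> = Dom C k" "Cod C \<mu> = Dom C k'" "k' \<cdot> \<mu> = \<iota> \<cdot> k"
    "p \<cdot> u' = v \<cdot> \<pi>" "Dom C \<nu> = Dom C k'" "Cod C \<nu> = Dom C l" "\<pi> \<cdot> k' = l \<cdot> \<nu>"
proof -
  have [simp]: "i \<in> Arr C" "p \<in> Arr C" "k \<in> Arr C" "u \<in> Arr C" "l \<in> Arr C" "v \<in> Arr C"
    "Cod C i = Dom C p" "Cod C k = Dom C u" "Cod C l = Dom C v"
    using conflD ip ku lv by auto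
  have pi: "p \<cdot> i = Zero C (Dom C i) (Cod C p)" using conflD[OF ip] by auto
  obtain h where h: "h \<in> Arr C" "Dom C h = Dom C v" "Cod C h = Dom C p" "p \<cdot> h = v"
  proof (rule projectiveE[OF Q, of p v])
    show "deflation C p" using ip by (auto simp: deflation_def)
  qed simp_all
  obtain S i1 i2 p1 p2 where S: "is_biproduct C (Dom C u) (Dom C v) S" "S \<in> Obj C"
    "i1 \<in> Arr C" "Dom C i1 = Dom C u" "Cod C i1 = S" "i2 \<in> Arr C" "Dom C i2 = Dom C v" "Cod C i2 = S"
    "p1 \<in> Arr C" "Dom C p1 = S" "Cod C p1 = Dom C u" "p2 \<in> Arr C" "Dom C p2 = S" "Cod C p2 = Dom C v"
    "p1 \<cdot> i1 = Ident C (Dom C u)" "p2 \<cdot> i2 = Ident C (Dom C v)" "p2 \<cdot> i1 = Zero C (Dom C u) (Dom C v)"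
    "p1 \<cdot> i2 = Zero C (Dom C v) (Dom C u)" "(i1 \<cdot> p1) \<boxplus> (i2 \<cdot> p2) = Ident C S" "(i1, p2) \<in> Confl C"
    by (rule direct_sum[of "Dom C u" "Dom C v"]) simp_all
  define u' where "u' = i \<cdot> (u \<cdot> p1) \<boxplus> h \<cdot> p2"
  have u': "u' \<in> Arr C" "Dom C u' = S" "Cod C u' = Cod C i" "u' \<cdot> i1 = i \<cdot> u" "p \<cdot> u' = v \<cdot> p2"
    using S(2-18) h(1-3) pi by (simp_all add: u'_def comp_eq_comp[OF pi] comp_eq_comp[OF h(4)])
  obtain k' \<mu> \<nu> where K: "(k', u') \<in> Confl C" "(\<mu>, \<nu>) \<in> Confl C" "Cod C \<nu> = Dom C l"
    "Dom C \<nu> = Dom C k'"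
    "Dom C \<mu> = Dom C k" "p2 \<cdot> k' = l \<cdot> \<nu>" "k' \<cdot> \<mu> = i1 \<cdot> k"
    by (rule confl_3x3_deflation[OF S(20) ip ku lv, of u']) (use S(2-14) u' in simp_all)
  have "Cod C \<mu> = Dom C k'" using K(4) conflD(3)[OF K(2)] by simp
  then show thesis
    using that[OF S(20) K(1,2)] S u' K by simp
qed

end

section \<open>Resolving the target of an inflation over a resolution of its source\<close>

context frobenius_category
begin

text \<open>The new cover is the given one plus a projective cover of the cokernel of
  \<open>i\<close>. Besides covers, also the kernels must be joined by an inflation, because the
  kernels of successive steps are to form an inflation sequence themselves.\<close>

lemma projective_resolution_step:
  assumes "inflation C i" "(k, u) \<in> Confl C" "Cod C u = Dom C i" "projective C (Dom C u)"
  obtains k' u' \<kappa> \<pi> where "(k', u') \<in> Confl C" "Cod C u' = Cod C i" "projective C (Dom C u')"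
    "inflation C \<kappa>" "inflation C \<pi>" "Dom C \<kappa> = Dom C k" "Cod C \<kappa> = Dom C k'" "Dom C \<pi> = Dom C u"
    "Cod C \<pi> = Dom C u'" "u' \<cdot> \<pi> = i \<cdot> u" "k' \<cdot> \<kappa> = \<pi> \<cdot> k"
proof -
  obtain p where ip: "(i, p) \<in> Confl C" using assms by (auto simp: inflation_def)
  obtain l v where lv: "(l, v) \<in> Confl C" "Cod C v = Cod C p" "projective C (Dom C v)"
    using enough_projectives[of "Cod C p"] conflD(2)[OF ip] by (auto simp: deflation_def)
  obtain \<iota> \<pi> k' u' \<mu> \<nu> where *: "(\<iota>, \<pi>) \<in> Confl C" "(k', u') \<in> Confl C" "(\<mu>, \<nu>) \<in> Confl C"
    "Dom C \<iota> = Dom C u" "Cod C \<pi> = Dom C v" "Cod C \<iota> = Dom C u'"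
    "is_biproduct C (Dom C u) (Dom C v) (Dom C u')"
    "Cod C u' = Cod C i" "u' \<cdot> \<iota> = i \<cdot> u" "Dom C \<mu> = Dom C k" "Cod C \<mu> = Dom C k'" "k' \<cdot> \<mu> = \<iota> \<cdot> k"
    by (rule horseshoe[OF ip assms(2) lv(1) assms(3) lv(2,3)])
  have "inflation C \<iota>" "inflation C \<mu>" using *(1,3) by (auto simp: inflation_def)
  then show thesis
    using that[OF *(2), of \<mu> \<iota>] * projective_biproduct[OF assms(4) lv(3) *(7)] by simp
qed

text \<open>The embedding of the source is prescribed and that of the cokernel is chosen. Here the
  cokernels of the embeddings are to form an inflation sequence.\<close>

lemma injective_resolution_step:
  assumes "inflation C i" "(u, k) \<in> Confl C" "Dom C u = Dom C i" "injective C (Cod C u)"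
  obtains u' k' \<zeta> \<pi> where "(u', k') \<in> Confl C" "Dom C u' = Cod C i" "injective C (Cod C u')"
    "inflation C \<zeta>" "inflation C \<pi>" "Dom C \<zeta> = Cod C k" "Cod C \<zeta> = Cod C k'" "Dom C \<pi> = Cod C u"
    "Cod C \<pi> = Cod C u'" "\<pi> \<cdot> u = u' \<cdot> i" "\<zeta> \<cdot> k = k' \<cdot> \<pi>"
proof -
  interpret op: exact_category "op_cat C" by (rule exact_op)
  obtain p where ip: "(i, p) \<in> Confl C" using assms by (auto simp: inflation_def)
  obtain v l where lv: "(v, l) \<in> Confl C" "Dom C v = Cod C p" "injective C (Cod C v)"
    using enough_injectives[of "Cod C p"] conflD(2)[OF ip] by (auto simp: inflation_def)
  \<comment> \<open>In the opposite category the ends of the conflation trade places: the prescribed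
    embedding \<open>u\<close> covers the quotient, so its injective target supplies the
    projectivity that the horseshoe requires, and the chosen \<open>v\<close> covers the
    subobject.\<close>
  have *: "\<exists>\<iota> \<pi> k' u' \<mu> \<nu>. (\<pi>, \<iota>) \<in> Confl C \<and> (u', k') \<in> Confl C \<and> (\<nu>, \<mu>) \<in> Confl C \<and>
    Dom C \<pi> = Cod C u \<and> Dom C \<iota> = Cod C u' \<and> is_biproduct (op_cat C) (Cod C v) (Cod C u) (Cod C u') \<and>
    Dom C u' = Dom C p \<and> u' \<cdot> i = \<pi> \<cdot> u \<and> Cod C \<nu> = Cod C k' \<and> Dom C \<nu> = Cod C k \<and> k' \<cdot> \<pi> = \<nu> \<cdot> k"
    by (rule op.horseshoe[of p i l v k u]) (use assms ip lv in simp_all, metis)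
  then obtain \<iota> \<pi> k' u' \<mu> \<nu> where *: "(\<pi>, \<iota>) \<in> Confl C" "(u', k') \<in> Confl C" "(\<nu>, \<mu>) \<in> Confl C"
    "Dom C \<pi> = Cod C u" "Dom C \<iota> = Cod C u'" "is_biproduct (op_cat C) (Cod C v) (Cod C u) (Cod C u')"
    "Dom C u' = Dom C p" "u' \<cdot> i = \<pi> \<cdot> u" "Cod C \<nu> = Cod C k'" "Dom C \<nu> = Cod C k" "k' \<cdot> \<pi> = \<nu> \<cdot> k"
    by (elim exE conjE)
  have "inflation C \<nu>" "inflation C \<pi>" using *(1,3) by (auto simp: inflation_def)
  moreover have "injective C (Cod C u')" by (rule injective_biproduct[OF lv(3) assms(4) *(6)])
  moreover have "Cod C i = Dom C p" "Cod C \<pi> = Cod C u'" using conflD(3)[OF ip] conflD(3)[OF *(1)] *(5)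
    by simp_all
  ultimately show thesis
    using that[OF *(2), of \<nu> \<pi>] * by simp
qed

end

section \<open>Factor categories\<close>

locale factor_category = exact_category C
  for C :: "('o, 'm, 'x) exact_cat_scheme" (structure) +
  fixes \<X> :: "'o set"
  assumes additive_\<X>: "additive_subcategory C \<X>"
begin

abbreviation "res \<equiv> residue_class C \<X>"
abbreviation "\<I> \<equiv> factors_through C \<X>"
abbreviation "Q \<equiv> exact_factor_cat C \<X>"

lemma ideal_arr: "f \<in> \<I> \<Longrightarrow> f \<in> Arr C"
  by (simp add: factors_through_def)

lemma idealE:
  assumes "f \<in> \<I>"
  obtains g h where "g \<in> Arr C" "h \<in> Arr C" "Dom C g = Dom C f" "Cod C h = Cod C f" "Cod C g \<in> \<X>"
    "Dom C h = Cod C g" "f = h \<cdot> g"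
proof -
  obtain X g h where "X \<in> \<X>" "g \<in> Hom C (Dom C f) X" "h \<in> Hom C X (Cod C f)" "f = h \<cdot> g"
    using assms unfolding factors_through_def by blast
  then show thesis using that[of g h] unfolding Hom_iff by blast
qed

lemma idealI:
  assumes "g \<in> Arr C" "h \<in> Arr C" "Cod C g \<in> \<X>" "Dom C h = Cod C g"
  shows "h \<cdot> g \<in> \<I>"
  unfolding factors_through_def using assms
  by (intro CollectI conjI bexI[of _ "Cod C g"] bexI[of _ g] bexI[of _ h]) (auto simp: Hom_iff)

lemma \<X>_obj: "X \<in> \<X> \<Longrightarrow> X \<in> Obj C"
  using additive_\<X> by (auto simp: additive_subcategory_def)

lemma ideal_zero:
  assumes "X \<in> Obj C" "Y \<in> Obj C" shows "Zero C X Y \<in> \<I>"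
proof -
  obtain Z where "Z \<in> \<X>" using additive_\<X> by (auto simp: additive_subcategory_def)
  then have "Zero C Z Y \<cdot> Zero C X Z \<in> \<I>" using assms by (intro idealI) (simp_all add: \<X>_obj)
  then show ?thesis using assms \<open>Z \<in> \<X>\<close> by (simp add: \<X>_obj)
qed

lemma ideal_comp_left:
  assumes "f \<in> \<I>" "g \<in> Arr C" "Dom C g = Cod C f" shows "g \<cdot> f \<in> \<I>"
  using assms(1)
proof (rule idealE)
  fix u h assume *: "u \<in> Arr C" "h \<in> Arr C" "Dom C u = Dom C f" "Cod C h = Cod C f" "Cod C u \<in> \<X>"
    "Dom C h = Cod C u" "f = h \<cdot> u"
  then have "g \<cdot> f = (g \<cdot> h) \<cdot> u" using assms by simp
  also have "\<dots> \<in> \<I>" using * assms by (intro idealI) simp_all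
  finally show ?thesis .
qed

lemma ideal_comp_right:
  assumes "f \<in> \<I>" "g \<in> Arr C" "Cod C g = Dom C f" shows "f \<cdot> g \<in> \<I>"
  using assms(1)
proof (rule idealE)
  fix u h assume *: "u \<in> Arr C" "h \<in> Arr C" "Dom C u = Dom C f" "Cod C h = Cod C f" "Cod C u \<in> \<X>"
    "Dom C h = Cod C u" "f = h \<cdot> u"
  then have "f \<cdot> g = h \<cdot> (u \<cdot> g)" using assms by simp
  also have "\<dots> \<in> \<I>" using * assms by (intro idealI) simp_all
  finally show ?thesis .
qed

lemma ideal_neg: "f \<in> \<I> \<Longrightarrow> neg C f \<in> \<I>"
  using ideal_comp_left[of f "neg C (Ident C (Cod C f))"] ideal_arr[of f] by simp

text \<open>A sum of two factorizations factors through the biproduct of the intermediate objects,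
  and one such biproduct lies in \<open>\<X>\<close>.\<close>

lemma ideal_plus:
  assumes "f \<in> \<I>" "g \<in> \<I>" "Dom C f = Dom C g" "Cod C f = Cod C g" shows "f \<boxplus> g \<in> \<I>"
proof -
  obtain a b where f: "a \<in> Arr C" "b \<in> Arr C" "Dom C a = Dom C f" "Cod C b = Cod C f" "Cod C a \<in> \<X>"
    "Dom C b = Cod C a" "f = b \<cdot> a" using assms(1) by (rule idealE)
  obtain c d where g: "c \<in> Arr C" "d \<in> Arr C" "Dom C c = Dom C g" "Cod C d = Cod C g" "Cod C c \<in> \<X>"
    "Dom C d = Cod C c" "g = d \<cdot> c" using assms(2) by (rule idealE)
  obtain S where S: "S \<in> \<X>" "is_biproduct C (Cod C a) (Cod C c) S"
    using additive_\<X> f g unfolding additive_subcategory_def by meson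
  obtain i j p q where B: "S \<in> Obj C" "i \<in> Arr C" "Dom C i = Cod C a" "Cod C i = S" "j \<in> Arr C"
    "Dom C j = Cod C c"
    "Cod C j = S" "p \<in> Arr C" "Dom C p = S" "Cod C p = Cod C a" "q \<in> Arr C" "Dom C q = S"
    "Cod C q = Cod C c"
    "p \<cdot> i = Ident C (Cod C a)" "q \<cdot> j = Ident C (Cod C c)" "q \<cdot> i = Zero C (Cod C a) (Cod C c)"
    "p \<cdot> j = Zero C (Cod C c) (Cod C a)"
    using S(2) by (rule is_biproductE)
  have "(b \<cdot> p \<boxplus> d \<cdot> q) \<cdot> (i \<cdot> a \<boxplus> j \<cdot> c) \<in> \<I>"
    using f(1-6) g(1-6) B S assms(3,4) by (intro idealI) simp_all
  moreover have "(b \<cdot> p \<boxplus> d \<cdot> q) \<cdot> (i \<cdot> a \<boxplus> j \<cdot> c) = f \<boxplus> g"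
    unfolding f(7) g(7) using f(1-6) g(1-6) B assms(3,4) ideal_arr[OF assms(2)]
    by (simp add: comp_eq_comp[OF B(14)] comp_eq_comp[OF B(15)] comp_eq_comp[OF B(16)] comp_eq_comp[OF
      B(17)])
  ultimately show ?thesis by simp
qed

text \<open>Membership in a coset becomes a condition on a difference, so that equality of residue
  classes reduces to arithmetic in the ideal.\<close>

lemma mem_res:
  assumes "f \<in> Arr C"
  shows "g \<in> res f \<longleftrightarrow> g \<in> Arr C \<and> Dom C g = Dom C f \<and> Cod C g = Cod C f \<and> g \<boxplus> neg C f \<in> \<I>"
proof
  assume "g \<in> res f"
  then obtain k where k: "k \<in> Arr C" "Dom C k = Dom C f" "Cod C k = Cod C f" "k \<in> \<I>" "g = f \<boxplus> k"
    unfolding residue_class_def Hom_iff by blast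
  have "g \<boxplus> neg C f = f \<boxplus> (neg C f \<boxplus> k)"
    unfolding k(5) using assms k(1-3) plus_comm[of k "neg C f"] by simp
  then have "g \<boxplus> neg C f = k" using assms k by simp
  then show "g \<in> Arr C \<and> Dom C g = Dom C f \<and> Cod C g = Cod C f \<and> g \<boxplus> neg C f \<in> \<I>"
    using assms k by simp
next
  assume g: "g \<in> Arr C \<and> Dom C g = Dom C f \<and> Cod C g = Cod C f \<and> g \<boxplus> neg C f \<in> \<I>"
  have "f \<boxplus> (g \<boxplus> neg C f) = g \<boxplus> (f \<boxplus> neg C f)"
    using assms g by (intro plus_left_comm) simp_all
  then have "g = f \<boxplus> (g \<boxplus> neg C f)" using assms g by simp
  then show "g \<in> res f"
    unfolding residue_class_def mem_Collect_eq using assms g by (intro exI[of _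
      "g \<boxplus> neg C f"]) (simp add: Hom_iff)
qed

lemma res_eqI:
  assumes "f \<in> Arr C" "g \<in> Arr C" "Dom C g = Dom C f" "Cod C g = Cod C f" "g \<boxplus> neg C f \<in> \<I>"
  shows "res f = res g"
proof -
  have 1: "h \<boxplus> neg C f \<in> \<I> \<longleftrightarrow> h \<boxplus> neg C g \<in> \<I>" if h: "h \<in> Arr C" "Dom C h = Dom C f" "Cod C h = Cod C f"
    for h
  proof
    assume "h \<boxplus> neg C f \<in> \<I>"
    then have "(h \<boxplus> neg C f) \<boxplus> neg C (g \<boxplus> neg C f) \<in> \<I>"
      by (rule ideal_plus[OF _ ideal_neg[OF assms(5)]]) (use assms h in simp_all)
    also have "(h \<boxplus> neg C f) \<boxplus> neg C (g \<boxplus> neg C f) = h \<boxplus> (neg C f \<boxplus> (f \<boxplus> neg C g))"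
      using assms(1-4) h plus_comm[of "neg C g" f] by simp
    also have "\<dots> = h \<boxplus> neg C g" using assms(1-4) h by simp
    finally show "h \<boxplus> neg C g \<in> \<I>" .
  next
    assume "h \<boxplus> neg C g \<in> \<I>"
    then have "(h \<boxplus> neg C g) \<boxplus> (g \<boxplus> neg C f) \<in> \<I>"
      by (rule ideal_plus[OF _ assms(5)]) (use assms h in simp_all)
    then show "h \<boxplus> neg C f \<in> \<I>" using assms(1-4) h by simp
  qed
  show ?thesis using mem_res[OF assms(1)] mem_res[OF assms(2)] 1 assms by auto
qed

lemma res_eqD:
  assumes "res f = res g" "f \<in> Arr C" "g \<in> Arr C"
  shows "Dom C f = Dom C g" "Cod C f = Cod C g" "f \<boxplus> neg C g \<in> \<I>"
proof -
  have "f \<in> res f" using assms by (subst mem_res) (auto intro: ideal_zero)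
  then have "f \<in> res g" using assms by simp
  then show "Dom C f = Dom C g" "Cod C f = Cod C g" "f \<boxplus> neg C g \<in> \<I>"
    using mem_res assms by auto
qed

lemma rep_res:
  assumes "f \<in> Arr C"
  shows "rep (res f) \<in> Arr C" "Dom C (rep (res f)) = Dom C f" "Cod C (rep (res f)) = Cod C f"
    "rep (res f) \<boxplus> neg C f \<in> \<I>" "res (rep (res f)) = res f"
proof -
  have "f \<in> res f" using assms by (subst mem_res) (auto intro: ideal_zero)
  then have "rep (res f) \<in> res f" unfolding rep_def by (rule someI)
  then show *: "rep (res f) \<in> Arr C" "Dom C (rep (res f)) = Dom C f" "Cod C (rep (res f)) = Cod C f"
    "rep (res f) \<boxplus> neg C f \<in> \<I>" using mem_res[OF assms] by auto
  then show "res (rep (res f)) = res f" using res_eqI[OF assms, of "rep (res f)"] by simp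
qed

text \<open>The definition forms the closure under isomorphism in the bare factor category.
  Isomorphisms and composites are the same after adding conflations, so it may be taken in
  \<open>Q\<close>, the only category used from here on.\<close>

lemma factor_simps [simp]:
  "Obj Q = Obj C" "Arr Q = res ` Arr C"
  "Ident Q X = res (Ident C X)" "Zero Q X Y = res (Zero C X Y)"
  "Confl Q = iso_closure Q {(res i, res p) | i p. (i, p) \<in> Confl C}"
  by (auto simp: exact_factor_cat_def preadditive_cat.defs exact_cat.defs factor_cat_def
    proj_functor_def
      iso_closure_def Hom_def is_iso_def)

lemma factor_Dom_Cod:
  "Dom Q c = Dom C (rep c)" "Cod Q c = Cod C (rep c)" "d \<cdot>\<^bsub>Q\<^esub> c = res (rep d \<cdot> rep c)"
  "d \<boxplus>\<^bsub>Q\<^esub> c = res (rep d \<boxplus> rep c)"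
  by (simp_all add: exact_factor_cat_def preadditive_cat.defs exact_cat.defs factor_cat_def)

lemma factor_res_simps [simp]:
  assumes "f \<in> Arr C"
  shows "Dom Q (res f) = Dom C f" "Cod Q (res f) = Cod C f"
  using rep_res[OF assms] by (simp_all add: factor_Dom_Cod)

text \<open>Independence of representatives rests on \<open>(g' - g) \<cdot> f' + g \<cdot> (f' - f)
  = g' \<cdot> f' - g \<cdot> f\<close>, where primes denote the chosen representatives: both
  summands lie in the two-sided ideal.\<close>

lemma factor_comp [simp]:
  assumes f: "f \<in> Arr C" and g: "g \<in> Arr C" and fg: "Cod C f = Dom C g"
  shows "res g \<cdot>\<^bsub>Q\<^esub> res f = res (g \<cdot> f)"
proof -
  note F = rep_res[OF f] and G = rep_res[OF g]
  let ?f = "rep (res f)" and ?g = "rep (res g)"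
  have "(?g \<boxplus> neg C g) \<cdot> ?f \<boxplus> g \<cdot> (?f \<boxplus> neg C f) \<in> \<I>"
    by (rule ideal_plus[OF ideal_comp_right[OF G(4)] ideal_comp_left[OF F(4)]])
      (use F(1-3) G(1-3) f g fg in simp_all)
  moreover have "(?g \<boxplus> neg C g) \<cdot> ?f \<boxplus> g \<cdot> (?f \<boxplus> neg C f) = ?g \<cdot> ?f \<boxplus> neg C (g \<cdot> f)"
    using F(1-3) G(1-3) f g fg by simp
  ultimately have "?g \<cdot> ?f \<boxplus> neg C (g \<cdot> f) \<in> \<I>" by simp
  then have "res (g \<cdot> f) = res (?g \<cdot> ?f)"
    using F(1-3) G(1-3) f g fg by (intro res_eqI) simp_all
  then show ?thesis by (simp add: factor_Dom_Cod)
qed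

lemma factor_plus [simp]:
  assumes f: "f \<in> Arr C" and g: "g \<in> Arr C" and fg: "Dom C f = Dom C g" "Cod C f = Cod C g"
  shows "res g \<boxplus>\<^bsub>Q\<^esub> res f = res (g \<boxplus> f)"
proof -
  note F = rep_res[OF f] and G = rep_res[OF g]
  let ?f = "rep (res f)" and ?g = "rep (res g)"
  have "(?g \<boxplus> neg C g) \<boxplus> (?f \<boxplus> neg C f) \<in> \<I>"
    by (rule ideal_plus[OF G(4) F(4)]) (use F(1-3) G(1-3) f g fg in simp_all)
  moreover have "(?g \<boxplus> neg C g) \<boxplus> (?f \<boxplus> neg C f) = (?g \<boxplus> ?f) \<boxplus> neg C (g \<boxplus> f)"
    using F(1-3) G(1-3) f g fg plus_left_comm[of "neg C g" ?f "neg C f"] by simp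
  ultimately have "(?g \<boxplus> ?f) \<boxplus> neg C (g \<boxplus> f) \<in> \<I>" by simp
  then have "res (g \<boxplus> f) = res (?g \<boxplus> ?f)"
    using F(1-3) G(1-3) f g fg by (intro res_eqI) simp_all
  then show ?thesis by (simp add: factor_Dom_Cod)
qed

lemma Hom_factorE:
  assumes "c \<in> Hom Q X Y"
  obtains f where "f \<in> Arr C" "Dom C f = X" "Cod C f = Y" "c = res f"
  using assms by (auto simp: Hom_iff)

lemma factor_is_category: "category Q"
proof
  fix f assume "f \<in> Arr Q"
  then show "Dom Q f \<in> Obj Q" "Cod Q f \<in> Obj Q" by auto
next
  fix X assume "X \<in> Obj Q" then show "Ident Q X \<in> Hom Q X X" by (auto simp: Hom_iff)
next
  fix f g X Y Z assume "f \<in> Hom Q X Y" "g \<in> Hom Q Y Z"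
  then show "g \<cdot>\<^bsub>Q\<^esub> f \<in> Hom Q X Z" by (auto elim!: Hom_factorE simp: Hom_iff)
next
  fix f g h W X Y Z assume "f \<in> Hom Q W X" "g \<in> Hom Q X Y" "h \<in> Hom Q Y Z"
  then show "h \<cdot>\<^bsub>Q\<^esub> g \<cdot>\<^bsub>Q\<^esub> f = h \<cdot>\<^bsub>Q\<^esub> (g \<cdot>\<^bsub>Q\<^esub> f)" by (auto elim!: Hom_factorE)
next
  fix f X Y assume "f \<in> Hom Q X Y"
  then show "Ident Q Y \<cdot>\<^bsub>Q\<^esub> f = f" by (auto elim!: Hom_factorE)
next
  fix f X Y assume "f \<in> Hom Q X Y"
  then show "f \<cdot>\<^bsub>Q\<^esub> Ident Q X = f" by (auto elim!: Hom_factorE)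
qed

text \<open>Removability is phrased in \<open>factor_cat\<close>, whereas all calculations take
  place in \<open>Q\<close>; the two differ only by the field of conflations.\<close>

lemma factor_cat_kernel_cokernel:
  "kernel_cokernel_pair (factor_cat C \<X>) i p \<longleftrightarrow> kernel_cokernel_pair Q i p"
  by (simp add: kernel_cokernel_pair_def is_kernel_def is_cokernel_def Hom_def
      exact_factor_cat_def preadditive_cat.defs exact_cat.defs factor_cat_def)

lemma res_confl:
  assumes "(i, p) \<in> Confl C" shows "(res i, res p) \<in> Confl Q"
proof -
  interpret Q: category Q by (rule factor_is_category)
  note I = conflD(1-3)[OF assms]
  have id: "is_iso Q (res (Ident C X))" if "X \<in> Obj C" for X using Q.iso_Ident[of X] that by simp
  have mem: "(res i, res p) \<in> {(res i, res p) | i p. (i, p) \<in> Confl C}" using assms by blast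
  show ?thesis
    unfolding factor_simps(5)
    by (rule iso_closureI[OF mem id[of "Dom C i"] id[of "Cod C i"] id[of
      "Cod C p"]]) (use I in simp_all)
qed

end

section \<open>Frobenius quotients as functors with lifting properties\<close>

lemma is_functorD:
  assumes "is_functor C D F"
  shows "X \<in> Obj C \<Longrightarrow> FObj F X \<in> Obj D"
    and "f \<in> Arr C \<Longrightarrow> FArr F f \<in> Arr D"
    and "f \<in> Arr C \<Longrightarrow> Dom D (FArr F f) = FObj F (Dom C f)"
    and "f \<in> Arr C \<Longrightarrow> Cod D (FArr F f) = FObj F (Cod C f)"
    and "X \<in> Obj C \<Longrightarrow> FArr F (Ident C X) = Ident D (FObj F X)"
    and "\<lbrakk>f \<in> Arr C; g \<in> Arr C; Cod C f = Dom C g\<rbrakk> \<Longrightarrow> FArr F (g \<cdot>\<^bsub>C\<^esub> f) = FArr F g \<cdot>\<^bsub>D\<^esub> FArr F f"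
  using assms by (auto simp: is_functor_def Hom_iff)

lemma functor_is_iso:
  assumes "category C" "is_functor C D F" "is_iso C f"
  shows "is_iso D (FArr F f)"
proof -
  interpret category C by fact
  obtain g where g: "f \<in> Arr C" "g \<in> Arr C" "Dom C g = Cod C f" "Cod C g = Dom C f"
    "g \<cdot>\<^bsub>C\<^esub> f = Ident C (Dom C f)" "f \<cdot>\<^bsub>C\<^esub> g = Ident C (Cod C f)"
    using iso_inverse[OF assms(3)] by metis
  note F = is_functorD[OF assms(2)]
  have "FArr F g \<cdot>\<^bsub>D\<^esub> FArr F f = Ident D (FObj F (Dom C f))"
    "FArr F f \<cdot>\<^bsub>D\<^esub> FArr F g = Ident D (FObj F (Cod C f))"
    using F(6)[of f g] F(6)[of g f] F(5)[of "Dom C f"] F(5)[of "Cod C f"] g by simp_all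
  then show ?thesis using g F(2-4) by (intro is_isoI[where g = "FArr F g"]) simp_all
qed

section \<open>Exact functors and their essential kernels\<close>

locale exact_functor_between = C: exact_category C + D: exact_category D
  for C :: "('o, 'm, 'x) exact_cat_scheme" and D :: "('p, 'q, 'y) exact_cat_scheme" +
  fixes F :: "('o, 'm, 'p, 'q) cat_functor"
  assumes exact: "exact_functor C D F"
begin

abbreviation "F\<^sub>o \<equiv> FObj F"
abbreviation "F\<^sub>a \<equiv> FArr F"

lemma is_functor: "is_functor C D F"
  using exact by (auto simp: exact_functor_def additive_functor_def)

lemmas F_simps [simp] = is_functorD[OF is_functor]

lemma F_plus [simp]:
  assumes "f \<in> Arr C" "g \<in> Arr C" "Dom C f = Dom C g" "Cod C f = Cod C g"
  shows "F\<^sub>a (f \<boxplus>\<^bsub>C\<^esub> g) = F\<^sub>a f \<boxplus>\<^bsub>D\<^esub> F\<^sub>a g"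
proof -
  have "F\<^sub>a \<in> hom (hom_group C (Dom C f) (Cod C f)) (hom_group D (F\<^sub>o (Dom C f)) (F\<^sub>o (Cod C f)))"
    using exact assms(1) C.Dom_in[of f] C.Cod_in[of f] by (auto simp: exact_functor_def
      additive_functor_def)
  then show ?thesis using assms by (auto simp: hom_def hom_group_def Hom_iff)
qed

lemma F_zero [simp]:
  assumes "X \<in> Obj C" "Y \<in> Obj C" shows "F\<^sub>a (Zero C X Y) = Zero D (F\<^sub>o X) (F\<^sub>o Y)"
proof (rule D.plus_left_cancel)
  show "F\<^sub>a (Zero C X Y) \<boxplus>\<^bsub>D\<^esub> F\<^sub>a (Zero C X Y) = F\<^sub>a (Zero C X Y) \<boxplus>\<^bsub>D\<^esub> Zero D (F\<^sub>o X) (F\<^sub>o Y)"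
    using F_plus[of "Zero C X Y" "Zero C X Y"] assms by simp
qed (use assms in simp_all)

lemma F_neg [simp]:
  assumes "f \<in> Arr C" shows "F\<^sub>a (neg C f) = neg D (F\<^sub>a f)"
proof (rule D.neg_eqI[symmetric])
  show "F\<^sub>a f \<boxplus>\<^bsub>D\<^esub> F\<^sub>a (neg C f) = Zero D (Dom D (F\<^sub>a f)) (Cod D (F\<^sub>a f))"
    using F_plus[of f "neg C f"] assms by simp
qed (use assms in simp_all)

lemma F_confl: "(i, p) \<in> Confl C \<Longrightarrow> (F\<^sub>a i, F\<^sub>a p) \<in> Confl D"
  using exact by (auto simp: exact_functor_def)

lemma F_inflation: "inflation C i \<Longrightarrow> inflation D (F\<^sub>a i)"
  using F_confl by (auto simp: inflation_def)

text \<open>An object is killed as soon as its identity and its zero endomorphism have the same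
  image, which avoids speaking of zero objects of the target.\<close>

lemma ess_kernel_iff: "X \<in> ess_kernel C D F \<longleftrightarrow> X \<in> Obj C \<and> F\<^sub>a (Ident C X) = F\<^sub>a (Zero C X X)"
  by (auto simp: ess_kernel_def D.zero_object_iff)

lemma zero_in_ess_kernel: "zero_object C Z \<Longrightarrow> Z \<in> ess_kernel C D F"
  by (simp add: ess_kernel_iff C.zero_object_iff)

lemma F_ess_kernel_zero:
  assumes "f \<in> Arr C" "Cod C f \<in> ess_kernel C D F \<or> Dom C f \<in> ess_kernel C D F"
  shows "F\<^sub>a f = Zero D (F\<^sub>o (Dom C f)) (F\<^sub>o (Cod C f))"
  using assms D.zero_object_arr[of _ "F\<^sub>a f"] by (fastforce simp: ess_kernel_def)

lemma F_factors_through_zero: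
  assumes "f \<in> factors_through C (ess_kernel C D F)"
  shows "F\<^sub>a f = Zero D (F\<^sub>o (Dom C f)) (F\<^sub>o (Cod C f))"
proof -
  obtain X g h where X: "X \<in> ess_kernel C D F" "g \<in> Arr C" "h \<in> Arr C" "Dom C g = Dom C f" "Cod C g = X"
    "Dom C h = X" "Cod C h = Cod C f" "f = h \<cdot>\<^bsub>C\<^esub> g"
  proof -
    obtain X g h where "X \<in> ess_kernel C D F" "g \<in> Hom C (Dom C f) X" "h \<in> Hom C X (Cod C f)"
      "f = h \<cdot>\<^bsub>C\<^esub> g"
      using assms unfolding factors_through_def by blast
    then show thesis using that unfolding Hom_iff by blast
  qed
  have f: "f \<in> Arr C" using assms by (auto simp: factors_through_def)
  have "F\<^sub>a f = F\<^sub>a h \<cdot>\<^bsub>D\<^esub> F\<^sub>a g" unfolding X(8) using X(2-7) by simp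
  also have "\<dots> = Zero D (F\<^sub>o (Dom C f)) (F\<^sub>o (Cod C f))"
    using F_ess_kernel_zero[of g] X(1-7) f by simp
  finally show ?thesis .
qed

text \<open>The identity of \<open>S\<close> is \<open>i \<cdot> p + j \<cdot> q\<close>, and each
  term passes through a killed object.\<close>

lemma ess_kernel_biproduct:
  assumes X: "X \<in> ess_kernel C D F" and Y: "Y \<in> ess_kernel C D F" and S: "is_biproduct C X Y S"
  shows "S \<in> ess_kernel C D F"
proof -
  obtain i j p q where *: "S \<in> Obj C" "i \<in> Arr C" "Dom C i = X" "Cod C i = S" "j \<in> Arr C" "Dom C j = Y"
    "Cod C j = S"
    "p \<in> Arr C" "Dom C p = S" "Cod C p = X" "q \<in> Arr C" "Dom C q = S" "Cod C q = Y"
    "(i \<cdot>\<^bsub>C\<^esub> p) \<boxplus>\<^bsub>C\<^esub> (j \<cdot>\<^bsub>C\<^esub> q) = Ident C S"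
    using S by (rule C.is_biproductE)
  have "F\<^sub>a (Ident C S) = F\<^sub>a i \<cdot>\<^bsub>D\<^esub> F\<^sub>a p \<boxplus>\<^bsub>D\<^esub> F\<^sub>a j \<cdot>\<^bsub>D\<^esub> F\<^sub>a q"
    unfolding *(14)[symmetric] using *(1-13) by simp
  also have "\<dots> = F\<^sub>a (Zero C S S)"
    using F_ess_kernel_zero[of p] F_ess_kernel_zero[of q] X Y *(1-13) by simp
  finally show ?thesis using * by (simp add: ess_kernel_iff)
qed

lemma ess_kernel_additive: "additive_subcategory C (ess_kernel C D F)"
  unfolding additive_subcategory_def
proof (intro conjI ballI)
  show "ess_kernel C D F \<subseteq> Obj C" by (auto simp: ess_kernel_def)
  show "\<exists>Z\<in>ess_kernel C D F. zero_object C Z"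
    using C.ex_zero_object zero_in_ess_kernel by blast
  fix X Y assume XY: "X \<in> ess_kernel C D F" "Y \<in> ess_kernel C D F"
  then have "X \<in> Obj C" "Y \<in> Obj C" by (auto simp: ess_kernel_def)
  then obtain S where S: "is_biproduct C X Y S" using C.ex_biproduct by blast
  then show "\<exists>S\<in>ess_kernel C D F. is_biproduct C X Y S" using ess_kernel_biproduct[OF XY S] by blast
qed

text \<open>The identity of the retract passes through a killed object. This covers both direct
  summands and the complement of a split inflation.\<close>

lemma ess_kernel_retract:
  assumes "X \<in> ess_kernel C D F" "r \<in> Arr C" "s \<in> Arr C" "Dom C r = X" "Cod C s = X" "Dom C s = Cod C r"
    and rs: "r \<cdot>\<^bsub>C\<^esub> s = Ident C (Cod C r)"
  shows "Cod C r \<in> ess_kernel C D F"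
proof -
  have "F\<^sub>a (Ident C (Cod C r)) = F\<^sub>a r \<cdot>\<^bsub>D\<^esub> F\<^sub>a s" unfolding rs[symmetric] using assms(2-6) by simp
  also have "\<dots> = F\<^sub>a (Zero C (Cod C r) (Cod C r))"
    using F_ess_kernel_zero[of r] assms(1-6) by simp
  finally show ?thesis using assms by (simp add: ess_kernel_iff)
qed

lemma ess_kernel_summand_closed: "summand_closed C (ess_kernel C D F)"
  unfolding summand_closed_def
proof (intro ballI allI impI)
  fix S X Y assume S: "S \<in> ess_kernel C D F" "is_biproduct C X Y S"
  obtain i p where "i \<in> Arr C" "Dom C i = X" "Cod C i = S" "p \<in> Arr C" "Dom C p = S" "Cod C p = X"
    "p \<cdot>\<^bsub>C\<^esub> i = Ident C X"
    using S(2) by (rule C.is_biproductE)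
  then show "X \<in> ess_kernel C D F" using ess_kernel_retract[of S p i] S by simp
qed

end

section \<open>Full and dense functors, and lifting of conflations\<close>

definition full_functor ::
  "('o, 'm, 'x) cat_scheme \<Rightarrow> ('p, 'q, 'y) cat_scheme \<Rightarrow> ('o, 'm, 'p, 'q) cat_functor \<Rightarrow> bool" where
  "full_functor C D F \<longleftrightarrow> (\<forall>X \<in> Obj C. \<forall>Y \<in> Obj C. \<forall>h \<in> Hom D (FObj F X) (FObj F Y). \<exists>f \<in> Hom C X Y. FArr
  F f = h)"

definition dense_functor ::
  "('o, 'm, 'x) cat_scheme \<Rightarrow> ('p, 'q, 'y) cat_scheme \<Rightarrow> ('o, 'm, 'p, 'q) cat_functor \<Rightarrow> bool" where
  "dense_functor C D F \<longleftrightarrow> (\<forall>Y \<in> Obj D. \<exists>X \<in> Obj C. \<exists>f. is_iso D f \<and> Dom D f = FObj F X \<and> Cod D f = Y)"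

text \<open>The isomorphisms run from the image of the lifted conflation to the given one. For an
  inverse of the induced functor on the factor category this condition is exactness, because
  conflations there are isomorphic copies of images from \<open>C\<close>.\<close>

definition lifts_conflations ::
  "('o, 'm, 'x) exact_cat_scheme \<Rightarrow> ('p, 'q, 'y) exact_cat_scheme \<Rightarrow> ('o, 'm, 'p, 'q) cat_functor \<Rightarrow> bool"
  where
  "lifts_conflations C D F \<longleftrightarrow> (\<forall>(i, p) \<in> Confl D. \<exists>(i', p') \<in> Confl C. \<exists>a b c.
     is_iso D a \<and> is_iso D b \<and> is_iso D c \<and> Dom D a = FObj F (Dom C i') \<and> Cod D a = Dom D i \<and>
     Dom D b = FObj F (Cod C i') \<and> Cod D b = Cod D i \<and> Dom D c = FObj F (Cod C p') \<and> Cod D c = Cod D p \<and>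
     b \<cdot>\<^bsub>D\<^esub> FArr F i' = i \<cdot>\<^bsub>D\<^esub> a \<and> c \<cdot>\<^bsub>D\<^esub> FArr F p' = p \<cdot>\<^bsub>D\<^esub> b)"

lemma lifts_conflationsE:
  assumes "lifts_conflations C D F" "(i, p) \<in> Confl D"
  obtains i' p' a b c where "(i', p') \<in> Confl C"
     "is_iso D a" "is_iso D b" "is_iso D c" "Dom D a = FObj F (Dom C i')" "Cod D a = Dom D i"
     "Dom D b = FObj F (Cod C i')" "Cod D b = Cod D i" "Dom D c = FObj F (Cod C p')" "Cod D c = Cod D p"
     "b \<cdot>\<^bsub>D\<^esub> FArr F i' = i \<cdot>\<^bsub>D\<^esub> a" "c \<cdot>\<^bsub>D\<^esub> FArr F p' = p \<cdot>\<^bsub>D\<^esub> b"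
  using bspec[OF assms(1)[unfolded lifts_conflations_def] assms(2)] by (elim case_prodE bexE exE conjE)
    (auto simp: that)

lemma full_functorE:
  assumes "full_functor C D F" "X \<in> Obj C" "Y \<in> Obj C" "h \<in> Arr D" "Dom D h = FObj F X"
    "Cod D h = FObj F Y"
  obtains f where "f \<in> Arr C" "Dom C f = X" "Cod C f = Y" "FArr F f = h"
proof -
  have "\<exists>f \<in> Hom C X Y. FArr F f = h" using assms unfolding full_functor_def by (simp add: Hom_iff)
  then show thesis using that by (auto simp: Hom_iff)
qed

lemma dense_functorE:
  assumes "dense_functor C D F" "Y \<in> Obj D"
  obtains X f where "X \<in> Obj C" "is_iso D f" "Dom D f = FObj F X" "Cod D f = Y"
  using assms unfolding dense_functor_def by blast

text \<open>An extension of \<open>F Z\<close> by \<open>F X\<close> is a push-out of the image of a projective resolution of \<open>Z\<close>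
  along a map that lifts by fullness.\<close>

lemma (in exact_functor_between) lifts_conflationsI:
  assumes full: "full_functor C D F" and dense: "dense_functor C D F"
    and proj: "\<And>P. projective C P \<Longrightarrow> projective D (F\<^sub>o P)" and frob: "frobenius_category C"
  shows "lifts_conflations C D F"
proof -
  interpret C: frobenius_category C by fact
  have "\<exists>i' p'. (i', p') \<in> Confl C \<and> (\<exists>a b c.
     is_iso D a \<and> is_iso D b \<and> is_iso D c \<and> Dom D a = FObj F (Dom C i') \<and> Cod D a = Dom D i \<and>
     Dom D b = FObj F (Cod C i') \<and> Cod D b = Cod D i \<and> Dom D c = FObj F (Cod C p') \<and> Cod D c = Cod D p \<and>
     b \<cdot>\<^bsub>D\<^esub> FArr F i' = i \<cdot>\<^bsub>D\<^esub> a \<and> c \<cdot>\<^bsub>D\<^esub> FArr F p' = p \<cdot>\<^bsub>D\<^esub> b)"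
    if ip: "(i, p) \<in> Confl D" for i p
  proof -
    note [simp] = D.conflD(1-3)[OF ip]
    have pi: "p \<cdot>\<^bsub>D\<^esub> i = Zero D (Dom D i) (Cod D p)" using D.conflD(4)[OF ip] .
    note [simp] = pi D.comp_eq_comp[OF pi]
    obtain X \<alpha> where X: "X \<in> Obj C" "is_iso D \<alpha>" "Dom D \<alpha> = F\<^sub>o X" "Cod D \<alpha> = Dom D i"
      by (rule dense_functorE[OF dense, of "Dom D i"]) simp_all
    obtain Z \<gamma> where Z: "Z \<in> Obj C" "is_iso D \<gamma>" "Dom D \<gamma> = F\<^sub>o Z" "Cod D \<gamma> = Cod D p"
      by (rule dense_functorE[OF dense, of "Cod D p"]) simp_all
    have [simp]: "\<alpha> \<in> Arr D" "\<gamma> \<in> Arr D" using is_isoD(1)[OF X(2)] is_isoD(1)[OF Z(2)] .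
    obtain k u where ku: "(k, u) \<in> Confl C" "Cod C u = Z" "projective C (Dom C u)"
      using C.enough_projectives[OF Z(1)] by (auto simp: deflation_def)
    note [simp] = C.conflD(1-3)[OF ku(1)]
    have uk: "u \<cdot>\<^bsub>C\<^esub> k = Zero C (Dom C k) Z" using C.conflD(4)[OF ku(1)] ku(2) by simp
    have Fuk: "F\<^sub>a u \<cdot>\<^bsub>D\<^esub> F\<^sub>a k = Zero D (F\<^sub>o (Dom C k)) (F\<^sub>o Z)"
      using F_simps(6)[of k u] uk Z(1) by simp
    \<comment> \<open>The image of the projective cover is still projective, so it maps to the given
      extension over \<open>\<gamma>\<close>.\<close>
    obtain h where h: "h \<in> Arr D" "Dom D h = F\<^sub>o (Dom C u)" "Cod D h = Dom D p"
      "p \<cdot>\<^bsub>D\<^esub> h = \<gamma> \<cdot>\<^bsub>D\<^esub> F\<^sub>a u"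
    proof (rule D.projectiveE[OF proj[OF ku(3)], of p "\<gamma> \<cdot>\<^bsub>D\<^esub> F\<^sub>a u"])
      show "deflation D p" using ip by (auto simp: deflation_def)
    qed (use ku Z in simp_all)
    \<comment> \<open>Restricting \<open>h\<close> to the kernel of the cover lands in the kernel
      \<open>i\<close>; transported by \<open>\<alpha>'\<close>, this is the classifying arrow of
      the extension, the only one that must be lifted.\<close>
    obtain t where t: "t \<in> Arr D" "Dom D t = F\<^sub>o (Dom C k)" "Cod D t = Dom D i"
      "i \<cdot>\<^bsub>D\<^esub> t = h \<cdot>\<^bsub>D\<^esub> F\<^sub>a k"
      by (rule D.confl_lift[OF ip, of "h \<cdot>\<^bsub>D\<^esub> F\<^sub>a k"])
        (use h ku Z in \<open>simp_all add: D.comp_eq_comp[OF h(4)] Fuk\<close>)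
    obtain \<alpha>' where \<alpha>': "\<alpha>' \<in> Arr D" "Dom D \<alpha>' = Dom D i" "Cod D \<alpha>' = F\<^sub>o X"
      "\<alpha> \<cdot>\<^bsub>D\<^esub> \<alpha>' = Ident D (Dom D i)"
      using D.iso_inverse[OF X(2)] X by metis
    obtain g where g: "g \<in> Arr C" "Dom C g = Dom C k" "Cod C g = X" "F\<^sub>a g = \<alpha>' \<cdot>\<^bsub>D\<^esub> t"
      by (rule full_functorE[OF full, of "Dom C k" X "\<alpha>' \<cdot>\<^bsub>D\<^esub> t"]) (use X \<alpha>' t in simp_all)
    have \<alpha>g: "\<alpha> \<cdot>\<^bsub>D\<^esub> F\<^sub>a g = t" unfolding g(4) using X \<alpha>' t by (simp add: D.comp_eq_comp[OF \<alpha>'(4)])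
    obtain k' g' u' where po: "is_pushout C k g k' g'" and ku': "(k', u') \<in> Confl C" "Cod C u' = Z"
      "u' \<cdot>\<^bsub>C\<^esub> g' = u"
      using C.confl_pushout[OF ku(1) g(1,2)] ku(2) by metis
    note P = C.pushoutD[OF po]
    note [simp] = P(3,4) C.conflD(1-3)[OF ku'(1)]
    have [simp]: "Dom C k' = X" "Dom C g' = Dom C u" "Cod C g' = Dom C u'" using P g by simp_all
    have ug: "F\<^sub>a u' \<cdot>\<^bsub>D\<^esub> F\<^sub>a g' = F\<^sub>a u"
      using F_simps(6)[of g' u'] ku'(3) by simp
    have gk: "F\<^sub>a g' \<cdot>\<^bsub>D\<^esub> F\<^sub>a k = F\<^sub>a k' \<cdot>\<^bsub>D\<^esub> F\<^sub>a g"
      using F_simps(6)[of k g'] F_simps(6)[of g k'] P(9) g by (simp del: F_simps)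
    \<comment> \<open>The images of both conflations share their right-hand end, so the image square
      is again a push-out and induces the comparison \<open>b\<close> with the given
      extension.\<close>
    have PO: "is_pushout D (F\<^sub>a k) (F\<^sub>a g) (F\<^sub>a k') (F\<^sub>a g')"
      by (rule D.confl_map_pushout[OF F_confl[OF ku(1)] F_confl[OF ku'(1)]])
        (use g(1-3) ku ku' in \<open>simp_all add: ug gk\<close>)
    have uk': "F\<^sub>a u' \<cdot>\<^bsub>D\<^esub> F\<^sub>a k' = Zero D (F\<^sub>o X) (F\<^sub>o Z)"
      using F_simps(6)[of k' u'] C.conflD(4)[OF ku'(1)] ku' X(1) Z(1) by simp
    have "h \<cdot>\<^bsub>D\<^esub> F\<^sub>a k = (i \<cdot>\<^bsub>D\<^esub> \<alpha>) \<cdot>\<^bsub>D\<^esub> F\<^sub>a g"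
      using X g(1-3) t by (simp add: \<alpha>g)
    then obtain b where b: "b \<in> Arr D" "Dom D b = Cod D (F\<^sub>a k')" "Cod D b = Cod D (i \<cdot>\<^bsub>D\<^esub> \<alpha>)"
      "b \<cdot>\<^bsub>D\<^esub> F\<^sub>a g' = h"
      "b \<cdot>\<^bsub>D\<^esub> F\<^sub>a k' = i \<cdot>\<^bsub>D\<^esub> \<alpha>"
      using D.pushout_induced[OF PO, of h "i \<cdot>\<^bsub>D\<^esub> \<alpha>" thesis] h X g(1-3) by simp
    have [simp]: "Dom D b = F\<^sub>o (Dom C u')" "Cod D b = Dom D p" using b X by simp_all
    have pb: "p \<cdot>\<^bsub>D\<^esub> b = \<gamma> \<cdot>\<^bsub>D\<^esub> F\<^sub>a u'"
    proof (rule D.pushout_epi[OF PO])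
      show "(p \<cdot>\<^bsub>D\<^esub> b) \<cdot>\<^bsub>D\<^esub> F\<^sub>a g' = (\<gamma> \<cdot>\<^bsub>D\<^esub> F\<^sub>a u') \<cdot>\<^bsub>D\<^esub> F\<^sub>a g'"
        using b ku' Z ug h by simp
      show "(p \<cdot>\<^bsub>D\<^esub> b) \<cdot>\<^bsub>D\<^esub> F\<^sub>a k' = (\<gamma> \<cdot>\<^bsub>D\<^esub> F\<^sub>a u') \<cdot>\<^bsub>D\<^esub> F\<^sub>a k'"
        using b ku' Z X uk' h by simp
    qed (use b ku' Z in simp_all)
    \<comment> \<open>Absorbing \<open>\<gamma>\<close> into the deflation makes the right-hand
      comparison an identity, as the five lemma in \<open>confl_map_iso\<close> demands.\<close>
    have "(F\<^sub>a k', \<gamma> \<cdot>\<^bsub>D\<^esub> F\<^sub>a u') \<in> Confl D"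
      by (rule D.confl_iso[OF F_confl[OF ku'(1)] D.iso_Ident D.iso_Ident Z(2), of "F\<^sub>o X"
        "F\<^sub>o (Dom C u')"])
        (use Z X ku' in simp_all)
    then have "is_iso D b"
      by (rule D.confl_map_iso[OF _ ip b(1) X(2)]) (use b X Z ku' pb in simp_all)
    then show ?thesis
      using ku' X Z b pb by (intro exI[of _ k'] exI[of _ u'] conjI exI[of _ \<alpha>] exI[of _ b] exI[of _ \<gamma>])
        simp_all
  qed
  then show ?thesis unfolding lifts_conflations_def by fast
qed

text \<open>Pulling the deflation back along \<open>h\<close> turns the lifting problem into finding
  a section over the image of \<open>P\<close>. The pulled-back conflation lifts to
  \<open>C\<close>, where projectivity of \<open>P\<close> provides the section; fullness is used to
  lift the identification of the right-hand ends.\<close>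

lemma (in exact_functor_between) projective_image:
  assumes full: "full_functor C D F" and lifts: "lifts_conflations C D F" and P: "projective C P"
  shows "projective D (F\<^sub>o P)"
  unfolding projective_def Hom_iff
proof (intro conjI allI impI)
  have PO: "P \<in> Obj C" using P by (simp add: projective_def)
  then show "F\<^sub>o P \<in> Obj D" by simp
  fix q h assume "deflation D q" and h: "h \<in> Arr D \<and> Dom D h = F\<^sub>o P \<and> Cod D h = Cod D q"
  then obtain j where jq: "(j, q) \<in> Confl D" by (auto simp: deflation_def)
  obtain q' h' j' where pb: "is_pullback D q h q' h'" "(j', q') \<in> Confl D"
    using D.confl_pullback[OF jq, of h] h by metis
  note PB = D.pullbackD[OF pb(1)]
  obtain i0 p0 a b c where L: "(i0, p0) \<in> Confl C"
     "is_iso D a" "is_iso D b" "is_iso D c" "Dom D a = FObj F (Dom C i0)" "Cod D a = Dom D j'"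
     "Dom D b = FObj F (Cod C i0)" "Cod D b = Cod D j'" "Dom D c = FObj F (Cod C p0)"
     "Cod D c = Cod D q'"
     "b \<cdot>\<^bsub>D\<^esub> FArr F i0 = j' \<cdot>\<^bsub>D\<^esub> a" "c \<cdot>\<^bsub>D\<^esub> FArr F p0 = q' \<cdot>\<^bsub>D\<^esub> b"
    by (rule lifts_conflationsE[OF lifts pb(2)])
  have [simp]: "b \<in> Arr D" "c \<in> Arr D" using is_isoD(1)[OF L(3)] is_isoD(1)[OF L(4)] .
  note [simp] = C.conflD(1-3)[OF L(1)] D.conflD(1-3)[OF pb(2)]
  obtain c' where c': "c' \<in> Arr D" "Dom D c' = F\<^sub>o P" "Cod D c' = F\<^sub>o (Cod C p0)"
    "c \<cdot>\<^bsub>D\<^esub> c' = Ident D (F\<^sub>o P)"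
    using D.iso_inverse[OF L(4)] L PB h by metis
  obtain f where f: "f \<in> Arr C" "Dom C f = P" "Cod C f = Cod C p0" "F\<^sub>a f = c'"
    by (rule full_functorE[OF full, of P "Cod C p0" c']) (use PO c' in simp_all)
  obtain s where s: "s \<in> Arr C" "Dom C s = P" "Cod C s = Dom C p0" "p0 \<cdot>\<^bsub>C\<^esub> s = f"
  proof (rule C.projectiveE[OF P, of p0 f])
    show "deflation C p0" using L(1) by (auto simp: deflation_def)
  qed (use f in simp_all)
  have "q' \<cdot>\<^bsub>D\<^esub> (b \<cdot>\<^bsub>D\<^esub> F\<^sub>a s) = c \<cdot>\<^bsub>D\<^esub> (F\<^sub>a p0 \<cdot>\<^bsub>D\<^esub> F\<^sub>a s)"
    using s(1-3) L(7-10) PB(1-8) h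
    by (simp add: D.comp_eq_comp[OF L(12)[symmetric]] del: F_simps(6))
  also have "F\<^sub>a p0 \<cdot>\<^bsub>D\<^esub> F\<^sub>a s = c'" using F_simps(6)[of s p0] s f by simp
  finally have *: "q' \<cdot>\<^bsub>D\<^esub> (b \<cdot>\<^bsub>D\<^esub> F\<^sub>a s) = Ident D (F\<^sub>o P)" using c' by simp
  have "q \<cdot>\<^bsub>D\<^esub> (h' \<cdot>\<^bsub>D\<^esub> (b \<cdot>\<^bsub>D\<^esub> F\<^sub>a s)) = h \<cdot>\<^bsub>D\<^esub> (q' \<cdot>\<^bsub>D\<^esub> (b \<cdot>\<^bsub>D\<^esub> F\<^sub>a s))"
    using s(1-3) L(7-10) PB(1-8) h by (simp add: D.comp_eq_comp[OF PB(9)])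
  then have "q \<cdot>\<^bsub>D\<^esub> (h' \<cdot>\<^bsub>D\<^esub> (b \<cdot>\<^bsub>D\<^esub> F\<^sub>a s)) = h" unfolding * using h by simp
  then show "\<exists>g\<in>Hom D (F\<^sub>o P) (Dom D q). q \<cdot>\<^bsub>D\<^esub> g = h"
    using s(1-3) L(7-10) PB(1-8) h
    by (intro bexI[of _ "h' \<cdot>\<^bsub>D\<^esub> (b \<cdot>\<^bsub>D\<^esub> F\<^sub>a s)"]) (simp_all add: Hom_iff)
qed

locale quotient_functor = exact_functor_between C D F + C: frobenius_category C + D: frobenius_category
  D
  for C :: "('o, 'm, 'x) exact_cat_scheme" and D :: "('p, 'q, 'y) exact_cat_scheme"
    and F :: "('o, 'm, 'p, 'q) cat_functor" +
  assumes full: "full_functor C D F"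
    and dense: "dense_functor C D F"
    and projective_F: "projective C P \<Longrightarrow> projective D (FObj F P)"
    and ess_kernel_proj_inj: "ess_kernel C D F \<subseteq> proj_inj C"
    and zero_factors: "\<lbrakk>f \<in> Arr C; FArr F f = Zero D (FObj F (Dom C f)) (FObj F (Cod C f))\<rbrakk>
      \<Longrightarrow> f \<in> factors_through C (ess_kernel C D F)"

section \<open>From a Frobenius quotient to the lifting properties\<close>

lemma exact_functorD:
  assumes "exact_functor C D F"
  shows "is_functor C D F" "(i, p) \<in> Confl C \<Longrightarrow> (FArr F i, FArr F p) \<in> Confl D"
  using assms by (auto simp: exact_functor_def additive_functor_def)

text \<open>Everything is transported along the natural isomorphisms \<open>\<eta>\<close> and
  \<open>\<epsilon>\<close> of the equivalence. The given \<open>\<F>\<close> may be smaller than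
  the essential kernel, so the properties of the latter are derived by comparing the two.\<close>

theorem quotient_functor_of_frobenius_quotient:
  assumes quot: "frobenius_quotient C D F"
  shows "quotient_functor C D F"
proof -
  interpret C: frobenius_category C using quot by (simp add: frobenius_quotient_def)
  interpret D: frobenius_category D using quot by (simp add: frobenius_quotient_def)
  obtain \<F> F' where rem: "removable C \<F>" and eqv: "exact_equivalence (exact_factor_cat C \<F>) D F'"
    and FF': "functor_eq C F (functor_comp F' (proj_functor C \<F>))" and add: "additive_functor C D F"
    using quot unfolding frobenius_quotient_def by blast
  have "additive_subcategory C \<F>" using rem by (simp add: removable_def)
  then interpret K: factor_category C \<F> by unfold_locales
  interpret Q: category K.Q by (rule K.factor_is_category)
  obtain G where ex: "exact_functor K.Q D F'" "exact_functor D K.Q G"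
    and "naturally_isomorphic K.Q K.Q (functor_comp G F') functor_id"
    and "naturally_isomorphic D D (functor_comp F' G) functor_id"
    using eqv unfolding exact_equivalence_def by blast
  then obtain \<eta> \<epsilon> where \<eta>1: "\<forall>X \<in> Obj C. \<eta> X \<in> Hom K.Q (FObj G (FObj F' X)) X \<and> is_iso K.Q (\<eta> X)"
    and \<eta>2: "\<forall>f \<in> Arr K.Q. \<eta> (Cod K.Q f) \<cdot>\<^bsub>K.Q\<^esub> FArr G (FArr F' f) = f \<cdot>\<^bsub>K.Q\<^esub> \<eta> (Dom K.Q f)"
    and \<epsilon>1: "\<forall>X \<in> Obj D. \<epsilon> X \<in> Hom D (FObj F' (FObj G X)) X \<and> is_iso D (\<epsilon> X)"
    and \<epsilon>2: "\<forall>f \<in> Arr D. \<epsilon> (Cod D f) \<cdot>\<^bsub>D\<^esub> FArr F' (FArr G f) = f \<cdot>\<^bsub>D\<^esub> \<epsilon> (Dom D f)"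
    unfolding naturally_isomorphic_def functor_comp_def functor_id_def by auto
  note F' = is_functorD[OF exact_functorD(1)[OF ex(1)]]
    and G = is_functorD[OF exact_functorD(1)[OF ex(2)]]
  have \<eta>: "\<eta> X \<in> Arr K.Q" "Dom K.Q (\<eta> X) = FObj G (FObj F' X)" "Cod K.Q (\<eta> X) = X" "is_iso K.Q (\<eta> X)"
    if "X \<in> Obj C" for X using bspec[OF \<eta>1 that] unfolding Hom_iff by blast+
  have \<epsilon>: "\<epsilon> X \<in> Arr D" "Dom D (\<epsilon> X) = FObj F' (FObj G X)" "Cod D (\<epsilon> X) = X" "is_iso D (\<epsilon> X)"
    if "X \<in> Obj D" for X using bspec[OF \<epsilon>1 that] unfolding Hom_iff by blast+
  have FF: "FObj F X = FObj F' X" if "X \<in> Obj C" for X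
    using FF' that by (simp add: functor_eq_def functor_comp_def proj_functor_def)
  have Ff: "FArr F f = FArr F' (K.res f)" if "f \<in> Arr C" for f
    using FF' that by (simp add: functor_eq_def functor_comp_def proj_functor_def)
  have "exact_functor C D F"
    unfolding exact_functor_def
  proof (intro conjI add, clarify)
    fix i p assume "(i, p) \<in> Confl C"
    then show "(FArr F i, FArr F p) \<in> Confl D"
      using exact_functorD(2)[OF ex(1) K.res_confl] C.conflD by (simp add: Ff)
  qed
  then interpret F: exact_functor_between C D F by unfold_locales
  have G_obj: "FObj G Y \<in> Obj C" if "Y \<in> Obj D" for Y using G(1)[OF that] by simp
  have F'_obj: "FObj F' X \<in> Obj D" if "X \<in> Obj C" for X using F'(1)[of X] that by simp
  \<comment> \<open>Naturality expresses \<open>K.res f \<cdot> \<eta>\<close> through the image of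
    \<open>f\<close> alone, and the isomorphism \<open>\<eta>\<close> cancels. The same argument
    with \<open>\<epsilon>\<close> gives faithfulness of \<open>G\<close>.\<close>
  have faithful: "K.res f = K.res g" if "f \<in> Arr C" "g \<in> Arr C" "Dom C f = Dom C g" "Cod C f = Cod C g"
    "FArr F f = FArr F g" for f g
  proof -
    have "K.res f \<cdot>\<^bsub>K.Q\<^esub> \<eta> (Dom C f) = K.res g \<cdot>\<^bsub>K.Q\<^esub> \<eta> (Dom C f)"
      using bspec[OF \<eta>2, of "K.res f"] bspec[OF \<eta>2, of "K.res g"] that by (simp add: Ff)
    then show ?thesis
      by (rule Q.iso_epi[rotated]) (use \<eta>[of "Dom C f"] that in simp_all)
  qed
  have G_faithful: "h = h'" if h: "h \<in> Arr D" "h' \<in> Arr D" "Dom D h = Dom D h'" "Cod D h = Cod D h'"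
    "FArr G h = FArr G h'" for h h'
  proof -
    have "h \<cdot>\<^bsub>D\<^esub> \<epsilon> (Dom D h) = h' \<cdot>\<^bsub>D\<^esub> \<epsilon> (Dom D h)"
      using bspec[OF \<epsilon>2 h(1)] bspec[OF \<epsilon>2 h(2)] that by simp
    then show ?thesis
      by (rule D.iso_epi[rotated]) (use \<epsilon>[of "Dom D h"] that in simp_all)
  qed
  have full: "full_functor C D F"
    unfolding full_functor_def
  proof (intro ballI)
    fix X Y h assume X: "X \<in> Obj C" and Y: "Y \<in> Obj C" and "h \<in> Hom D (FObj F X) (FObj F Y)"
    then have h: "h \<in> Arr D" "Dom D h = FObj F' X" "Cod D h = FObj F' Y" by (auto simp: Hom_iff FF)
    obtain \<eta>' where \<eta>': "\<eta>' \<in> Arr K.Q" "Dom K.Q \<eta>' = X" "Cod K.Q \<eta>' = FObj G (FObj F' X)"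
      "\<eta>' \<cdot>\<^bsub>K.Q\<^esub> \<eta> X = Ident K.Q (FObj G (FObj F' X))"
      using Q.iso_inverse[OF \<eta>(4)[OF X]] \<eta>(2,3)[OF X] by metis
    note [simp del] = K.factor_simps(2)
    \<comment> \<open>The candidate is \<open>G h\<close> conjugated by \<open>\<eta>\<close>.
      Naturality shows that \<open>G\<close> takes the same value on its image and on
      \<open>h\<close>, and \<open>G\<close> is faithful.\<close>
    define c where "c = \<eta> Y \<cdot>\<^bsub>K.Q\<^esub> (FArr G h \<cdot>\<^bsub>K.Q\<^esub> \<eta>')"
    have c: "c \<in> Arr K.Q" "Dom K.Q c = X" "Cod K.Q c = Y"
      unfolding c_def using \<eta>' \<eta>(1-3)[OF X] \<eta>(1-3)[OF Y] h G by simp_all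
    have "\<eta> Y \<cdot>\<^bsub>K.Q\<^esub> FArr G (FArr F' c) = c \<cdot>\<^bsub>K.Q\<^esub> \<eta> X"
      using bspec[OF \<eta>2 c(1)] c by simp
    also have "\<dots> = \<eta> Y \<cdot>\<^bsub>K.Q\<^esub> FArr G h"
      unfolding c_def using \<eta>' \<eta>(1-3)[OF X] \<eta>(1-3)[OF Y] h G X Y
      by (simp del: K.factor_simps(3))
    finally have "FArr G (FArr F' c) = FArr G h"
      by (rule Q.iso_mono[OF \<eta>(4)[OF Y]]) (use \<eta>(1-3)[OF Y] h G c F' X Y in simp_all)
    then have F'c: "FArr F' c = h"
      by (rule G_faithful[rotated -1]) (use h c F' in simp_all)
    obtain f where f: "f \<in> Arr C" "c = K.res f" using c(1) unfolding K.factor_simps(2) by blast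
    then show "\<exists>f\<in>Hom C X Y. FArr F f = h"
      by (intro bexI[of _ f]) (use f c F'c in \<open>simp_all add: Hom_iff Ff\<close>)
  qed
  have dense: "dense_functor C D F"
    unfolding dense_functor_def
  proof (intro ballI)
    fix Y assume "Y \<in> Obj D"
    then show "\<exists>X\<in>Obj C. \<exists>f. is_iso D f \<and> Dom D f = FObj F X \<and> Cod D f = Y"
      using \<epsilon>[of Y] G_obj[of Y] by (intro bexI[of _ "FObj G Y"] exI[of _ "\<epsilon> Y"]) (simp_all add: FF)
  qed
  have ideal_F: "f \<in> K.\<I>" if "f \<in> Arr C" "FArr F f = Zero D (FObj F (Dom C f)) (FObj F (Cod C f))" for f
  proof -
    have "K.res f = K.res (Zero C (Dom C f) (Cod C f))" using that by (intro faithful) simp_all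
    then show ?thesis using K.res_eqD(3)[of f "Zero C (Dom C f) (Cod C f)"] that by simp
  qed
  have F_ker: "X \<in> ess_kernel C D F" if "X \<in> \<F>" for X
  proof -
    have X: "X \<in> Obj C" using that K.\<X>_obj by blast
    then have "Ident C X \<in> K.\<I>" using K.idealI[of "Ident C X" "Ident C X"] that by simp
    then have "K.res (Zero C X X) = K.res (Ident C X)" using X by (intro K.res_eqI) simp_all
    then show ?thesis using X Ff[of "Ident C X"] Ff[of "Zero C X X"] by (simp add: F.ess_kernel_iff)
  qed
  have factors: "f \<in> factors_through C (ess_kernel C D F)"
    if "f \<in> Arr C" "FArr F f = Zero D (FObj F (Dom C f)) (FObj F (Cod C f))" for f
    using ideal_F[OF that] F_ker unfolding factors_through_def by blast
  \<comment> \<open>The identity of a killed object lies in the ideal of \<open>\<F>\<close>, which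
    makes the object a retract of a member of \<open>\<F>\<close>, and retracts inherit projectivity
    and injectivity.\<close>
  have ker: "ess_kernel C D F \<subseteq> proj_inj C"
  proof
    fix X assume "X \<in> ess_kernel C D F"
    then have X: "X \<in> Obj C" "FArr F (Ident C X) = FArr F (Zero C X X)" by (auto simp: F.ess_kernel_iff)
    then have id: "Ident C X \<in> K.\<I>" by (intro ideal_F) simp_all
    obtain g h where gh: "g \<in> Arr C" "h \<in> Arr C" "Dom C g = X" "Cod C h = X" "Cod C g \<in> \<F>"
      "Dom C h = Cod C g" "Ident C X = h \<cdot>\<^bsub>C\<^esub> g" 
      using K.idealE[OF id] C.Ident_arr[OF X(1)] by metis
    have "Cod C g \<in> proj_inj C" using gh rem by (auto simp: removable_def)
    then show "X \<in> proj_inj C"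
      using C.projective_retract[of "Cod C g" h g] C.injective_retract[of
        "Cod C g" h g] gh by (simp add: proj_inj_def)
  qed
  \<comment> \<open>Under the exact functor \<open>G\<close>, a conflation of \<open>D\<close>
    becomes one of the factor category, hence isomorphic to the class of a conflation of
    \<open>C\<close> by definition of the exact structure. Applying \<open>F'\<close> and composing
    with \<open>\<epsilon>\<close> brings the isomorphism back to \<open>D\<close>.\<close>
  have lifts: "lifts_conflations C D F"
    unfolding lifts_conflations_def
  proof clarify
    fix i p assume ip: "(i, p) \<in> Confl D"
    note I = D.conflD(1-3)[OF ip]
    have "(FArr G i, FArr G p) \<in> Confl K.Q" by (rule exact_functorD(2)[OF ex(2) ip])
    then obtain i0 p0 a b c where L: "(i0, p0) \<in> Confl C" "is_iso K.Q a" "is_iso K.Q b" "is_iso K.Q c"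
      "a \<in> Hom K.Q (Dom K.Q (K.res i0)) (Dom K.Q (FArr G i))"
      "b \<in> Hom K.Q (Cod K.Q (K.res i0)) (Cod K.Q (FArr G i))"
      "c \<in> Hom K.Q (Cod K.Q (K.res p0)) (Cod K.Q (FArr G p))" "b \<cdot>\<^bsub>K.Q\<^esub> K.res i0 = FArr G i \<cdot>\<^bsub>K.Q\<^esub> a"
      "c \<cdot>\<^bsub>K.Q\<^esub> K.res p0 = FArr G p \<cdot>\<^bsub>K.Q\<^esub> b"
      unfolding K.factor_simps(5) unfolding iso_closure_def by blast
    note I0 = C.conflD(1-3)[OF L(1)]
    note [simp del] = K.factor_simps(2)
    have R: "K.res i0 \<in> Arr K.Q" "K.res p0 \<in> Arr K.Q" using I0 unfolding K.factor_simps(2) by blast+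
    have abc: "a \<in> Arr K.Q" "Dom K.Q a = Dom C i0" "Cod K.Q a = FObj G (Dom D i)"
      "b \<in> Arr K.Q" "Dom K.Q b = Cod C i0" "Cod K.Q b = FObj G (Cod D i)"
      "c \<in> Arr K.Q" "Dom K.Q c = Cod C p0" "Cod K.Q c = FObj G (Cod D p)"
      using L(5-7) I I0 G by (simp_all add: Hom_iff)
    \<comment> \<open>One commuting square in the factor category, from the class of
      \<open>f0\<close> to \<open>G f\<close>, yields one in \<open>D\<close> from the image of
      \<open>f0\<close> to \<open>f\<close>. It is used for both arrows of the conflation.\<close>
    have transfer: "\<epsilon> (Cod D f) \<cdot>\<^bsub>D\<^esub> FArr F' v \<cdot>\<^bsub>D\<^esub> FArr F f0 = f \<cdot>\<^bsub>D\<^esub> (\<epsilon> (Dom D f) \<cdot>\<^bsub>D\<^esub> FArr F' u)"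
      if "f \<in> Arr D" "f0 \<in> Arr C" "K.res f0 \<in> Arr K.Q" "u \<in> Arr K.Q" "Dom K.Q u = Dom C f0"
        "Cod K.Q u = FObj G (Dom D f)"
       "v \<in> Arr K.Q" "Dom K.Q v = Cod C f0" "Cod K.Q v = FObj G (Cod D f)"
       "v \<cdot>\<^bsub>K.Q\<^esub> K.res f0 = FArr G f \<cdot>\<^bsub>K.Q\<^esub> u"
      for f f0 u v
    proof -
      have "FArr F' v \<cdot>\<^bsub>D\<^esub> FArr F f0 = FArr F' (v \<cdot>\<^bsub>K.Q\<^esub> K.res f0)"
        using F'(6)[of "K.res f0" v] that by (simp add: Ff)
      also have "\<dots> = FArr F' (FArr G f) \<cdot>\<^bsub>D\<^esub> FArr F' u"
        unfolding that(10) using F'(6)[of u "FArr G f"] G that by simp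
      finally have 1: "FArr F' v \<cdot>\<^bsub>D\<^esub> FArr F f0 = FArr F' (FArr G f) \<cdot>\<^bsub>D\<^esub> FArr F' u" .
      have "\<epsilon> (Cod D f) \<cdot>\<^bsub>D\<^esub> FArr F' v \<cdot>\<^bsub>D\<^esub> FArr F f0 = \<epsilon> (Cod D f) \<cdot>\<^bsub>D\<^esub> (FArr F' v \<cdot>\<^bsub>D\<^esub> FArr F f0)"
        using \<epsilon>[of "Cod D f"] that F' by (simp add: FF)
      also have "\<dots> = (\<epsilon> (Cod D f) \<cdot>\<^bsub>D\<^esub> FArr F' (FArr G f)) \<cdot>\<^bsub>D\<^esub> FArr F' u"
        unfolding 1 using \<epsilon>[of "Cod D f"] that F' G by simp
      also have "\<dots> = f \<cdot>\<^bsub>D\<^esub> (\<epsilon> (Dom D f) \<cdot>\<^bsub>D\<^esub> FArr F' u)"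
        unfolding bspec[OF \<epsilon>2 that(1)] using \<epsilon>[of "Dom D f"] that F' by simp
      finally show ?thesis .
    qed
    have iso: "is_iso D (\<epsilon> X \<cdot>\<^bsub>D\<^esub> FArr F' u)" "Dom D (\<epsilon> X \<cdot>\<^bsub>D\<^esub> FArr F' u) = FObj F (Dom K.Q u)"
      "Cod D (\<epsilon> X \<cdot>\<^bsub>D\<^esub> FArr F' u) = X"
      if "u \<in> Arr K.Q" "is_iso K.Q u" "X \<in> Obj D" "Cod K.Q u = FObj G X" for u X
    proof -
      have "is_iso D (FArr F' u)"
        by (rule functor_is_iso[OF Q.category_axioms exact_functorD(1)[OF ex(1)]]) fact
      then show "is_iso D (\<epsilon> X \<cdot>\<^bsub>D\<^esub> FArr F' u)" using \<epsilon>[OF that(3)] that F' by (intro D.iso_comp)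
        simp_all
      show "Dom D (\<epsilon> X \<cdot>\<^bsub>D\<^esub> FArr F' u) = FObj F (Dom K.Q u)"
        using \<epsilon>[OF that(3)] that F' Q.Dom_in[of u] by (simp add: FF)
      show "Cod D (\<epsilon> X \<cdot>\<^bsub>D\<^esub> FArr F' u) = X"
        using \<epsilon>[OF that(3)] that F' by simp
    qed
    show "\<exists>(i', p')\<in>Confl C. \<exists>a b c. is_iso D a \<and> is_iso D b \<and> is_iso D c \<and>
      Dom D a = FObj F (Dom C i') \<and> Cod D a = Dom D i \<and> Dom D b = FObj F (Cod C i') \<and> Cod D b = Cod D i
        \<and>
      Dom D c = FObj F (Cod C p') \<and> Cod D c = Cod D p \<and>
      b \<cdot>\<^bsub>D\<^esub> FArr F i' = i \<cdot>\<^bsub>D\<^esub> a \<and> c \<cdot>\<^bsub>D\<^esub> FArr F p' = p \<cdot>\<^bsub>D\<^esub> b"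
      apply (rule bexI[OF _ L(1)], unfold case_prod_conv)
      apply (rule exI[of _ "\<epsilon> (Dom D i) \<cdot>\<^bsub>D\<^esub> FArr F' a"], rule exI[of _ "\<epsilon> (Cod D i) \<cdot>\<^bsub>D\<^esub> FArr F' b"],
          rule exI[of _ "\<epsilon> (Cod D p) \<cdot>\<^bsub>D\<^esub> FArr F' c"])
      using transfer[of i i0 a b] transfer[of p p0 b c] abc R I I0 iso[OF abc(1) L(2) _ abc(3)]
        iso[OF abc(4) L(3) _ abc(6)] iso[OF abc(7) L(4) _ abc(9)] L(8,9)
      by simp
  qed
  have "projective D (FObj F P)" if "projective C P" for P
    by (rule F.projective_image[OF full lifts that])
  then show ?thesis by unfold_locales (use full dense ker factors in auto)
qed

section \<open>From the lifting properties back to a Frobenius quotient\<close>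

context quotient_functor
begin

sublocale K: factor_category C "ess_kernel C D F"
  by unfold_locales (rule ess_kernel_additive)

declare K.factor_simps(2) [simp del]

lemma Arr_factor: "c \<in> Arr K.Q \<Longrightarrow> \<exists>f. f \<in> Arr C \<and> c = K.res f"
  by (auto simp: K.factor_simps(2))

lemma res_Arr [simp]: "f \<in> Arr C \<Longrightarrow> K.res f \<in> Arr K.Q"
  by (auto simp: K.factor_simps(2))

text \<open>The ideal of the essential kernel consists exactly of the arrows killed by
  \<open>F\<close>: one inclusion is \<open>zero_factors\<close>, the other
  \<open>F_factors_through_zero\<close>. Equations between residue classes can therefore be checked
  in \<open>D\<close>.\<close>

lemma res_eq_iff:
  assumes "f \<in> Arr C" "g \<in> Arr C" "Dom C f = Dom C g" "Cod C f = Cod C g"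
  shows "K.res f = K.res g \<longleftrightarrow> F\<^sub>a f = F\<^sub>a g"
proof
  assume "K.res f = K.res g"
  then have "f \<boxplus>\<^bsub>C\<^esub> neg C g \<in> K.\<I>" by (rule K.res_eqD(3)) fact+
  from F_factors_through_zero[OF this] show "F\<^sub>a f = F\<^sub>a g"
    using assms by (intro D.eq_if_diff_zero[of "F\<^sub>a f" "F\<^sub>a g"]) simp_all
next
  assume "F\<^sub>a f = F\<^sub>a g"
  then have "f \<boxplus>\<^bsub>C\<^esub> neg C g \<in> K.\<I>" using assms by (intro zero_factors) simp_all
  then show "K.res f = K.res g" using assms K.res_eqI[of g f] by simp
qed

text \<open>The value on a class is computed from its chosen representative; by
  \<open>res_eq_iff\<close> any other member gives the same arrow.\<close>

definition induced :: "('o, 'm set, 'p, 'q) cat_functor" where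
  "induced = \<lparr>FObj = FObj F, FArr = (\<lambda>c. FArr F (rep c))\<rparr>"

lemma induced_obj [simp]: "FObj induced = F\<^sub>o"
  by (simp add: induced_def)

lemma induced_res [simp]: "f \<in> Arr C \<Longrightarrow> FArr induced (K.res f) = F\<^sub>a f"
  using K.rep_res[of f] res_eq_iff[of "rep (K.res f)" f] by (simp add: induced_def)

lemma induced_functor: "is_functor K.Q D induced"
  unfolding is_functor_def
  by (auto simp: Hom_iff dest!: Arr_factor)

lemma induced_eq: "functor_eq C F (functor_comp induced (proj_functor C (ess_kernel C D F)))"
  by (simp add: functor_eq_def functor_comp_def proj_functor_def)

lemma induced_additive: "additive_functor K.Q D induced"
  unfolding additive_functor_def
  by (auto simp: induced_functor hom_def hom_group_def Hom_iff dest!: Arr_factor)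

text \<open>A conflation of the factor category is isomorphic to the class of a conflation of
  \<open>C\<close>; its image is then isomorphic to a conflation of \<open>D\<close>, and these are
  closed under isomorphism.\<close>

lemma induced_exact: "exact_functor K.Q D induced"
  unfolding exact_functor_def
proof (intro conjI induced_additive, clarify)
  fix i' p' assume "(i', p') \<in> Confl K.Q"
  then obtain i p a b c where L: "(i, p) \<in> Confl C" "is_iso K.Q a" "is_iso K.Q b" "is_iso K.Q c"
      "a \<in> Hom K.Q (Dom K.Q (K.res i)) (Dom K.Q i')" "b \<in> Hom K.Q (Cod K.Q (K.res i)) (Cod K.Q i')"
      "c \<in> Hom K.Q (Cod K.Q (K.res p)) (Cod K.Q p')" "b \<cdot>\<^bsub>K.Q\<^esub> K.res i = i' \<cdot>\<^bsub>K.Q\<^esub> a"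
      "c \<cdot>\<^bsub>K.Q\<^esub> K.res p = p' \<cdot>\<^bsub>K.Q\<^esub> b" "i' \<in> Arr K.Q" "p' \<in> Arr K.Q" "Cod K.Q i' = Dom K.Q p'"
    unfolding K.factor_simps(5) unfolding iso_closure_def by blast
  note I = C.conflD(1-3)[OF L(1)] and G = is_functorD[OF induced_functor]
  have iso: "is_iso D (FArr induced u)" if "is_iso K.Q u" for u
    by (rule functor_is_iso[OF K.factor_is_category induced_functor that])
  note [simp] = I G(2-4)[OF L(10)] G(2-4)[OF L(11)]
  have abc: "a \<in> Arr K.Q" "b \<in> Arr K.Q" "c \<in> Arr K.Q" "Dom K.Q a = Dom C i" "Cod K.Q a = Dom K.Q i'"
    "Dom K.Q b = Cod C i" "Cod K.Q b = Cod K.Q i'" "Dom K.Q c = Cod C p" "Cod K.Q c = Cod K.Q p'"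
    using L(5-7) by (simp_all add: Hom_iff)
  show "(FArr induced i', FArr induced p') \<in> Confl D"
  proof (rule D.confl_iso[OF F_confl[OF L(1)] iso[OF L(2)] iso[OF L(3)] iso[OF L(4)]])
    show "FArr induced b \<cdot>\<^bsub>D\<^esub> F\<^sub>a i = FArr induced i' \<cdot>\<^bsub>D\<^esub> FArr induced a"
      using G(6)[of "K.res i" b] G(6)[of a i'] L(8,10) abc by simp
    show "FArr induced c \<cdot>\<^bsub>D\<^esub> F\<^sub>a p = FArr induced p' \<cdot>\<^bsub>D\<^esub> FArr induced b"
      using G(6)[of "K.res p" c] G(6)[of b p'] L(9-12) abc by simp
  qed (use abc L(10-12) G in simp_all)
qed

text \<open>Universal properties are borrowed from \<open>D\<close>: the factorization exists there
  because the image is a conflation, fullness lifts it to \<open>C\<close>, and uniqueness follows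
  since classes with equal images coincide.\<close>

lemma res_kernel_cokernel:
  assumes ip: "(i, p) \<in> Confl C"
  shows "kernel_cokernel_pair K.Q (K.res i) (K.res p)"
proof -
  note [simp] = C.conflD(1-3)[OF ip]
  have pi: "p \<cdot>\<^bsub>C\<^esub> i = Zero C (Dom C i) (Cod C p)" using C.conflD(4)[OF ip] .
  note FC = F_confl[OF ip]
  have "is_kernel K.Q (K.res i) (K.res p)"
    unfolding is_kernel_def
  proof (intro conjI ballI impI)
    fix T c assume T: "T \<in> Obj K.Q" "c \<in> Hom K.Q T (Dom K.Q (K.res p))"
      "K.res p \<cdot>\<^bsub>K.Q\<^esub> c = Zero K.Q T (Cod K.Q (K.res p))"
    then obtain f where f: "f \<in> Arr C" "Dom C f = T" "Cod C f = Dom C p" "c = K.res f"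
      by (elim K.Hom_factorE) simp
    have "K.res (p \<cdot>\<^bsub>C\<^esub> f) = K.res (Zero C T (Cod C p))" using T f by simp
    then have Fpf: "F\<^sub>a p \<cdot>\<^bsub>D\<^esub> F\<^sub>a f = Zero D (F\<^sub>o T) (F\<^sub>o (Cod C p))"
      using f T by (subst (asm) res_eq_iff) simp_all
    obtain h where h: "h \<in> Arr D" "Dom D h = F\<^sub>o T" "Cod D h = F\<^sub>o (Dom C i)" "F\<^sub>a i \<cdot>\<^bsub>D\<^esub> h = F\<^sub>a f"
      by (rule D.confl_lift[OF FC, of "F\<^sub>a f"]) (use f Fpf in simp_all)
    obtain g where g: "g \<in> Arr C" "Dom C g = T" "Cod C g = Dom C i" "F\<^sub>a g = h"
      by (rule full_functorE[OF full, of T "Dom C i" h]) (use T h in simp_all)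
    show "\<exists>!g. g \<in> Hom K.Q T (Dom K.Q (K.res i)) \<and> K.res i \<cdot>\<^bsub>K.Q\<^esub> g = c"
    proof (rule ex1I)
      show "K.res g \<in> Hom K.Q T (Dom K.Q (K.res i)) \<and> K.res i \<cdot>\<^bsub>K.Q\<^esub> K.res g = c"
        using g f h by (simp add: Hom_iff res_eq_iff)
      fix d assume d: "d \<in> Hom K.Q T (Dom K.Q (K.res i)) \<and> K.res i \<cdot>\<^bsub>K.Q\<^esub> d = c"
      then obtain g' where g': "g' \<in> Arr C" "Dom C g' = T" "Cod C g' = Dom C i" "d = K.res g'"
        using K.Hom_factorE[of d T "Dom C i" thesis] by simp
      then have "K.res (i \<cdot>\<^bsub>C\<^esub> g') = K.res f" using d f by simp
      then have "F\<^sub>a i \<cdot>\<^bsub>D\<^esub> F\<^sub>a g' = F\<^sub>a i \<cdot>\<^bsub>D\<^esub> F\<^sub>a g"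
        using g g' f h by (subst (asm) res_eq_iff) simp_all
      then have "F\<^sub>a g' = F\<^sub>a g" by (rule D.confl_mono[OF FC]) (use g g' h in simp_all)
      then show "d = K.res g" using g g' by (simp add: res_eq_iff)
    qed
  qed (simp_all add: pi)
  moreover have "is_cokernel K.Q (K.res p) (K.res i)"
    unfolding is_cokernel_def
  proof (intro conjI ballI impI)
    fix T c assume T: "T \<in> Obj K.Q" "c \<in> Hom K.Q (Cod K.Q (K.res i)) T"
      "c \<cdot>\<^bsub>K.Q\<^esub> K.res i = Zero K.Q (Dom K.Q (K.res i)) T"
    then obtain f where f: "f \<in> Arr C" "Dom C f = Dom C p" "Cod C f = T" "c = K.res f"
      by (elim K.Hom_factorE) simp
    have "K.res (f \<cdot>\<^bsub>C\<^esub> i) = K.res (Zero C (Dom C i) T)" using T f by simp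
    then have Ffi: "F\<^sub>a f \<cdot>\<^bsub>D\<^esub> F\<^sub>a i = Zero D (F\<^sub>o (Dom C i)) (F\<^sub>o T)"
      using f T by (subst (asm) res_eq_iff) simp_all
    obtain h where h: "h \<in> Arr D" "Cod D h = F\<^sub>o T" "Dom D h = F\<^sub>o (Cod C p)" "h \<cdot>\<^bsub>D\<^esub> F\<^sub>a p = F\<^sub>a f"
      by (rule D.confl_descend[OF FC, of "F\<^sub>a f"]) (use f Ffi in simp_all)
    obtain g where g: "g \<in> Arr C" "Dom C g = Cod C p" "Cod C g = T" "F\<^sub>a g = h"
      by (rule full_functorE[OF full, of "Cod C p" T h]) (use T h in simp_all)
    show "\<exists>!g. g \<in> Hom K.Q (Cod K.Q (K.res p)) T \<and> g \<cdot>\<^bsub>K.Q\<^esub> K.res p = c"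
    proof (rule ex1I)
      show "K.res g \<in> Hom K.Q (Cod K.Q (K.res p)) T \<and> K.res g \<cdot>\<^bsub>K.Q\<^esub> K.res p = c"
        using g f h by (simp add: Hom_iff res_eq_iff)
      fix d assume d: "d \<in> Hom K.Q (Cod K.Q (K.res p)) T \<and> d \<cdot>\<^bsub>K.Q\<^esub> K.res p = c"
      then obtain g' where g': "g' \<in> Arr C" "Dom C g' = Cod C p" "Cod C g' = T" "d = K.res g'"
        using K.Hom_factorE[of d "Cod C p" T thesis] by simp
      then have "K.res (g' \<cdot>\<^bsub>C\<^esub> p) = K.res f" using d f by simp
      then have "F\<^sub>a g' \<cdot>\<^bsub>D\<^esub> F\<^sub>a p = F\<^sub>a g \<cdot>\<^bsub>D\<^esub> F\<^sub>a p"
        using g g' f h by (subst (asm) res_eq_iff) simp_all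
      then have "F\<^sub>a g' = F\<^sub>a g" by (rule D.confl_epi[OF FC]) (use g g' h in simp_all)
      then show "d = K.res g" using g g' by (simp add: res_eq_iff)
    qed
  qed (simp_all add: pi)
  ultimately show ?thesis by (simp add: kernel_cokernel_pair_def)
qed

lemma ess_kernel_removable: "removable C (ess_kernel C D F)"
  unfolding removable_def K.factor_cat_kernel_cokernel
  using ess_kernel_additive ess_kernel_proj_inj res_kernel_cokernel by (auto simp: proj_functor_def)

lemma res_iso:
  assumes f: "f \<in> Arr C" and iso: "is_iso D (F\<^sub>a f)"
  shows "is_iso K.Q (K.res f)"
proof -
  obtain h where h: "h \<in> Arr D" "Dom D h = F\<^sub>o (Cod C f)" "Cod D h = F\<^sub>o (Dom C f)"
    "h \<cdot>\<^bsub>D\<^esub> F\<^sub>a f = Ident D (F\<^sub>o (Dom C f))" "F\<^sub>a f \<cdot>\<^bsub>D\<^esub> h = Ident D (F\<^sub>o (Cod C f))"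
    using D.iso_inverse[OF iso] F_simps(3,4)[OF f] by metis
  obtain g where g: "g \<in> Arr C" "Dom C g = Cod C f" "Cod C g = Dom C f" "F\<^sub>a g = h"
    by (rule full_functorE[OF full, of "Cod C f" "Dom C f" h]) (use f h in simp_all)
  show ?thesis
    by (rule is_isoI[where g = "K.res g"]) (use f g h in \<open>simp_all add: res_eq_iff\<close>)
qed

text \<open>The quasi-inverse picks for each \<open>Y\<close> an object \<open>H Y\<close> of
  \<open>C\<close> with an isomorphism \<open>\<epsilon> Y\<close> from its image to
  \<open>Y\<close>, and lifts each arrow of \<open>D\<close> conjugated by these
  isomorphisms.\<close>

lemma induced_equivalence: "exact_equivalence K.Q D induced"
proof -
  have lifts: "lifts_conflations C D F"
    by (rule lifts_conflationsI[OF full dense projective_F]) (auto intro: C.frobenius_category_axioms)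
  have "\<forall>Y \<in> Obj D. \<exists>X. X \<in> Obj C \<and> (\<exists>e. is_iso D e \<and> Dom D e = F\<^sub>o X \<and> Cod D e = Y)"
    using dense unfolding dense_functor_def by blast
  then obtain H where H: "\<forall>Y \<in> Obj D. H Y \<in> Obj C \<and> (\<exists>e. is_iso D e \<and> Dom D e = F\<^sub>o (H Y) \<and>
    Cod D e = Y)"
    by (rule bchoice[THEN exE])
  then have "\<forall>Y \<in> Obj D. \<exists>e. is_iso D e \<and> Dom D e = F\<^sub>o (H Y) \<and> Cod D e = Y" by blast
  then obtain \<epsilon> where e: "\<forall>Y \<in> Obj D. is_iso D (\<epsilon> Y) \<and> Dom D (\<epsilon> Y) = F\<^sub>o (H Y) \<and> Cod D (\<epsilon> Y) = Y"
    by (rule bchoice[THEN exE])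
  have "\<forall>Y \<in> Obj D. \<exists>e. is_iso D e \<and> Dom D e = Y \<and> Cod D e = F\<^sub>o (H Y) \<and>
    e \<cdot>\<^bsub>D\<^esub> \<epsilon> Y = Ident D (F\<^sub>o (H Y)) \<and>
    \<epsilon> Y \<cdot>\<^bsub>D\<^esub> e = Ident D Y"
    using e D.iso_inverse by metis
  then obtain \<delta> where d: "\<forall>Y \<in> Obj D. is_iso D (\<delta> Y) \<and> Dom D (\<delta> Y) = Y \<and> Cod D (\<delta> Y) = F\<^sub>o (H Y) \<and>
    \<delta> Y \<cdot>\<^bsub>D\<^esub> \<epsilon> Y = Ident D (F\<^sub>o (H Y)) \<and> \<epsilon> Y \<cdot>\<^bsub>D\<^esub> \<delta> Y = Ident D Y"
    by (rule bchoice[THEN exE])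
  have H_obj [simp]: "H Y \<in> Obj C" if "Y \<in> Obj D" for Y using H that by blast
  have e_simps [simp]: "\<epsilon> Y \<in> Arr D" "\<delta> Y \<in> Arr D" "Dom D (\<epsilon> Y) = F\<^sub>o (H Y)" "Cod D (\<epsilon> Y) = Y"
    "Dom D (\<delta> Y) = Y"
     "Cod D (\<delta> Y) = F\<^sub>o (H Y)" "\<delta> Y \<cdot>\<^bsub>D\<^esub> \<epsilon> Y = Ident D (F\<^sub>o (H Y))" "\<epsilon> Y \<cdot>\<^bsub>D\<^esub> \<delta> Y = Ident D Y"
     "is_iso D (\<delta> Y)" "is_iso D (\<epsilon> Y)"
    if "Y \<in> Obj D" for Y using bspec[OF e that] bspec[OF d that] is_isoD(1)[of D "\<epsilon> Y"] is_isoD(1)[of D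
      "\<delta> Y"] by auto
  have [simp]: "\<epsilon> Y \<cdot>\<^bsub>D\<^esub> (\<delta> Y \<cdot>\<^bsub>D\<^esub> f) = f" if "f \<in> Arr D" "Cod D f = Y" for f Y
    using D.comp_eq_comp[OF e_simps(8)[of Y], of f] that D.Cod_in[of f] by simp
  have [simp]: "\<delta> Y \<cdot>\<^bsub>D\<^esub> (\<epsilon> Y \<cdot>\<^bsub>D\<^esub> f) = f" if "f \<in> Arr D" "Cod D f = F\<^sub>o (H Y)" "Y \<in> Obj D" for f Y
    using D.comp_eq_comp[OF e_simps(7)[of Y], of f] that by simp
  have "\<forall>h \<in> Arr D. \<exists>f. f \<in> Arr C \<and> Dom C f = H (Dom D h) \<and> Cod C f = H (Cod D h) \<and>
    F\<^sub>a f = \<delta> (Cod D h) \<cdot>\<^bsub>D\<^esub> (h \<cdot>\<^bsub>D\<^esub> \<epsilon> (Dom D h))"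
  proof
    fix h assume h: "h \<in> Arr D"
    show "\<exists>f. f \<in> Arr C \<and> Dom C f = H (Dom D h) \<and> Cod C f = H (Cod D h) \<and>
      F\<^sub>a f = \<delta> (Cod D h) \<cdot>\<^bsub>D\<^esub> (h \<cdot>\<^bsub>D\<^esub> \<epsilon> (Dom D h))"
      by (rule full_functorE[OF full, of "H (Dom D h)" "H (Cod D h)"
        "\<delta> (Cod D h) \<cdot>\<^bsub>D\<^esub> (h \<cdot>\<^bsub>D\<^esub> \<epsilon> (Dom D h))"])
        (use h in auto)
  qed
  then obtain g where g: "\<forall>h \<in> Arr D. g h \<in> Arr C \<and> Dom C (g h) = H (Dom D h) \<and>
    Cod C (g h) = H (Cod D h) \<and>
    F\<^sub>a (g h) = \<delta> (Cod D h) \<cdot>\<^bsub>D\<^esub> (h \<cdot>\<^bsub>D\<^esub> \<epsilon> (Dom D h))" by (rule bchoice[THEN exE])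
  have g_simps [simp]: "g h \<in> Arr C" "Dom C (g h) = H (Dom D h)" "Cod C (g h) = H (Cod D h)"
    "F\<^sub>a (g h) = \<delta> (Cod D h) \<cdot>\<^bsub>D\<^esub> (h \<cdot>\<^bsub>D\<^esub> \<epsilon> (Dom D h))" if "h \<in> Arr D" for h using g that by blast+
  \<comment> \<open>The chosen lifts \<open>g h\<close> respect identities, composition and sums
    only up to arrows killed by \<open>F\<close>; passing to residue classes makes the assignment an
    additive functor.\<close>
  define G where "G = \<lparr>FObj = H, FArr = (\<lambda>h. K.res (g h))\<rparr>"
  have [simp]: "FObj G = H" "FArr G h = K.res (g h)" for h by (simp_all add: G_def)
  have G: "is_functor D K.Q G"
    unfolding is_functor_def by (auto simp: Hom_iff res_eq_iff)
  have add: "additive_functor D K.Q G"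
    unfolding additive_functor_def by (auto simp: G hom_def hom_group_def Hom_iff res_eq_iff)
  have exG: "exact_functor D K.Q G"
    unfolding exact_functor_def
  proof (intro conjI add, clarify)
    fix i p assume ip: "(i, p) \<in> Confl D"
    note [simp] = D.conflD(1-3)[OF ip]
    obtain i' p' a b c where L: "(i', p') \<in> Confl C"
       "is_iso D a" "is_iso D b" "is_iso D c" "Dom D a = FObj F (Dom C i')" "Cod D a = Dom D i"
       "Dom D b = FObj F (Cod C i')" "Cod D b = Cod D i" "Dom D c = FObj F (Cod C p')"
       "Cod D c = Cod D p"
       "b \<cdot>\<^bsub>D\<^esub> FArr F i' = i \<cdot>\<^bsub>D\<^esub> a" "c \<cdot>\<^bsub>D\<^esub> FArr F p' = p \<cdot>\<^bsub>D\<^esub> b"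
      by (rule lifts_conflationsE[OF lifts ip])
    note I' [simp] = C.conflD(1-3)[OF L(1)]
    \<comment> \<open>Each of the three comparison isomorphisms lifts to an arrow of
      \<open>C\<close> ending at a chosen object. The arrow need not be invertible in
      \<open>C\<close>, but its class is, because its image is.\<close>
    have lift: "\<exists>f. f \<in> Arr C \<and> Dom C f = X \<and> Cod C f = H (Cod D h) \<and> F\<^sub>a f = \<delta> (Cod D h) \<cdot>\<^bsub>D\<^esub> h \<and>
      is_iso K.Q (K.res f)"
      if hX: "is_iso D h" "Dom D h = F\<^sub>o X" "X \<in> Obj C" for h X
    proof -
      have h: "h \<in> Arr D" using is_isoD(1)[OF hX(1)] .
      obtain f where f: "f \<in> Arr C" "Dom C f = X" "Cod C f = H (Cod D h)" "F\<^sub>a f = \<delta> (Cod D h) \<cdot>\<^bsub>D\<^esub> h"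
        by (rule full_functorE[OF full, of X "H (Cod D h)" "\<delta> (Cod D h) \<cdot>\<^bsub>D\<^esub> h"]) (use hX h in auto)
      have "is_iso D (\<delta> (Cod D h) \<cdot>\<^bsub>D\<^esub> h)" using that h by (intro D.iso_comp) simp_all
      then show ?thesis using f res_iso[of f] by auto
    qed
    obtain a' where a': "a' \<in> Arr C" "Dom C a' = Dom C i'" "Cod C a' = H (Dom D i)"
      "F\<^sub>a a' = \<delta> (Dom D i) \<cdot>\<^bsub>D\<^esub> a" "is_iso K.Q (K.res a')"
      using lift[OF L(2,5)] L(6) by auto
    obtain b' where b': "b' \<in> Arr C" "Dom C b' = Cod C i'" "Cod C b' = H (Cod D i)"
      "F\<^sub>a b' = \<delta> (Cod D i) \<cdot>\<^bsub>D\<^esub> b" "is_iso K.Q (K.res b')"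
      using lift[OF L(3,7)] L(8) by auto
    obtain c' where c': "c' \<in> Arr C" "Dom C c' = Cod C p'" "Cod C c' = H (Cod D p)"
      "F\<^sub>a c' = \<delta> (Cod D p) \<cdot>\<^bsub>D\<^esub> c" "is_iso K.Q (K.res c')"
      using lift[OF L(4,9)] L(10) by auto
    have [simp]: "a \<in> Arr D" "b \<in> Arr D" "c \<in> Arr D"
      using is_isoD(1)[OF L(2)] is_isoD(1)[OF L(3)] is_isoD(1)[OF L(4)] by auto
    have mem: "(K.res i', K.res p') \<in> {(K.res i, K.res p) | i p. (i, p) \<in> Confl C}" using L(1) by blast
    have "K.res b' \<cdot>\<^bsub>K.Q\<^esub> K.res i' = K.res (g i) \<cdot>\<^bsub>K.Q\<^esub> K.res a'"
    proof -
      have "F\<^sub>a (b' \<cdot>\<^bsub>C\<^esub> i') = \<delta> (Cod D i) \<cdot>\<^bsub>D\<^esub> (i \<cdot>\<^bsub>D\<^esub> a)"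
        using L(7,8) by (simp add: b'(1-4) L(11))
      moreover have "F\<^sub>a (g i \<cdot>\<^bsub>C\<^esub> a') = \<delta> (Cod D i) \<cdot>\<^bsub>D\<^esub> (i \<cdot>\<^bsub>D\<^esub> a)"
        using L(6) by (simp add: a'(1-4))
      ultimately show ?thesis by (simp add: res_eq_iff a'(1-3) b'(1-3) del: F_simps(6) g_simps(4))
    qed
    moreover have "K.res c' \<cdot>\<^bsub>K.Q\<^esub> K.res p' = K.res (g p) \<cdot>\<^bsub>K.Q\<^esub> K.res b'"
    proof -
      have "F\<^sub>a (c' \<cdot>\<^bsub>C\<^esub> p') = \<delta> (Cod D p) \<cdot>\<^bsub>D\<^esub> (p \<cdot>\<^bsub>D\<^esub> b)"
        using L(9,10) by (simp add: c'(1-4) L(12))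
      moreover have "F\<^sub>a (g p \<cdot>\<^bsub>C\<^esub> b') = \<delta> (Cod D p) \<cdot>\<^bsub>D\<^esub> (p \<cdot>\<^bsub>D\<^esub> b)"
        using L(8) by (simp add: b'(1-4))
      ultimately show ?thesis by (simp add: res_eq_iff c'(1-3) b'(1-3) del: F_simps(6) g_simps(4))
    qed
    ultimately have
      "(K.res (g i), K.res (g p)) \<in> iso_closure K.Q {(K.res i, K.res p) | i p. (i, p) \<in> Confl C}"
      by (intro iso_closureI[OF mem a'(5) b'(5) c'(5)]) (simp_all add: a'(1-3) b'(1-3) c'(1-3))
    then show "(FArr G i, FArr G p) \<in> Confl K.Q" by simp
  qed
  \<comment> \<open>The second natural isomorphism is the lift of \<open>\<epsilon>\<close> at the
    image of \<open>X\<close>; its naturality is checked in \<open>D\<close>.\<close>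
  have "\<forall>X \<in> Obj C. \<exists>f. f \<in> Arr C \<and> Dom C f = H (F\<^sub>o X) \<and> Cod C f = X \<and> F\<^sub>a f = \<epsilon> (F\<^sub>o X)"
  proof
    fix X assume "X \<in> Obj C"
    then show "\<exists>f. f \<in> Arr C \<and> Dom C f = H (F\<^sub>o X) \<and> Cod C f = X \<and> F\<^sub>a f = \<epsilon> (F\<^sub>o X)"
      by - (rule full_functorE[OF full, of "H (F\<^sub>o X)" X "\<epsilon> (F\<^sub>o X)"], auto)
  qed
  then obtain \<eta> where \<eta>: "\<forall>X \<in> Obj C. \<eta> X \<in> Arr C \<and> Dom C (\<eta> X) = H (F\<^sub>o X) \<and> Cod C (\<eta> X) = X \<and>
    F\<^sub>a (\<eta> X) = \<epsilon> (F\<^sub>o X)"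
    by (rule bchoice[THEN exE])
  have \<eta>_simps [simp]: "\<eta> X \<in> Arr C" "Dom C (\<eta> X) = H (F\<^sub>o X)" "Cod C (\<eta> X) = X" "F\<^sub>a (\<eta> X) = \<epsilon> (F\<^sub>o X)"
    if "X \<in> Obj C" for X using \<eta> that by blast+
  have "naturally_isomorphic K.Q K.Q (functor_comp G induced) functor_id"
    unfolding naturally_isomorphic_def functor_comp_def functor_id_def
  proof (intro exI[of _ "\<lambda>X. K.res (\<eta> X)"] conjI ballI)
    fix X assume "X \<in> Obj K.Q"
    then show "is_iso K.Q (K.res (\<eta> X))" by (intro res_iso) simp_all
  next
    fix c assume "c \<in> Arr K.Q"
    then obtain f where f: "f \<in> Arr C" "c = K.res f" using Arr_factor by blast
    have "K.res (\<eta> (Cod C f) \<cdot>\<^bsub>C\<^esub> g (F\<^sub>a f)) = K.res (f \<cdot>\<^bsub>C\<^esub> \<eta> (Dom C f))"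
      by (subst res_eq_iff) (use f(1) in simp_all)
    then show "K.res (\<eta> (Cod K.Q c)) \<cdot>\<^bsub>K.Q\<^esub> FArr \<lparr>FObj = FObj G \<circ> FObj induced, FArr =
      FArr G \<circ> FArr induced\<rparr> c
      = FArr \<lparr>FObj = \<lambda>X. X, FArr = \<lambda>f. f\<rparr> c \<cdot>\<^bsub>K.Q\<^esub> K.res (\<eta> (Dom K.Q c))"
      using f by simp
  qed (auto simp: Hom_iff)
  moreover have "naturally_isomorphic D D (functor_comp induced G) functor_id"
    unfolding naturally_isomorphic_def functor_comp_def functor_id_def
    by (rule exI[of _ \<epsilon>]) (auto simp: Hom_iff)
  ultimately show ?thesis using induced_exact exG unfolding exact_equivalence_def by blast
qed

theorem is_frobenius_quotient: "frobenius_quotient C D F"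
  unfolding frobenius_quotient_def
  using ess_kernel_removable induced_equivalence induced_eq exact
    C.frobenius_category_axioms D.frobenius_category_axioms
  by (auto simp: exact_functor_def)

end

section \<open>The exact category of inflation sequences\<close>

definition cmp :: "('o, 'm) inf_arr \<Rightarrow> nat \<Rightarrow> 'm" where
  "cmp \<phi> s = fst (snd \<phi>) s"

text \<open>Restriction to the index sets yields the extensional families that the definition of
  inflation sequences prescribes, so families may be given by formulas with arbitrary values
  outside. The same holds for \<open>mk_arr\<close>.\<close>

definition mk_obj :: "nat \<Rightarrow> (nat \<Rightarrow> 'o) \<Rightarrow> (nat \<Rightarrow> 'm) \<Rightarrow> ('o, 'm) inf_obj" where
  "mk_obj n X \<iota> = (restrict X {1..n}, restrict \<iota> {1..<n})"

definition mk_arr :: "nat \<Rightarrow> ('o, 'm) inf_obj \<Rightarrow> (nat \<Rightarrow> 'm) \<Rightarrow> ('o, 'm) inf_obj \<Rightarrow> ('o, 'm) inf_arr" where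
  "mk_arr n X f Y = (X, restrict f {1..n}, Y)"

lemma mk_obj_simps [simp]:
  "1 \<le> s \<Longrightarrow> s \<le> n \<Longrightarrow> fst (mk_obj n X \<iota>) s = X s"
  "1 \<le> s \<Longrightarrow> s < n \<Longrightarrow> snd (mk_obj n X \<iota>) s = \<iota> s"
  by (simp_all add: mk_obj_def)

text \<open>Componentwise data are picked simultaneously for all indices; the guard inside the
  choice leaves the values out of range arbitrary. \<open>choice_step\<close> is the analogue for
  structure maps, whose last index is \<open>n - 1\<close>.\<close>

lemma choice_range:
  assumes "\<And>s::nat. 1 \<le> s \<Longrightarrow> s \<le> n \<Longrightarrow> \<exists>a. P s a"
  obtains a where "\<forall>s. 1 \<le> s \<and> s \<le> n \<longrightarrow> P s (a s)"
proof -
  have "\<forall>s. \<exists>a. 1 \<le> s \<and> s \<le> n \<longrightarrow> P s a" using assms by blast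
  from choice[OF this] show thesis using that by blast
qed

lemma choice_range3:
  assumes "\<And>s::nat. 1 \<le> s \<Longrightarrow> s \<le> n \<Longrightarrow> \<exists>a b c. P s a b c"
  obtains a b c where "\<forall>s. 1 \<le> s \<and> s \<le> n \<longrightarrow> P s (a s) (b s) (c s)"
proof -
  have "\<exists>x. P s (fst x) (fst (snd x)) (snd (snd x))" if "1 \<le> s" "s \<le> n" for s
    using assms[OF that] by auto
  then obtain x where "\<forall>s. 1 \<le> s \<and> s \<le> n \<longrightarrow> P s (fst (x s)) (fst (snd (x s))) (snd (snd (x s)))"
    by (rule choice_range)
  then show thesis by (rule that)
qed

lemma choice_step:
  assumes "\<And>s::nat. 1 \<le> s \<Longrightarrow> s < n \<Longrightarrow> \<exists>a. P s a"
  obtains a where "\<forall>s. 1 \<le> s \<and> s < n \<longrightarrow> P s (a s)"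
proof -
  have "\<forall>s. \<exists>a. 1 \<le> s \<and> s < n \<longrightarrow> P s a" using assms by blast
  from choice[OF this] show thesis using that by blast
qed

section \<open>The additive category of inflation sequences\<close>

locale inflation_category = exact_category C
  for C :: "('o, 'm, 'x) exact_cat_scheme" (structure) +
  fixes n :: nat
begin

abbreviation "I \<equiv> Inf_cat n C"

lemma Inf_simps [simp]:
  "Obj I = inf_Obj n C" "Arr I = inf_Arr n C"
  "Ident I X = mk_arr n X (\<lambda>s. Ident C (fst X s)) X"
  "Zero I X Y = mk_arr n X (\<lambda>s. Zero C (fst X s) (fst Y s)) Y"
  by (simp_all add: Inf_cat_def mk_arr_def)

lemma Inf_Dom_Cod [simp]: "Dom I (mk_arr n X f Y) = X" "Cod I (mk_arr n X f Y) = Y"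
  "1 \<le> s \<Longrightarrow> s \<le> n \<Longrightarrow> cmp (mk_arr n X f Y) s = f s"
  by (simp_all add: Inf_cat_def mk_arr_def cmp_def)

lemma Inf_comp: "\<psi> \<cdot>\<^bsub>I\<^esub> \<phi> = mk_arr n (Dom I \<phi>) (\<lambda>s. cmp \<psi> s \<cdot> cmp \<phi> s) (Cod I \<psi>)"
  by (cases \<phi>; cases \<psi>) (simp add: Inf_cat_def mk_arr_def cmp_def)

lemma Inf_plus: "\<psi> \<boxplus>\<^bsub>I\<^esub> \<phi> = mk_arr n (Dom I \<psi>) (\<lambda>s. cmp \<psi> s \<boxplus> cmp \<phi> s) (Cod I \<psi>)"
  by (cases \<phi>; cases \<psi>) (simp add: Inf_cat_def mk_arr_def cmp_def)

lemma Inf_comp_simps [simp]: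
  "Dom I (\<psi> \<cdot>\<^bsub>I\<^esub> \<phi>) = Dom I \<phi>" "Cod I (\<psi> \<cdot>\<^bsub>I\<^esub> \<phi>) = Cod I \<psi>"
  "1 \<le> s \<Longrightarrow> s \<le> n \<Longrightarrow> cmp (\<psi> \<cdot>\<^bsub>I\<^esub> \<phi>) s = cmp \<psi> s \<cdot> cmp \<phi> s"
  "Dom I (\<psi> \<boxplus>\<^bsub>I\<^esub> \<phi>) = Dom I \<psi>" "Cod I (\<psi> \<boxplus>\<^bsub>I\<^esub> \<phi>) = Cod I \<psi>"
  "1 \<le> s \<Longrightarrow> s \<le> n \<Longrightarrow> cmp (\<psi> \<boxplus>\<^bsub>I\<^esub> \<phi>) s = cmp \<psi> s \<boxplus> cmp \<phi> s"
  by (simp_all add: Inf_comp Inf_plus)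

lemma inf_objD [simp]:
  assumes "X \<in> inf_Obj n C"
  shows "1 \<le> s \<Longrightarrow> s \<le> n \<Longrightarrow> fst X s \<in> Obj C"
    "1 \<le> s \<Longrightarrow> s < n \<Longrightarrow> snd X s \<in> Arr C"
    "1 \<le> s \<Longrightarrow> s < n \<Longrightarrow> Dom C (snd X s) = fst X s"
    "1 \<le> s \<Longrightarrow> s < n \<Longrightarrow> Cod C (snd X s) = fst X (Suc s)"
  using assms by (auto simp: inf_Obj_def PiE_iff Hom_iff)

lemma inf_obj_inflation: "X \<in> inf_Obj n C \<Longrightarrow> 1 \<le> s \<Longrightarrow> s < n \<Longrightarrow> inflation C (snd X s)"
  by (auto simp: inf_Obj_def PiE_iff)

lemma mk_obj_in:
  assumes "\<And>s. 1 \<le> s \<Longrightarrow> s \<le> n \<Longrightarrow> X s \<in> Obj C"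
    "\<And>s. 1 \<le> s \<Longrightarrow> s < n \<Longrightarrow> inflation C (\<iota> s)"
    "\<And>s. 1 \<le> s \<Longrightarrow> s < n \<Longrightarrow> Dom C (\<iota> s) = X s"
    "\<And>s. 1 \<le> s \<Longrightarrow> s < n \<Longrightarrow> Cod C (\<iota> s) = X (Suc s)"
  shows "mk_obj n X \<iota> \<in> inf_Obj n C"
  using assms inflationD by (auto simp: inf_Obj_def mk_obj_def Hom_iff)

lemma inf_arrD [simp]:
  assumes "\<phi> \<in> inf_Arr n C"
  shows "Dom I \<phi> \<in> inf_Obj n C" "Cod I \<phi> \<in> inf_Obj n C"
    "1 \<le> s \<Longrightarrow> s \<le> n \<Longrightarrow> cmp \<phi> s \<in> Arr C"
    "1 \<le> s \<Longrightarrow> s \<le> n \<Longrightarrow> Dom C (cmp \<phi> s) = fst (Dom I \<phi>) s"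
    "1 \<le> s \<Longrightarrow> s \<le> n \<Longrightarrow> Cod C (cmp \<phi> s) = fst (Cod I \<phi>) s"
  using assms by (auto simp: inf_Arr_def PiE_iff Hom_iff cmp_def Inf_cat_def)

lemma inf_nat:
  assumes "\<phi> \<in> inf_Arr n C" "Y = Cod I \<phi>" "1 \<le> s" "s < n"
  shows "snd Y s \<cdot> cmp \<phi> s = cmp \<phi> (Suc s) \<cdot> snd (Dom I \<phi>) s"
  using assms by (auto simp: inf_Arr_def PiE_iff Hom_iff cmp_def Inf_cat_def)

lemma inf_nat' [simp]:
  assumes "\<phi> \<in> inf_Arr n C" "Y = Cod I \<phi>" "1 \<le> s" "s < n" "x \<in> Arr C" "Cod C x = fst (Dom I \<phi>) s"
  shows "snd Y s \<cdot> (cmp \<phi> s \<cdot> x) = cmp \<phi> (Suc s) \<cdot> (snd (Dom I \<phi>) s \<cdot> x)"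
  using comp_eq_comp[OF inf_nat[OF assms(1-4)], of x] assms by simp

declare inf_nat [simp]

lemma mk_arr_in:
  assumes "X \<in> inf_Obj n C" "Y \<in> inf_Obj n C"
    "\<And>s. 1 \<le> s \<Longrightarrow> s \<le> n \<Longrightarrow> f s \<in> Arr C"
    "\<And>s. 1 \<le> s \<Longrightarrow> s \<le> n \<Longrightarrow> Dom C (f s) = fst X s"
    "\<And>s. 1 \<le> s \<Longrightarrow> s \<le> n \<Longrightarrow> Cod C (f s) = fst Y s"
    "\<And>s. 1 \<le> s \<Longrightarrow> s < n \<Longrightarrow> snd Y s \<cdot> f s = f (Suc s) \<cdot> snd X s"
  shows "mk_arr n X f Y \<in> inf_Arr n C"
  using assms by (auto simp: inf_Arr_def mk_arr_def Hom_iff)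

lemma inf_arr_eqI:
  assumes "\<phi> \<in> inf_Arr n C" "\<psi> \<in> inf_Arr n C" "Dom I \<phi> = Dom I \<psi>" "Cod I \<phi> = Cod I \<psi>"
    "\<And>s. 1 \<le> s \<Longrightarrow> s \<le> n \<Longrightarrow> cmp \<phi> s = cmp \<psi> s"
  shows "\<phi> = \<psi>"
proof -
  obtain X f Y X' g Y' where [simp]: "\<phi> = (X, f, Y)" "\<psi> = (X', g, Y')" by (cases \<phi>; cases \<psi>) auto
  have "f = g"
    by (rule PiE_ext[of f "{1..n}" "\<lambda>s. Arr C" g])
      (use assms in \<open>auto simp: inf_Arr_def cmp_def PiE_iff Hom_iff\<close>)
  then show ?thesis using assms by (simp add: Inf_cat_def)
qed

lemma comp_in [simp]:
  assumes "\<phi> \<in> inf_Arr n C" "\<psi> \<in> inf_Arr n C" "Cod I \<phi> = Dom I \<psi>"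
  shows "\<psi> \<cdot>\<^bsub>I\<^esub> \<phi> \<in> inf_Arr n C"
  unfolding Inf_comp by (rule mk_arr_in) (use assms in simp_all)

lemma plus_in [simp]:
  assumes "\<phi> \<in> inf_Arr n C" "\<psi> \<in> inf_Arr n C" "Dom I \<phi> = Dom I \<psi>" "Cod I \<phi> = Cod I \<psi>"
  shows "\<psi> \<boxplus>\<^bsub>I\<^esub> \<phi> \<in> inf_Arr n C"
  unfolding Inf_plus by (rule mk_arr_in) (use assms in simp_all)

lemma ident_in [simp]: "X \<in> inf_Obj n C \<Longrightarrow> mk_arr n X (\<lambda>s. Ident C (fst X s)) X \<in> inf_Arr n C"
  by (rule mk_arr_in) simp_all

lemma zero_in [simp]:
  "\<lbrakk>X \<in> inf_Obj n C; Y \<in> inf_Obj n C\<rbrakk> \<Longrightarrow> mk_arr n X (\<lambda>s. Zero C (fst X s) (fst Y s)) Y \<in> inf_Arr n C"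
  by (rule mk_arr_in) simp_all

sublocale I: category I
proof
  fix f g h X Y Z W
  show "f \<in> Arr I \<Longrightarrow> Dom I f \<in> Obj I" "f \<in> Arr I \<Longrightarrow> Cod I f \<in> Obj I" "X \<in> Obj I \<Longrightarrow> Ident I X \<in> Hom I X X"
    "f \<in> Hom I X Y \<Longrightarrow> g \<in> Hom I Y Z \<Longrightarrow> g \<cdot>\<^bsub>I\<^esub> f \<in> Hom I X Z" by (auto simp: Hom_iff)
  show "f \<in> Hom I W X \<Longrightarrow> g \<in> Hom I X Y \<Longrightarrow> h \<in> Hom I Y Z \<Longrightarrow> h \<cdot>\<^bsub>I\<^esub> g \<cdot>\<^bsub>I\<^esub> f = h \<cdot>\<^bsub>I\<^esub> (g \<cdot>\<^bsub>I\<^esub> f)"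
    by (rule inf_arr_eqI) (simp_all add: Hom_iff)
  show "f \<in> Hom I X Y \<Longrightarrow> Ident I Y \<cdot>\<^bsub>I\<^esub> f = f" by (rule inf_arr_eqI) (auto simp: Hom_iff)
  show "f \<in> Hom I X Y \<Longrightarrow> f \<cdot>\<^bsub>I\<^esub> Ident I X = f" by (rule inf_arr_eqI) (auto simp: Hom_iff)
qed

lemma Inf_preadditive: "preadditive_category I"
proof (intro preadditive_category.intro preadditive_category_axioms.intro I.category_axioms)
  fix X Y assume "X \<in> Obj I" "Y \<in> Obj I"
  then have X: "X \<in> inf_Obj n C" and Y: "Y \<in> inf_Obj n C" by auto
  show "comm_group (hom_group I X Y)"
  proof (rule comm_groupI; unfold hom_group_def monoid.simps partial_object.simps)
    fix f assume "f \<in> Hom I X Y"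
    then have f [simp]: "f \<in> inf_Arr n C" "Dom I f = X" "Cod I f = Y" by (auto simp: Hom_iff)
    have [simp]: "mk_arr n X (\<lambda>s. neg C (cmp f s)) Y \<in> inf_Arr n C"
      by (rule mk_arr_in) (use X Y in simp_all)
    have "mk_arr n X (\<lambda>s. neg C (cmp f s)) Y \<boxplus>\<^bsub>I\<^esub> f = Zero I X Y"
      by (rule inf_arr_eqI) (use X Y in simp_all)
    then show "\<exists>g\<in>Hom I X Y. g \<boxplus>\<^bsub>I\<^esub> f = Zero I X Y"
      by (intro bexI[of _ "mk_arr n X (\<lambda>s. neg C (cmp f s)) Y"]) (simp_all add: Hom_iff)
    show "Zero I X Y \<boxplus>\<^bsub>I\<^esub> f = f"
      by (rule inf_arr_eqI) (use X Y in simp_all)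
    fix g assume "g \<in> Hom I X Y"
    then have g [simp]: "g \<in> inf_Arr n C" "Dom I g = X" "Cod I g = Y" by (auto simp: Hom_iff)
    show "f \<boxplus>\<^bsub>I\<^esub> g \<in> Hom I X Y" by (simp add: Hom_iff)
    show "f \<boxplus>\<^bsub>I\<^esub> g = g \<boxplus>\<^bsub>I\<^esub> f"
      by (rule inf_arr_eqI) (use X Y in \<open>auto intro: plus_comm\<close>)
    fix h assume "h \<in> Hom I X Y"
    then have h [simp]: "h \<in> inf_Arr n C" "Dom I h = X" "Cod I h = Y" by (auto simp: Hom_iff)
    show "f \<boxplus>\<^bsub>I\<^esub> g \<boxplus>\<^bsub>I\<^esub> h = f \<boxplus>\<^bsub>I\<^esub> (g \<boxplus>\<^bsub>I\<^esub> h)"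
      by (rule inf_arr_eqI) (use X Y in simp_all)
  qed (use X Y in \<open>simp add: Hom_iff\<close>)
next
  fix f g g' X Y Z
  show "f \<in> Hom I X Y \<Longrightarrow> g \<in> Hom I Y Z \<Longrightarrow> g' \<in> Hom I Y Z \<Longrightarrow> (g \<boxplus>\<^bsub>I\<^esub> g') \<cdot>\<^bsub>I\<^esub> f = g \<cdot>\<^bsub>I\<^esub> f \<boxplus>\<^bsub>I\<^esub> g' \<cdot>\<^bsub>I\<^esub> f"
    by (rule inf_arr_eqI) (simp_all add: Hom_iff)
next
  fix f f' g X Y Z
  show "f \<in> Hom I X Y \<Longrightarrow> f' \<in> Hom I X Y \<Longrightarrow> g \<in> Hom I Y Z \<Longrightarrow> g \<cdot>\<^bsub>I\<^esub> (f \<boxplus>\<^bsub>I\<^esub> f') = g \<cdot>\<^bsub>I\<^esub> f \<boxplus>\<^bsub>I\<^esub> g \<cdot>\<^bsub>I\<^esub> f'"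
    by (rule inf_arr_eqI) (simp_all add: Hom_iff)
qed

sublocale I: preadditive_category I by (rule Inf_preadditive)

lemma zero_object_Inf:
  assumes "Z \<in> inf_Obj n C" "\<And>s. 1 \<le> s \<Longrightarrow> s \<le> n \<Longrightarrow> zero_object C (fst Z s)"
  shows "zero_object I Z"
  unfolding I.zero_object_iff
proof
  show "Ident I Z = Zero I Z Z"
    by (rule inf_arr_eqI) (use assms in \<open>auto simp: zero_object_iff\<close>)
qed (use assms in simp)

lemma zero_object_InfD:
  assumes "zero_object I Z" "1 \<le> s" "s \<le> n"
  shows "zero_object C (fst Z s)"
proof -
  have Z: "Z \<in> inf_Obj n C" "Ident I Z = Zero I Z Z" using assms I.zero_object_iff by auto
  have "cmp (Ident I Z) s = cmp (Zero I Z Z) s" by (simp only: Z(2))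
  then show ?thesis using assms(2,3) Z(1) by (simp add: zero_object_iff)
qed

lemma Confl_Inf_iff:
  "(\<phi>, \<psi>) \<in> Confl I \<longleftrightarrow> \<phi> \<in> inf_Arr n C \<and> \<psi> \<in> inf_Arr n C \<and> Cod I \<phi> = Dom I \<psi> \<and>
    (\<forall>s. 1 \<le> s \<longrightarrow> s \<le> n \<longrightarrow> (cmp \<phi> s, cmp \<psi> s) \<in> Confl C)"
  by (cases \<phi>; cases \<psi>) (auto simp: Inf_cat_def cmp_def)

lemma Confl_InfD:
  assumes "(\<phi>, \<psi>) \<in> Confl I"
  shows "\<phi> \<in> inf_Arr n C" "\<psi> \<in> inf_Arr n C" "Cod I \<phi> = Dom I \<psi>"
    "1 \<le> s \<Longrightarrow> s \<le> n \<Longrightarrow> (cmp \<phi> s, cmp \<psi> s) \<in> Confl C"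
  using assms Confl_Inf_iff by auto

text \<open>Compatible arrows \<open>\<upsilon>\<close> on the middle terms are automatically
  inflations by \<open>inflation_middle\<close>. Products, push-outs, pull-backs and cokernels are
  recognized as inflation sequences in this way.\<close>

lemma Inf_extension:
  assumes X: "X \<in> inf_Obj n C" and Z: "Z \<in> inf_Obj n C"
    and ip: "\<And>s. 1 \<le> s \<Longrightarrow> s \<le> n \<Longrightarrow> (i s, p s) \<in> Confl C"
    and "\<And>s. 1 \<le> s \<Longrightarrow> s \<le> n \<Longrightarrow> Dom C (i s) = fst X s"
    and "\<And>s. 1 \<le> s \<Longrightarrow> s \<le> n \<Longrightarrow> Cod C (p s) = fst Z s"
    and "\<And>s. 1 \<le> s \<Longrightarrow> s < n \<Longrightarrow> \<upsilon> s \<in> Arr C"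
    and "\<And>s. 1 \<le> s \<Longrightarrow> s < n \<Longrightarrow> Dom C (\<upsilon> s) = Cod C (i s)"
    and "\<And>s. 1 \<le> s \<Longrightarrow> s < n \<Longrightarrow> Cod C (\<upsilon> s) = Cod C (i (Suc s))"
    and "\<And>s. 1 \<le> s \<Longrightarrow> s < n \<Longrightarrow> \<upsilon> s \<cdot> i s = i (Suc s) \<cdot> snd X s"
    and "\<And>s. 1 \<le> s \<Longrightarrow> s < n \<Longrightarrow> snd Z s \<cdot> p s = p (Suc s) \<cdot> \<upsilon> s"
  defines "Y \<equiv> mk_obj n (\<lambda>s. Cod C (i s)) \<upsilon>"
  shows "Y \<in> inf_Obj n C" "mk_arr n X i Y \<in> inf_Arr n C" "mk_arr n Y p Z \<in> inf_Arr n C"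
    "(mk_arr n X i Y, mk_arr n Y p Z) \<in> Confl I"
proof -
  have [simp]: "i s \<in> Arr C" "p s \<in> Arr C" "Cod C (i s) = Dom C (p s)" if "1 \<le> s" "s \<le> n" for s
    using conflD[OF ip[OF that]] by auto
  note [simp] = assms(4-10)
  show Y: "Y \<in> inf_Obj n C"
    unfolding Y_def
  proof (rule mk_obj_in)
    fix s assume s: "1 \<le> s" "s < n"
    show "inflation C (\<upsilon> s)"
      by (rule inflation_middle[OF ip[of s] ip[of "Suc s"], of "snd X s" "snd Z s"])
       (use s X Z inf_obj_inflation in simp_all)
  qed simp_all
  have [simp]: "fst Y s = Dom C (p s)" if "1 \<le> s" "s \<le> n" for s using that unfolding Y_def by simp
  have [simp]: "snd Y s = \<upsilon> s" if "1 \<le> s" "s < n" for s using that unfolding Y_def by simp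
  show 1: "mk_arr n X i Y \<in> inf_Arr n C" by (rule mk_arr_in) (use X Y in simp_all)
  show 2: "mk_arr n Y p Z \<in> inf_Arr n C" by (rule mk_arr_in) (use Z Y in simp_all)
  show "(mk_arr n X i Y, mk_arr n Y p Z) \<in> Confl I"
    unfolding Confl_Inf_iff using 1 2 ip by simp
qed

lemma Inf_additive: "additive_category I"
proof (intro additive_category.intro Inf_preadditive additive_category_axioms.intro)
  obtain Z where Z: "zero_object C Z" "Z \<in> Obj C" using zero_objectE by metis
  have "zero_object I (mk_obj n (\<lambda>_. Z) (\<lambda>_. Ident C Z))"
    by (rule zero_object_Inf, rule mk_obj_in) (use Z inflation_Ident in simp_all)
  then show "\<exists>Z. zero_object I Z" by blast
next
  fix X Y assume "X \<in> Obj I" "Y \<in> Obj I"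
  then have [simp]: "X \<in> inf_Obj n C" "Y \<in> inf_Obj n C" by auto
  \<comment> \<open>Middle object and four structure arrows belong together, so they are packed into
    one tuple and chosen at once.\<close>
  define B where "B s t \<longleftrightarrow> (\<exists>S i j p q. t = (S, i, j, p, q) \<and> S \<in> Obj C \<and>
    i \<in> Arr C \<and> Dom C i = fst X s \<and> Cod C i = S \<and> j \<in> Arr C \<and> Dom C j = fst Y s \<and> Cod C j = S \<and>
    p \<in> Arr C \<and> Dom C p = S \<and> Cod C p = fst X s \<and> q \<in> Arr C \<and> Dom C q = S \<and> Cod C q = fst Y s \<and>
    p \<cdot> i = Ident C (fst X s) \<and> q \<cdot> j = Ident C (fst Y s) \<and> q \<cdot> i = Zero C (fst X s) (fst Y s) \<and>
    p \<cdot> j = Zero C (fst Y s) (fst X s) \<and> (i \<cdot> p) \<boxplus> (j \<cdot> q) = Ident C S \<and> (i, q) \<in> Confl C)" for s t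
  have ex: "\<exists>t. B s t" if "1 \<le> s" "s \<le> n" for s
    unfolding B_def by (rule direct_sum[of "fst X s" "fst Y s"]) (use that in simp_all, blast)
  obtain t where t: "\<forall>s. 1 \<le> s \<and> s \<le> n \<longrightarrow> B s (t s)" using ex by (rule choice_range)
  define i where "i s = fst (snd (t s))" for s
  define j where "j s = fst (snd (snd (t s)))" for s
  define p where "p s = fst (snd (snd (snd (t s))))" for s
  define q where "q s = snd (snd (snd (snd (t s))))" for s
  define S where "S s = Cod C (i s)" for s
  have b: "S s \<in> Obj C"
    "i s \<in> Arr C" "Dom C (i s) = fst X s" "Cod C (i s) = S s" "j s \<in> Arr C" "Dom C (j s) = fst Y s"
    "Cod C (j s) = S s"
    "p s \<in> Arr C" "Dom C (p s) = S s" "Cod C (p s) = fst X s" "q s \<in> Arr C" "Dom C (q s) = S s"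
    "Cod C (q s) = fst Y s"
    "p s \<cdot> i s = Ident C (fst X s)" "q s \<cdot> j s = Ident C (fst Y s)"
    "q s \<cdot> i s = Zero C (fst X s) (fst Y s)"
    "p s \<cdot> j s = Zero C (fst Y s) (fst X s)" "(i s \<cdot> p s) \<boxplus> (j s \<cdot> q s) = Ident C (S s)"
    "(i s, q s) \<in> Confl C"
    if "1 \<le> s" "s \<le> n" for s
    using t that unfolding B_def i_def j_def p_def q_def S_def by auto
  note [simp] = b(1-18) comp_eq_comp[OF b(14)] comp_eq_comp[OF b(15)] comp_eq_comp[OF b(16)]
    comp_eq_comp[OF b(17)]
  \<comment> \<open>The diagonal matrix with the two given structure maps as entries.\<close>
  define \<upsilon> where "\<upsilon> s = i (Suc s) \<cdot> (snd X s \<cdot> p s) \<boxplus> j (Suc s) \<cdot> (snd Y s \<cdot> q s)" for s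
  let ?S = "mk_obj n (\<lambda>s. Cod C (i s)) \<upsilon>"
  have *: "?S \<in> inf_Obj n C" "mk_arr n X i ?S \<in> inf_Arr n C" "mk_arr n ?S q Y \<in> inf_Arr n C"
    by (rule Inf_extension(1-3)[of X Y i q \<upsilon>]; simp add: \<upsilon>_def b(19))+
  have j: "mk_arr n Y j ?S \<in> inf_Arr n C" by (rule mk_arr_in) (use * in \<open>simp_all add: \<upsilon>_def\<close>)
  have p: "mk_arr n ?S p X \<in> inf_Arr n C" by (rule mk_arr_in) (use * in \<open>simp_all add: \<upsilon>_def\<close>)
  have "is_biproduct I X Y ?S"
    by (rule I.is_biproductI[where i = "mk_arr n X i ?S" and j = "mk_arr n Y j ?S" and p =
      "mk_arr n ?S p X" and q = "mk_arr n ?S q Y"])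
      (use * j p in \<open>simp_all\<close>, (rule inf_arr_eqI; use * j p in simp)+)
  then show "\<exists>S. is_biproduct I X Y S" by blast
qed

sublocale I: additive_category I by (rule Inf_additive)

section \<open>Componentwise isomorphisms and the exactness axioms\<close>

lemma Inf_isoD:
  assumes "is_iso I \<phi>" "1 \<le> s" "s \<le> n"
  shows "is_iso C (cmp \<phi> s)"
proof -
  obtain \<psi> where \<psi>: "\<phi> \<in> Arr I" "\<psi> \<in> Arr I" "Dom I \<psi> = Cod I \<phi>" "Cod I \<psi> = Dom I \<phi>"
    "\<psi> \<cdot>\<^bsub>I\<^esub> \<phi> = Ident I (Dom I \<phi>)" "\<phi> \<cdot>\<^bsub>I\<^esub> \<psi> = Ident I (Cod I \<phi>)"
    using I.iso_inverse[OF assms(1)] by metis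
  have "cmp (\<psi> \<cdot>\<^bsub>I\<^esub> \<phi>) s = cmp (Ident I (Dom I \<phi>)) s" "cmp (\<phi> \<cdot>\<^bsub>I\<^esub> \<psi>) s = cmp (Ident I (Cod I \<phi>)) s"
    by (simp_all only: \<psi>)
  then show ?thesis
    by (intro is_isoI[where g = "cmp \<psi> s"]) (use assms(2,3) \<psi>(1-4) in simp_all)
qed

lemma Inf_isoI:
  assumes \<phi>: "\<phi> \<in> inf_Arr n C" and iso: "\<And>s. 1 \<le> s \<Longrightarrow> s \<le> n \<Longrightarrow> is_iso C (cmp \<phi> s)"
  shows "is_iso I \<phi>"
proof -
  have ex: "\<exists>g. g \<in> Arr C \<and> Dom C g = fst (Cod I \<phi>) s \<and> Cod C g = fst (Dom I \<phi>) s \<and>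
     g \<cdot> cmp \<phi> s = Ident C (fst (Dom I \<phi>) s) \<and> cmp \<phi> s \<cdot> g = Ident C (fst (Cod I \<phi>) s)" if "1 \<le> s" "s \<le>
       n" for s
    using iso_inverse[OF iso[OF that]] inf_arrD(3-5)[OF \<phi> that] by metis
  obtain g where g: "\<forall>s. 1 \<le> s \<and> s \<le> n \<longrightarrow> g s \<in> Arr C \<and> Dom C (g s) = fst (Cod I \<phi>) s \<and>
    Cod C (g s) = fst (Dom I \<phi>) s \<and>
     g s \<cdot> cmp \<phi> s = Ident C (fst (Dom I \<phi>) s) \<and> cmp \<phi> s \<cdot> g s = Ident C (fst (Cod I \<phi>) s)"
    using ex by (rule choice_range)
  have g': "g s \<in> Arr C" "Dom C (g s) = fst (Cod I \<phi>) s" "Cod C (g s) = fst (Dom I \<phi>) s"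
     "g s \<cdot> cmp \<phi> s = Ident C (fst (Dom I \<phi>) s)" "cmp \<phi> s \<cdot> g s = Ident C (fst (Cod I \<phi>) s)"
     if "1 \<le> s" "s \<le> n" for s
    using g that by blast+
  note [simp] = g' comp_eq_comp[OF g'(4)] \<phi>
  let ?g = "mk_arr n (Cod I \<phi>) g (Dom I \<phi>)"
  have G: "?g \<in> inf_Arr n C"
  proof (rule mk_arr_in)
    fix s assume s: "1 \<le> s" "s < n"
    \<comment> \<open>Componentwise inverses need no further choice: they commute with the structure
      maps because \<open>\<phi>\<close> does.\<close>
    have "snd (Dom I \<phi>) s \<cdot> g s = g (Suc s) \<cdot> (cmp \<phi> (Suc s) \<cdot> (snd (Dom I \<phi>) s \<cdot> g s))"
      using s by simp
    also have "cmp \<phi> (Suc s) \<cdot> (snd (Dom I \<phi>) s \<cdot> g s) = snd (Cod I \<phi>) s \<cdot> (cmp \<phi> s \<cdot> g s)"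
      using s by (simp del: g'(5))
    also have "\<dots> = snd (Cod I \<phi>) s" using s by simp
    finally show "snd (Dom I \<phi>) s \<cdot> g s = g (Suc s) \<cdot> snd (Cod I \<phi>) s" .
  qed simp_all
  show ?thesis
    by (rule is_isoI[where g = ?g]) (use G in simp_all, (rule inf_arr_eqI; use G in simp)+)
qed

text \<open>Factorizations are found at each index separately. Being unique, they commute with the
  structure maps: compose with the monic \<open>cmp \<phi> (Suc s)\<close>, respectively with the
  epic \<open>cmp \<psi> s\<close>, and cancel.\<close>

lemma Confl_Inf_kernel_cokernel:
  assumes conf: "(\<phi>, \<psi>) \<in> Confl I"
  shows "kernel_cokernel_pair I \<phi> \<psi>"
proof -
  note C = Confl_InfD[OF conf]
  note [simp] = C(1-3)
  have z: "\<psi> \<cdot>\<^bsub>I\<^esub> \<phi> = Zero I (Dom I \<phi>) (Cod I \<psi>)"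
    by (rule inf_arr_eqI) (use conflD(4)[OF C(4)] in simp_all)
  have "is_kernel I \<phi> \<psi>"
  proof (rule I.kernelI)
    fix f assume "f \<in> Arr I" "Cod I f = Dom I \<psi>" and pf: "\<psi> \<cdot>\<^bsub>I\<^esub> f = Zero I (Dom I f) (Cod I \<psi>)"
    then have f [simp]: "f \<in> inf_Arr n C" "Cod I f = Dom I \<psi>" by auto
    have "\<exists>g. g \<in> Arr C \<and> Dom C g = fst (Dom I f) s \<and> Cod C g = fst (Dom I \<phi>) s \<and> cmp \<phi> s \<cdot> g = cmp f s"
      if s: "1 \<le> s" "s \<le> n" for s
    proof -
      have "cmp (\<psi> \<cdot>\<^bsub>I\<^esub> f) s = cmp (Zero I (Dom I f) (Cod I \<psi>)) s" by (simp only: pf)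
      then have "cmp \<psi> s \<cdot> cmp f s = Zero C (fst (Dom I f) s) (fst (Cod I \<psi>) s)" using s by simp
      then show ?thesis by - (rule confl_lift[OF C(4)[OF s], of "cmp f s"], use s in simp_all, blast)
    qed
    then obtain g where "\<forall>s. 1 \<le> s \<and> s \<le> n \<longrightarrow> g s \<in> Arr C \<and> Dom C (g s) = fst (Dom I f) s \<and>
      Cod C (g s) = fst (Dom I \<phi>) s \<and> cmp \<phi> s \<cdot> g s = cmp f s"
    by (rule choice_range)
    then have g: "g s \<in> Arr C" "Dom C (g s) = fst (Dom I f) s" "Cod C (g s) = fst (Dom I \<phi>) s"
      "cmp \<phi> s \<cdot> g s = cmp f s"
      if "1 \<le> s" "s \<le> n" for s using that by blast+
    note [simp] = g comp_eq_comp[OF g(4)]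
    have G [simp]: "mk_arr n (Dom I f) g (Dom I \<phi>) \<in> inf_Arr n C"
    proof (rule mk_arr_in)
      fix s assume s: "1 \<le> s" "s < n"
      show "snd (Dom I \<phi>) s \<cdot> g s = g (Suc s) \<cdot> snd (Dom I f) s"
      proof (rule confl_mono[OF C(4)[of "Suc s"]])
        have "cmp \<phi> (Suc s) \<cdot> (snd (Dom I \<phi>) s \<cdot> g s) = snd (Dom I \<psi>) s \<cdot> (cmp \<phi> s \<cdot> g s)"
          using s by (simp del: g(4))
        also have "\<dots> = cmp \<phi> (Suc s) \<cdot> (g (Suc s) \<cdot> snd (Dom I f) s)" using s by simp
        finally show
          "cmp \<phi> (Suc s) \<cdot> (snd (Dom I \<phi>) s \<cdot> g s) = cmp \<phi> (Suc s) \<cdot> (g (Suc s) \<cdot> snd (Dom I f) s)" .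
      qed (use s in simp_all)
    qed simp_all
    have "\<phi> \<cdot>\<^bsub>I\<^esub> mk_arr n (Dom I f) g (Dom I \<phi>) = f" by (rule inf_arr_eqI) simp_all
    then show "\<exists>g. g \<in> Arr I \<and> Dom I g = Dom I f \<and> Cod I g = Dom I \<phi> \<and> \<phi> \<cdot>\<^bsub>I\<^esub> g = f"
      by (intro exI[of _ "mk_arr n (Dom I f) g (Dom I \<phi>)"]) simp
  next
    fix u v assume *: "u \<in> Arr I" "v \<in> Arr I" "Cod I u = Dom I \<phi>" "Cod I v = Dom I \<phi>"
      "Dom I u = Dom I v"
      "\<phi> \<cdot>\<^bsub>I\<^esub> u = \<phi> \<cdot>\<^bsub>I\<^esub> v"
    show "u = v"
    proof (rule inf_arr_eqI)
      fix s assume s: "1 \<le> s" "s \<le> n"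
      have "cmp (\<phi> \<cdot>\<^bsub>I\<^esub> u) s = cmp (\<phi> \<cdot>\<^bsub>I\<^esub> v) s" by (simp only: *(6))
      then show "cmp u s = cmp v s"
        by - (rule confl_mono[OF C(4)[OF s]], use s *(1-5) in simp_all)
    qed (use * in simp_all)
  qed (use z in simp_all)
  moreover have "is_cokernel I \<psi> \<phi>"
  proof (rule I.cokernelI)
    fix f assume "f \<in> Arr I" "Dom I f = Dom I \<psi>" and pf: "f \<cdot>\<^bsub>I\<^esub> \<phi> = Zero I (Dom I \<phi>) (Cod I f)"
    then have f [simp]: "f \<in> inf_Arr n C" "Dom I f = Dom I \<psi>" by auto
    have "\<exists>g. g \<in> Arr C \<and> Dom C g = fst (Cod I \<psi>) s \<and> Cod C g = fst (Cod I f) s \<and> g \<cdot> cmp \<psi> s = cmp f s"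
      if s: "1 \<le> s" "s \<le> n" for s
    proof -
      have "cmp (f \<cdot>\<^bsub>I\<^esub> \<phi>) s = cmp (Zero I (Dom I \<phi>) (Cod I f)) s" by (simp only: pf)
      then have "cmp f s \<cdot> cmp \<phi> s = Zero C (fst (Dom I \<phi>) s) (fst (Cod I f) s)" using s by simp
      then show ?thesis by - (rule confl_descend[OF C(4)[OF s], of "cmp f s"], use s in simp_all, blast)
    qed
    then obtain g where "\<forall>s. 1 \<le> s \<and> s \<le> n \<longrightarrow> g s \<in> Arr C \<and> Dom C (g s) = fst (Cod I \<psi>) s \<and>
      Cod C (g s) = fst (Cod I f) s \<and> g s \<cdot> cmp \<psi> s = cmp f s"
    by (rule choice_range)
    then have g: "g s \<in> Arr C" "Dom C (g s) = fst (Cod I \<psi>) s" "Cod C (g s) = fst (Cod I f) s"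
      "g s \<cdot> cmp \<psi> s = cmp f s"
      if "1 \<le> s" "s \<le> n" for s using that by blast+
    note [simp] = g comp_eq_comp[OF g(4)]
    have G [simp]: "mk_arr n (Cod I \<psi>) g (Cod I f) \<in> inf_Arr n C"
    proof (rule mk_arr_in)
      fix s assume s: "1 \<le> s" "s < n"
      show "snd (Cod I f) s \<cdot> g s = g (Suc s) \<cdot> snd (Cod I \<psi>) s"
        by (rule confl_epi[OF C(4)[of s]]) (use s in simp_all)
    qed simp_all
    have "mk_arr n (Cod I \<psi>) g (Cod I f) \<cdot>\<^bsub>I\<^esub> \<psi> = f" by (rule inf_arr_eqI) simp_all
    then show "\<exists>g. g \<in> Arr I \<and> Cod I g = Cod I f \<and> Dom I g = Cod I \<psi> \<and> g \<cdot>\<^bsub>I\<^esub> \<psi> = f"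
      by (intro exI[of _ "mk_arr n (Cod I \<psi>) g (Cod I f)"]) simp
  next
    fix u v assume *: "u \<in> Arr I" "v \<in> Arr I" "Dom I u = Cod I \<psi>" "Dom I v = Cod I \<psi>"
      "Cod I u = Cod I v"
      "u \<cdot>\<^bsub>I\<^esub> \<psi> = v \<cdot>\<^bsub>I\<^esub> \<psi>"
    show "u = v"
    proof (rule inf_arr_eqI)
      fix s assume s: "1 \<le> s" "s \<le> n"
      have "cmp (u \<cdot>\<^bsub>I\<^esub> \<psi>) s = cmp (v \<cdot>\<^bsub>I\<^esub> \<psi>) s" by (simp only: *(6))
      then show "cmp u s = cmp v s"
        by - (rule confl_epi[OF C(4)[OF s]], use s *(1-5) in simp_all)
    qed (use * in simp_all)
  qed (use z in simp_all)
  ultimately show ?thesis by (simp add: kernel_cokernel_pair_def)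
qed

lemma Confl_Inf_iso_closed: "iso_closure I (Confl I) \<subseteq> Confl I"
proof clarify
  fix \<phi>' \<psi>' assume "(\<phi>', \<psi>') \<in> iso_closure I (Confl I)"
  then obtain \<phi> \<psi> a b c where *: "(\<phi>, \<psi>) \<in> Confl I" "is_iso I a" "is_iso I b" "is_iso I c" "\<phi>' \<in> Arr I"
    "\<psi>' \<in> Arr I"
    "Cod I \<phi>' = Dom I \<psi>'" "a \<in> Hom I (Dom I \<phi>) (Dom I \<phi>')" "b \<in> Hom I (Cod I \<phi>) (Cod I \<phi>')"
    "c \<in> Hom I (Cod I \<psi>) (Cod I \<psi>')" "b \<cdot>\<^bsub>I\<^esub> \<phi> = \<phi>' \<cdot>\<^bsub>I\<^esub> a" "c \<cdot>\<^bsub>I\<^esub> \<psi> = \<psi>' \<cdot>\<^bsub>I\<^esub> b"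
    unfolding iso_closure_def by blast
  note C = Confl_InfD[OF *(1)]
  show "(\<phi>', \<psi>') \<in> Confl I"
    unfolding Confl_Inf_iff
  proof (intro conjI allI impI)
    fix s assume s: "1 \<le> s" "s \<le> n"
    have "cmp (b \<cdot>\<^bsub>I\<^esub> \<phi>) s = cmp (\<phi>' \<cdot>\<^bsub>I\<^esub> a) s" "cmp (c \<cdot>\<^bsub>I\<^esub> \<psi>) s = cmp (\<psi>' \<cdot>\<^bsub>I\<^esub> b) s"
      by (simp_all only: *)
    then show "(cmp \<phi>' s, cmp \<psi>' s) \<in> Confl C"
      by (intro confl_iso[OF C(4)[OF s] Inf_isoD[OF *(2) s] Inf_isoD[OF *(3) s] Inf_isoD[OF *(4) s]])
        (use s C(1-3) *(5-10) in \<open>simp_all add: Hom_iff\<close>)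
  qed (use * in simp_all)
qed

lemma inflation_Ident_Inf:
  assumes "X \<in> inf_Obj n C"
  shows "inflation I (Ident I X)" "deflation I (Ident I X)"
proof -
  obtain Z where Z: "zero_object I Z" "Z \<in> inf_Obj n C" by (rule I.zero_objectE) simp
  have "(Ident I X, Zero I X Z) \<in> Confl I" "(Zero I Z X, Ident I X) \<in> Confl I"
    unfolding Confl_Inf_iff
    using assms Z confl_Ident_zero zero_object_InfD[OF Z(1)] confl_zero_Ident by simp_all
  then show "inflation I (Ident I X)" "deflation I (Ident I X)" unfolding inflation_def deflation_def
    by blast+
qed

text \<open>The componentwise cokernels of the composite must form an inflation sequence. By
  \<open>noether\<close> they are extensions of the cokernel of \<open>\<psi>\<close> by that of
  \<open>\<phi>\<close>, both of which are inflation sequences.\<close>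

lemma inflation_Comp_Inf:
  assumes "inflation I \<phi>" "inflation I \<psi>" and [simp]: "Cod I \<phi> = Dom I \<psi>"
  shows "inflation I (\<psi> \<cdot>\<^bsub>I\<^esub> \<phi>)"
proof -
  obtain p q where pq: "(\<phi>, p) \<in> Confl I" "(\<psi>, q) \<in> Confl I" using assms by (auto simp: inflation_def)
  note P = Confl_InfD[OF pq(1)] and Q = Confl_InfD[OF pq(2)]
  have [simp]: "\<phi> \<in> inf_Arr n C" "\<psi> \<in> inf_Arr n C" "p \<in> inf_Arr n C" "q \<in> inf_Arr n C"
    "Dom I p = Dom I \<psi>" "Dom I q = Cod I \<psi>"
    using P Q by auto
  have "\<exists>r \<mu> \<nu>. (cmp \<psi> s \<cdot> cmp \<phi> s, r) \<in> Confl C \<and> (\<mu>, \<nu>) \<in> Confl C \<and> Dom C \<mu> = fst (Cod I p) s \<and>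
    Cod C \<mu> = Cod C r \<and>
    Cod C \<nu> = fst (Cod I q) s \<and> r \<cdot> cmp \<psi> s = \<mu> \<cdot> cmp p s \<and> \<nu> \<cdot> r = cmp q s" if "1 \<le> s" "s \<le> n" for s
    by (rule noether[OF P(4)[OF that] Q(4)[OF that]]) (use that in simp_all, blast)
  then obtain r \<mu> \<nu> where "\<forall>s. 1 \<le> s \<and> s \<le> n \<longrightarrow> (cmp \<psi> s \<cdot> cmp \<phi> s, r s) \<in> Confl C \<and>
    (\<mu> s, \<nu> s) \<in> Confl C \<and> Dom C (\<mu> s) = fst (Cod I p) s \<and> Cod C (\<mu> s) = Cod C (r s) \<and>
    Cod C (\<nu> s) = fst (Cod I q) s \<and> r s \<cdot> cmp \<psi> s = \<mu> s \<cdot> cmp p s \<and> \<nu> s \<cdot> r s = cmp q s"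
    by (rule choice_range3)
  then have N: "(cmp \<psi> s \<cdot> cmp \<phi> s, r s) \<in> Confl C" "(\<mu> s, \<nu> s) \<in> Confl C"
    "Dom C (\<mu> s) = fst (Cod I p) s" "Cod C (\<mu> s) = Cod C (r s)"
    "Cod C (\<nu> s) = fst (Cod I q) s" "\<mu> s \<cdot> cmp p s = r s \<cdot> cmp \<psi> s" "\<nu> s \<cdot> r s = cmp q s"
    if "1 \<le> s" "s \<le> n" for s
    using that by auto
  have R: "r s \<in> Arr C" "\<mu> s \<in> Arr C" "\<nu> s \<in> Arr C" "Dom C (r s) = fst (Cod I \<psi>) s"
    "Dom C (\<nu> s) = Cod C (r s)"
    "r s \<cdot> (cmp \<psi> s \<cdot> cmp \<phi> s) = Zero C (fst (Dom I \<phi>) s) (Cod C (r s))"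
    if "1 \<le> s" "s \<le> n" for s
    using conflD(1-4)[OF N(1)[OF that]] conflD(1-3)[OF N(2)[OF that]] N(4)[OF that] that by simp_all
  note [simp] = R(1-5) N(3-7) comp_eq_comp[OF N(6)] comp_eq_comp[OF N(7)]
  have "\<exists>\<upsilon>. \<upsilon> \<in> Arr C \<and> Cod C \<upsilon> = Cod C (r (Suc s)) \<and> Dom C \<upsilon> = Cod C (r s) \<and>
    \<upsilon> \<cdot> r s = r (Suc s) \<cdot> snd (Cod I \<psi>) s"
    if s: "1 \<le> s" "s < n" for s
  proof -
    have "(r (Suc s) \<cdot> snd (Cod I \<psi>) s) \<cdot> (cmp \<psi> s \<cdot> cmp \<phi> s) =
      (r (Suc s) \<cdot> (cmp \<psi> (Suc s) \<cdot> cmp \<phi> (Suc s))) \<cdot> snd (Dom I \<phi>) s"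
      using s by simp
    also have "\<dots> = Zero C (fst (Dom I \<phi>) s) (Cod C (r (Suc s)))"
      using s R(6)[of "Suc s"] by simp
    finally show ?thesis
      by - (rule confl_descend[OF N(1)[of s], of "r (Suc s) \<cdot> snd (Cod I \<psi>) s"], use s
        in simp_all, blast)
  qed
  then obtain \<upsilon> where "\<forall>s. 1 \<le> s \<and> s < n \<longrightarrow> \<upsilon> s \<in> Arr C \<and> Cod C (\<upsilon> s) = Cod C (r (Suc s)) \<and>
    Dom C (\<upsilon> s) = Cod C (r s) \<and> \<upsilon> s \<cdot> r s = r (Suc s) \<cdot> snd (Cod I \<psi>) s"
    by (rule choice_step)
  then have U: "\<upsilon> s \<in> Arr C" "Cod C (\<upsilon> s) = Cod C (r (Suc s))" "Dom C (\<upsilon> s) = Cod C (r s)"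
    "\<upsilon> s \<cdot> r s = r (Suc s) \<cdot> snd (Cod I \<psi>) s"
    if "1 \<le> s" "s < n" for s using that by blast+
  note [simp] = U comp_eq_comp[OF U(4)]
  define D where "D = mk_obj n (\<lambda>s. Cod C (\<mu> s)) \<upsilon>"
  have D: "D \<in> inf_Obj n C"
    unfolding D_def
  proof (rule Inf_extension(1)[of "Cod I p" "Cod I q" \<mu> \<nu>])
    fix s assume s: "1 \<le> s" "s < n"
    show "\<upsilon> s \<cdot> \<mu> s = \<mu> (Suc s) \<cdot> snd (Cod I p) s"
      by (rule confl_epi[OF P(4)[of s]]) (use s in simp_all)
    show "snd (Cod I q) s \<cdot> \<nu> s = \<nu> (Suc s) \<cdot> \<upsilon> s"
      by (rule confl_epi[OF N(1)[of s]]) (use s in simp_all)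
  qed (use N(2) in simp_all)
  have "mk_arr n (Cod I \<psi>) r D \<in> inf_Arr n C"
    by (rule mk_arr_in) (use D in \<open>simp_all add: D_def\<close>)
  then have "(\<psi> \<cdot>\<^bsub>I\<^esub> \<phi>, mk_arr n (Cod I \<psi>) r D) \<in> Confl I"
    unfolding Confl_Inf_iff using N(1) by simp
  then show ?thesis unfolding inflation_def by blast
qed

text \<open>Now the kernels of the composites have to be joined by inflations. They are extensions
  of the kernel of \<open>\<psi>\<close> by the kernel of \<open>\<phi>\<close>. Duality gives no
  shortcut, since it would turn the inflations inside the objects into deflations.\<close>

lemma deflation_Comp_Inf:
  assumes "deflation I \<phi>" "deflation I \<psi>" and [simp]: "Cod I \<phi> = Dom I \<psi>"
  shows "deflation I (\<psi> \<cdot>\<^bsub>I\<^esub> \<phi>)"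
proof -
  obtain k l where pq: "(k, \<phi>) \<in> Confl I" "(l, \<psi>) \<in> Confl I" using assms by (auto simp: deflation_def)
  note P = Confl_InfD[OF pq(1)] and Q = Confl_InfD[OF pq(2)]
  have [simp]: "\<phi> \<in> inf_Arr n C" "\<psi> \<in> inf_Arr n C" "k \<in> inf_Arr n C" "l \<in> inf_Arr n C"
    "Cod I k = Dom I \<phi>" "Cod I l = Dom I \<psi>"
    using P Q by auto
  have "\<exists>m \<mu> \<nu>. (m, cmp \<psi> s \<cdot> cmp \<phi> s) \<in> Confl C \<and> (\<mu>, \<nu>) \<in> Confl C \<and> Cod C \<nu> = fst (Dom I l) s \<and>
    Dom C \<nu> = Dom C m \<and>
    Dom C \<mu> = fst (Dom I k) s \<and> cmp \<phi> s \<cdot> m = cmp l s \<cdot> \<nu> \<and> m \<cdot> \<mu> = cmp k s" if "1 \<le> s" "s \<le> n" for s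
    by (rule noether_deflation[OF P(4)[OF that] Q(4)[OF that]]) (use that in simp_all, blast)
  then obtain m \<mu> \<nu> where "\<forall>s. 1 \<le> s \<and> s \<le> n \<longrightarrow> (m s, cmp \<psi> s \<cdot> cmp \<phi> s) \<in> Confl C \<and>
    (\<mu> s, \<nu> s) \<in> Confl C \<and> Cod C (\<nu> s) = fst (Dom I l) s \<and> Dom C (\<nu> s) = Dom C (m s) \<and>
    Dom C (\<mu> s) = fst (Dom I k) s \<and> cmp \<phi> s \<cdot> m s = cmp l s \<cdot> \<nu> s \<and> m s \<cdot> \<mu> s = cmp k s"
    by (rule choice_range3)
  then have N: "(m s, cmp \<psi> s \<cdot> cmp \<phi> s) \<in> Confl C" "(\<mu> s, \<nu> s) \<in> Confl C"
    "Cod C (\<nu> s) = fst (Dom I l) s" "Dom C (\<nu> s) = Dom C (m s)"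
    "Dom C (\<mu> s) = fst (Dom I k) s" "cmp l s \<cdot> \<nu> s = cmp \<phi> s \<cdot> m s" "m s \<cdot> \<mu> s = cmp k s"
    if "1 \<le> s" "s \<le> n" for s
    using that by auto
  have R: "m s \<in> Arr C" "\<mu> s \<in> Arr C" "\<nu> s \<in> Arr C" "Cod C (m s) = fst (Dom I \<phi>) s"
    "Cod C (\<mu> s) = Dom C (m s)"
    "cmp \<psi> s \<cdot> (cmp \<phi> s \<cdot> m s) = Zero C (Dom C (m s)) (fst (Cod I \<psi>) s)"
    if "1 \<le> s" "s \<le> n" for s
    using conflD(1-4)[OF N(1)[OF that]] conflD(1-3)[OF N(2)[OF that]] N(4)[OF that] that by simp_all
  note [simp] = R N(3-7) comp_eq_comp[OF N(6)] comp_eq_comp[OF N(7)]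
  have "\<exists>\<upsilon>. \<upsilon> \<in> Arr C \<and> Dom C \<upsilon> = Dom C (m s) \<and> Cod C \<upsilon> = Dom C (m (Suc s)) \<and>
    m (Suc s) \<cdot> \<upsilon> = snd (Dom I \<phi>) s \<cdot> m s"
    if s: "1 \<le> s" "s < n" for s
  proof -
    have "cmp \<psi> (Suc s) \<cdot> (cmp \<phi> (Suc s) \<cdot> (snd (Dom I \<phi>) s \<cdot> m s)) =
      snd (Cod I \<psi>) s \<cdot> (cmp \<psi> s \<cdot> (cmp \<phi> s \<cdot> m s))"
      using s by (simp del: R(6))
    also have "\<dots> = Zero C (Dom C (m s)) (fst (Cod I \<psi>) (Suc s))" using s by simp
    finally show ?thesis
      by - (rule confl_lift[OF N(1)[of "Suc s"], of "snd (Dom I \<phi>) s \<cdot> m s"], use s in simp_all, blast)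
  qed
  then obtain \<upsilon> where "\<forall>s. 1 \<le> s \<and> s < n \<longrightarrow> \<upsilon> s \<in> Arr C \<and> Dom C (\<upsilon> s) = Dom C (m s) \<and>
    Cod C (\<upsilon> s) = Dom C (m (Suc s)) \<and> m (Suc s) \<cdot> \<upsilon> s = snd (Dom I \<phi>) s \<cdot> m s"
    by (rule choice_step)
  then have U: "\<upsilon> s \<in> Arr C" "Dom C (\<upsilon> s) = Dom C (m s)" "Cod C (\<upsilon> s) = Dom C (m (Suc s))"
    "m (Suc s) \<cdot> \<upsilon> s = snd (Dom I \<phi>) s \<cdot> m s"
    if "1 \<le> s" "s < n" for s using that by blast+
  note [simp] = U comp_eq_comp[OF U(4)]
  define D where "D = mk_obj n (\<lambda>s. Cod C (\<mu> s)) \<upsilon>"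
  have D: "D \<in> inf_Obj n C"
    unfolding D_def
  proof (rule Inf_extension(1)[of "Dom I k" "Dom I l" \<mu> \<nu>])
    fix s assume s: "1 \<le> s" "s < n"
    show "\<upsilon> s \<cdot> \<mu> s = \<mu> (Suc s) \<cdot> snd (Dom I k) s"
      by (rule confl_mono[OF N(1)[of "Suc s"]]) (use s in simp_all)
    have nat: "cmp \<phi> (Suc s) \<cdot> (snd (Dom I \<phi>) s \<cdot> m s) = snd (Dom I \<psi>) s \<cdot> (cmp \<phi> s \<cdot> m s)"
      using s by simp
    have natl: "cmp l (Suc s) \<cdot> (snd (Dom I l) s \<cdot> \<nu> s) = snd (Dom I \<psi>) s \<cdot> (cmp l s \<cdot> \<nu> s)"
      using s by (simp del: N(6))
    show "snd (Dom I l) s \<cdot> \<nu> s = \<nu> (Suc s) \<cdot> \<upsilon> s"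
      by (rule confl_mono[OF Q(4)[of "Suc s"]]) (use s nat natl in simp_all)
  qed (use N(2) in simp_all)
  have "mk_arr n D m (Dom I \<phi>) \<in> inf_Arr n C"
    by (rule mk_arr_in) (use D in \<open>simp_all add: D_def\<close>)
  then have "(mk_arr n D m (Dom I \<phi>), \<psi> \<cdot>\<^bsub>I\<^esub> \<phi>) \<in> Confl I"
    unfolding Confl_Inf_iff using N(1) by simp
  then show ?thesis unfolding deflation_def by blast
qed

text \<open>A push-out keeps the cokernel, so the componentwise push-outs are extensions of the
  cokernel of \<open>\<phi>\<close> by the target of \<open>f\<close>. The universal property is
  componentwise, and uniqueness makes the induced arrows compatible.\<close>

lemma inflation_pushout_Inf:
  assumes infl: "inflation I \<phi>" and f [simp]: "f \<in> inf_Arr n C" "Dom I f = Dom I \<phi>"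
  shows "\<exists>\<phi>' f'. is_pushout I \<phi> f \<phi>' f' \<and> inflation I \<phi>'"
proof -
  obtain p where pq: "(\<phi>, p) \<in> Confl I" using assms by (auto simp: inflation_def)
  note P = Confl_InfD[OF pq]
  have [simp]: "\<phi> \<in> inf_Arr n C" "p \<in> inf_Arr n C" "Dom I p = Cod I \<phi>" using P by auto
  have "\<exists>i' f' p'. is_pushout C (cmp \<phi> s) (cmp f s) i' f' \<and> (i', p') \<in> Confl C \<and>
    Cod C p' = fst (Cod I p) s \<and> p' \<cdot> f' = cmp p s"
    if "1 \<le> s" "s \<le> n" for s
    by (rule confl_pushout[OF P(4)[OF that], of "cmp f s"]) (use that in simp_all, blast)
  then obtain i' f' p' where "\<forall>s. 1 \<le> s \<and> s \<le> n \<longrightarrow> is_pushout C (cmp \<phi> s) (cmp f s) (i' s) (f' s) \<and>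
    (i' s, p' s) \<in> Confl C \<and> Cod C (p' s) = fst (Cod I p) s \<and> p' s \<cdot> f' s = cmp p s"
    by (rule choice_range3)
  then have N: "is_pushout C (cmp \<phi> s) (cmp f s) (i' s) (f' s)" "(i' s, p' s) \<in> Confl C"
    "Cod C (p' s) = fst (Cod I p) s" "p' s \<cdot> f' s = cmp p s"
    if "1 \<le> s" "s \<le> n" for s using that by auto
  have R: "i' s \<in> Arr C" "f' s \<in> Arr C" "p' s \<in> Arr C" "Dom C (i' s) = fst (Cod I f) s"
    "Dom C (f' s) = fst (Cod I \<phi>) s"
    "Cod C (f' s) = Dom C (p' s)" "Cod C (i' s) = Dom C (p' s)" "f' s \<cdot> cmp \<phi> s = i' s \<cdot> cmp f s"
    "p' s \<cdot> i' s = Zero C (fst (Cod I f) s) (fst (Cod I p) s)"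
    if "1 \<le> s" "s \<le> n" for s
    using pushoutD[OF N(1)[OF that]] conflD(1-4)[OF N(2)[OF that]] N(3)[OF that] that by simp_all
  note [simp] = R N(3,4) comp_eq_comp[OF R(8)] comp_eq_comp[OF R(9)] comp_eq_comp[OF N(4)]
  have "\<exists>\<upsilon>. \<upsilon> \<in> Arr C \<and> Dom C \<upsilon> = Dom C (p' s) \<and> Cod C \<upsilon> = Dom C (p' (Suc s)) \<and>
    \<upsilon> \<cdot> f' s = f' (Suc s) \<cdot> snd (Cod I \<phi>) s \<and> \<upsilon> \<cdot> i' s = i' (Suc s) \<cdot> snd (Cod I f) s"
    if s: "1 \<le> s" "s < n" for s
    by (rule pushout_induced[OF N(1)[of s], of "f' (Suc s) \<cdot> snd (Cod I \<phi>) s"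
      "i' (Suc s) \<cdot> snd (Cod I f) s"])
      (use s in simp_all, blast)
  then obtain \<upsilon> where "\<forall>s. 1 \<le> s \<and> s < n \<longrightarrow> \<upsilon> s \<in> Arr C \<and> Dom C (\<upsilon> s) = Dom C (p' s) \<and>
    Cod C (\<upsilon> s) = Dom C (p' (Suc s)) \<and>
    \<upsilon> s \<cdot> f' s = f' (Suc s) \<cdot> snd (Cod I \<phi>) s \<and> \<upsilon> s \<cdot> i' s = i' (Suc s) \<cdot> snd (Cod I f) s"
    by (rule choice_step)
  then have U: "\<upsilon> s \<in> Arr C" "Dom C (\<upsilon> s) = Dom C (p' s)" "Cod C (\<upsilon> s) = Dom C (p' (Suc s))"
    "\<upsilon> s \<cdot> f' s = f' (Suc s) \<cdot> snd (Cod I \<phi>) s" "\<upsilon> s \<cdot> i' s = i' (Suc s) \<cdot> snd (Cod I f) s"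
    if "1 \<le> s" "s < n" for s using that by blast+
  note [simp] = U comp_eq_comp[OF U(4)] comp_eq_comp[OF U(5)]
  define Y where "Y = mk_obj n (\<lambda>s. Cod C (i' s)) \<upsilon>"
  have p'\<upsilon>: "snd (Cod I p) s \<cdot> p' s = p' (Suc s) \<cdot> \<upsilon> s" if s: "1 \<le> s" "s < n" for s
    by (rule pushout_epi[OF N(1)[of s]]) (use s in simp_all)
  have Y: "Y \<in> inf_Obj n C" and i': "mk_arr n (Cod I f) i' Y \<in> inf_Arr n C"
    and conf: "(mk_arr n (Cod I f) i' Y, mk_arr n Y p' (Cod I p)) \<in> Confl I"
    unfolding Y_def by (rule Inf_extension(1,2,4)[of "Cod I f" "Cod I p" i' p' \<upsilon>]; use p'\<upsilon> N(2)
      in simp)+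
  have f': "mk_arr n (Cod I \<phi>) f' Y \<in> inf_Arr n C"
    by (rule mk_arr_in) (use Y in \<open>simp_all add: Y_def\<close>)
  note [simp] = Y i' f'
  have Ys [simp]: "fst Y s = Dom C (p' s)" if "1 \<le> s" "s \<le> n" for s using that by (simp add: Y_def)
  have Ys' [simp]: "snd Y s = \<upsilon> s" if "1 \<le> s" "s < n" for s using that by (simp add: Y_def)
  have "is_pushout I \<phi> f (mk_arr n (Cod I f) i' Y) (mk_arr n (Cod I \<phi>) f' Y)"
  proof (rule I.pushoutI)
    show "mk_arr n (Cod I \<phi>) f' Y \<cdot>\<^bsub>I\<^esub> \<phi> = mk_arr n (Cod I f) i' Y \<cdot>\<^bsub>I\<^esub> f"
      by (rule inf_arr_eqI) simp_all
  next
    fix u v assume "u \<in> Arr I" "v \<in> Arr I" "Cod I u = Cod I v" "Dom I u = Cod I \<phi>" "Dom I v = Cod I f"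
      and uv: "u \<cdot>\<^bsub>I\<^esub> \<phi> = v \<cdot>\<^bsub>I\<^esub> f"
    then have [simp]: "u \<in> inf_Arr n C" "v \<in> inf_Arr n C" "Cod I u = Cod I v" "Dom I u = Cod I \<phi>"
      "Dom I v = Cod I f" by auto
    have "\<exists>w. w \<in> Arr C \<and> Dom C w = Dom C (p' s) \<and> Cod C w = fst (Cod I v) s \<and> w \<cdot> f' s = cmp u s \<and>
      w \<cdot> i' s = cmp v s"
      if s: "1 \<le> s" "s \<le> n" for s
    proof -
      have "cmp (u \<cdot>\<^bsub>I\<^esub> \<phi>) s = cmp (v \<cdot>\<^bsub>I\<^esub> f) s" by (simp only: uv)
      then show ?thesis
        by - (rule pushout_induced[OF N(1)[OF s], of "cmp u s" "cmp v s"], use s in simp_all, blast)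
    qed
    then obtain w where "\<forall>s. 1 \<le> s \<and> s \<le> n \<longrightarrow> w s \<in> Arr C \<and> Dom C (w s) = Dom C (p' s) \<and>
      Cod C (w s) = fst (Cod I v) s \<and> w s \<cdot> f' s = cmp u s \<and> w s \<cdot> i' s = cmp v s"
    by (rule choice_range)
    then have W: "w s \<in> Arr C" "Dom C (w s) = Dom C (p' s)" "Cod C (w s) = fst (Cod I v) s"
      "w s \<cdot> f' s = cmp u s" "w s \<cdot> i' s = cmp v s"
      if "1 \<le> s" "s \<le> n" for s using that by blast+
    note [simp] = W comp_eq_comp[OF W(4)] comp_eq_comp[OF W(5)]
    have w [simp]: "mk_arr n Y w (Cod I v) \<in> inf_Arr n C"
    proof (rule mk_arr_in)
      fix s assume s: "1 \<le> s" "s < n"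
      show "snd (Cod I v) s \<cdot> w s = w (Suc s) \<cdot> snd Y s"
        by (rule pushout_epi[OF N(1)[of s]]) (use s in simp_all)
    qed simp_all
    have "mk_arr n Y w (Cod I v) \<cdot>\<^bsub>I\<^esub> mk_arr n (Cod I \<phi>) f' Y = u"
      "mk_arr n Y w (Cod I v) \<cdot>\<^bsub>I\<^esub> mk_arr n (Cod I f) i' Y = v"
      by (rule inf_arr_eqI; simp)+
    then show "\<exists>w. w \<in> Arr I \<and> Dom I w = Cod I (mk_arr n (Cod I f) i' Y) \<and> Cod I w = Cod I v \<and>
      w \<cdot>\<^bsub>I\<^esub> mk_arr n (Cod I \<phi>) f' Y = u \<and> w \<cdot>\<^bsub>I\<^esub> mk_arr n (Cod I f) i' Y = v"
      by (intro exI[of _ "mk_arr n Y w (Cod I v)"]) simp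
  next
    fix u v assume *: "u \<in> Arr I" "v \<in> Arr I" "Cod I u = Cod I v"
      "Dom I u = Cod I (mk_arr n (Cod I f) i' Y)"
      "Dom I v = Cod I (mk_arr n (Cod I f) i' Y)"
      "u \<cdot>\<^bsub>I\<^esub> mk_arr n (Cod I \<phi>) f' Y = v \<cdot>\<^bsub>I\<^esub> mk_arr n (Cod I \<phi>) f' Y"
      "u \<cdot>\<^bsub>I\<^esub> mk_arr n (Cod I f) i' Y = v \<cdot>\<^bsub>I\<^esub> mk_arr n (Cod I f) i' Y"
    show "u = v"
    proof (rule inf_arr_eqI)
      fix s assume s: "1 \<le> s" "s \<le> n"
      have "cmp (u \<cdot>\<^bsub>I\<^esub> mk_arr n (Cod I \<phi>) f' Y) s = cmp (v \<cdot>\<^bsub>I\<^esub> mk_arr n (Cod I \<phi>) f' Y) s"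
        "cmp (u \<cdot>\<^bsub>I\<^esub> mk_arr n (Cod I f) i' Y) s = cmp (v \<cdot>\<^bsub>I\<^esub> mk_arr n (Cod I f) i' Y) s"
        by (simp_all only: *)
      then have e: "cmp u s \<cdot> f' s = cmp v s \<cdot> f' s" "cmp u s \<cdot> i' s = cmp v s \<cdot> i' s"
        using s by simp_all
      show "cmp u s = cmp v s"
        by (rule pushout_epi[OF N(1)[OF s] _ _ _ _ _ e]) (use s * in simp_all)
    qed (use * in simp_all)
  qed simp_all
  moreover have "inflation I (mk_arr n (Cod I f) i' Y)" using conf unfolding inflation_def by blast
  ultimately show ?thesis by blast
qed

text \<open>A pull-back keeps the kernel, so the componentwise pull-backs are extensions of the
  source of \<open>f\<close> by the kernel of \<open>\<phi>\<close>.\<close>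

lemma deflation_pullback_Inf:
  assumes infl: "deflation I \<phi>" and f [simp]: "f \<in> inf_Arr n C" "Cod I f = Cod I \<phi>"
  shows "\<exists>\<phi>' f'. is_pullback I \<phi> f \<phi>' f' \<and> deflation I \<phi>'"
proof -
  obtain k where pq: "(k, \<phi>) \<in> Confl I" using assms by (auto simp: deflation_def)
  note P = Confl_InfD[OF pq]
  have [simp]: "\<phi> \<in> inf_Arr n C" "k \<in> inf_Arr n C" "Cod I k = Dom I \<phi>" using P by auto
  have "\<exists>p' f' i'. is_pullback C (cmp \<phi> s) (cmp f s) p' f' \<and> (i', p') \<in> Confl C \<and>
    Dom C i' = fst (Dom I k) s \<and> f' \<cdot> i' = cmp k s"
    if "1 \<le> s" "s \<le> n" for s
    by (rule confl_pullback[OF P(4)[OF that], of "cmp f s"]) (use that in simp_all, blast)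
  then obtain p' f' i' where "\<forall>s. 1 \<le> s \<and> s \<le> n \<longrightarrow> is_pullback C (cmp \<phi> s) (cmp f s) (p' s) (f' s) \<and>
    (i' s, p' s) \<in> Confl C \<and> Dom C (i' s) = fst (Dom I k) s \<and> f' s \<cdot> i' s = cmp k s"
    by (rule choice_range3)
  then have N: "is_pullback C (cmp \<phi> s) (cmp f s) (p' s) (f' s)" "(i' s, p' s) \<in> Confl C"
    "Dom C (i' s) = fst (Dom I k) s" "f' s \<cdot> i' s = cmp k s"
    if "1 \<le> s" "s \<le> n" for s using that by auto
  have R: "i' s \<in> Arr C" "f' s \<in> Arr C" "p' s \<in> Arr C" "Cod C (p' s) = fst (Dom I f) s"
    "Cod C (f' s) = fst (Dom I \<phi>) s"
    "Dom C (f' s) = Cod C (i' s)" "Dom C (p' s) = Cod C (i' s)" "cmp \<phi> s \<cdot> f' s = cmp f s \<cdot> p' s"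
    "p' s \<cdot> i' s = Zero C (fst (Dom I k) s) (fst (Dom I f) s)"
    if "1 \<le> s" "s \<le> n" for s
    using pullbackD[OF N(1)[OF that]] conflD(1-4)[OF N(2)[OF that]] N(3)[OF that] that by simp_all
  note [simp] = R N(3,4) comp_eq_comp[OF R(8)] comp_eq_comp[OF R(9)] comp_eq_comp[OF N(4)]
  have "\<exists>\<upsilon>. \<upsilon> \<in> Arr C \<and> Cod C \<upsilon> = Cod C (i' (Suc s)) \<and> Dom C \<upsilon> = Cod C (i' s) \<and>
    f' (Suc s) \<cdot> \<upsilon> = snd (Dom I \<phi>) s \<cdot> f' s \<and> p' (Suc s) \<cdot> \<upsilon> = snd (Dom I f) s \<cdot> p' s"
    if s: "1 \<le> s" "s < n" for s
  proof -
    have "cmp \<phi> (Suc s) \<cdot> (snd (Dom I \<phi>) s \<cdot> f' s) = snd (Cod I \<phi>) s \<cdot> (cmp \<phi> s \<cdot> f' s)"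
      using s by (simp del: R(8))
    also have "\<dots> = cmp f (Suc s) \<cdot> (snd (Dom I f) s \<cdot> p' s)" using s by simp
    finally show ?thesis
      by - (rule pullback_induced[OF N(1)[of "Suc s"], of "snd (Dom I \<phi>) s \<cdot> f' s"
        "snd (Dom I f) s \<cdot> p' s"],
        use s in simp_all, blast)
  qed
  then obtain \<upsilon> where "\<forall>s. 1 \<le> s \<and> s < n \<longrightarrow> \<upsilon> s \<in> Arr C \<and> Cod C (\<upsilon> s) = Cod C (i' (Suc s)) \<and>
    Dom C (\<upsilon> s) = Cod C (i' s) \<and>
    f' (Suc s) \<cdot> \<upsilon> s = snd (Dom I \<phi>) s \<cdot> f' s \<and> p' (Suc s) \<cdot> \<upsilon> s = snd (Dom I f) s \<cdot> p' s"
    by (rule choice_step)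
  then have U: "\<upsilon> s \<in> Arr C" "Cod C (\<upsilon> s) = Cod C (i' (Suc s))" "Dom C (\<upsilon> s) = Cod C (i' s)"
    "f' (Suc s) \<cdot> \<upsilon> s = snd (Dom I \<phi>) s \<cdot> f' s" "p' (Suc s) \<cdot> \<upsilon> s = snd (Dom I f) s \<cdot> p' s"
    if "1 \<le> s" "s < n" for s using that by blast+
  note [simp] = U comp_eq_comp[OF U(4)] comp_eq_comp[OF U(5)]
  define Y where "Y = mk_obj n (\<lambda>s. Cod C (i' s)) \<upsilon>"
  have i'\<upsilon>: "\<upsilon> s \<cdot> i' s = i' (Suc s) \<cdot> snd (Dom I k) s" if s: "1 \<le> s" "s < n" for s
    by (rule pullback_mono[OF N(1)[of "Suc s"]]) (use s in simp_all)
  have Y: "Y \<in> inf_Obj n C" and p': "mk_arr n Y p' (Dom I f) \<in> inf_Arr n C"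
    and conf: "(mk_arr n (Dom I k) i' Y, mk_arr n Y p' (Dom I f)) \<in> Confl I"
    unfolding Y_def by (rule Inf_extension(1,3,4)[of "Dom I k" "Dom I f" i' p' \<upsilon>]; use i'\<upsilon> N(2)
      in simp)+
  have f': "mk_arr n Y f' (Dom I \<phi>) \<in> inf_Arr n C"
    by (rule mk_arr_in) (use Y in \<open>simp_all add: Y_def\<close>)
  note [simp] = Y p' f'
  have Ys [simp]: "fst Y s = Cod C (i' s)" if "1 \<le> s" "s \<le> n" for s using that by (simp add: Y_def)
  have Ys' [simp]: "snd Y s = \<upsilon> s" if "1 \<le> s" "s < n" for s using that by (simp add: Y_def)
  have "is_pullback I \<phi> f (mk_arr n Y p' (Dom I f)) (mk_arr n Y f' (Dom I \<phi>))"
  proof (rule I.pullbackI)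
    show "\<phi> \<cdot>\<^bsub>I\<^esub> mk_arr n Y f' (Dom I \<phi>) = f \<cdot>\<^bsub>I\<^esub> mk_arr n Y p' (Dom I f)"
      by (rule inf_arr_eqI) simp_all
  next
    fix u v assume "u \<in> Arr I" "v \<in> Arr I" "Dom I u = Dom I v" "Cod I u = Dom I \<phi>" "Cod I v = Dom I f"
      and uv: "\<phi> \<cdot>\<^bsub>I\<^esub> u = f \<cdot>\<^bsub>I\<^esub> v"
    then have [simp]: "u \<in> inf_Arr n C" "v \<in> inf_Arr n C" "Dom I u = Dom I v" "Cod I u = Dom I \<phi>"
      "Cod I v = Dom I f" by auto
    have "\<exists>w. w \<in> Arr C \<and> Cod C w = Cod C (i' s) \<and> Dom C w = fst (Dom I v) s \<and> f' s \<cdot> w = cmp u s \<and>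
      p' s \<cdot> w = cmp v s"
      if s: "1 \<le> s" "s \<le> n" for s
    proof -
      have "cmp (\<phi> \<cdot>\<^bsub>I\<^esub> u) s = cmp (f \<cdot>\<^bsub>I\<^esub> v) s" by (simp only: uv)
      then show ?thesis
        by - (rule pullback_induced[OF N(1)[OF s], of "cmp u s" "cmp v s"], use s in simp_all, blast)
    qed
    then obtain w where "\<forall>s. 1 \<le> s \<and> s \<le> n \<longrightarrow> w s \<in> Arr C \<and> Cod C (w s) = Cod C (i' s) \<and>
      Dom C (w s) = fst (Dom I v) s \<and> f' s \<cdot> w s = cmp u s \<and> p' s \<cdot> w s = cmp v s"
    by (rule choice_range)
    then have W: "w s \<in> Arr C" "Cod C (w s) = Cod C (i' s)" "Dom C (w s) = fst (Dom I v) s"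
      "f' s \<cdot> w s = cmp u s" "p' s \<cdot> w s = cmp v s"
      if "1 \<le> s" "s \<le> n" for s using that by blast+
    note [simp] = W comp_eq_comp[OF W(4)] comp_eq_comp[OF W(5)]
    have w [simp]: "mk_arr n (Dom I v) w Y \<in> inf_Arr n C"
    proof (rule mk_arr_in)
      fix s assume s: "1 \<le> s" "s < n"
      show "snd Y s \<cdot> w s = w (Suc s) \<cdot> snd (Dom I v) s"
        by (rule pullback_mono[OF N(1)[of "Suc s"]]) (use s in simp_all)
    qed simp_all
    have "mk_arr n Y f' (Dom I \<phi>) \<cdot>\<^bsub>I\<^esub> mk_arr n (Dom I v) w Y = u"
      "mk_arr n Y p' (Dom I f) \<cdot>\<^bsub>I\<^esub> mk_arr n (Dom I v) w Y = v"
      by (rule inf_arr_eqI; simp)+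
    then show "\<exists>w. w \<in> Arr I \<and> Cod I w = Dom I (mk_arr n Y p' (Dom I f)) \<and> Dom I w = Dom I v \<and>
      mk_arr n Y f' (Dom I \<phi>) \<cdot>\<^bsub>I\<^esub> w = u \<and> mk_arr n Y p' (Dom I f) \<cdot>\<^bsub>I\<^esub> w = v"
      by (intro exI[of _ "mk_arr n (Dom I v) w Y"]) simp
  next
    fix u v assume *: "u \<in> Arr I" "v \<in> Arr I" "Dom I u = Dom I v"
      "Cod I u = Dom I (mk_arr n Y p' (Dom I f))"
      "Cod I v = Dom I (mk_arr n Y p' (Dom I f))"
      "mk_arr n Y f' (Dom I \<phi>) \<cdot>\<^bsub>I\<^esub> u = mk_arr n Y f' (Dom I \<phi>) \<cdot>\<^bsub>I\<^esub> v"
      "mk_arr n Y p' (Dom I f) \<cdot>\<^bsub>I\<^esub> u = mk_arr n Y p' (Dom I f) \<cdot>\<^bsub>I\<^esub> v"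
    show "u = v"
    proof (rule inf_arr_eqI)
      fix s assume s: "1 \<le> s" "s \<le> n"
      have "cmp (mk_arr n Y f' (Dom I \<phi>) \<cdot>\<^bsub>I\<^esub> u) s = cmp (mk_arr n Y f' (Dom I \<phi>) \<cdot>\<^bsub>I\<^esub> v) s"
        "cmp (mk_arr n Y p' (Dom I f) \<cdot>\<^bsub>I\<^esub> u) s = cmp (mk_arr n Y p' (Dom I f) \<cdot>\<^bsub>I\<^esub> v) s"
        by (simp_all only: *)
      then have e: "f' s \<cdot> cmp u s = f' s \<cdot> cmp v s" "p' s \<cdot> cmp u s = p' s \<cdot> cmp v s"
        using s by simp_all
      show "cmp u s = cmp v s"
        by (rule pullback_mono[OF N(1)[OF s] _ _ _ _ _ e]) (use s * in simp_all)
    qed (use * in simp_all)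
  qed simp_all
  moreover have "deflation I (mk_arr n Y p' (Dom I f))" using conf unfolding deflation_def by blast
  ultimately show ?thesis by blast
qed

lemma Inf_exact: "exact_category I"
  by (intro exact_category.intro Inf_additive exact_category_axioms.intro)
    (use Confl_Inf_kernel_cokernel Confl_Inf_iso_closed inflation_Ident_Inf inflation_Comp_Inf
      deflation_Comp_Inf
      inflation_pushout_Inf deflation_pullback_Inf in simp_all)

sublocale I: exact_category I by (rule Inf_exact)

end

text \<open>\<open>dependent_nat_choice\<close> counts from 0 without bound. All constraints are
  guarded: index 0 is arbitrary, the step from 0 to 1 uses \<open>base\<close>, and nothing is
  required beyond \<open>n\<close>.\<close>

lemma dependent_choice_range:
  assumes base: "1 \<le> n \<Longrightarrow> \<exists>x. P 1 x"
    and step: "\<And>s x. 1 \<le> s \<Longrightarrow> s < n \<Longrightarrow> P s x \<Longrightarrow> \<exists>y. P (Suc s) y \<and> R s x y"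
  obtains f where "\<forall>s::nat. 1 \<le> s \<and> s \<le> n \<longrightarrow> P s (f s)" "\<forall>s. 1 \<le> s \<and> s < n \<longrightarrow> R s (f s) (f (Suc s))"
proof -
  have "\<exists>f. \<forall>s. (1 \<le> s \<and> s \<le> n \<longrightarrow> P s (f s)) \<and> (1 \<le> s \<and> s < n \<longrightarrow> R s (f s) (f (Suc s)))"
  proof (rule dependent_nat_choice)
    fix x s assume x: "1 \<le> s \<and> s \<le> n \<longrightarrow> P s x"
    show "\<exists>y. (1 \<le> Suc s \<and> Suc s \<le> n \<longrightarrow> P (Suc s) y) \<and> (1 \<le> s \<and> s < n \<longrightarrow> R s x y)"
    proof (cases "s = 0")
      case True
      then show ?thesis using base by auto
    next
      case False
      then show ?thesis using step[of s x] x by (cases "s < n") auto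
    qed
  qed simp
  then show thesis using that by blast
qed

section \<open>The Frobenius property of inflation sequences\<close>

locale inflation_frobenius = frobenius_category C + inflation_category C n
  for C :: "('o, 'm, 'x) exact_cat_scheme" (structure) and n :: nat
begin

text \<open>Lifts are chosen along the sequence. An independent lift at the next index misses
  compatibility by \<open>d\<close>, which is killed by the deflation, so subtracting a multiple of
  \<open>d\<close> leaves it a lift.\<close>

lemma projective_InfI:
  assumes X: "X \<in> inf_Obj n C" and proj: "\<And>s. 1 \<le> s \<Longrightarrow> s \<le> n \<Longrightarrow> projective C (fst X s)"
  shows "projective I X"
  unfolding projective_def
proof (intro conjI allI impI)
  fix \<psi> g assume "deflation I \<psi>" and "g \<in> Hom I X (Cod I \<psi>)"
  then obtain \<phi> where conf: "(\<phi>, \<psi>) \<in> Confl I" and g [simp]: "g \<in> inf_Arr n C" "Dom I g = X"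
    "Cod I g = Cod I \<psi>"
    by (auto simp: deflation_def Hom_iff)
  note P = Confl_InfD[OF conf]
  note [simp] = X P(2)
  define L where "L s h \<longleftrightarrow> h \<in> Arr C \<and> Dom C h = fst X s \<and> Cod C h = fst (Dom I \<psi>) s \<and>
    cmp \<psi> s \<cdot> h = cmp g s" for s h
  have lift: "\<exists>h. L s h" if s: "1 \<le> s" "s \<le> n" for s
  proof -
    have "deflation C (cmp \<psi> s)" using P(4)[OF s] by (auto simp: deflation_def)
    then show ?thesis unfolding L_def
      by - (rule projectiveE[OF proj[OF s], of "cmp \<psi> s" "cmp g s"], use s in simp_all, blast)
  qed
  obtain h where h1: "\<forall>s. 1 \<le> s \<and> s \<le> n \<longrightarrow> L s (h s)"
    and h2: "\<forall>s. 1 \<le> s \<and> s < n \<longrightarrow> snd (Dom I \<psi>) s \<cdot> h s = h (Suc s) \<cdot> snd X s"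
  proof (rule dependent_choice_range[of n L "\<lambda>s h h'. snd (Dom I \<psi>) s \<cdot> h = h' \<cdot> snd X s"])
    fix s h assume s: "1 \<le> s" "s < n" and "L s h"
    then have h: "h \<in> Arr C" "Dom C h = fst X s" "Cod C h = fst (Dom I \<psi>) s"
      "cmp \<psi> s \<cdot> h = cmp g s" by (auto simp: L_def)
    obtain h0 where h0: "h0 \<in> Arr C" "Dom C h0 = fst X (Suc s)" "Cod C h0 = fst (Dom I \<psi>) (Suc s)"
      "cmp \<psi> (Suc s) \<cdot> h0 = cmp g (Suc s)"
      using lift[of "Suc s"] s by (auto simp: L_def)
    \<comment> \<open>Projectives are injective, so the structure map of \<open>X\<close> has a
      retraction \<open>r\<close>. This extends \<open>d\<close> to the next index as
      \<open>d \<cdot> r\<close>.\<close>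
    have "injective C (fst X s)" using proj[of s] projective_iff_injective s by simp
    then obtain r where r: "r \<in> Arr C" "Dom C r = fst X (Suc s)" "Cod C r = fst X s"
      "r \<cdot> snd X s = Ident C (fst X s)"
      by (rule injectiveE[of "fst X s" "snd X s" "Ident C (fst X s)"]) (use s inf_obj_inflation
        in simp_all)
    note [simp] = h(1-3) h0(1-3) r(1-3)
    define d where "d = h0 \<cdot> snd X s \<boxplus> neg C (snd (Dom I \<psi>) s \<cdot> h)"
    have d [simp]: "d \<in> Arr C" "Dom C d = fst X s" "Cod C d = fst (Dom I \<psi>) (Suc s)"
      using s by (simp_all add: d_def)
    have "cmp \<psi> (Suc s) \<cdot> (snd (Dom I \<psi>) s \<cdot> h) = snd (Cod I \<psi>) s \<cdot> (cmp \<psi> s \<cdot> h)" using s by simp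
    also have "\<dots> = cmp g (Suc s) \<cdot> snd X s" unfolding h(4) using s by simp
    finally have \<psi>d: "cmp \<psi> (Suc s) \<cdot> d = Zero C (fst X s) (fst (Cod I \<psi>) (Suc s))"
      unfolding d_def using s by (simp add: comp_eq_comp[OF h0(4)])
    have "L (Suc s) (h0 \<boxplus> neg C (d \<cdot> r))"
      unfolding L_def using s h0(4) by (simp add: comp_eq_comp[OF \<psi>d])
    moreover have "snd (Dom I \<psi>) s \<cdot> h = (h0 \<boxplus> neg C (d \<cdot> r)) \<cdot> snd X s"
      using s r(4) by (simp add: d_def)
    ultimately show "\<exists>y. L (Suc s) y \<and> snd (Dom I \<psi>) s \<cdot> h = y \<cdot> snd X s" by blast
  qed (use lift in auto)
  have H: "h s \<in> Arr C" "Dom C (h s) = fst X s" "Cod C (h s) = fst (Dom I \<psi>) s"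
    "cmp \<psi> s \<cdot> h s = cmp g s"
    if "1 \<le> s" "s \<le> n" for s using h1 that by (auto simp: L_def)
  note [simp] = H
  have [simp]: "mk_arr n X h (Dom I \<psi>) \<in> inf_Arr n C" by (rule mk_arr_in) (use h2 in simp_all)
  have "\<psi> \<cdot>\<^bsub>I\<^esub> mk_arr n X h (Dom I \<psi>) = g" by (rule inf_arr_eqI) simp_all
  then show "\<exists>h\<in>Hom I X (Dom I \<psi>). \<psi> \<cdot>\<^bsub>I\<^esub> h = g"
    by (intro bexI[of _ "mk_arr n X h (Dom I \<psi>)"]) (simp_all add: Hom_iff)
qed (use X in simp)

text \<open>The defect of an independent extension at the next index vanishes on the inflation,
  hence comes from the cokernel sequence, along whose structure map it extends into the injective
  target.\<close>

lemma injective_InfI: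
  assumes X: "X \<in> inf_Obj n C" and inj: "\<And>s. 1 \<le> s \<Longrightarrow> s \<le> n \<Longrightarrow> injective C (fst X s)"
  shows "injective I X"
  unfolding injective_def
proof (intro conjI allI impI)
  fix \<phi> g assume "inflation I \<phi>" and "g \<in> Hom I (Dom I \<phi>) X"
  then obtain \<psi> where conf: "(\<phi>, \<psi>) \<in> Confl I" and g [simp]: "g \<in> inf_Arr n C" "Cod I g = X"
    "Dom I g = Dom I \<phi>"
    by (auto simp: inflation_def Hom_iff)
  note P = Confl_InfD[OF conf]
  note [simp] = X P(1,2)
  have PD [simp]: "Dom I \<psi> = Cod I \<phi>" using P(3) by simp
  define L where "L s h \<longleftrightarrow> h \<in> Arr C \<and> Dom C h = fst (Cod I \<phi>) s \<and> Cod C h = fst X s \<and>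
    h \<cdot> cmp \<phi> s = cmp g s" for s h
  have lift: "\<exists>h. L s h" if s: "1 \<le> s" "s \<le> n" for s
  proof -
    have "inflation C (cmp \<phi> s)" using P(4)[OF s] by (auto simp: inflation_def)
    then show ?thesis unfolding L_def
      by - (rule injectiveE[OF inj[OF s], of "cmp \<phi> s" "cmp g s"], use s in simp_all, blast)
  qed
  obtain h where h1: "\<forall>s. 1 \<le> s \<and> s \<le> n \<longrightarrow> L s (h s)"
    and h2: "\<forall>s. 1 \<le> s \<and> s < n \<longrightarrow> snd X s \<cdot> h s = h (Suc s) \<cdot> snd (Cod I \<phi>) s"
  proof (rule dependent_choice_range[of n L "\<lambda>s h h'. snd X s \<cdot> h = h' \<cdot> snd (Cod I \<phi>) s"])
    fix s h assume s: "1 \<le> s" "s < n" and "L s h"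
    then have h: "h \<in> Arr C" "Dom C h = fst (Cod I \<phi>) s" "Cod C h = fst X s"
      "h \<cdot> cmp \<phi> s = cmp g s" by (auto simp: L_def)
    obtain h0 where h0: "h0 \<in> Arr C" "Dom C h0 = fst (Cod I \<phi>) (Suc s)" "Cod C h0 = fst X (Suc s)"
      "h0 \<cdot> cmp \<phi> (Suc s) = cmp g (Suc s)"
      using lift[of "Suc s"] s by (auto simp: L_def)
    note [simp] = h h0 comp_eq_comp[OF h(4)] comp_eq_comp[OF h0(4)]
    define d where "d = snd X s \<cdot> h \<boxplus> neg C (h0 \<cdot> snd (Cod I \<phi>) s)"
    have d [simp]: "d \<in> Arr C" "Dom C d = fst (Cod I \<phi>) s" "Cod C d = fst X (Suc s)"
      using s by (simp_all add: d_def)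
    have \<psi>\<phi>: "cmp \<psi> (Suc s) \<cdot> cmp \<phi> (Suc s) = Zero C (fst (Dom I \<phi>) (Suc s)) (fst (Cod I \<psi>) (Suc s))"
      using conflD(4)[OF P(4)[of "Suc s"]] s by simp
    \<comment> \<open>Both composites restrict to the same arrow, since \<open>h\<close> and
      \<open>h0\<close> extend the components of \<open>g\<close> and \<open>g\<close> is a
      morphism.\<close>
    have "d \<cdot> cmp \<phi> s = Zero C (fst (Dom I \<phi>) s) (Cod C d)"
      unfolding d_def using s by simp
    then obtain e where e: "e \<in> Arr C" "Cod C e = fst X (Suc s)" "Dom C e = fst (Cod I \<psi>) s"
      "e \<cdot> cmp \<psi> s = d"
      by - (rule confl_descend[OF P(4)[of s], of d], use s in simp_all)
    obtain e' where e': "e' \<in> Arr C" "Dom C e' = fst (Cod I \<psi>) (Suc s)" "Cod C e' = fst X (Suc s)"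
      "e' \<cdot> snd (Cod I \<psi>) s = e"
      by (rule injectiveE[OF inj[of "Suc s"], of "snd (Cod I \<psi>) s" e]) (use s e inf_obj_inflation
        in simp_all)
    have "e' \<cdot> (cmp \<psi> (Suc s) \<cdot> snd (Cod I \<phi>) s) = e' \<cdot> (snd (Cod I \<psi>) s \<cdot> cmp \<psi> s)" using s by simp
    also have "\<dots> = d" using s e e' by (simp add: comp_eq_comp[OF e'(4)] del: inf_nat)
    finally have nat: "e' \<cdot> (cmp \<psi> (Suc s) \<cdot> snd (Cod I \<phi>) s) = d" .
    \<comment> \<open>The correction passes through the cokernel at index \<open>Suc s\<close>, so
      it does not affect the values along \<open>\<phi>\<close>.\<close>
    have "L (Suc s) (h0 \<boxplus> e' \<cdot> cmp \<psi> (Suc s))"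
      unfolding L_def using s e' by (simp add: \<psi>\<phi>)
    moreover have "h0 \<cdot> snd (Cod I \<phi>) s \<boxplus> d = snd X s \<cdot> h"
      unfolding d_def using s by (subst plus_left_comm) simp_all
    then have "snd X s \<cdot> h = (h0 \<boxplus> e' \<cdot> cmp \<psi> (Suc s)) \<cdot> snd (Cod I \<phi>) s"
      using s e' nat by simp
    ultimately show "\<exists>y. L (Suc s) y \<and> snd X s \<cdot> h = y \<cdot> snd (Cod I \<phi>) s" by blast
  qed (use lift in auto)
  have H: "h s \<in> Arr C" "Dom C (h s) = fst (Cod I \<phi>) s" "Cod C (h s) = fst X s"
    "h s \<cdot> cmp \<phi> s = cmp g s"
    if "1 \<le> s" "s \<le> n" for s using h1 that by (auto simp: L_def)
  note [simp] = H
  have [simp]: "mk_arr n (Cod I \<phi>) h X \<in> inf_Arr n C" by (rule mk_arr_in) (use h2 in simp_all)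
  have "mk_arr n (Cod I \<phi>) h X \<cdot>\<^bsub>I\<^esub> \<phi> = g" by (rule inf_arr_eqI) simp_all
  then show "\<exists>h\<in>Hom I (Cod I \<phi>) X. h \<cdot>\<^bsub>I\<^esub> \<phi> = g"
    by (intro bexI[of _ "mk_arr n (Cod I \<phi>) h X"]) (simp_all add: Hom_iff)
qed (use X in simp)

text \<open>The cover at each index extends the previous one. The state of the recursion is the
  whole conflation, because the kernels must become an inflation sequence as well.\<close>

lemma componentwise_projective_cover:
  assumes X: "X \<in> inf_Obj n C"
  obtains u where "deflation I u" "Cod I u = X" "\<And>s. 1 \<le> s \<Longrightarrow> s \<le> n \<Longrightarrow> projective C (fst (Dom I u) s)"
proof -
  note [simp] = X
  define L where "L s t \<longleftrightarrow> t \<in> Confl C \<and> Cod C (snd t) = fst X s \<and> projective C (Dom C (snd t))" for s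
    and t :: "'m \<times> 'm"
  \<comment> \<open>The pair \<open>m\<close> holds the inflations between consecutive kernels and
    between consecutive covers. It depends on two states, so the recursion only records its
    existence and \<open>choice_step\<close> selects it afterwards.\<close>
  define R where "R s t t' m \<longleftrightarrow> inflation C (fst m) \<and> inflation C (snd m) \<and>
    Dom C (fst m) = Dom C (fst t) \<and> Cod C (fst m) = Dom C (fst t') \<and>
    Dom C (snd m) = Dom C (snd t) \<and> Cod C (snd m) = Dom C (snd t') \<and> snd t' \<cdot> snd m = snd X s \<cdot> snd t \<and>
      fst t' \<cdot> fst m = snd m \<cdot> fst t"
    for s and t t' :: "'m \<times> 'm" and m
  obtain t where t1: "\<forall>s. 1 \<le> s \<and> s \<le> n \<longrightarrow> L s (t s)" and t2:
    "\<forall>s. 1 \<le> s \<and> s < n \<longrightarrow> (\<exists>m. R s (t s) (t (Suc s)) m)"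
  proof (rule dependent_choice_range[of n L "\<lambda>s x y. \<exists>m. R s x y m"])
    assume "1 \<le> n"
    then obtain k u where "(k, u) \<in> Confl C" "Cod C u = fst X 1" "projective C (Dom C u)"
      using enough_projectives[of "fst X 1"] by (auto simp: deflation_def)
    then show "\<exists>x. L 1 x" by (intro exI[of _ "(k, u)"]) (simp add: L_def)
  next
    fix s x assume s: "1 \<le> s" "s < n" and "L s x"
    then have x: "(fst x, snd x) \<in> Confl C" "Cod C (snd x) = Dom C (snd X s)"
      "projective C (Dom C (snd x))" by (simp_all add: L_def)
    obtain k' u' \<kappa> \<pi> where "(k', u') \<in> Confl C" "Cod C u' = Cod C (snd X s)" "projective C (Dom C u')"
    "inflation C \<kappa>" "inflation C \<pi>" "Dom C \<kappa> = Dom C (fst x)" "Cod C \<kappa> = Dom C k'"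
    "Dom C \<pi> = Dom C (snd x)"
    "Cod C \<pi> = Dom C u'" "u' \<cdot> \<pi> = snd X s \<cdot> snd x" "k' \<cdot> \<kappa> = \<pi> \<cdot> fst x"
      by (rule projective_resolution_step[OF inf_obj_inflation[OF X s] x])
    then have "L (Suc s) (k', u') \<and> R s x (k', u') (\<kappa>, \<pi>)" using s by (simp add: L_def R_def)
    then show "\<exists>y. L (Suc s) y \<and> (\<exists>m. R s x y m)" by blast
  qed
  obtain m where m: "\<forall>s. 1 \<le> s \<and> s < n \<longrightarrow> R s (t s) (t (Suc s)) (m s)"
    by (rule choice_step[of n "\<lambda>s. R s (t s) (t (Suc s))"]) (use t2 in auto)
  define k where "k s = fst (t s)" for s
  define u where "u s = snd (t s)" for s
  define \<kappa> where "\<kappa> s = fst (m s)" for s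
  define \<pi> where "\<pi> s = snd (m s)" for s
  have ku: "(k s, u s) \<in> Confl C" "Cod C (u s) = fst X s" "projective C (Dom C (u s))"
    if "1 \<le> s" "s \<le> n" for s
    using t1 that by (auto simp: L_def k_def u_def)
  have M: "inflation C (\<kappa> s)" "inflation C (\<pi> s)" "Dom C (\<kappa> s) = Dom C (k s)"
    "Cod C (\<kappa> s) = Dom C (k (Suc s))"
    "Dom C (\<pi> s) = Dom C (u s)" "Cod C (\<pi> s) = Dom C (u (Suc s))" "u (Suc s) \<cdot> \<pi> s = snd X s \<cdot> u s"
    "k (Suc s) \<cdot> \<kappa> s = \<pi> s \<cdot> k s"
    if "1 \<le> s" "s < n" for s using m that by (auto simp: R_def k_def u_def \<kappa>_def \<pi>_def)
  note [simp] = conflD(1-3)[OF ku(1)] ku(2) M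
  define K where "K = mk_obj n (\<lambda>s. Dom C (k s)) \<kappa>"
  define P where "P = mk_obj n (\<lambda>s. Dom C (u s)) \<pi>"
  have K: "K \<in> inf_Obj n C" unfolding K_def by (rule mk_obj_in) simp_all
  have P: "P \<in> inf_Obj n C" unfolding P_def by (rule mk_obj_in) simp_all
  have "mk_arr n K k P \<in> inf_Arr n C" "mk_arr n P u X \<in> inf_Arr n C"
    by (rule mk_arr_in; use K P in \<open>simp add: K_def P_def\<close>)+
  then have "(mk_arr n K k P, mk_arr n P u X) \<in> Confl I" unfolding Confl_Inf_iff using ku by simp
  then have "deflation I (mk_arr n P u X)" unfolding deflation_def by blast
  then show thesis by (rule that) (simp_all add: P_def ku(3))
qed

lemma componentwise_injective_hull:
  assumes X: "X \<in> inf_Obj n C"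
  obtains u where "inflation I u" "Dom I u = X" "\<And>s. 1 \<le> s \<Longrightarrow> s \<le> n \<Longrightarrow> injective C (fst (Cod I u) s)"
proof -
  note [simp] = X
  define L where "L s t \<longleftrightarrow> t \<in> Confl C \<and> Dom C (fst t) = fst X s \<and> injective C (Cod C (fst t))" for s
    and t :: "'m \<times> 'm"
  define R where "R s t t' m \<longleftrightarrow> inflation C (fst m) \<and> inflation C (snd m) \<and>
    Dom C (fst m) = Cod C (snd t) \<and> Cod C (fst m) = Cod C (snd t') \<and>
    Dom C (snd m) = Cod C (fst t) \<and> Cod C (snd m) = Cod C (fst t') \<and> snd m \<cdot> fst t = fst t' \<cdot> snd X s \<and>
      fst m \<cdot> snd t = snd t' \<cdot> snd m"
    for s and t t' :: "'m \<times> 'm" and m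
  obtain t where t1: "\<forall>s. 1 \<le> s \<and> s \<le> n \<longrightarrow> L s (t s)" and t2:
    "\<forall>s. 1 \<le> s \<and> s < n \<longrightarrow> (\<exists>m. R s (t s) (t (Suc s)) m)"
  proof (rule dependent_choice_range[of n L "\<lambda>s x y. \<exists>m. R s x y m"])
    assume "1 \<le> n"
    then obtain k u where "(u, k) \<in> Confl C" "Dom C u = fst X 1" "injective C (Cod C u)"
      using enough_injectives[of "fst X 1"] by (auto simp: inflation_def)
    then show "\<exists>x. L 1 x" by (intro exI[of _ "(u, k)"]) (simp add: L_def)
  next
    fix s x assume s: "1 \<le> s" "s < n" and "L s x"
    then have x: "(fst x, snd x) \<in> Confl C" "Dom C (fst x) = Dom C (snd X s)"
      "injective C (Cod C (fst x))" by (simp_all add: L_def)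
    obtain u' k' \<zeta> \<pi> where "(u', k') \<in> Confl C" "Dom C u' = Cod C (snd X s)" "injective C (Cod C u')"
    "inflation C \<zeta>" "inflation C \<pi>" "Dom C \<zeta> = Cod C (snd x)" "Cod C \<zeta> = Cod C k'"
    "Dom C \<pi> = Cod C (fst x)"
    "Cod C \<pi> = Cod C u'" "\<pi> \<cdot> fst x = u' \<cdot> snd X s" "\<zeta> \<cdot> snd x = k' \<cdot> \<pi>"
      by (rule injective_resolution_step[OF inf_obj_inflation[OF X s] x])
    then have "L (Suc s) (u', k') \<and> R s x (u', k') (\<zeta>, \<pi>)" using s by (simp add: L_def R_def)
    then show "\<exists>y. L (Suc s) y \<and> (\<exists>m. R s x y m)" by blast
  qed
  obtain m where m: "\<forall>s. 1 \<le> s \<and> s < n \<longrightarrow> R s (t s) (t (Suc s)) (m s)"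
    by (rule choice_step[of n "\<lambda>s. R s (t s) (t (Suc s))"]) (use t2 in auto)
  define u where "u s = fst (t s)" for s
  define k where "k s = snd (t s)" for s
  define \<zeta> where "\<zeta> s = fst (m s)" for s
  define \<pi> where "\<pi> s = snd (m s)" for s
  have ku: "(u s, k s) \<in> Confl C" "Dom C (u s) = fst X s" "injective C (Cod C (u s))"
    if "1 \<le> s" "s \<le> n" for s
    using t1 that by (auto simp: L_def k_def u_def)
  have M: "inflation C (\<zeta> s)" "inflation C (\<pi> s)" "Dom C (\<zeta> s) = Cod C (k s)"
    "Cod C (\<zeta> s) = Cod C (k (Suc s))"
    "Dom C (\<pi> s) = Cod C (u s)" "Cod C (\<pi> s) = Cod C (u (Suc s))" "\<pi> s \<cdot> u s = u (Suc s) \<cdot> snd X s"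
    "\<zeta> s \<cdot> k s = k (Suc s) \<cdot> \<pi> s"
    if "1 \<le> s" "s < n" for s using m that by (auto simp: R_def k_def u_def \<zeta>_def \<pi>_def)
  have ku': "u s \<in> Arr C" "k s \<in> Arr C" "Dom C (k s) = Cod C (u s)" if "1 \<le> s" "s \<le> n" for s
    using conflD(1-3)[OF ku(1)[OF that]] by auto
  note [simp] = ku' ku(2) M
  define Z where "Z = mk_obj n (\<lambda>s. Cod C (k s)) \<zeta>"
  define P where "P = mk_obj n (\<lambda>s. Cod C (u s)) \<pi>"
  have Z: "Z \<in> inf_Obj n C" unfolding Z_def by (rule mk_obj_in) simp_all
  have P: "P \<in> inf_Obj n C" unfolding P_def by (rule mk_obj_in) simp_all
  have "mk_arr n X u P \<in> inf_Arr n C" "mk_arr n P k Z \<in> inf_Arr n C"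
    by (rule mk_arr_in; use Z P in \<open>simp add: Z_def P_def\<close>)+
  then have "(mk_arr n X u P, mk_arr n P k Z) \<in> Confl I" unfolding Confl_Inf_iff using ku by simp
  then have "inflation I (mk_arr n X u P)" unfolding inflation_def by blast
  then show thesis by (rule that) (simp_all add: P_def ku(3))
qed

text \<open>A projective sequence is a retract of its componentwise projective cover, and retracts
  are taken at each index.\<close>

lemma projective_InfD:
  assumes X: "projective I X" and s: "1 \<le> s" "s \<le> n"
  shows "projective C (fst X s)"
proof -
  have X' [simp]: "X \<in> inf_Obj n C" using X by (simp add: projective_def)
  obtain u where u: "deflation I u" "Cod I u = X" "projective C (fst (Dom I u) s)"
    using componentwise_projective_cover[OF X'] s by metis
  have [simp]: "u \<in> inf_Arr n C" using I.deflationD[OF u(1)] by simp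
  obtain v where v: "v \<in> Arr I" "Dom I v = X" "Cod I v = Dom I u" "u \<cdot>\<^bsub>I\<^esub> v = Ident I X"
    by (rule I.projectiveE[OF X u(1), of "Ident I X"]) (use u(2) in simp_all)
  have "cmp (u \<cdot>\<^bsub>I\<^esub> v) s = cmp (Ident I X) s" by (simp only: v(4))
  then show ?thesis
    using projective_retract[OF u(3), of "cmp u s" "cmp v s"] u(2) v(1-3) s by simp
qed

lemma injective_InfD:
  assumes X: "injective I X" and s: "1 \<le> s" "s \<le> n"
  shows "injective C (fst X s)"
proof -
  have X' [simp]: "X \<in> inf_Obj n C" using X by (simp add: injective_def)
  obtain u where u: "inflation I u" "Dom I u = X" "injective C (fst (Cod I u) s)"
    using componentwise_injective_hull[OF X'] s by metis
  have [simp]: "u \<in> inf_Arr n C" using I.inflationD[OF u(1)] by simp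
  obtain v where v: "v \<in> Arr I" "Cod I v = X" "Dom I v = Cod I u" "v \<cdot>\<^bsub>I\<^esub> u = Ident I X"
    by (rule I.injectiveE[OF X u(1), of "Ident I X"]) (use u(2) in simp_all)
  have "cmp (v \<cdot>\<^bsub>I\<^esub> u) s = cmp (Ident I X) s" by (simp only: v(4))
  then show ?thesis
    using injective_retract[OF u(3), of "cmp v s" "cmp u s"] u(2) v(1-3) s by simp
qed

text \<open>Projective and injective objects are both described componentwise, so the two classes
  agree because they agree in \<open>C\<close>; the componentwise covers and hulls supply enough of
  them.\<close>

theorem Inf_frobenius: "frobenius_category I"
proof (intro frobenius_category.intro Inf_exact frobenius_category_axioms.intro)
  fix X assume "X \<in> Obj I"
  then have X: "X \<in> inf_Obj n C" by simp
  obtain u where u: "deflation I u" "Cod I u = X" "\<And>s. 1 \<le> s \<Longrightarrow> s \<le> n \<Longrightarrow> projective C (fst (Dom I u) s)"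
    using componentwise_projective_cover[OF X] by metis
  then show "\<exists>p. deflation I p \<and> Cod I p = X \<and> projective I (Dom I p)"
    using projective_InfI[of "Dom I u"] I.deflationD[OF u(1)] by (intro exI[of _ u]) simp
  obtain v where v: "inflation I v" "Dom I v = X" "\<And>s. 1 \<le> s \<Longrightarrow> s \<le> n \<Longrightarrow> injective C (fst (Cod I v) s)"
    using componentwise_injective_hull[OF X] by metis
  then show "\<exists>i. inflation I i \<and> Dom I i = X \<and> injective I (Cod I i)"
    using injective_InfI[of "Cod I v"] I.inflationD[OF v(1)] by (intro exI[of _ v]) simp
next
  fix X
  show "projective I X \<longleftrightarrow> injective I X"
  proof
    assume "projective I X"
    then show "injective I X"
      by (intro injective_InfI) (auto simp: projective_iff_injective[symmetric] dest: projective_InfD,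
        simp add: projective_def)
  next
    assume "injective I X"
    then show "projective I X"
      by (intro projective_InfI) (auto simp: projective_iff_injective dest: injective_InfD, simp add:
        injective_def)
  qed
qed

end

section \<open>The functor induced on inflation sequences\<close>

locale Inf_quotient_functor = quotient_functor C D F
  for C :: "('o, 'm, 'x) exact_cat_scheme" and D :: "('p, 'q, 'y) exact_cat_scheme"
    and F :: "('o, 'm, 'p, 'q) cat_functor" +
  fixes n :: nat
begin

sublocale CI: inflation_frobenius C n by unfold_locales
sublocale DI: inflation_frobenius D n by unfold_locales

abbreviation "IF \<equiv> Inf_functor n F"

lemma IF_obj_eq: "FObj IF X = mk_obj n (\<lambda>s. F\<^sub>o (fst X s)) (\<lambda>s. F\<^sub>a (snd X s))"
  by (cases X) (simp add: Inf_functor_def mk_obj_def Let_def)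

lemma IF_arr_eq:
  "FArr IF \<phi> = mk_arr n (FObj IF (Dom CI.I \<phi>)) (\<lambda>s. F\<^sub>a (cmp \<phi> s)) (FObj IF (Cod CI.I \<phi>))"
  by (cases \<phi>) (simp add: Inf_functor_def mk_arr_def cmp_def Inf_cat_def Let_def)

lemma IF_obj_simps [simp]:
  "1 \<le> s \<Longrightarrow> s \<le> n \<Longrightarrow> fst (FObj IF X) s = F\<^sub>o (fst X s)"
  "1 \<le> s \<Longrightarrow> s < n \<Longrightarrow> snd (FObj IF X) s = F\<^sub>a (snd X s)"
  by (simp_all add: IF_obj_eq)

lemma IF_arr_simps [simp]:
  "1 \<le> s \<Longrightarrow> s \<le> n \<Longrightarrow> cmp (FArr IF \<phi>) s = F\<^sub>a (cmp \<phi> s)"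
  "Dom DI.I (FArr IF \<phi>) = FObj IF (Dom CI.I \<phi>)" "Cod DI.I (FArr IF \<phi>) = FObj IF (Cod CI.I \<phi>)"
  by (simp_all add: IF_arr_eq)

lemma IF_obj_in [simp]: "X \<in> inf_Obj n C \<Longrightarrow> FObj IF X \<in> inf_Obj n D"
  unfolding IF_obj_eq by (rule DI.mk_obj_in) (simp_all add: F_inflation CI.inf_obj_inflation)

lemma F_nat:
  assumes "\<phi> \<in> inf_Arr n C" "1 \<le> s" "s < n"
  shows "F\<^sub>a (snd (Cod CI.I \<phi>) s) \<cdot>\<^bsub>D\<^esub> F\<^sub>a (cmp \<phi> s) = F\<^sub>a (cmp \<phi> (Suc s)) \<cdot>\<^bsub>D\<^esub> F\<^sub>a (snd (Dom CI.I \<phi>)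
    s)"
proof -
  have "F\<^sub>a (snd (Cod CI.I \<phi>) s \<cdot>\<^bsub>C\<^esub> cmp \<phi> s) = F\<^sub>a (cmp \<phi> (Suc s) \<cdot>\<^bsub>C\<^esub> snd (Dom CI.I \<phi>) s)"
    using assms by simp
  then show ?thesis using assms by (simp del: CI.inf_nat)
qed

lemma IF_arr_in [simp]: "\<phi> \<in> inf_Arr n C \<Longrightarrow> FArr IF \<phi> \<in> inf_Arr n D"
  unfolding IF_arr_eq by (rule DI.mk_arr_in) (simp_all add: F_nat)

lemma IF_is_functor: "is_functor CI.I DI.I IF"
  unfolding is_functor_def
proof (intro conjI ballI impI)
  fix X assume "X \<in> Obj CI.I"
  then show "FArr IF (Ident CI.I X) = Ident DI.I (FObj IF X)"
    by (intro DI.inf_arr_eqI) simp_all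
next
  fix f g assume "f \<in> Arr CI.I" "g \<in> Arr CI.I" "Cod CI.I f = Dom CI.I g"
  then show "FArr IF (g \<cdot>\<^bsub>CI.I\<^esub> f) = FArr IF g \<cdot>\<^bsub>DI.I\<^esub> FArr IF f"
    by (intro DI.inf_arr_eqI) simp_all
qed (simp_all add: Hom_iff)

lemma IF_exact: "exact_functor CI.I DI.I IF"
  unfolding exact_functor_def additive_functor_def
proof (intro conjI ballI)
  fix X Y assume "X \<in> Obj CI.I" "Y \<in> Obj CI.I"
  have "FArr IF (f \<boxplus>\<^bsub>CI.I\<^esub> g) = FArr IF f \<boxplus>\<^bsub>DI.I\<^esub> FArr IF g"
    if "f \<in> Hom CI.I X Y" "g \<in> Hom CI.I X Y" for f g
    by (rule DI.inf_arr_eqI) (use that in \<open>simp_all add: Hom_iff\<close>)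
  then show "FArr IF \<in> hom (hom_group CI.I X Y) (hom_group DI.I (FObj IF X) (FObj IF Y))"
    by (auto simp: hom_def hom_group_def Hom_iff)
next
  fix x assume "x \<in> Confl CI.I"
  then show "case x of (i, p) \<Rightarrow> (FArr IF i, FArr IF p) \<in> Confl DI.I"
    by (cases x) (simp only: case_prod_conv, auto simp only: CI.Confl_Inf_iff DI.Confl_Inf_iff IF_arr_in
      IF_arr_simps intro!: F_confl)
qed (rule IF_is_functor)

text \<open>Zero objects among inflation sequences are those with zero components.\<close>

lemma IF_ess_kernel_iff:
  "X \<in> ess_kernel CI.I DI.I IF \<longleftrightarrow> X \<in> inf_Obj n C \<and> (\<forall>s. 1 \<le> s \<longrightarrow> s \<le> n \<longrightarrow> fst X s \<in> ess_kernel C D F)"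
proof
  assume "X \<in> ess_kernel CI.I DI.I IF"
  then have X: "X \<in> inf_Obj n C" "zero_object DI.I (FObj IF X)" by (auto simp: ess_kernel_def)
  show "X \<in> inf_Obj n C \<and> (\<forall>s. 1 \<le> s \<longrightarrow> s \<le> n \<longrightarrow> fst X s \<in> ess_kernel C D F)"
    using DI.zero_object_InfD[OF X(2)] X(1) by (auto simp: ess_kernel_def)
next
  assume X: "X \<in> inf_Obj n C \<and> (\<forall>s. 1 \<le> s \<longrightarrow> s \<le> n \<longrightarrow> fst X s \<in> ess_kernel C D F)"
  then have "zero_object DI.I (FObj IF X)"
    by (intro DI.zero_object_Inf) (simp_all add: ess_kernel_def)
  then show "X \<in> ess_kernel CI.I DI.I IF" using X by (simp add: ess_kernel_def)
qed

lemma ess_kernel_injective: "X \<in> ess_kernel C D F \<Longrightarrow> injective C X"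
  using ess_kernel_proj_inj by (auto simp: proj_inj_def)

lemma IF_ess_kernel_proj_inj: "ess_kernel CI.I DI.I IF \<subseteq> proj_inj CI.I"
proof
  fix X assume "X \<in> ess_kernel CI.I DI.I IF"
  then have X: "X \<in> inf_Obj n C" "\<And>s. 1 \<le> s \<Longrightarrow> s \<le> n \<Longrightarrow> fst X s \<in> ess_kernel C D F"
    by (auto simp: IF_ess_kernel_iff)
  then show "X \<in> proj_inj CI.I"
    using CI.projective_InfI[OF X(1)] CI.injective_InfI[OF X(1)] ess_kernel_injective
      C.projective_iff_injective
    by (simp add: proj_inj_def)
qed

text \<open>The square with a componentwise lift commutes up to a map through an injective object of the
  kernel, which extends along the inflation and can be subtracted.\<close>

lemma IF_full: "full_functor CI.I DI.I IF"
  unfolding full_functor_def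
proof (intro ballI)
  fix X Y h assume "X \<in> Obj CI.I" "Y \<in> Obj CI.I" "h \<in> Hom DI.I (FObj IF X) (FObj IF Y)"
  then have [simp]: "X \<in> inf_Obj n C" "Y \<in> inf_Obj n C" "h \<in> inf_Arr n D" "Dom DI.I h = FObj IF X"
    "Cod DI.I h = FObj IF Y"
    by (auto simp: Hom_iff)
  define L where "L s f \<longleftrightarrow> f \<in> Arr C \<and> Dom C f = fst X s \<and> Cod C f = fst Y s \<and> F\<^sub>a f = cmp h s" for s f
  have lift: "\<exists>f. L s f" if "1 \<le> s" "s \<le> n" for s
    unfolding L_def by (rule full_functorE[OF full, of "fst X s" "fst Y s"
      "cmp h s"]) (use that in simp_all, blast)
  obtain f where f1: "\<forall>s. 1 \<le> s \<and> s \<le> n \<longrightarrow> L s (f s)"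
    and f2: "\<forall>s. 1 \<le> s \<and> s < n \<longrightarrow> snd Y s \<cdot>\<^bsub>C\<^esub> f s = f (Suc s) \<cdot>\<^bsub>C\<^esub> snd X s"
  proof (rule dependent_choice_range[of n L "\<lambda>s f f'. snd Y s \<cdot>\<^bsub>C\<^esub> f = f' \<cdot>\<^bsub>C\<^esub> snd X s"])
    fix s f assume s: "1 \<le> s" "s < n" and "L s f"
    then have f: "f \<in> Arr C" "Dom C f = fst X s" "Cod C f = fst Y s"
      "F\<^sub>a f = cmp h s" by (auto simp: L_def)
    obtain f0 where f0: "f0 \<in> Arr C" "Dom C f0 = fst X (Suc s)" "Cod C f0 = fst Y (Suc s)"
      "F\<^sub>a f0 = cmp h (Suc s)"
      using lift[of "Suc s"] s by (auto simp: L_def)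
    note [simp] = f f0
    define d where "d = snd Y s \<cdot>\<^bsub>C\<^esub> f \<boxplus>\<^bsub>C\<^esub> neg C (f0 \<cdot>\<^bsub>C\<^esub> snd X s)"
    have d [simp]: "d \<in> Arr C" "Dom C d = fst X s" "Cod C d = fst Y (Suc s)"
      using s by (simp_all add: d_def)
    have nat: "F\<^sub>a (snd Y s) \<cdot>\<^bsub>D\<^esub> cmp h s = cmp h (Suc s) \<cdot>\<^bsub>D\<^esub> F\<^sub>a (snd X s)"
      using DI.inf_nat[of h "FObj IF Y" s] s by simp
    have "F\<^sub>a d = Zero D (F\<^sub>o (Dom C d)) (F\<^sub>o (Cod C d))"
      unfolding d_def using s by (simp add: nat)
    then have "d \<in> factors_through C (ess_kernel C D F)" by (intro zero_factors) simp_all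
    then obtain a b where ab: "a \<in> Arr C" "b \<in> Arr C" "Dom C a = Dom C d" "Cod C b = Cod C d"
      "Cod C a \<in> ess_kernel C D F"
      "Dom C b = Cod C a" "d = b \<cdot>\<^bsub>C\<^esub> a" by (rule K.idealE)
    obtain a' where a': "a' \<in> Arr C" "Dom C a' = fst X (Suc s)" "Cod C a' = Cod C a"
      "a' \<cdot>\<^bsub>C\<^esub> snd X s = a"
      by (rule C.injectiveE[OF ess_kernel_injective[OF ab(5)], of
        "snd X s" a]) (use s ab(1-6) CI.inf_obj_inflation in simp_all)
    \<comment> \<open>Since \<open>a'\<close> ends in a killed object, adding
      \<open>b \<cdot> a'\<close> to \<open>f0\<close> leaves the image under \<open>F\<close>
      unchanged.\<close>
    have "F\<^sub>a a' = Zero D (F\<^sub>o (fst X (Suc s))) (F\<^sub>o (Cod C a))"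
      using F_ess_kernel_zero[of a'] a' ab(5) by simp
    then have "L (Suc s) (f0 \<boxplus>\<^bsub>C\<^esub> b \<cdot>\<^bsub>C\<^esub> a')"
      unfolding L_def using s ab(1-6) a' by simp
    moreover have "(f0 \<boxplus>\<^bsub>C\<^esub> b \<cdot>\<^bsub>C\<^esub> a') \<cdot>\<^bsub>C\<^esub> snd X s = f0 \<cdot>\<^bsub>C\<^esub> snd X s \<boxplus>\<^bsub>C\<^esub> d"
      unfolding ab(7) using s ab(1-6) a' by simp
    then have "snd Y s \<cdot>\<^bsub>C\<^esub> f = (f0 \<boxplus>\<^bsub>C\<^esub> b \<cdot>\<^bsub>C\<^esub> a') \<cdot>\<^bsub>C\<^esub> snd X s"
      unfolding d_def using s C.plus_left_comm[of "f0 \<cdot>\<^bsub>C\<^esub> snd X s" "snd Y s \<cdot>\<^bsub>C\<^esub> f"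
        "neg C (f0 \<cdot>\<^bsub>C\<^esub> snd X s)"] by simp
    ultimately show "\<exists>y. L (Suc s) y \<and> snd Y s \<cdot>\<^bsub>C\<^esub> f = y \<cdot>\<^bsub>C\<^esub> snd X s" by blast
  qed (use lift in auto)
  have H: "f s \<in> Arr C" "Dom C (f s) = fst X s" "Cod C (f s) = fst Y s" "F\<^sub>a (f s) = cmp h s"
    if "1 \<le> s" "s \<le> n" for s using f1 that by (auto simp: L_def)
  note [simp] = H
  have [simp]: "mk_arr n X f Y \<in> inf_Arr n C" by (rule CI.mk_arr_in) (use f2 in simp_all)
  have "FArr IF (mk_arr n X f Y) = h" by (rule DI.inf_arr_eqI) simp_all
  then show "\<exists>f\<in>Hom CI.I X Y. FArr IF f = h"
    by (intro bexI[of _ "mk_arr n X f Y"]) (simp_all add: Hom_iff)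
qed

text \<open>A lift of the inflation \<open>i\<close> may start at the wrong object; pushing it out along a map that
  \<open>F\<close> inverts corrects this.\<close>

lemma lift_inflation:
  assumes i: "inflation D i" and X: "X \<in> Obj C" and \<eta>: "is_iso D \<eta>" "Dom D \<eta> = F\<^sub>o X"
    "Cod D \<eta> = Dom D i"
  obtains u \<eta>' where "inflation C u" "Dom C u = X" "is_iso D \<eta>'" "Dom D \<eta>' = F\<^sub>o (Cod C u)"
    "Cod D \<eta>' = Cod D i"
    "i \<cdot>\<^bsub>D\<^esub> \<eta> = \<eta>' \<cdot>\<^bsub>D\<^esub> F\<^sub>a u"
proof -
  obtain p where ip: "(i, p) \<in> Confl D" using i by (auto simp: inflation_def)
  have lifts: "lifts_conflations C D F"
    by (rule lifts_conflationsI[OF full dense projective_F]) (auto intro: C.frobenius_category_axioms)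
  obtain u v a b c where L: "(u, v) \<in> Confl C"
     "is_iso D a" "is_iso D b" "is_iso D c" "Dom D a = FObj F (Dom C u)" "Cod D a = Dom D i"
     "Dom D b = FObj F (Cod C u)" "Cod D b = Cod D i" "Dom D c = FObj F (Cod C v)" "Cod D c = Cod D p"
     "b \<cdot>\<^bsub>D\<^esub> FArr F u = i \<cdot>\<^bsub>D\<^esub> a" "c \<cdot>\<^bsub>D\<^esub> FArr F v = p \<cdot>\<^bsub>D\<^esub> b"
    by (rule lifts_conflationsE[OF lifts ip])
  note [simp] = is_isoD(1)[OF L(2)] is_isoD(1)[OF L(3)] is_isoD(1)[OF \<eta>(1)] C.conflD(1-3)[OF L(1)]
    D.conflD(1-3)[OF ip]
  obtain \<delta> where \<delta>: "is_iso D \<delta>" "\<delta> \<in> Arr D" "Dom D \<delta> = Dom D i" "Cod D \<delta> = F\<^sub>o X"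
    "\<eta> \<cdot>\<^bsub>D\<^esub> \<delta> = Ident D (Dom D i)"
    using D.iso_inverse[OF \<eta>(1)] \<eta>(2,3) by metis
  obtain g where g: "g \<in> Arr C" "Dom C g = Dom C u" "Cod C g = X" "F\<^sub>a g = \<delta> \<cdot>\<^bsub>D\<^esub> a"
    by (rule full_functorE[OF full, of "Dom C u" X "\<delta> \<cdot>\<^bsub>D\<^esub> a"]) (use X \<delta> L(5,6) in simp_all)
  have Fg: "is_iso D (F\<^sub>a g)" unfolding g(4) by (rule D.iso_comp) (use L \<delta> in simp_all)
  obtain u' g' v' where po: "is_pushout C u g u' g'" and uv': "(u', v') \<in> Confl C" "Cod C v' = Cod C v"
    "v' \<cdot>\<^bsub>C\<^esub> g' = v"
    using C.confl_pushout[OF L(1) g(1,2)] by metis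
  note P = C.pushoutD[OF po]
  note [simp] = P(3,4) C.conflD(1-3)[OF uv'(1)]
  have [simp]: "Dom C u' = X" "Dom C g' = Dom C v" "Cod C g' = Dom C v'" using P g by simp_all
  have gu: "F\<^sub>a g' \<cdot>\<^bsub>D\<^esub> F\<^sub>a u = F\<^sub>a u' \<cdot>\<^bsub>D\<^esub> F\<^sub>a g"
    using F_simps(6)[of u g'] F_simps(6)[of g u'] P(9) g by (simp del: F_simps)
  have vg: "F\<^sub>a v' \<cdot>\<^bsub>D\<^esub> F\<^sub>a g' = F\<^sub>a v" using F_simps(6)[of g' v'] uv'(3) by simp
  \<comment> \<open>The push-out arrow \<open>g'\<close> joins two conflations with the same
    right-hand end; after applying \<open>F\<close> its left neighbour \<open>g\<close> is
    invertible, so the five lemma applies.\<close>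
  have Fg': "is_iso D (F\<^sub>a g')"
    by (rule D.confl_map_iso[OF F_confl[OF L(1)] F_confl[OF uv'(1)] _ Fg]) (use g(1-3) uv' gu vg
      in simp_all)
  obtain \<gamma> where \<gamma>: "is_iso D \<gamma>" "\<gamma> \<in> Arr D" "Dom D \<gamma> = F\<^sub>o (Dom C v')" "Cod D \<gamma> = F\<^sub>o (Dom C v)"
    "\<gamma> \<cdot>\<^bsub>D\<^esub> F\<^sub>a g' = Ident D (F\<^sub>o (Dom C v))"
    using D.iso_inverse[OF Fg'] by (metis F_simps(3,4) P(4) \<open>Cod C g' = Dom C v'\<close> \<open>Dom C g' = Dom C v\<close>)
  show thesis
  proof (rule that[of u' "b \<cdot>\<^bsub>D\<^esub> \<gamma>"])
    show "inflation C u'" using uv' by (auto simp: inflation_def)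
    show "is_iso D (b \<cdot>\<^bsub>D\<^esub> \<gamma>)" by (rule D.iso_comp) (use L \<gamma> in simp_all)
    have "(i \<cdot>\<^bsub>D\<^esub> \<eta>) \<cdot>\<^bsub>D\<^esub> F\<^sub>a g = i \<cdot>\<^bsub>D\<^esub> a"
      unfolding g(4) using \<eta> \<delta> L(5,6) by (simp add: D.comp_eq_comp[OF \<delta>(5)])
    also have "\<dots> = b \<cdot>\<^bsub>D\<^esub> (\<gamma> \<cdot>\<^bsub>D\<^esub> (F\<^sub>a g' \<cdot>\<^bsub>D\<^esub> F\<^sub>a u))"
      using L(7,8,11) \<gamma> by (simp add: D.comp_eq_comp[OF \<gamma>(5)] del: F_simps(6))
    also have "\<dots> = ((b \<cdot>\<^bsub>D\<^esub> \<gamma>) \<cdot>\<^bsub>D\<^esub> F\<^sub>a u') \<cdot>\<^bsub>D\<^esub> F\<^sub>a g"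
      unfolding gu using L(7,8) \<gamma> g(1-3) by simp
    finally show "i \<cdot>\<^bsub>D\<^esub> \<eta> = b \<cdot>\<^bsub>D\<^esub> \<gamma> \<cdot>\<^bsub>D\<^esub> F\<^sub>a u'"
      by - (rule D.iso_epi[OF Fg], use L(7,8) \<gamma> g(1-3) \<eta> in simp_all)
  qed (use L(7,8) \<gamma> in simp_all)
qed

text \<open>The state carries an object of \<open>C\<close> with an isomorphism from its image to
  \<open>fst Y s\<close>. The next inflation must start at precisely this object with this
  isomorphism, hence the prescribed source in \<open>lift_inflation\<close>.\<close>

lemma IF_dense: "dense_functor CI.I DI.I IF"
  unfolding dense_functor_def
proof (intro ballI)
  fix Y assume "Y \<in> Obj DI.I"
  then have Y [simp]: "Y \<in> inf_Obj n D" by simp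
  define L where "L s t \<longleftrightarrow> fst t \<in> Obj C \<and> is_iso D (snd t) \<and> Dom D (snd t) = F\<^sub>o (fst t) \<and>
    Cod D (snd t) = fst Y s" for s and t :: "'o \<times> 'q"
  define R where "R s t t' u \<longleftrightarrow> inflation C u \<and> Dom C u = fst t \<and> Cod C u = fst t' \<and> snd Y s \<cdot>\<^bsub>D\<^esub> snd t =
    snd t' \<cdot>\<^bsub>D\<^esub> F\<^sub>a u"
    for s and t t' :: "'o \<times> 'q" and u
  obtain t where t1: "\<forall>s. 1 \<le> s \<and> s \<le> n \<longrightarrow> L s (t s)" and t2:
    "\<forall>s. 1 \<le> s \<and> s < n \<longrightarrow> (\<exists>u. R s (t s) (t (Suc s)) u)"
  proof (rule dependent_choice_range[of n L "\<lambda>s x y. \<exists>u. R s x y u"])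
    assume n: "1 \<le> n"
    obtain X f where "X \<in> Obj C" "is_iso D f" "Dom D f = F\<^sub>o X" "Cod D f = fst Y 1"
      by (rule dense_functorE[OF dense, of "fst Y 1"]) (use n in simp_all)
    then show "\<exists>x. L 1 x" by (intro exI[of _ "(X, f)"]) (simp add: L_def)
  next
    fix s x assume s: "1 \<le> s" "s < n" and "L s x"
    then have x: "fst x \<in> Obj C" "is_iso D (snd x)" "Dom D (snd x) = F\<^sub>o (fst x)"
      "Cod D (snd x) = Dom D (snd Y s)"
      by (simp_all add: L_def)
    obtain u \<eta>' where u: "inflation C u" "Dom C u = fst x" "is_iso D \<eta>'" "Dom D \<eta>' = F\<^sub>o (Cod C u)"
      "Cod D \<eta>' = Cod D (snd Y s)"
      "snd Y s \<cdot>\<^bsub>D\<^esub> snd x = \<eta>' \<cdot>\<^bsub>D\<^esub> F\<^sub>a u"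
      by (rule lift_inflation[OF DI.inf_obj_inflation[OF Y s] x])
    then have "L (Suc s) (Cod C u, \<eta>') \<and> R s x (Cod C u, \<eta>') u"
      using s C.inflationD[OF u(1)] by (simp add: L_def R_def)
    then show "\<exists>y. L (Suc s) y \<and> (\<exists>u. R s x y u)" by blast
  qed
  obtain u where u: "\<forall>s. 1 \<le> s \<and> s < n \<longrightarrow> R s (t s) (t (Suc s)) (u s)"
    by (rule choice_step[of n "\<lambda>s. R s (t s) (t (Suc s))"]) (use t2 in auto)
  define \<eta> where "\<eta> s = snd (t s)" for s
  define X where "X = mk_obj n (\<lambda>s. fst (t s)) u"
  have T: "fst (t s) \<in> Obj C" "is_iso D (\<eta> s)" "Dom D (\<eta> s) = F\<^sub>o (fst (t s))" "Cod D (\<eta> s) = fst Y s"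
    "\<eta> s \<in> Arr D"
    if "1 \<le> s" "s \<le> n" for s
    using t1 that is_isoD(1)[of D "\<eta> s"] by (auto simp: L_def \<eta>_def)
  have U: "inflation C (u s)" "Dom C (u s) = fst (t s)" "Cod C (u s) = fst (t (Suc s))"
    "snd Y s \<cdot>\<^bsub>D\<^esub> \<eta> s = \<eta> (Suc s) \<cdot>\<^bsub>D\<^esub> F\<^sub>a (u s)"
    if "1 \<le> s" "s < n" for s
    using u that by (auto simp: R_def \<eta>_def)
  note [simp] = T U
  have X [simp]: "X \<in> inf_Obj n C" unfolding X_def by (rule CI.mk_obj_in) simp_all
  have "mk_arr n (FObj IF X) \<eta> Y \<in> inf_Arr n D" by (rule DI.mk_arr_in) (simp_all, simp_all add: X_def)
  then have "is_iso DI.I (mk_arr n (FObj IF X) \<eta> Y)" by (rule DI.Inf_isoI) simp_all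
  then show "\<exists>X\<in>Obj CI.I. \<exists>f. is_iso DI.I f \<and> Dom DI.I f = FObj IF X \<and> Cod DI.I f = Y"
    by (intro bexI[of _ X] exI[of _ "mk_arr n (FObj IF X) \<eta> Y"]) simp_all
qed

text \<open>The new intermediate object is the old one plus a killed object that absorbs the error,
  so the inclusion \<open>\<kappa>\<close> of the old one is an inflation and the intermediate
  objects form an inflation sequence.\<close>

lemma extend_factorization:
  assumes iota: "inflation C \<iota>" and f: "f \<in> Arr C" "Dom C f = Cod C \<iota>"
    "F\<^sub>a f = Zero D (F\<^sub>o (Dom C f)) (F\<^sub>o (Cod C f))"
    and a: "a \<in> Arr C" "Dom C a = Dom C \<iota>" "Cod C a \<in> ess_kernel C D F"
    and b: "b \<in> Arr C" "Dom C b = Cod C a" "Cod C b = Cod C f" and ba: "b \<cdot>\<^bsub>C\<^esub> a = f \<cdot>\<^bsub>C\<^esub> \<iota>"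
  obtains a' b' \<kappa> where "a' \<in> Arr C" "Dom C a' = Cod C \<iota>" "Cod C a' \<in> ess_kernel C D F" "b' \<in> Arr C"
    "Dom C b' = Cod C a'"
    "Cod C b' = Cod C f" "b' \<cdot>\<^bsub>C\<^esub> a' = f" "inflation C \<kappa>" "Dom C \<kappa> = Cod C a" "Cod C \<kappa> = Cod C a'"
    "a' \<cdot>\<^bsub>C\<^esub> \<iota> = \<kappa> \<cdot>\<^bsub>C\<^esub> a" "b' \<cdot>\<^bsub>C\<^esub> \<kappa> = b"
proof -
  obtain p where ip: "(\<iota>, p) \<in> Confl C" using iota by (auto simp: inflation_def)
  note [simp] = C.conflD(1-3)[OF ip] f(1,2) a(1,2) b
  note pz = C.conflD(4)[OF ip]
  note Finj = ess_kernel_injective[OF a(3)]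
  obtain a1 where a1: "a1 \<in> Arr C" "Dom C a1 = Cod C \<iota>" "Cod C a1 = Cod C a" "a1 \<cdot>\<^bsub>C\<^esub> \<iota> = a"
    by (rule C.injectiveE[OF Finj iota, of a]) simp_all
  \<comment> \<open>Extending \<open>a\<close> by injectivity gives a factorization that is correct
    only along \<open>\<iota>\<close>. The error \<open>e\<close> vanishes there and descends to the
    cokernel; the descended arrow is again killed by \<open>F\<close>, because the image of
    \<open>p\<close> is epic.\<close>
  define e where "e = f \<boxplus>\<^bsub>C\<^esub> neg C (b \<cdot>\<^bsub>C\<^esub> a1)"
  have e [simp]: "e \<in> Arr C" "Dom C e = Dom C p" "Cod C e = Cod C f"
    using a1(1-3) by (simp_all add: e_def)
  have "e \<cdot>\<^bsub>C\<^esub> \<iota> = Zero C (Dom C \<iota>) (Cod C e)" unfolding e_def using a1 ba by simp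
  then obtain h where h: "h \<in> Arr C" "Cod C h = Cod C f" "Dom C h = Cod C p" "h \<cdot>\<^bsub>C\<^esub> p = e"
    by - (rule C.confl_descend[OF ip, of e], simp_all)
  have Fb: "F\<^sub>a b = Zero D (F\<^sub>o (Cod C a)) (F\<^sub>o (Cod C f))" using F_ess_kernel_zero[of b] a(3) by simp
  have Fe: "F\<^sub>a e = Zero D (F\<^sub>o (Dom C p)) (F\<^sub>o (Cod C f))" unfolding e_def
    using a1(1-3) f(3) Fb by simp
  have "F\<^sub>a h = Zero D (F\<^sub>o (Cod C p)) (F\<^sub>o (Cod C f))"
  proof (rule D.confl_epi[OF F_confl[OF ip]])
    show "F\<^sub>a h \<cdot>\<^bsub>D\<^esub> F\<^sub>a p = Zero D (F\<^sub>o (Cod C p)) (F\<^sub>o (Cod C f)) \<cdot>\<^bsub>D\<^esub> F\<^sub>a p"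
      using F_simps(6)[of p h] h Fe by simp
  qed (use h in simp_all)
  then have "h \<in> factors_through C (ess_kernel C D F)" using h by (intro zero_factors) simp_all
  then obtain c d where cd: "c \<in> Arr C" "d \<in> Arr C" "Dom C c = Dom C h" "Cod C d = Cod C h"
    "Cod C c \<in> ess_kernel C D F"
      "Dom C d = Cod C c" "h = d \<cdot>\<^bsub>C\<^esub> c" by (rule K.idealE)
  have dcp: "d \<cdot>\<^bsub>C\<^esub> (c \<cdot>\<^bsub>C\<^esub> p) = e" using cd(1-6) h(1-3) unfolding h(4)[symmetric] cd(7) by simp
  obtain S i j p1 q1 where S: "is_biproduct C (Cod C a) (Cod C c) S" "S \<in> Obj C"
    "i \<in> Arr C" "Dom C i = Cod C a" "Cod C i = S" "j \<in> Arr C" "Dom C j = Cod C c" "Cod C j = S"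
    "p1 \<in> Arr C" "Dom C p1 = S" "Cod C p1 = Cod C a" "q1 \<in> Arr C" "Dom C q1 = S" "Cod C q1 = Cod C c"
    "p1 \<cdot>\<^bsub>C\<^esub> i = Ident C (Cod C a)" "q1 \<cdot>\<^bsub>C\<^esub> j = Ident C (Cod C c)"
    "q1 \<cdot>\<^bsub>C\<^esub> i = Zero C (Cod C a) (Cod C c)"
    "p1 \<cdot>\<^bsub>C\<^esub> j = Zero C (Cod C c) (Cod C a)" "(i \<cdot>\<^bsub>C\<^esub> p1) \<boxplus>\<^bsub>C\<^esub> (j \<cdot>\<^bsub>C\<^esub> q1) = Ident C S"
    "(i, q1) \<in> Confl C"
    by (rule C.direct_sum[of "Cod C a" "Cod C c"]) (use cd in simp_all)
  note [simp] = S(2-18) C.comp_eq_comp[OF S(15)] C.comp_eq_comp[OF S(16)] C.comp_eq_comp[OF S(17)]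
    C.comp_eq_comp[OF S(18)]
    a1(1-3) cd(1,2,6)
  have [simp]: "Dom C c = Cod C p" "Cod C d = Cod C f" using cd h by simp_all
  show thesis
  \<comment> \<open>Row and column of the two contributions: the first summand carries
    \<open>b \<cdot> a1\<close>, the second carries \<open>d \<cdot> (c \<cdot> p) = e\<close>, and
    together they give \<open>f\<close>.\<close>
  proof (rule that[of "i \<cdot>\<^bsub>C\<^esub> a1 \<boxplus>\<^bsub>C\<^esub> j \<cdot>\<^bsub>C\<^esub> (c \<cdot>\<^bsub>C\<^esub> p)" "b \<cdot>\<^bsub>C\<^esub> p1 \<boxplus>\<^bsub>C\<^esub> d \<cdot>\<^bsub>C\<^esub> q1" i])
    have "S \<in> ess_kernel C D F" by (rule ess_kernel_biproduct[OF a(3) cd(5) S(1)])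
    then show "Cod C (i \<cdot>\<^bsub>C\<^esub> a1 \<boxplus>\<^bsub>C\<^esub> j \<cdot>\<^bsub>C\<^esub> (c \<cdot>\<^bsub>C\<^esub> p)) \<in> ess_kernel C D F" by simp
    show "inflation C i" using S(20) by (auto simp: inflation_def)
    show "(i \<cdot>\<^bsub>C\<^esub> a1 \<boxplus>\<^bsub>C\<^esub> j \<cdot>\<^bsub>C\<^esub> (c \<cdot>\<^bsub>C\<^esub> p)) \<cdot>\<^bsub>C\<^esub> \<iota> = i \<cdot>\<^bsub>C\<^esub> a"
      by (simp add: a1(4) pz)
    have "b \<cdot>\<^bsub>C\<^esub> a1 \<boxplus>\<^bsub>C\<^esub> e = f" unfolding e_def by (subst C.plus_left_comm) simp_all
    then show "(b \<cdot>\<^bsub>C\<^esub> p1 \<boxplus>\<^bsub>C\<^esub> d \<cdot>\<^bsub>C\<^esub> q1) \<cdot>\<^bsub>C\<^esub> (i \<cdot>\<^bsub>C\<^esub> a1 \<boxplus>\<^bsub>C\<^esub> j \<cdot>\<^bsub>C\<^esub> (c \<cdot>\<^bsub>C\<^esub> p)) = f"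
      by (simp add: dcp)
  qed simp_all
qed

text \<open>The factorization at index \<open>s\<close>, continued by the structure map of
  \<open>Y\<close>, is a factorization of the next component restricted along the structure map of
  \<open>X\<close>; this is the situation of \<open>extend_factorization\<close>.\<close>

lemma IF_zero_factors:
  assumes f: "f \<in> Arr CI.I" and z: "FArr IF f = Zero DI.I (FObj IF (Dom CI.I f)) (FObj IF (Cod CI.I f))"
  shows "f \<in> factors_through CI.I (ess_kernel CI.I DI.I IF)"
proof -
  have [simp]: "f \<in> inf_Arr n C" using f by simp
  define X where "X = Dom CI.I f"
  define Y where "Y = Cod CI.I f"
  have XY [simp]: "X \<in> inf_Obj n C" "Y \<in> inf_Obj n C" "Dom CI.I f = X"
    "Cod CI.I f = Y" by (simp_all add: X_def Y_def)
  have fz: "F\<^sub>a (cmp f s) = Zero D (F\<^sub>o (fst X s)) (F\<^sub>o (fst Y s))" if "1 \<le> s" "s \<le> n" for s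
  proof -
    have "cmp (FArr IF f) s = cmp (Zero DI.I (FObj IF (Dom CI.I f)) (FObj IF (Cod CI.I f))) s" by
      (simp only: z)
    then show ?thesis using that by simp
  qed
  define L where "L s t \<longleftrightarrow> fst t \<in> Arr C \<and> Dom C (fst t) = fst X s \<and> Cod C (fst t) \<in> ess_kernel C D F \<and>
    snd t \<in> Arr C \<and> Dom C (snd t) = Cod C (fst t) \<and> Cod C (snd t) = fst Y s \<and> snd t \<cdot>\<^bsub>C\<^esub> fst t = cmp f
      s"
    for s and t :: "'m \<times> 'm"
  define R where "R s t t' \<kappa> \<longleftrightarrow> inflation C \<kappa> \<and> Dom C \<kappa> = Cod C (fst t) \<and> Cod C \<kappa> = Cod C (fst t') \<and>
    fst t' \<cdot>\<^bsub>C\<^esub> snd X s = \<kappa> \<cdot>\<^bsub>C\<^esub> fst t \<and> snd t' \<cdot>\<^bsub>C\<^esub> \<kappa> = snd Y s \<cdot>\<^bsub>C\<^esub> snd t" for s and t t' :: "'m \<times>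
      'm" and \<kappa>
  obtain t where t1: "\<forall>s. 1 \<le> s \<and> s \<le> n \<longrightarrow> L s (t s)" and t2:
    "\<forall>s. 1 \<le> s \<and> s < n \<longrightarrow> (\<exists>u. R s (t s) (t (Suc s)) u)"
  proof (rule dependent_choice_range[of n L "\<lambda>s x y. \<exists>u. R s x y u"])
    assume n: "1 \<le> n"
    then have "cmp f 1 \<in> factors_through C (ess_kernel C D F)" by (intro zero_factors) (simp_all add:
      fz)
    then obtain a b where "a \<in> Arr C" "b \<in> Arr C" "Dom C a = Dom C (cmp f 1)"
      "Cod C b = Cod C (cmp f 1)" "Cod C a \<in> ess_kernel C D F"
      "Dom C b = Cod C a" "cmp f 1 = b \<cdot>\<^bsub>C\<^esub> a" by (rule K.idealE)
    then show "\<exists>x. L 1 x" using n by (intro exI[of _ "(a, b)"]) (simp add: L_def)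
  next
    fix s x assume s: "1 \<le> s" "s < n" and "L s x"
    then have x: "fst x \<in> Arr C" "Dom C (fst x) = fst X s" "Cod C (fst x) \<in> ess_kernel C D F"
      "snd x \<in> Arr C" "Dom C (snd x) = Cod C (fst x)" "Cod C (snd x) = fst Y s"
      "snd x \<cdot>\<^bsub>C\<^esub> fst x = cmp f s" by (simp_all add: L_def)
    obtain a' b' \<kappa> where "a' \<in> Arr C" "Dom C a' = Cod C (snd X s)" "Cod C a' \<in> ess_kernel C D F"
      "b' \<in> Arr C" "Dom C b' = Cod C a'"
      "Cod C b' = Cod C (cmp f (Suc s))" "b' \<cdot>\<^bsub>C\<^esub> a' = cmp f (Suc s)" "inflation C \<kappa>"
      "Dom C \<kappa> = Cod C (fst x)" "Cod C \<kappa> = Cod C a'"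
      "a' \<cdot>\<^bsub>C\<^esub> snd X s = \<kappa> \<cdot>\<^bsub>C\<^esub> fst x" "b' \<cdot>\<^bsub>C\<^esub> \<kappa> = snd Y s \<cdot>\<^bsub>C\<^esub> snd x"
      by (rule extend_factorization[OF CI.inf_obj_inflation[OF XY(1) s], of "cmp f (Suc s)" "fst x"
        "snd Y s \<cdot>\<^bsub>C\<^esub> snd x"])
        (use s x fz in simp_all)
    then have "L (Suc s) (a', b') \<and> R s x (a', b') \<kappa>" using s by (simp add: L_def R_def)
    then show "\<exists>y. L (Suc s) y \<and> (\<exists>u. R s x y u)" by blast
  qed
  obtain \<kappa> where k: "\<forall>s. 1 \<le> s \<and> s < n \<longrightarrow> R s (t s) (t (Suc s)) (\<kappa> s)"
    by (rule choice_step[of n "\<lambda>s. R s (t s) (t (Suc s))"]) (use t2 in auto)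
  define a where "a s = fst (t s)" for s
  define b where "b s = snd (t s)" for s
  define Q where "Q = mk_obj n (\<lambda>s. Cod C (a s)) \<kappa>"
  have T: "a s \<in> Arr C" "Dom C (a s) = fst X s" "Cod C (a s) \<in> ess_kernel C D F"
      "b s \<in> Arr C" "Dom C (b s) = Cod C (a s)" "Cod C (b s) = fst Y s" "b s \<cdot>\<^bsub>C\<^esub> a s = cmp f s"
    if "1 \<le> s" "s \<le> n" for s using t1 that by (auto simp: L_def a_def b_def)
  have U: "inflation C (\<kappa> s)" "Dom C (\<kappa> s) = Cod C (a s)" "Cod C (\<kappa> s) = Cod C (a (Suc s))"
    "\<kappa> s \<cdot>\<^bsub>C\<^esub> a s = a (Suc s) \<cdot>\<^bsub>C\<^esub> snd X s"
    "b (Suc s) \<cdot>\<^bsub>C\<^esub> \<kappa> s = snd Y s \<cdot>\<^bsub>C\<^esub> b s" if "1 \<le> s" "s < n" for s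
    using k that by (auto simp: R_def a_def b_def)
  note [simp] = T U
  have Q: "Q \<in> inf_Obj n C" unfolding Q_def by (rule CI.mk_obj_in) simp_all
  have A: "mk_arr n X a Q \<in> inf_Arr n C" by (rule CI.mk_arr_in) (use Q in \<open>simp_all add: Q_def\<close>)
  have B: "mk_arr n Q b Y \<in> inf_Arr n C" by (rule CI.mk_arr_in) (use Q in \<open>simp_all add: Q_def\<close>)
  have "f = mk_arr n Q b Y \<cdot>\<^bsub>CI.I\<^esub> mk_arr n X a Q" by (rule CI.inf_arr_eqI) (use A B in simp_all)
  moreover have "Q \<in> ess_kernel CI.I DI.I IF"
    unfolding IF_ess_kernel_iff using Q by (auto simp: Q_def)
  ultimately show ?thesis
    unfolding factors_through_def mem_Collect_eq
    by (intro conjI f bexI[of _ Q] bexI[of _ "mk_arr n X a Q"] bexI[of _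
      "mk_arr n Q b Y"]) (use A B in \<open>simp_all add: Hom_iff\<close>)
qed

lemma IF_projective: "projective CI.I P \<Longrightarrow> projective DI.I (FObj IF P)"
  by (rule DI.projective_InfI)
    (auto intro!: IF_obj_in simp: projective_F CI.projective_InfD, simp add: projective_def)

sublocale IF: quotient_functor CI.I DI.I IF
proof (intro quotient_functor.intro exact_functor_between.intro exact_functor_between_axioms.intro
    quotient_functor_axioms.intro)
  show "exact_category CI.I" "exact_category DI.I" by (rule CI.Inf_exact, rule DI.Inf_exact)
  show "frobenius_category CI.I" "frobenius_category DI.I" by (rule CI.Inf_frobenius, rule
    DI.Inf_frobenius)
qed (rule IF_exact IF_full IF_dense IF_projective IF_ess_kernel_proj_inj IF_zero_factors; assumption?)+

end

text \<open>The subcategory contains some biproduct \<open>T\<close>. Any other one is isomorphic to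
  \<open>T\<close>, hence a direct summand of \<open>T\<close> with zero complement.\<close>

lemma (in additive_category) summand_closed_biproduct:
  assumes add: "additive_subcategory C \<X>" and closed: "summand_closed C \<X>"
    and XY: "X \<in> \<X>" "Y \<in> \<X>" and S: "is_biproduct C X Y S"
  shows "S \<in> \<X>"
proof -
  obtain T where T: "T \<in> \<X>" "is_biproduct C X Y T"
    using add XY unfolding additive_subcategory_def by meson
  obtain f where f: "is_iso C f" "Dom C f = T" "Cod C f = S" using biproduct_unique[OF T(2) S] by blast
  obtain g where g: "f \<in> Arr C" "g \<in> Arr C" "Dom C g = S" "Cod C g = T"
    "g \<cdot> f = Ident C T" "f \<cdot> g = Ident C S"
    using iso_inverse[OF f(1)] f by metis
  obtain Z where Z: "zero_object C Z" "Z \<in> Obj C" "Ident C Z = Zero C Z Z" by (rule zero_objectE)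
  have TS: "T \<in> Obj C" "S \<in> Obj C" using S T by (auto simp: is_biproduct_def)
  have "is_biproduct C S Z T"
    by (rule is_biproductI[where i = g and p = f and j = "Zero C Z T" and q = "Zero C T Z"])
      (use f g Z TS in simp_all)
  then show ?thesis using closed T unfolding summand_closed_def by blast
qed

section \<open>The essential kernel of the induced functor\<close>

context Inf_quotient_functor
begin

lemma inf_obj_eqI:
  assumes "X \<in> inf_Obj n C" "Y \<in> inf_Obj n C" "\<And>s. 1 \<le> s \<Longrightarrow> s \<le> n \<Longrightarrow> fst X s = fst Y s"
    "\<And>s. 1 \<le> s \<Longrightarrow> s < n \<Longrightarrow> snd X s = snd Y s"
  shows "X = Y"
proof -
  have "fst X = fst Y"
    by (rule PiE_ext[of _ "{1..n}" "\<lambda>_. Obj C"]) (use assms in \<open>auto simp: inf_Obj_def\<close>)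
  moreover have "snd X = snd Y"
    by (rule PiE_ext[of _ "{1..<n}" "\<lambda>_. Arr C"]) (use assms in \<open>auto simp: inf_Obj_def PiE_iff
      Hom_iff\<close>)
  ultimately show ?thesis by (rule prod_eqI)
qed

lemma the_zero: "zero_object C (the_zero C)"
  unfolding the_zero_def using C.ex_zero_object by (rule someI_ex)

lemma the_zero_simps [simp]: "the_zero C \<in> Obj C"
  "Ident C (the_zero C) = Zero C (the_zero C) (the_zero C)"
  using the_zero C.zero_object_iff by auto

lemma theta_simps [simp]:
  "1 \<le> t \<Longrightarrow> t \<le> n \<Longrightarrow> fst (theta n C j P) t = (if t < j then the_zero C else P)"
  "1 \<le> t \<Longrightarrow> t < n \<Longrightarrow> snd (theta n C j P) t =
    (if t < j then Zero C (the_zero C) (if Suc t < j then the_zero C else P) else Ident C P)"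
  by (simp_all add: theta_def Let_def)

text \<open>The structure maps below index \<open>j\<close> start at the zero object, including the
  jump to \<open>P\<close> at index \<open>j - 1\<close>; such arrows are inflations with the
  identity as cokernel.\<close>

lemma theta_in:
  assumes "P \<in> Obj C" shows "theta n C j P \<in> inf_Obj n C"
proof -
  have "theta n C j P = mk_obj n (\<lambda>t. if t < j then the_zero C else P)
    (\<lambda>t. if t < j then Zero C (the_zero C) (if Suc t < j then the_zero C else P) else Ident C P)"
    by (auto simp: theta_def mk_obj_def Let_def fun_eq_iff restrict_def)
  also have "\<dots> \<in> inf_Obj n C"
    by (rule CI.mk_obj_in) (use assms the_zero in \<open>auto simp: C.inflation_zero C.inflation_Ident\<close>)
  finally show ?thesis .
qed

lemma theta_ess_kernel:
  assumes "P \<in> ess_kernel C D F" shows "theta n C j P \<in> ess_kernel CI.I DI.I IF"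
proof -
  have "P \<in> Obj C" using assms by (simp add: ess_kernel_def)
  then show ?thesis
    using theta_in assms zero_in_ess_kernel[OF the_zero] by (simp add: IF_ess_kernel_iff)
qed

text \<open>The sequence frozen at index \<open>j\<close>: from there on the object at
  \<open>j\<close> is repeated with identities. These truncations interpolate between
  \<open>theta n C 1 (fst X 1)\<close> at \<open>j = 1\<close> and \<open>X\<close> itself at
  \<open>j = n\<close>.\<close>

definition trunc :: "('o, 'm) inf_obj \<Rightarrow> nat \<Rightarrow> ('o, 'm) inf_obj" where
  "trunc X j = mk_obj n (\<lambda>s. fst X (min s j)) (\<lambda>s. if s < j then snd X s else Ident C (fst X j))"

lemma trunc_simps [simp]:
  "1 \<le> s \<Longrightarrow> s \<le> n \<Longrightarrow> fst (trunc X j) s = (if s \<le> j then fst X s else fst X j)"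
  "1 \<le> s \<Longrightarrow> s < n \<Longrightarrow> snd (trunc X j) s = (if s < j then snd X s else Ident C (fst X j))"
  by (auto simp: trunc_def)

lemma trunc_in:
  assumes "X \<in> inf_Obj n C" "1 \<le> j" "j \<le> n" shows "trunc X j \<in> inf_Obj n C"
proof -
  have "min s j = (if s < j then s else j)" "min (Suc s) j = (if s < j then Suc s else j)" for s by auto
  then show ?thesis
    unfolding trunc_def
    by (intro CI.mk_obj_in) (use assms in \<open>simp_all add: C.inflation_Ident CI.inf_obj_inflation\<close>)
qed

text \<open>The structure map at \<open>j\<close> splits because its source is injective. Its
  complement \<open>P\<close> first appears at index \<open>Suc j\<close> and persists by
  identities, which is the shape of \<open>theta\<close>; being a retract of a killed object,
  \<open>P\<close> is killed.\<close>

lemma trunc_step: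
  assumes X [simp]: "X \<in> inf_Obj n C" and ker: "\<And>s. 1 \<le> s \<Longrightarrow> s \<le> n \<Longrightarrow> fst X s \<in> ess_kernel C D F"
    and j: "1 \<le> j" "j < n"
  obtains P where "P \<in> ess_kernel C D F"
    "is_biproduct CI.I (trunc X j) (theta n C (Suc j) P) (trunc X (Suc j))"
proof -
  define \<iota> where "\<iota> = snd X j"
  have \<iota> [simp]: "\<iota> \<in> Arr C" "Dom C \<iota> = fst X j" "Cod C \<iota> = fst X (Suc j)"
    using j by (simp_all add: \<iota>_def)
  have infl: "inflation C \<iota>" using CI.inf_obj_inflation[OF X j] by (simp add: \<iota>_def)
  then obtain p where ip: "(\<iota>, p) \<in> Confl C" by (auto simp: inflation_def)
  have inj: "injective C (fst X j)" using ess_kernel_injective ker j by simp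
  obtain r where r: "r \<in> Arr C" "Dom C r = Cod C \<iota>" "Cod C r = fst X j" "r \<cdot>\<^bsub>C\<^esub> \<iota> = Ident C (fst X j)"
    by (rule C.injectiveE[OF inj infl, of "Ident C (fst X j)"]) (use j in simp_all)
  obtain s where s: "s \<in> Arr C" "Dom C s = Cod C p" "Cod C s = Cod C \<iota>" "p \<cdot>\<^bsub>C\<^esub> s = Ident C (Cod C p)"
    "r \<cdot>\<^bsub>C\<^esub> s = Zero C (Cod C p) (Dom C \<iota>)" "(\<iota> \<cdot>\<^bsub>C\<^esub> r) \<boxplus>\<^bsub>C\<^esub> (s \<cdot>\<^bsub>C\<^esub> p) = Ident C (Cod C \<iota>)"
    by (rule C.split_confl[OF ip, of r]) (use r in simp_all)
  define P where "P = Cod C p"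
  have p: "p \<in> Arr C" "Dom C p = fst X (Suc j)" "Cod C p = P" "p \<cdot>\<^bsub>C\<^esub> \<iota> = Zero C (fst X j) P"
    using C.conflD(2-4)[OF ip] by (simp_all add: P_def)
  have P: "P \<in> ess_kernel C D F"
    unfolding P_def by (rule ess_kernel_retract[OF ker[of "Suc j"] p(1) s(1)]) (use j p s
      in \<open>simp_all add: P_def\<close>)
  have [simp]: "P \<in> Obj C" using p(1,3) C.Cod_in by auto
  note [simp] = p r s[folded P_def]
  define W where "W = trunc X j"
  define W' where "W' = trunc X (Suc j)"
  define T where "T = theta n C (Suc j) P"
  have [simp]: "W \<in> inf_Obj n C" "W' \<in> inf_Obj n C" "T \<in> inf_Obj n C"
    using j trunc_in theta_in by (simp_all add: W_def W'_def T_def)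
  have fstW [simp]: "fst W t = (if t \<le> j then fst X t else fst X j)"
    "fst W' t = (if t \<le> j then fst X t else fst X (Suc j))"
    "fst T t = (if t \<le> j then the_zero C else P)" if "1 \<le> t" "t \<le> n" for t
    using that by (auto simp: W_def W'_def T_def le_Suc_eq)
  have sndW [simp]: "snd W t = (if t < j then snd X t else Ident C (fst X j))"
    "snd W' t = (if t < j then snd X t else if t = j then \<iota> else Ident C (fst X (Suc j)))"
    "snd T t = (if t < j then Zero C (the_zero C) (the_zero C) else if t =
    j then Zero C (the_zero C) P else Ident C P)" if "1 \<le> t" "t < n" for t
    using that by (auto simp: W_def W'_def T_def \<iota>_def)
  have XO [simp]: "fst X t \<in> Obj C" if "1 \<le> t" "t \<le> n" for t using that by simp
  have XOj [simp]: "fst X j \<in> Obj C" "fst X (Suc j) \<in> Obj C" using j by simp_all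
  have cases_t: "t < j \<or> t = j \<or> j < t" for t by auto
  \<comment> \<open>Up to index \<open>j\<close> the truncations agree and the \<open>theta\<close>
    summand is zero; beyond it the splitting data of the structure map are used. At \<open>j\<close>
    itself compatibility is exactly \<open>r \<cdot> \<iota> = 1\<close> and
    \<open>p \<cdot> \<iota> = 0\<close>.\<close>
  define i' where "i' = mk_arr n W (\<lambda>t. if t \<le> j then Ident C (fst X t) else \<iota>) W'"
  define j' where "j' = mk_arr n T (\<lambda>t. if t \<le> j then Zero C (the_zero C) (fst X t) else s) W'"
  define p' where "p' = mk_arr n W' (\<lambda>t. if t \<le> j then Ident C (fst X t) else r) W"
  define q' where "q' = mk_arr n W' (\<lambda>t. if t \<le> j then Zero C (fst X t) (the_zero C) else p) T"
  have arr [simp]: "i' \<in> inf_Arr n C" "j' \<in> inf_Arr n C" "p' \<in> inf_Arr n C" "q' \<in> inf_Arr n C"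
    unfolding i'_def j'_def p'_def q'_def
    by (rule CI.mk_arr_in; (simp; fail)?; (use cases_t in \<open>auto simp: Suc_le_eq\<close>; fail)?)+
  have dc [simp]: "Dom CI.I i' = W" "Cod CI.I i' = W'" "Dom CI.I j' = T" "Cod CI.I j' = W'"
    "Dom CI.I p' = W'" "Cod CI.I p' = W"
    "Dom CI.I q' = W'" "Cod CI.I q' = T" by (simp_all add: i'_def j'_def p'_def q'_def)
  have [simp]: "cmp i' t = (if t \<le> j then Ident C (fst X t) else \<iota>)"
    "cmp j' t = (if t \<le> j then Zero C (the_zero C) (fst X t) else s)"
    "cmp p' t = (if t \<le> j then Ident C (fst X t) else r)"
    "cmp q' t = (if t \<le> j then Zero C (fst X t) (the_zero C) else p)"
    if "1 \<le> t" "t \<le> n" for t using that by (simp_all add: i'_def j'_def p'_def q'_def)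
  have "is_biproduct CI.I W T W'"
  proof (rule CI.I.is_biproductI[where i = i' and j = j' and p = p' and q = q'])
    show "p' \<cdot>\<^bsub>CI.I\<^esub> i' = Ident CI.I W" "q' \<cdot>\<^bsub>CI.I\<^esub> j' = Ident CI.I T" "q' \<cdot>\<^bsub>CI.I\<^esub> i' = Zero CI.I W T"
      "p' \<cdot>\<^bsub>CI.I\<^esub> j' = Zero CI.I T W" "i' \<cdot>\<^bsub>CI.I\<^esub> p' \<boxplus>\<^bsub>CI.I\<^esub> j' \<cdot>\<^bsub>CI.I\<^esub> q' = Ident CI.I W'"
      by (rule CI.inf_arr_eqI; simp)+
  qed simp_all
  then show thesis using that P by (simp add: W_def W'_def T_def)
qed

text \<open>The kernel contains the \<open>theta\<close> objects and is additive and closed under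
  summands, so it contains their closure. Conversely, each truncation of a killed sequence adds one
  \<open>theta\<close> object to the previous truncation.\<close>

theorem IF_ess_kernel:
  assumes "1 \<le> n"
  shows "ess_kernel CI.I DI.I IF =
    add_closure CI.I {theta n C j P | j P. 1 \<le> j \<and> j \<le> n \<and> P \<in> ess_kernel C D F}" (is "?K = add_closure
      _ ?T")
proof
  have "?T \<subseteq> ?K" using theta_ess_kernel by auto
  then show "add_closure CI.I ?T \<subseteq> ?K"
    unfolding add_closure_def using IF.ess_kernel_additive IF.ess_kernel_summand_closed by
      (intro Inter_lower) simp
  show "?K \<subseteq> add_closure CI.I ?T"
  proof
    fix X assume "X \<in> ?K"
    then have X: "X \<in> inf_Obj n C" and ker: "\<And>s. 1 \<le> s \<Longrightarrow> s \<le> n \<Longrightarrow> fst X s \<in> ess_kernel C D F"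
      by (auto simp: IF_ess_kernel_iff)
    show "X \<in> add_closure CI.I ?T"
      unfolding add_closure_def
    proof (intro InterI, elim CollectE conjE)
      fix \<X> assume \<X>: "additive_subcategory CI.I \<X>" "summand_closed CI.I \<X>" "?T \<subseteq> \<X>"
      have "1 \<le> j \<Longrightarrow> j \<le> n \<Longrightarrow> trunc X j \<in> \<X>" for j
      proof (induction j rule: nat_induct_at_least[of 1])
        case base
        \<comment> \<open>Frozen at the first index, the sequence is constant with identities and no
          zeros in front.\<close>
        have "trunc X 1 = theta n C 1 (fst X 1)"
          by (rule inf_obj_eqI) (use X assms trunc_in theta_in in \<open>auto simp: le_antisym le_Suc_eq\<close>)
        then show ?case using \<X>(3) ker[of 1] assms by auto
      next
        case (Suc j)
        obtain P where P: "P \<in> ess_kernel C D F"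
          "is_biproduct CI.I (trunc X j) (theta n C (Suc j) P) (trunc X (Suc j))"
          by (rule trunc_step[OF X ker, of j]) (use Suc in simp_all)
        have "theta n C (Suc j) P \<in> ?T" using P(1) Suc.prems by (intro CollectI exI[of _
          "Suc j"] exI[of _ P]) simp
        then have "theta n C (Suc j) P \<in> \<X>" using \<X>(3) by blast
        then show ?case using CI.I.summand_closed_biproduct[OF \<X>(1,2) _ _ P(2)] Suc by simp
      qed
      then have "trunc X n \<in> \<X>" using assms by simp
      moreover have "trunc X n = X"
        by (rule inf_obj_eqI) (use X assms trunc_in in simp_all)
      ultimately show "X \<in> \<X>" by simp
    qed
  qed
qed

end

theorem theorem3p5:
  fixes A :: "('o, 'm) exact_cat"
    and B :: "('p, 'q) exact_cat"
    and F :: "('o, 'm, 'p, 'q) cat_functor"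
    and n :: nat
  assumes "frobenius_category A"
    and "frobenius_category B"
    and "frobenius_quotient A B F"
    and "n \<ge> 1"
  shows "frobenius_quotient (Inf_cat n A) (Inf_cat n B) (Inf_functor n F) \<and>
    ess_kernel (Inf_cat n A) (Inf_cat n B) (Inf_functor n F) =
      add_closure (Inf_cat n A) {theta n A j P | j P. 1 \<le> j \<and> j \<le> n \<and> P \<in> ess_kernel A B F}"
proof -
  interpret quotient_functor A B F by (rule quotient_functor_of_frobenius_quotient) fact
  interpret Inf_quotient_functor A B F n by unfold_locales
  show ?thesis using IF.is_frobenius_quotient IF_ess_kernel[OF assms(4)] by simp
qed

end
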